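(* Let $\mathcal{C}$ be a braided pseudo-unitary fusion category over $k$. An étale algebra $A$ in $\mathcal{C}$ is Galois if and only if it is maximally symmetric.
   Context: $k$ is an algebraically closed field of characteristic zero. A tensor category is a $k$-linear abelian monoidal category with $k$-linear tensor product whose unit object $I$ is simple, in particular $\mathcal{C}(I,I)\cong k$; $\mathcal{C}(X,Y)$ denotes the hom-space. A fusion category is a semi-simple spherical tensor category with finitely many isomorphism classes of simple objects. For pseudo-unitary $\mathcal{C}$, $d(X)$ denotes the pseudo-unitary dimension of $X\in\mathcal{C}$ (the dimension for the canonical spherical structure, which equals the Frobenius–Perron dimension). Write $\mathrm{ev}_X\colon X^*\otimes X\to I$, $\mathrm{coev}_X\colon I\to X\otimes X^*$ for evaluation and coevaluation and $s_X\colon X\to X^{**}$ for the spherical structure. Algebras $A=(A,m,\iota)$ are associative and unital. The canonical trace of $A$ is $\varepsilon=\mathrm{ev}_{A^*}\circ(s_A\otimes 1)\circ(m\otimes 1)\circ(1\otimes\mathrm{coev}_A)\colon A\to I$, and the canonical pairing is $b=\varepsilon\circ m$. $A$ is separable if $b$ is non-degenerate, i.e. there is $\kappa\colon I\to A\otimes A$ with $(b\otimes 1)\circ(1\otimes\kappa)=1_A$. An étale algebra is a commutative separable algebra $A$ with $\mathcal{C}(I,A)=k$. The convolution algebra $Q(A)$ is $\mathcal{C}(A,A)$ with product $x*y=m\circ(x\otimes y)\circ m^\vee$, where $m^\vee=(m\otimes 1)\circ(1\otimes\kappa)\colon A\to A\otimes A$, and unit $\iota\circ\varepsilon$. For étale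 $A$ it is a commutative semi-simple algebra; $K(A)$ denotes its set of minimal idempotents. Every algebra automorphism of $A$ is an element of $K(A)$. An étale algebra $A$ is Galois if $\mathrm{Aut}_{\mathrm{alg}}(A)=K(A)$, i.e. if $\mathcal{C}(A,A)=k[\mathrm{Aut}_{\mathrm{alg}}(A)]$ (the algebra automorphisms of $A$ form a $k$-basis of $\mathcal{C}(A,A)$). An étale algebra $A$ is maximally symmetric if $\dim_k\mathcal{C}(A,A)=d(A)$. *)

theory Defs
  imports "HOL-Computational_Algebra.Polynomial" "Jordan_Normal_Form.Char_Poly"
begin

no_notation mult (infixl \<open>\<otimes>\<index>\<close> 70)

text \<open>
  Objects form the type \<open>'o\<close>; all morphisms live in one \<open>'k\<close>-vector space \<open>'m\<close> (think of the
  direct sum of all hom-spaces) in which every hom-space is a subspace. Only the restrictions of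
  \<open>comp\<close> and \<open>mten\<close> to hom-spaces are ever constrained. Composition is written in function
  order: \<open>g \<cdot> f\<close> is ``\<open>g\<close> after \<open>f\<close>''.
\<close>

record ('k, 'o, 'm) btcat =
  scal :: "'k \<Rightarrow> 'm \<Rightarrow> 'm"
  hom :: "'o \<Rightarrow> 'o \<Rightarrow> 'm set"
  comp :: "'m \<Rightarrow> 'm \<Rightarrow> 'm" (infixr \<open>\<cdot>\<index>\<close> 67)
  idm :: "'o \<Rightarrow> 'm"
  oten :: "'o \<Rightarrow> 'o \<Rightarrow> 'o" (infixr \<open>\<boxtimes>\<index>\<close> 70)
  mten :: "'m \<Rightarrow> 'm \<Rightarrow> 'm" (infixr \<open>\<otimes>\<index>\<close> 70)
  unit_ob :: "'o" (\<open>\<I>\<index>\<close>)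
  assoc :: "'o \<Rightarrow> 'o \<Rightarrow> 'o \<Rightarrow> 'm"  \<comment> \<open>\<open>(X \<boxtimes> Y) \<boxtimes> Z \<rightarrow> X \<boxtimes> (Y \<boxtimes> Z)\<close>\<close>
  lunit :: "'o \<Rightarrow> 'm"  \<comment> \<open>\<open>\<I> \<boxtimes> X \<rightarrow> X\<close>\<close>
  runit :: "'o \<Rightarrow> 'm"  \<comment> \<open>\<open>X \<boxtimes> \<I> \<rightarrow> X\<close>\<close>
  dual :: "'o \<Rightarrow> 'o"
  ev :: "'o \<Rightarrow> 'm"  \<comment> \<open>\<open>dual X \<boxtimes> X \<rightarrow> \<I>\<close>\<close>
  coev :: "'o \<Rightarrow> 'm"  \<comment> \<open>\<open>\<I> \<rightarrow> X \<boxtimes> dual X\<close>\<close>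
  braid :: "'o \<Rightarrow> 'o \<Rightarrow> 'm"  \<comment> \<open>\<open>X \<boxtimes> Y \<rightarrow> Y \<boxtimes> X\<close>\<close>

locale btcat_data =
  fixes C :: "('k::{alg_closed_field, field_char_0}, 'o, 'm::ab_group_add) btcat" (structure)
begin

abbreviation Hom :: "'o \<Rightarrow> 'o \<Rightarrow> 'm set" where "Hom \<equiv> hom C"
abbreviation Id :: "'o \<Rightarrow> 'm" where "Id \<equiv> idm C"
abbreviation sc :: "'k \<Rightarrow> 'm \<Rightarrow> 'm" where "sc \<equiv> scal C"
abbreviation Dual :: "'o \<Rightarrow> 'o" where "Dual \<equiv> dual C"
abbreviation Ev :: "'o \<Rightarrow> 'm" where "Ev \<equiv> ev C"
abbreviation Coev :: "'o \<Rightarrow> 'm" where "Coev \<equiv> coev C"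
abbreviation \<alpha> :: "'o \<Rightarrow> 'o \<Rightarrow> 'o \<Rightarrow> 'm" where "\<alpha> \<equiv> assoc C"
abbreviation \<l> :: "'o \<Rightarrow> 'm" where "\<l> \<equiv> lunit C"
abbreviation \<r> :: "'o \<Rightarrow> 'm" where "\<r> \<equiv> runit C"
abbreviation \<beta> :: "'o \<Rightarrow> 'o \<Rightarrow> 'm" where "\<beta> \<equiv> braid C"

definition hom_dim :: "'o \<Rightarrow> 'o \<Rightarrow> nat" where
  "hom_dim X Y = vector_space.dim sc (Hom X Y)"

definition inverse_pair :: "'o \<Rightarrow> 'o \<Rightarrow> 'm \<Rightarrow> 'm \<Rightarrow> bool" where
  "inverse_pair X Y f g \<longleftrightarrow> f \<in> Hom X Y \<and> g \<in> Hom Y X \<and> g \<cdot> f = Id X \<and> f \<cdot> g = Id Y"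

definition iso_arr :: "'o \<Rightarrow> 'o \<Rightarrow> 'm \<Rightarrow> bool" where
  "iso_arr X Y f \<longleftrightarrow> (\<exists>g. inverse_pair X Y f g)"

definition inv_arr :: "'o \<Rightarrow> 'o \<Rightarrow> 'm \<Rightarrow> 'm" where
  "inv_arr X Y f = (THE g. inverse_pair X Y f g)"

definition isomorphic :: "'o \<Rightarrow> 'o \<Rightarrow> bool" where
  "isomorphic X Y \<longleftrightarrow> (\<exists>f. iso_arr X Y f)"

text \<open>In a linear category, left (right) cancellability may be tested against zero.\<close>

definition mono_arr :: "'o \<Rightarrow> 'o \<Rightarrow> 'm \<Rightarrow> bool" where
  "mono_arr X Y f \<longleftrightarrow> f \<in> Hom X Y \<and> (\<forall>W. \<forall>g\<in>Hom W X. f \<cdot> g = 0 \<longrightarrow> g = 0)"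

definition epi_arr :: "'o \<Rightarrow> 'o \<Rightarrow> 'm \<Rightarrow> bool" where
  "epi_arr X Y f \<longleftrightarrow> f \<in> Hom X Y \<and> (\<forall>W. \<forall>g\<in>Hom Y W. g \<cdot> f = 0 \<longrightarrow> g = 0)"

definition kernel_of :: "'o \<Rightarrow> 'o \<Rightarrow> 'm \<Rightarrow> 'o \<Rightarrow> 'm \<Rightarrow> bool" where
  "kernel_of X Y f N i \<longleftrightarrow> i \<in> Hom N X \<and> f \<cdot> i = 0 \<and>
     (\<forall>W. \<forall>g\<in>Hom W X. f \<cdot> g = 0 \<longrightarrow> (\<exists>!h. h \<in> Hom W N \<and> i \<cdot> h = g))"

definition cokernel_of :: "'o \<Rightarrow> 'o \<Rightarrow> 'm \<Rightarrow> 'o \<Rightarrow> 'm \<Rightarrow> bool" where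
  "cokernel_of X Y f Q p \<longleftrightarrow> p \<in> Hom Y Q \<and> p \<cdot> f = 0 \<and>
     (\<forall>W. \<forall>g\<in>Hom Y W. g \<cdot> f = 0 \<longrightarrow> (\<exists>!h. h \<in> Hom Q W \<and> h \<cdot> p = g))"

text \<open>The empty list exhibits \<open>X\<close> as a zero object.\<close>

definition direct_sum :: "'o \<Rightarrow> 'o list \<Rightarrow> bool" where
  "direct_sum X Xs \<longleftrightarrow> (\<exists>i p.
     (\<forall>a<length Xs. i a \<in> Hom (Xs ! a) X \<and> p a \<in> Hom X (Xs ! a)) \<and>
     (\<forall>a<length Xs. \<forall>b<length Xs. p a \<cdot> i b = (if a = b then Id (Xs ! a) else 0)) \<and>
     (\<Sum>a<length Xs. i a \<cdot> p a) = Id X)"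

definition simple_ob :: "'o \<Rightarrow> bool" where
  "simple_ob X \<longleftrightarrow> Id X \<noteq> 0 \<and> (\<forall>Y f. mono_arr Y X f \<longrightarrow> f = 0 \<or> iso_arr Y X f)"

definition simple_reps :: "'o list \<Rightarrow> bool" where
  "simple_reps Xs \<longleftrightarrow> (\<forall>X\<in>set Xs. simple_ob X) \<and>
     (\<forall>X. simple_ob X \<longrightarrow> (\<exists>!a. a < length Xs \<and> isomorphic (Xs ! a) X))"

definition irr :: "'o list" where
  "irr = (SOME Xs. simple_reps Xs)"

abbreviation \<alpha>inv :: "'o \<Rightarrow> 'o \<Rightarrow> 'o \<Rightarrow> 'm" where
  "\<alpha>inv X Y Z \<equiv> inv_arr ((X \<boxtimes> Y) \<boxtimes> Z) (X \<boxtimes> (Y \<boxtimes> Z)) (\<alpha> X Y Z)"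
abbreviation \<l>inv :: "'o \<Rightarrow> 'm" where
  "\<l>inv X \<equiv> inv_arr (\<I> \<boxtimes> X) X (\<l> X)"
abbreviation \<r>inv :: "'o \<Rightarrow> 'm" where
  "\<r>inv X \<equiv> inv_arr (X \<boxtimes> \<I>) X (\<r> X)"

text \<open>
  The morphism \<open>h : W \<rightarrow> dual P\<close> corresponding to a pairing \<open>e : W \<boxtimes> P \<rightarrow> \<I>\<close>, characterised by
  \<open>Ev P \<cdot> (h \<otimes> Id P) = e\<close>. It yields dual morphisms and the canonical isomorphism
  \<open>dual Y \<boxtimes> dual X \<rightarrow> dual (X \<boxtimes> Y)\<close>.
\<close>

definition mate :: "'o \<Rightarrow> 'o \<Rightarrow> 'm \<Rightarrow> 'm" where
  "mate W P e = \<l> (Dual P) \<cdot> (e \<otimes> Id (Dual P)) \<cdot> \<alpha>inv W P (Dual P) \<cdot> (Id W \<otimes> Coev P) \<cdot> \<r>inv W"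

definition dual_arr :: "'o \<Rightarrow> 'o \<Rightarrow> 'm \<Rightarrow> 'm" where
  "dual_arr X Y f = mate (Dual Y) X (Ev Y \<cdot> (Id (Dual Y) \<otimes> f))"

definition dual_ten :: "'o \<Rightarrow> 'o \<Rightarrow> 'm" where
  "dual_ten X Y = mate (Dual Y \<boxtimes> Dual X) (X \<boxtimes> Y)
     (Ev Y \<cdot> (Id (Dual Y) \<otimes> (\<l> Y \<cdot> (Ev X \<otimes> Id Y) \<cdot> \<alpha>inv (Dual X) X Y)) \<cdot>
      \<alpha> (Dual Y) (Dual X) (X \<boxtimes> Y))"

text \<open>
  The last two conjuncts say that the natural isomorphism \<open>s : X \<rightarrow> dual (dual X)\<close> is monoidal.
\<close>

definition pivotal :: "('o \<Rightarrow> 'm) \<Rightarrow> bool" where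
  "pivotal s \<longleftrightarrow>
     (\<forall>X. iso_arr X (Dual (Dual X)) (s X)) \<and>
     (\<forall>X Y. \<forall>f\<in>Hom X Y. s Y \<cdot> f = dual_arr (Dual Y) (Dual X) (dual_arr X Y f) \<cdot> s X) \<and>
     (\<forall>X Y. dual_arr (Dual Y \<boxtimes> Dual X) (Dual (X \<boxtimes> Y)) (dual_ten X Y) \<cdot> s (X \<boxtimes> Y) =
            dual_ten (Dual Y) (Dual X) \<cdot> (s X \<otimes> s Y)) \<and>
     Ev (Dual \<I>) \<cdot> (s \<I> \<otimes> Id (Dual \<I>)) = Ev \<I> \<cdot> \<r>inv (Dual \<I>) \<cdot> \<l> (Dual \<I>)"

definition trace_right :: "('o \<Rightarrow> 'm) \<Rightarrow> 'o \<Rightarrow> 'm \<Rightarrow> 'm" where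
  "trace_right s X f = Ev (Dual X) \<cdot> ((s X \<cdot> f) \<otimes> Id (Dual X)) \<cdot> Coev X"

definition trace_left :: "('o \<Rightarrow> 'm) \<Rightarrow> 'o \<Rightarrow> 'm \<Rightarrow> 'm" where
  "trace_left s X f =
     Ev X \<cdot> (Id (Dual X) \<otimes> (f \<cdot> inv_arr X (Dual (Dual X)) (s X))) \<cdot> Coev (Dual X)"

definition spherical :: "('o \<Rightarrow> 'm) \<Rightarrow> bool" where
  "spherical s \<longleftrightarrow> pivotal s \<and> (\<forall>X. \<forall>f\<in>Hom X X. trace_left s X f = trace_right s X f)"

definition qdim :: "('o \<Rightarrow> 'm) \<Rightarrow> 'o \<Rightarrow> 'k" where
  "qdim s X = (THE c. trace_right s X (Id X) = sc c (Id \<I>))"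

definition global_dim :: "('o \<Rightarrow> 'm) \<Rightarrow> 'k" where
  "global_dim s = (\<Sum>X\<leftarrow>irr. (qdim s X)\<^sup>2)"

text \<open>
  The matrix of left multiplication by \<open>X\<close> on the Grothendieck ring in the basis of simple objects;
  the multiplicity of a simple \<open>S\<close> in \<open>Y\<close> is the dimension of \<open>Hom S Y\<close>.
\<close>

definition fusion_matrix :: "'o \<Rightarrow> real mat" where
  "fusion_matrix X =
     mat (length irr) (length irr) (\<lambda>(a, b). real (hom_dim (irr ! a) (X \<boxtimes> irr ! b)))"

definition fp_dim :: "'o \<Rightarrow> real" where
  "fp_dim X = Max {r. r \<ge> 0 \<and> eigenvalue (fusion_matrix X) r}"

definition global_fp_dim :: real where
  "global_fp_dim = (\<Sum>X\<leftarrow>irr. (fp_dim X)\<^sup>2)"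

text \<open>
  Frobenius--Perron dimensions are real, categorical dimensions lie in the abstract field \<open>'k\<close>.
  They are compared along an embedding \<open>\<phi>\<close> into \<open>'k\<close> of a subfield \<open>K\<close> of the reals containing all
  Frobenius--Perron dimensions (for \<open>'k = \<complex>\<close>, the inclusion).
\<close>

definition real_embedding :: "real set \<Rightarrow> (real \<Rightarrow> 'k) \<Rightarrow> bool" where
  "real_embedding K \<phi> \<longleftrightarrow>
     1 \<in> K \<and> (\<forall>x\<in>K. \<forall>y\<in>K. x - y \<in> K \<and> x * y \<in> K) \<and> (\<forall>x\<in>K. inverse x \<in> K) \<and>
     \<phi> 1 = 1 \<and> (\<forall>x\<in>K. \<forall>y\<in>K. \<phi> (x + y) = \<phi> x + \<phi> y \<and> \<phi> (x * y) = \<phi> x * \<phi> y) \<and>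
     (\<forall>X. fp_dim X \<in> K)"

definition pseudo_unitary :: "('o \<Rightarrow> 'm) \<Rightarrow> (real \<Rightarrow> 'k) \<Rightarrow> bool" where
  "pseudo_unitary s \<phi> \<longleftrightarrow> global_dim s = \<phi> global_fp_dim"

text \<open>
  For given \<open>\<phi>\<close>, a pseudo-unitary fusion category has exactly one canonical spherical structure \<open>t\<close>
  (Etingof, Nikshych, Ostrik); the pseudo-unitary dimension is \<open>d X = qdim t X\<close>.
\<close>

definition canonical_spherical :: "(real \<Rightarrow> 'k) \<Rightarrow> ('o \<Rightarrow> 'm) \<Rightarrow> bool" where
  "canonical_spherical \<phi> t \<longleftrightarrow>
     spherical t \<and> (\<forall>X. simple_ob X \<longrightarrow> qdim t X = \<phi> (fp_dim X))"

end

locale linear_category = btcat_data C + vector_space "scal C" for C (structure) +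
  assumes subspace_Hom: "subspace (Hom X Y)"
    and Id_Hom: "Id X \<in> Hom X X"
    and comp_Hom: "f \<in> Hom X Y \<Longrightarrow> g \<in> Hom Y Z \<Longrightarrow> g \<cdot> f \<in> Hom X Z"
    and comp_Id_right: "f \<in> Hom X Y \<Longrightarrow> f \<cdot> Id X = f"
    and comp_Id_left: "f \<in> Hom X Y \<Longrightarrow> Id Y \<cdot> f = f"
    and comp_assoc: "f \<in> Hom W X \<Longrightarrow> g \<in> Hom X Y \<Longrightarrow> h \<in> Hom Y Z \<Longrightarrow> (h \<cdot> g) \<cdot> f = h \<cdot> (g \<cdot> f)"
    and comp_add_right: "f \<in> Hom X Y \<Longrightarrow> f' \<in> Hom X Y \<Longrightarrow> g \<in> Hom Y Z \<Longrightarrow>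
      g \<cdot> (f + f') = g \<cdot> f + g \<cdot> f'"
    and comp_add_left: "f \<in> Hom X Y \<Longrightarrow> g \<in> Hom Y Z \<Longrightarrow> g' \<in> Hom Y Z \<Longrightarrow>
      (g + g') \<cdot> f = g \<cdot> f + g' \<cdot> f"
    and comp_sc_right: "f \<in> Hom X Y \<Longrightarrow> g \<in> Hom Y Z \<Longrightarrow> g \<cdot> sc c f = sc c (g \<cdot> f)"
    and comp_sc_left: "f \<in> Hom X Y \<Longrightarrow> g \<in> Hom Y Z \<Longrightarrow> sc c g \<cdot> f = sc c (g \<cdot> f)"

locale abelian_category = linear_category +
  assumes finite_direct_sums: "\<exists>X. direct_sum X Xs"
    and kernels: "f \<in> Hom X Y \<Longrightarrow> \<exists>N i. kernel_of X Y f N i"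
    and cokernels: "f \<in> Hom X Y \<Longrightarrow> \<exists>Q p. cokernel_of X Y f Q p"
    and mono_normal: "mono_arr X Y f \<Longrightarrow> \<exists>Z g. g \<in> Hom Y Z \<and> kernel_of Y Z g X f"
    and epi_normal: "epi_arr X Y f \<Longrightarrow> \<exists>Z g. g \<in> Hom Z X \<and> cokernel_of Z X g Y f"

locale tensor_category = abelian_category +
  assumes mten_Hom: "f \<in> Hom X Y \<Longrightarrow> f' \<in> Hom X' Y' \<Longrightarrow> f \<otimes> f' \<in> Hom (X \<boxtimes> X') (Y \<boxtimes> Y')"
    and mten_Id: "Id X \<otimes> Id Y = Id (X \<boxtimes> Y)"
    and mten_comp: "f \<in> Hom X Y \<Longrightarrow> g \<in> Hom Y Z \<Longrightarrow> f' \<in> Hom X' Y' \<Longrightarrow> g' \<in> Hom Y' Z' \<Longrightarrow>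
      (g \<cdot> f) \<otimes> (g' \<cdot> f') = (g \<otimes> g') \<cdot> (f \<otimes> f')"
    and mten_add_left: "f \<in> Hom X Y \<Longrightarrow> g \<in> Hom X Y \<Longrightarrow> f' \<in> Hom X' Y' \<Longrightarrow>
      (f + g) \<otimes> f' = f \<otimes> f' + g \<otimes> f'"
    and mten_add_right: "f \<in> Hom X Y \<Longrightarrow> f' \<in> Hom X' Y' \<Longrightarrow> g' \<in> Hom X' Y' \<Longrightarrow>
      f \<otimes> (f' + g') = f \<otimes> f' + f \<otimes> g'"
    and mten_sc_left: "f \<in> Hom X Y \<Longrightarrow> f' \<in> Hom X' Y' \<Longrightarrow> sc c f \<otimes> f' = sc c (f \<otimes> f')"
    and mten_sc_right: "f \<in> Hom X Y \<Longrightarrow> f' \<in> Hom X' Y' \<Longrightarrow> f \<otimes> sc c f' = sc c (f \<otimes> f')"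
    and \<alpha>_iso: "iso_arr ((X \<boxtimes> Y) \<boxtimes> Z) (X \<boxtimes> (Y \<boxtimes> Z)) (\<alpha> X Y Z)"
    and \<l>_iso: "iso_arr (\<I> \<boxtimes> X) X (\<l> X)"
    and \<r>_iso: "iso_arr (X \<boxtimes> \<I>) X (\<r> X)"
    and \<alpha>_natural: "f \<in> Hom X X' \<Longrightarrow> g \<in> Hom Y Y' \<Longrightarrow> h \<in> Hom Z Z' \<Longrightarrow>
      \<alpha> X' Y' Z' \<cdot> ((f \<otimes> g) \<otimes> h) = (f \<otimes> (g \<otimes> h)) \<cdot> \<alpha> X Y Z"
    and \<l>_natural: "f \<in> Hom X Y \<Longrightarrow> \<l> Y \<cdot> (Id \<I> \<otimes> f) = f \<cdot> \<l> X"
    and \<r>_natural: "f \<in> Hom X Y \<Longrightarrow> \<r> Y \<cdot> (f \<otimes> Id \<I>) = f \<cdot> \<r> X"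
    and pentagon: "\<alpha> W X (Y \<boxtimes> Z) \<cdot> \<alpha> (W \<boxtimes> X) Y Z =
      (Id W \<otimes> \<alpha> X Y Z) \<cdot> \<alpha> W (X \<boxtimes> Y) Z \<cdot> (\<alpha> W X Y \<otimes> Id Z)"
    and triangle: "(Id X \<otimes> \<l> Y) \<cdot> \<alpha> X \<I> Y = \<r> X \<otimes> Id Y"
    and unit_simple: "simple_ob \<I>"
    and unit_End: "f \<in> Hom \<I> \<I> \<Longrightarrow> \<exists>c. f = sc c (Id \<I>)"

locale fusion_category = tensor_category C for C (structure) and s +
  assumes Ev_Hom: "Ev X \<in> Hom (Dual X \<boxtimes> X) \<I>"
    and Coev_Hom: "Coev X \<in> Hom \<I> (X \<boxtimes> Dual X)"
    and zigzag: "\<r> X \<cdot> (Id X \<otimes> Ev X) \<cdot> \<alpha> X (Dual X) X \<cdot> (Coev X \<otimes> Id X) \<cdot> \<l>inv X = Id X"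
    and zigzag_dual: "\<l> (Dual X) \<cdot> (Ev X \<otimes> Id (Dual X)) \<cdot> \<alpha>inv (Dual X) X (Dual X) \<cdot>
      (Id (Dual X) \<otimes> Coev X) \<cdot> \<r>inv (Dual X) = Id (Dual X)"
    and spherical_s: "spherical s"
    and semisimple: "\<exists>Xs. (\<forall>S\<in>set Xs. simple_ob S) \<and> direct_sum X Xs"
    and finitely_many_simples: "\<exists>Xs. simple_reps Xs"

locale braided_fusion_category = fusion_category +
  assumes \<beta>_iso: "iso_arr (X \<boxtimes> Y) (Y \<boxtimes> X) (\<beta> X Y)"
    and \<beta>_natural: "f \<in> Hom X X' \<Longrightarrow> g \<in> Hom Y Y' \<Longrightarrow> \<beta> X' Y' \<cdot> (f \<otimes> g) = (g \<otimes> f) \<cdot> \<beta> X Y"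
    and hexagon: "\<alpha> Y Z X \<cdot> \<beta> X (Y \<boxtimes> Z) \<cdot> \<alpha> X Y Z =
      (Id Y \<otimes> \<beta> X Z) \<cdot> \<alpha> Y X Z \<cdot> (\<beta> X Y \<otimes> Id Z)"
    and hexagon_inv: "\<alpha>inv Z X Y \<cdot> \<beta> (X \<boxtimes> Y) Z \<cdot> \<alpha>inv X Y Z =
      (\<beta> X Z \<otimes> Id Y) \<cdot> \<alpha>inv X Z Y \<cdot> (Id X \<otimes> \<beta> Y Z)"

context btcat_data
begin

definition algebra :: "'o \<Rightarrow> 'm \<Rightarrow> 'm \<Rightarrow> bool" where
  "algebra A m u \<longleftrightarrow> m \<in> Hom (A \<boxtimes> A) A \<and> u \<in> Hom \<I> A \<and>
     m \<cdot> (m \<otimes> Id A) = m \<cdot> (Id A \<otimes> m) \<cdot> \<alpha> A A A \<and>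
     m \<cdot> (u \<otimes> Id A) = \<l> A \<and> m \<cdot> (Id A \<otimes> u) = \<r> A"

definition can_trace :: "('o \<Rightarrow> 'm) \<Rightarrow> 'o \<Rightarrow> 'm \<Rightarrow> 'm" where
  "can_trace s A m = Ev (Dual A) \<cdot> (s A \<otimes> Id (Dual A)) \<cdot> (m \<otimes> Id (Dual A)) \<cdot>
     \<alpha>inv A A (Dual A) \<cdot> (Id A \<otimes> Coev A) \<cdot> \<r>inv A"

definition can_pairing :: "('o \<Rightarrow> 'm) \<Rightarrow> 'o \<Rightarrow> 'm \<Rightarrow> 'm" where
  "can_pairing s A m = can_trace s A m \<cdot> m"

definition copairing :: "('o \<Rightarrow> 'm) \<Rightarrow> 'o \<Rightarrow> 'm \<Rightarrow> 'm \<Rightarrow> bool" where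
  "copairing s A m \<kappa> \<longleftrightarrow> \<kappa> \<in> Hom \<I> (A \<boxtimes> A) \<and>
     \<l> A \<cdot> (can_pairing s A m \<otimes> Id A) \<cdot> \<alpha>inv A A A \<cdot> (Id A \<otimes> \<kappa>) \<cdot> \<r>inv A = Id A"

definition separable :: "('o \<Rightarrow> 'm) \<Rightarrow> 'o \<Rightarrow> 'm \<Rightarrow> bool" where
  "separable s A m \<longleftrightarrow> (\<exists>\<kappa>. copairing s A m \<kappa>)"

definition etale :: "('o \<Rightarrow> 'm) \<Rightarrow> 'o \<Rightarrow> 'm \<Rightarrow> 'm \<Rightarrow> bool" where
  "etale s A m u \<longleftrightarrow> algebra A m u \<and> m \<cdot> \<beta> A A = m \<and> separable s A m \<and> hom_dim \<I> A = 1"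

text \<open>The copairing of a separable algebra is unique, so the choice is immaterial.\<close>

definition comult :: "('o \<Rightarrow> 'm) \<Rightarrow> 'o \<Rightarrow> 'm \<Rightarrow> 'm" where
  "comult s A m =
     (m \<otimes> Id A) \<cdot> \<alpha>inv A A A \<cdot> (Id A \<otimes> (SOME \<kappa>. copairing s A m \<kappa>)) \<cdot> \<r>inv A"

definition convolution :: "('o \<Rightarrow> 'm) \<Rightarrow> 'o \<Rightarrow> 'm \<Rightarrow> 'm \<Rightarrow> 'm \<Rightarrow> 'm" where
  "convolution s A m x y = m \<cdot> (x \<otimes> y) \<cdot> comult s A m"

definition conv_idempotents :: "('o \<Rightarrow> 'm) \<Rightarrow> 'o \<Rightarrow> 'm \<Rightarrow> 'm set" where
  "conv_idempotents s A m = {p \<in> Hom A A. convolution s A m p p = p}"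

text \<open>Minimality refers to the order \<open>q \<le> p \<longleftrightarrow> p * q = q\<close> on the idempotents of the commutative
  convolution algebra.\<close>

definition minimal_idempotents :: "('o \<Rightarrow> 'm) \<Rightarrow> 'o \<Rightarrow> 'm \<Rightarrow> 'm set" where
  "minimal_idempotents s A m = {p \<in> conv_idempotents s A m. p \<noteq> 0 \<and>
     (\<forall>q\<in>conv_idempotents s A m. convolution s A m p q = q \<longrightarrow> q = 0 \<or> q = p)}"

definition algebra_auts :: "'o \<Rightarrow> 'm \<Rightarrow> 'm \<Rightarrow> 'm set" where
  "algebra_auts A m u = {g. iso_arr A A g \<and> g \<cdot> m = m \<cdot> (g \<otimes> g) \<and> g \<cdot> u = u}"

definition galois :: "('o \<Rightarrow> 'm) \<Rightarrow> 'o \<Rightarrow> 'm \<Rightarrow> 'm \<Rightarrow> bool" where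
  "galois s A m u \<longleftrightarrow> algebra_auts A m u = minimal_idempotents s A m"

definition maximally_symmetric :: "('o \<Rightarrow> 'm) \<Rightarrow> 'o \<Rightarrow> bool" where
  "maximally_symmetric t A \<longleftrightarrow> of_nat (hom_dim A A) = qdim t A"

end

end

theory Submission
  imports Defs "Jordan_Normal_Form.Schur_Decomposition"
begin

text \<open>
  The convolution algebra \<open>Q(A) = Hom A A\<close> is commutative and reduced, so its minimal idempotents
  form a basis and sum to the unit \<open>u \<cdot> \<epsilon>\<close>. Write \<open>\<epsilon> \<cdot> x = \<lambda>(x) \<epsilon>\<close>; then \<open>\<lambda>(u \<cdot> \<epsilon>) = d(A)\<close>, hence
  \<open>\<Sum> \<lambda>(p) = d(A)\<close> over the minimal idempotents \<open>p\<close>. An automorphism has \<open>\<lambda> = 1\<close>, so Galois implies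
  maximally symmetric. Conversely, \<open>x \<in> Q(A)\<close> acts on \<open>A \<boxtimes> A\<close> by \<open>a \<otimes> b \<mapsto> \<Sum> a e\<^sub>i \<otimes> x(f\<^sub>i) b\<close> with trace
  \<open>\<lambda>(x) d(A)\<close>. For a minimal idempotent \<open>p\<close> the image of this action contains a copy of \<open>A\<close>, and
  positivity of Frobenius--Perron dimensions gives \<open>\<lambda>(p) \<ge> 1\<close>, with equality only if the image is
  that copy, which forces \<open>p\<close> to be an automorphism. If the number of minimal idempotents is \<open>d(A)\<close>,
  equality holds for all of them.

  The spherical structure \<open>s\<close> need not be the canonical one \<open>t\<close>, but the comparison \<open>s\<^sub>A\<^sup>-\<^sup>1 \<cdot> t\<^sub>A\<close> is an
  algebra automorphism of \<open>A\<close> with \<open>s\<close>-trace \<open>qdim t A \<noteq> 0\<close>, whereas a nontrivial automorphism has trace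
  zero; hence \<open>s\<^sub>A = t\<^sub>A\<close>.

  Coherence is dealt with by strictification: a morphism between words \<open>[X\<^sub>1, \<dots>, X\<^sub>n]\<close> is a family of
  morphisms \<open>X\<^sub>1 \<boxtimes> (\<dots> \<boxtimes> (X\<^sub>n \<boxtimes> W)) \<rightarrow> Y\<^sub>1 \<boxtimes> (\<dots> \<boxtimes> (Y\<^sub>k \<boxtimes> W))\<close>, natural in \<open>W\<close> and compatible with the
  associators. Words compose in a strict monoidal category, and \<open>Hom X Y\<close> is recovered as the morphisms
  \<open>[X] \<rightarrow> [Y]\<close>. An extra element \<open>Bot\<close>, the value of every ill-typed composite, makes associativity hold
  without side conditions.
\<close>

section \<open>Strict calculus: words of objects and natural families\<close>

text \<open>Dimensions and traces take values in \<open>'k\<close>, which carries no order. Every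
  inequality is therefore kept on real preimages under \<open>\<phi>\<close>: the trace of an
  idempotent is \<open>\<phi>\<close> of a nonnegative element of \<open>K\<close>, and a vanishing
  sum in \<open>'k\<close> is pulled back to the reals by injectivity of the field embedding on
  \<open>K\<close>. As \<open>fp_dim\<close> is the maximum of a set of nonnegative eigenvalues, it
  is meaningful only once that set is known to be nonempty; hence the excursion into nonnegative
  matrices. Strict positivity for simple objects then follows from the nonvanishing of their
  categorical dimension. Images of idempotents are never formed as objects. That the image of the
  action of \<open>p\<close> contains a copy of \<open>A\<close> becomes an idempotent below
  \<open>P p\<close> that factors through \<open>A\<close>; its complement is an idempotent again,
  so its trace is controlled. The equality case gives only a one-sided inverse of \<open>p\<close>;
  faithfulness of the trace on idempotents makes it two-sided.\<close>

datatype ('o, 'm) sarr = Bot | Arr "'o list" "'o list" "'o \<Rightarrow> 'm"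

context btcat_data
begin

fun ob :: "'o list \<Rightarrow> 'o \<Rightarrow> 'o" where
  "ob [] W = W"
| "ob (X # xs) W = X \<boxtimes> ob xs W"

fun wk :: "'o list \<Rightarrow> 'm \<Rightarrow> 'm" where
  "wk [] g = g"
| "wk (X # xs) g = Id X \<otimes> wk xs g"

fun asc :: "'o list \<Rightarrow> 'o \<Rightarrow> 'o \<Rightarrow> 'm" where
  "asc [] W V = Id (W \<boxtimes> V)"
| "asc (X # xs) W V = (Id X \<otimes> asc xs W V) \<cdot> \<alpha> X (ob xs W) V"

text \<open>The third conjunct makes a family a morphism of right module functors, with
  \<open>asc\<close> as the module structure of \<open>ob xs\<close>. It is what ties the components
  of a family together: between one-letter words it leaves only the families
  \<open>f \<otimes> Id W\<close>, see \<open>hat_full\<close>.\<close>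

definition natfam :: "'o list \<Rightarrow> 'o list \<Rightarrow> ('o \<Rightarrow> 'm) \<Rightarrow> bool" where
  "natfam xs ys \<phi> \<longleftrightarrow> (\<forall>W. \<phi> W \<in> Hom (ob xs W) (ob ys W)) \<and>
     (\<forall>W V. \<forall>g\<in>Hom W V. \<phi> V \<cdot> wk xs g = wk ys g \<cdot> \<phi> W) \<and>
     (\<forall>W V. asc ys W V \<cdot> (\<phi> W \<otimes> Id V) = \<phi> (W \<boxtimes> V) \<cdot> asc xs W V)"

definition SH :: "'o list \<Rightarrow> 'o list \<Rightarrow> ('o, 'm) sarr set" where
  "SH xs ys = {Arr xs ys \<phi> | \<phi>. natfam xs ys \<phi>}"

fun scomp :: "('o, 'm) sarr \<Rightarrow> ('o, 'm) sarr \<Rightarrow> ('o, 'm) sarr" where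
  "scomp (Arr ys' zs \<psi>) (Arr xs ys \<phi>) =
     (if ys' = ys \<and> natfam ys zs \<psi> \<and> natfam xs ys \<phi> then Arr xs zs (\<lambda>W. \<psi> W \<cdot> \<phi> W) else Bot)"
| "scomp _ _ = Bot"

fun whisk :: "'o list \<Rightarrow> ('o, 'm) sarr \<Rightarrow> 'o list \<Rightarrow> ('o, 'm) sarr" where
  "whisk ps (Arr xs ys \<phi>) qs = (if natfam xs ys \<phi>
     then Arr (ps @ xs @ qs) (ps @ ys @ qs) (\<lambda>W. wk ps (\<phi> (ob qs W))) else Bot)"
| "whisk ps Bot qs = Bot"

fun sscale :: "'k \<Rightarrow> ('o, 'm) sarr \<Rightarrow> ('o, 'm) sarr" where
  "sscale c (Arr xs ys \<phi>) = (if natfam xs ys \<phi> then Arr xs ys (\<lambda>W. sc c (\<phi> W)) else Bot)"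
| "sscale c Bot = Bot"

definition sid :: "'o list \<Rightarrow> ('o, 'm) sarr" where
  "sid xs = Arr xs xs (\<lambda>W. Id (ob xs W))"

end

section \<open>Linear structure of hom-spaces and inverses\<close>

context linear_category
begin
lemma sc_Hom: "f \<in> Hom X Y \<Longrightarrow> sc c f \<in> Hom X Y"
  by (rule subspace_scale[OF subspace_Hom])
lemma zero_Hom: "0 \<in> Hom X Y"
  by (rule subspace_0[OF subspace_Hom])
lemma add_Hom: "f \<in> Hom X Y \<Longrightarrow> g \<in> Hom X Y \<Longrightarrow> f + g \<in> Hom X Y"
  by (rule subspace_add[OF subspace_Hom])
lemma diff_Hom: "f \<in> Hom X Y \<Longrightarrow> g \<in> Hom X Y \<Longrightarrow> f - g \<in> Hom X Y"
  by (rule subspace_diff[OF subspace_Hom])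
lemma sum_Hom: "(\<And>a. a \<in> S \<Longrightarrow> f a \<in> Hom X Y) \<Longrightarrow> sum f S \<in> Hom X Y"
  by (rule subspace_sum[OF subspace_Hom])

lemma inverse_pair_unique:
  assumes "inverse_pair X Y f g" "inverse_pair X Y f h" shows "g = h"
proof -
  have g: "g \<in> Hom Y X" "g \<cdot> f = Id X" and f: "f \<in> Hom X Y" and h: "h \<in> Hom Y X" "f \<cdot> h = Id Y"
    using assms unfolding inverse_pair_def by auto
  have "g = g \<cdot> (f \<cdot> h)" using comp_Id_right[OF g(1)] h(2) by simp
  also have "\<dots> = (g \<cdot> f) \<cdot> h" by (rule comp_assoc[OF h(1) f g(1), symmetric])
  also have "\<dots> = h" using comp_Id_left[OF h(1)] g(2) by simp
  finally show ?thesis .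
qed

lemma inv_arr_eq: "inverse_pair X Y f g \<Longrightarrow> inv_arr X Y f = g"
  unfolding inv_arr_def using inverse_pair_unique by blast

lemma inverse_pair_inv_arr: "iso_arr X Y f \<Longrightarrow> inverse_pair X Y f (inv_arr X Y f)"
  unfolding iso_arr_def using inv_arr_eq by blast

lemma iso_arr_Hom: "iso_arr X Y f \<Longrightarrow> f \<in> Hom X Y"
  and inv_arr_Hom: "iso_arr X Y f \<Longrightarrow> inv_arr X Y f \<in> Hom Y X"
  and inv_arr_comp: "iso_arr X Y f \<Longrightarrow> inv_arr X Y f \<cdot> f = Id X"
  and comp_inv_arr: "iso_arr X Y f \<Longrightarrow> f \<cdot> inv_arr X Y f = Id Y"
  using inverse_pair_inv_arr unfolding inverse_pair_def by blast+

lemma comp_zero_right: "g \<in> Hom Y Z \<Longrightarrow> g \<cdot> 0 = 0"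
  using comp_add_right[of 0 Y Y 0 g Z] zero_Hom by simp
lemma comp_zero_left: "f \<in> Hom X Y \<Longrightarrow> 0 \<cdot> f = 0"
  using comp_add_left[of f X Y 0 Y 0] zero_Hom by simp
lemma comp_diff_right: "f \<in> Hom X Y \<Longrightarrow> f' \<in> Hom X Y \<Longrightarrow> g \<in> Hom Y Z \<Longrightarrow>
      g \<cdot> (f - f') = g \<cdot> f - g \<cdot> f'"
  using comp_add_right[of "f - f'" X Y f' g Z] diff_Hom[of f X Y f'] by (simp add: algebra_simps)
lemma comp_diff_left: "f \<in> Hom X Y \<Longrightarrow> g \<in> Hom Y Z \<Longrightarrow> g' \<in> Hom Y Z \<Longrightarrow>
      (g - g') \<cdot> f = g \<cdot> f - g' \<cdot> f"
  using comp_add_left[of f X Y "g - g'" Z g'] diff_Hom[of g Y Z g'] by (simp add: algebra_simps)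
end

section \<open>Closure of natural families under composition and whiskering\<close>

context tensor_category
begin

lemma wk_Hom: "g \<in> Hom W V \<Longrightarrow> wk xs g \<in> Hom (ob xs W) (ob xs V)"
  by (induction xs) (auto intro: mten_Hom Id_Hom)

lemma wk_Id: "wk xs (Id W) = Id (ob xs W)"
  by (induction xs) (auto simp: mten_Id)

lemma ten_comp_left: "f \<in> Hom X Y \<Longrightarrow> g \<in> Hom Y Z \<Longrightarrow> (g \<cdot> f) \<otimes> Id V = (g \<otimes> Id V) \<cdot> (f \<otimes> Id V)"
  using mten_comp[of f X Y g Z "Id V" V V "Id V" V] Id_Hom[of V] comp_Id_left[of "Id V" V V] by simp
lemma ten_comp_right: "f \<in> Hom X Y \<Longrightarrow> g \<in> Hom Y Z \<Longrightarrow> Id V \<otimes> (g \<cdot> f) = (Id V \<otimes> g) \<cdot> (Id V \<otimes> f)"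
  using mten_comp[of "Id V" V V "Id V" V f X Y g Z] Id_Hom[of V] comp_Id_left[of "Id V" V V] by simp

lemma wk_comp: "f \<in> Hom W V \<Longrightarrow> g \<in> Hom V U \<Longrightarrow> wk xs (g \<cdot> f) = wk xs g \<cdot> wk xs f"
proof (induction xs)
  case (Cons X xs)
  then show ?case using ten_comp_right[OF wk_Hom[of f W V xs] wk_Hom[of g V U xs], of X] by simp
qed auto

lemma wk_sc: "f \<in> Hom W V \<Longrightarrow> wk xs (sc c f) = sc c (wk xs f)"
proof (induction xs)
  case (Cons X xs)
  then show ?case using mten_sc_right[OF Id_Hom wk_Hom[of f W V xs]] by simp
qed auto

lemma wk_append: "wk (xs @ ys) g = wk xs (wk ys g)"
  by (induction xs) auto
lemma ob_append: "ob (xs @ ys) g = ob xs (ob ys g)"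
  by (induction xs) auto

lemma asc_Hom: "asc xs W V \<in> Hom (ob xs W \<boxtimes> V) (ob xs (W \<boxtimes> V))"
proof (induction xs)
  case (Cons X xs)
  have "\<alpha> X (ob xs W) V \<in> Hom ((X \<boxtimes> ob xs W) \<boxtimes> V) (X \<boxtimes> (ob xs W \<boxtimes> V))" by (rule iso_arr_Hom[OF \<alpha>_iso])
  moreover have "Id X \<otimes> asc xs W V \<in> Hom (X \<boxtimes> (ob xs W \<boxtimes> V)) (X \<boxtimes> ob xs (W \<boxtimes> V))"
    using Cons by (intro mten_Hom Id_Hom)
  ultimately show ?case by (simp add: comp_Hom)
qed (simp add: Id_Hom)

lemma \<alpha>_Hom: "\<alpha> X Y Z \<in> Hom ((X \<boxtimes> Y) \<boxtimes> Z) (X \<boxtimes> (Y \<boxtimes> Z))" by (rule iso_arr_Hom[OF \<alpha>_iso])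

lemma asc_append: "asc (xs @ ys) W V = wk xs (asc ys W V) \<cdot> asc xs (ob ys W) V"
proof (induction xs)
  case Nil
  then show ?case using comp_Id_right[OF asc_Hom] by simp
next
  case (Cons X xs)
  have 1: "Id X \<otimes> (wk xs (asc ys W V) \<cdot> asc xs (ob ys W) V)
    = (Id X \<otimes> wk xs (asc ys W V)) \<cdot> (Id X \<otimes> asc xs (ob ys W) V)"
    by (rule ten_comp_right[OF asc_Hom wk_Hom[OF asc_Hom]])
  have 2: "((Id X \<otimes> wk xs (asc ys W V)) \<cdot> (Id X \<otimes> asc xs (ob ys W) V)) \<cdot> \<alpha> X (ob (xs @ ys) W) V
    = (Id X \<otimes> wk xs (asc ys W V)) \<cdot> (Id X \<otimes> asc xs (ob ys W) V) \<cdot> \<alpha> X (ob (xs @ ys) W) V"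
    unfolding ob_append
    by (rule comp_assoc[OF \<alpha>_Hom mten_Hom[OF Id_Hom asc_Hom] mten_Hom[OF Id_Hom wk_Hom[OF asc_Hom]]])
  show ?case using Cons 1 2 by (simp add: ob_append)
qed

lemma asc_natural: "g \<in> Hom W W' \<Longrightarrow> asc xs W' V \<cdot> (wk xs g \<otimes> Id V) = wk xs (g \<otimes> Id V) \<cdot> asc xs W V"
proof (induction xs)
  case Nil
  then show ?case using comp_Id_right[OF mten_Hom[OF Nil Id_Hom]] comp_Id_left[OF mten_Hom[OF Nil Id_Hom]] by simp
next
  case (Cons X xs)
  note w = wk_Hom[OF Cons.prems, of xs]
  have "asc (X # xs) W' V \<cdot> (wk (X # xs) g \<otimes> Id V)
     = (Id X \<otimes> asc xs W' V) \<cdot> (\<alpha> X (ob xs W') V \<cdot> ((Id X \<otimes> wk xs g) \<otimes> Id V))"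
    using comp_assoc[OF mten_Hom[OF mten_Hom[OF Id_Hom w] Id_Hom] \<alpha>_Hom mten_Hom[OF Id_Hom asc_Hom]] by simp
  also have "\<dots> = (Id X \<otimes> asc xs W' V) \<cdot> ((Id X \<otimes> (wk xs g \<otimes> Id V)) \<cdot> \<alpha> X (ob xs W) V)"
    using \<alpha>_natural[OF Id_Hom w Id_Hom] by simp
  also have "\<dots> = ((Id X \<otimes> asc xs W' V) \<cdot> (Id X \<otimes> (wk xs g \<otimes> Id V))) \<cdot> \<alpha> X (ob xs W) V"
    using comp_assoc[OF \<alpha>_Hom mten_Hom[OF Id_Hom mten_Hom[OF w Id_Hom]] mten_Hom[OF Id_Hom asc_Hom]] by simp
  also have "\<dots> = (Id X \<otimes> (wk xs (g \<otimes> Id V) \<cdot> asc xs W V)) \<cdot> \<alpha> X (ob xs W) V"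
    using Cons.IH[OF Cons.prems] by (simp only: ten_comp_right[OF mten_Hom[OF w Id_Hom] asc_Hom, symmetric])
  also have "\<dots> = ((Id X \<otimes> wk xs (g \<otimes> Id V)) \<cdot> (Id X \<otimes> asc xs W V)) \<cdot> \<alpha> X (ob xs W) V"
    using ten_comp_right[OF asc_Hom wk_Hom[OF mten_Hom[OF Cons.prems Id_Hom]]] by simp
  also have "\<dots> = wk (X # xs) (g \<otimes> Id V) \<cdot> asc (X # xs) W V"
    using comp_assoc[OF \<alpha>_Hom mten_Hom[OF Id_Hom asc_Hom] mten_Hom[OF Id_Hom wk_Hom[OF mten_Hom[OF Cons.prems Id_Hom]]]] by simp
  finally show ?case .
qed

lemma natfamD:
  assumes "natfam xs ys \<phi>"
  shows "\<phi> W \<in> Hom (ob xs W) (ob ys W)"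
    and "g \<in> Hom W V \<Longrightarrow> \<phi> V \<cdot> wk xs g = wk ys g \<cdot> \<phi> W"
    and "asc ys W V \<cdot> (\<phi> W \<otimes> Id V) = \<phi> (W \<boxtimes> V) \<cdot> asc xs W V"
  using assms unfolding natfam_def by blast+

lemma natfam_Id: "natfam xs xs (\<lambda>W. Id (ob xs W))"
  unfolding natfam_def
proof (intro conjI allI ballI)
  fix W V h
  show "Id (ob xs W) \<in> Hom (ob xs W) (ob xs W)" by (rule Id_Hom)
  show "asc xs W V \<cdot> (Id (ob xs W) \<otimes> Id V) = Id (ob xs (W \<boxtimes> V)) \<cdot> asc xs W V"
    unfolding mten_Id using comp_Id_right[OF asc_Hom] comp_Id_left[OF asc_Hom] by simp
  assume "h \<in> Hom W V"
  then show "Id (ob xs V) \<cdot> wk xs h = wk xs h \<cdot> Id (ob xs W)"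
    using comp_Id_right[OF wk_Hom] comp_Id_left[OF wk_Hom] by simp
qed

lemma natfam_comp:
  assumes f: "natfam xs ys \<phi>" and g: "natfam ys zs \<psi>"
  shows "natfam xs zs (\<lambda>W. \<psi> W \<cdot> \<phi> W)"
  unfolding natfam_def
proof (intro conjI allI ballI)
  note F = natfamD[OF f] and G = natfamD[OF g]
  fix W V
  show "\<psi> W \<cdot> \<phi> W \<in> Hom (ob xs W) (ob zs W)" by (rule comp_Hom[OF F(1) G(1)])
  show "asc zs W V \<cdot> ((\<psi> W \<cdot> \<phi> W) \<otimes> Id V) = (\<psi> (W \<boxtimes> V) \<cdot> \<phi> (W \<boxtimes> V)) \<cdot> asc xs W V" 
    using ten_comp_left[OF F(1) G(1), of W V] F(3)[of W V] G(3)[of W V]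
      comp_assoc[OF mten_Hom[OF F(1) Id_Hom] mten_Hom[OF G(1) Id_Hom] asc_Hom, of W V]
      comp_assoc[OF asc_Hom F(1) G(1), of W V]
      comp_assoc[OF mten_Hom[OF F(1) Id_Hom] asc_Hom G(1), of W V] by simp
  fix h assume h: "h \<in> Hom W V"
  show "(\<psi> V \<cdot> \<phi> V) \<cdot> wk xs h = wk zs h \<cdot> \<psi> W \<cdot> \<phi> W"
    using F(2)[OF h] G(2)[OF h] comp_assoc[OF wk_Hom[OF h] F(1) G(1)]
    comp_assoc[OF F(1) G(1) wk_Hom[OF h]] comp_assoc[OF F(1) wk_Hom[OF h] G(1)] by simp
qed

text \<open>By \<open>asc_append\<close> the associator of the long word splits into those of
  \<open>ps\<close>, of the middle word and of \<open>qs\<close>. The part for \<open>ps\<close> is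
  passed by \<open>asc_natural\<close>, the middle part by the module condition on
  \<open>\<phi>\<close>, and the part for \<open>qs\<close> by naturality of \<open>\<phi>\<close>
  along \<open>asc qs W V\<close> itself.\<close>

lemma natfam_whisk:
  assumes f: "natfam xs ys \<phi>"
  shows "natfam (ps @ xs @ qs) (ps @ ys @ qs) (\<lambda>W. wk ps (\<phi> (ob qs W)))"
  unfolding natfam_def
proof (intro conjI allI ballI)
  note F = natfamD[OF f]
  fix W V
  show "wk ps (\<phi> (ob qs W)) \<in> Hom (ob (ps @ xs @ qs) W) (ob (ps @ ys @ qs) W)"
    unfolding ob_append by (rule wk_Hom[OF F(1)])
  show "asc (ps @ ys @ qs) W V \<cdot> (wk ps (\<phi> (ob qs W)) \<otimes> Id V) =
           wk ps (\<phi> (ob qs (W \<boxtimes> V))) \<cdot> asc (ps @ xs @ qs) W V"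
  proof -
    let ?Q = "ob qs W"
    have 1: "asc (ps @ us @ qs) W V = wk ps (wk us (asc qs W V) \<cdot> asc us ?Q V) \<cdot> asc ps (ob us ?Q) V" for us
      unfolding asc_append ob_append by simp
    have "asc (ps @ ys @ qs) W V \<cdot> (wk ps (\<phi> ?Q) \<otimes> Id V)
      = wk ps (wk ys (asc qs W V) \<cdot> asc ys ?Q V) \<cdot> (asc ps (ob ys ?Q) V \<cdot> (wk ps (\<phi> ?Q) \<otimes> Id V))"
      unfolding 1 by (rule comp_assoc[OF mten_Hom[OF wk_Hom[OF F(1)] Id_Hom] asc_Hom wk_Hom[OF comp_Hom[OF asc_Hom wk_Hom[OF asc_Hom]]]])
    also have "\<dots> = wk ps (wk ys (asc qs W V) \<cdot> asc ys ?Q V) \<cdot> (wk ps (\<phi> ?Q \<otimes> Id V) \<cdot> asc ps (ob xs ?Q) V)"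
      by (simp add: asc_natural[OF F(1)])
    also have "\<dots> = wk ps ((wk ys (asc qs W V) \<cdot> asc ys ?Q V) \<cdot> (\<phi> ?Q \<otimes> Id V)) \<cdot> asc ps (ob xs ?Q) V"
      using comp_assoc[OF asc_Hom wk_Hom[OF mten_Hom[OF F(1) Id_Hom]] wk_Hom[OF comp_Hom[OF asc_Hom wk_Hom[OF asc_Hom]]]]
        wk_comp[OF mten_Hom[OF F(1) Id_Hom] comp_Hom[OF asc_Hom wk_Hom[OF asc_Hom]]] by simp
    also have "(wk ys (asc qs W V) \<cdot> asc ys ?Q V) \<cdot> (\<phi> ?Q \<otimes> Id V)
       = wk ys (asc qs W V) \<cdot> \<phi> (?Q \<boxtimes> V) \<cdot> asc xs ?Q V"
      using comp_assoc[OF mten_Hom[OF F(1) Id_Hom] asc_Hom wk_Hom[OF asc_Hom]] F(3) by simp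
    also have "\<dots> = (wk ys (asc qs W V) \<cdot> \<phi> (?Q \<boxtimes> V)) \<cdot> asc xs ?Q V"
      by (rule comp_assoc[OF asc_Hom F(1) wk_Hom[OF asc_Hom], symmetric])
    also have "\<dots> = (\<phi> (ob qs (W \<boxtimes> V)) \<cdot> wk xs (asc qs W V)) \<cdot> asc xs ?Q V"
      using F(2)[OF asc_Hom[of qs W V]] by simp
    also have "\<dots> = \<phi> (ob qs (W \<boxtimes> V)) \<cdot> wk xs (asc qs W V) \<cdot> asc xs ?Q V"
      by (rule comp_assoc[OF asc_Hom wk_Hom[OF asc_Hom] F(1)])
    also have "wk ps \<dots> \<cdot> asc ps (ob xs ?Q) V = wk ps (\<phi> (ob qs (W \<boxtimes> V))) \<cdot> asc (ps @ xs @ qs) W V"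
      unfolding 1 wk_comp[OF comp_Hom[OF asc_Hom wk_Hom[OF asc_Hom]] F(1)]
      by (rule comp_assoc[OF asc_Hom wk_Hom[OF comp_Hom[OF asc_Hom wk_Hom[OF asc_Hom]]] wk_Hom[OF F(1)]])
    finally show ?thesis .
  qed
  fix h assume h: "h \<in> Hom W V"
  show "wk ps (\<phi> (ob qs V)) \<cdot> wk (ps @ xs @ qs) h = wk (ps @ ys @ qs) h \<cdot> wk ps (\<phi> (ob qs W))"
    unfolding wk_append using F(2)[OF wk_Hom[OF h, of qs]]
     wk_comp[OF wk_Hom[OF wk_Hom[OF h]] F(1), of ps] wk_comp[OF F(1) wk_Hom[OF wk_Hom[OF h]], of ps] by metis
qed

lemma natfam_sc:
  assumes f: "natfam xs ys \<phi>"
  shows "natfam xs ys (\<lambda>W. sc c (\<phi> W))"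
  unfolding natfam_def
proof (intro conjI allI ballI)
  note F = natfamD[OF f]
  fix W V
  show "sc c (\<phi> W) \<in> Hom (ob xs W) (ob ys W)" by (rule sc_Hom[OF F(1)])
  show "asc ys W V \<cdot> (sc c (\<phi> W) \<otimes> Id V) = sc c (\<phi> (W \<boxtimes> V)) \<cdot> asc xs W V"
    using mten_sc_left[OF F(1) Id_Hom] F(3)[of W V] comp_sc_left[OF asc_Hom F(1)]
     comp_sc_right[OF mten_Hom[OF F(1) Id_Hom] asc_Hom] by simp
  fix h assume h: "h \<in> Hom W V"
  show "sc c (\<phi> V) \<cdot> wk xs h = wk ys h \<cdot> sc c (\<phi> W)"
    using F(2)[OF h] comp_sc_left[OF wk_Hom[OF h] F(1)] comp_sc_right[OF F(1) wk_Hom[OF h]] by simp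
qed

section \<open>Laws of the strict monoidal calculus\<close>

lemma scomp_assoc: "scomp (scomp h g) f = scomp h (scomp g f)"
proof -
  { fix ys zs us \<psi> \<phi> \<chi> xs assume *: "natfam zs us \<chi>" "natfam ys zs \<psi>" "natfam xs ys \<phi>" 
    have "(\<lambda>W. (\<chi> W \<cdot> \<psi> W) \<cdot> \<phi> W) = (\<lambda>W. \<chi> W \<cdot> \<psi> W \<cdot> \<phi> W)"
      using comp_assoc[OF natfamD(1)[OF *(3)] natfamD(1)[OF *(2)] natfamD(1)[OF *(1)]] by auto }
  then show ?thesis by (cases h; cases g; cases f) (auto simp: natfam_comp)
qed

lemma whisk_scomp: "whisk ps (scomp g f) qs = scomp (whisk ps g qs) (whisk ps f qs)"
proof -
  { fix ys zs \<psi> \<phi> xs assume *: "natfam ys zs \<psi>" "natfam xs ys \<phi>" 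
    have "(\<lambda>W. wk ps (\<psi> (ob qs W) \<cdot> \<phi> (ob qs W))) = (\<lambda>W. wk ps (\<psi> (ob qs W)) \<cdot> wk ps (\<phi> (ob qs W)))"
      using wk_comp[OF natfamD(1)[OF *(2)] natfamD(1)[OF *(1)]] by auto }
  then show ?thesis by (cases g; cases f) (auto simp: natfam_comp natfam_whisk)
qed

lemma whisk_whisk: "whisk ps (whisk us f vs) qs = whisk (ps @ us) f (vs @ qs)"
  by (cases f) (auto simp: natfam_whisk wk_append ob_append)

lemma whisk_sscale: "whisk ps (sscale c f) qs = sscale c (whisk ps f qs)"
proof -
  { fix \<phi> xs ys assume *: "natfam xs ys \<phi>" 
    have "(\<lambda>W. wk ps (sc c (\<phi> (ob qs W)))) = (\<lambda>W. sc c (wk ps (\<phi> (ob qs W))))"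
      using wk_sc[OF natfamD(1)[OF *]] by auto }
  then show ?thesis by (cases f) (auto simp: natfam_sc natfam_whisk)
qed

lemma scomp_sscale: "scomp (sscale c g) f = sscale c (scomp g f)" "scomp g (sscale c f) = sscale c (scomp g f)"
proof -
  { fix ys zs \<psi> \<phi> xs assume *: "natfam ys zs \<psi>" "natfam xs ys \<phi>" 
    have "(\<lambda>W. sc c (\<psi> W) \<cdot> \<phi> W) = (\<lambda>W. sc c (\<psi> W \<cdot> \<phi> W))"
      "(\<lambda>W. \<psi> W \<cdot> sc c (\<phi> W)) = (\<lambda>W. sc c (\<psi> W \<cdot> \<phi> W))"
      using comp_sc_left[OF natfamD(1)[OF *(2)] natfamD(1)[OF *(1)]]
         comp_sc_right[OF natfamD(1)[OF *(2)] natfamD(1)[OF *(1)]] by auto }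
  then show "scomp (sscale c g) f = sscale c (scomp g f)" "scomp g (sscale c f) = sscale c (scomp g f)"
    by (cases g; cases f; auto simp: natfam_comp natfam_sc)+
qed

lemma scomp_sid: "f \<in> SH xs ys \<Longrightarrow> scomp f (sid xs) = f" "f \<in> SH xs ys \<Longrightarrow> scomp (sid ys) f = f"
proof -
  { fix \<phi> assume *: "natfam xs ys \<phi>"
    have "(\<lambda>W. \<phi> W \<cdot> Id (ob xs W)) = \<phi>" "(\<lambda>W. Id (ob ys W) \<cdot> \<phi> W) = \<phi>"
      using comp_Id_left[OF natfamD(1)[OF *]] comp_Id_right[OF natfamD(1)[OF *]] by auto }
  then show "f \<in> SH xs ys \<Longrightarrow> scomp f (sid xs) = f" "f \<in> SH xs ys \<Longrightarrow> scomp (sid ys) f = f"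
    unfolding SH_def sid_def by (auto simp: natfam_Id)
qed

lemma whisk_sid: "whisk ps (sid xs) qs = sid (ps @ xs @ qs)"
  unfolding sid_def by (auto simp: natfam_Id wk_Id ob_append)

lemma whisk_Nil: "f \<in> SH xs ys \<Longrightarrow> whisk [] f [] = f"
  unfolding SH_def by auto

text \<open>Interchange is naturality of the left family, applied to the component of the right
  one.\<close>

lemma interchange:
  assumes "f \<in> SH xs ys" "g \<in> SH us vs"
  shows "scomp (whisk ps f (zs @ vs @ qs)) (whisk (ps @ xs @ zs) g qs)
   = scomp (whisk (ps @ ys @ zs) g qs) (whisk ps f (zs @ us @ qs))"
proof -
  obtain \<phi> \<psi> where f: "f = Arr xs ys \<phi>" "natfam xs ys \<phi>" and g: "g = Arr us vs \<psi>" "natfam us vs \<psi>"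
    using assms unfolding SH_def by auto
  have "wk ps (\<phi> (ob zs (ob vs (ob qs W)))) \<cdot> wk ps (wk xs (wk zs (\<psi> (ob qs W))))
    = wk ps (wk ys (wk zs (\<psi> (ob qs W)))) \<cdot> wk ps (\<phi> (ob zs (ob us (ob qs W))))" for W
  proof -
    have z: "wk zs (\<psi> (ob qs W)) \<in> Hom (ob zs (ob us (ob qs W))) (ob zs (ob vs (ob qs W)))"
      by (rule wk_Hom[OF natfamD(1)[OF g(2)]])
    show ?thesis using natfamD(2)[OF f(2) z] wk_comp[OF wk_Hom[OF z] natfamD(1)[OF f(2)], of ps]
        wk_comp[OF natfamD(1)[OF f(2)] wk_Hom[OF z], of ps] by metis
  qed
  moreover have "natfam (ps @ xs @ zs @ us @ qs) (ps @ ys @ zs @ us @ qs) (\<lambda>W. wk ps (\<phi> (ob (zs @ us @ qs) W)))"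
    "natfam (ps @ xs @ zs @ vs @ qs) (ps @ ys @ zs @ vs @ qs) (\<lambda>W. wk ps (\<phi> (ob (zs @ vs @ qs) W)))"
    "natfam (ps @ xs @ zs @ us @ qs) (ps @ xs @ zs @ vs @ qs) (\<lambda>W. wk (ps @ xs @ zs) (\<psi> (ob qs W)))"
    "natfam (ps @ ys @ zs @ us @ qs) (ps @ ys @ zs @ vs @ qs) (\<lambda>W. wk (ps @ ys @ zs) (\<psi> (ob qs W)))"
    using natfam_whisk[OF f(2), of ps "zs @ us @ qs"] natfam_whisk[OF f(2), of ps "zs @ vs @ qs"]
      natfam_whisk[OF g(2), of "ps @ xs @ zs" qs] natfam_whisk[OF g(2), of "ps @ ys @ zs" qs] by simp_all
  ultimately show ?thesis unfolding f(1) g(1) using f(2) g(2)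
    by (auto simp: wk_append ob_append)
qed

end

section \<open>Embedding of the category into the calculus of words\<close>

context btcat_data
begin
fun sdom :: "('o, 'm) sarr \<Rightarrow> 'o list" where "sdom (Arr xs ys \<phi>) = xs" | "sdom Bot = []"
fun scod :: "('o, 'm) sarr \<Rightarrow> 'o list" where "scod (Arr xs ys \<phi>) = ys" | "scod Bot = []"
fun valid :: "('o, 'm) sarr \<Rightarrow> bool" where
  "valid (Arr xs ys \<phi>) = natfam xs ys \<phi>" | "valid Bot = False"

notation scomp (infixr "\<star>" 65)

definition hat :: "'o \<Rightarrow> 'o \<Rightarrow> 'm \<Rightarrow> ('o, 'm) sarr" where
  "hat X Y f = Arr [X] [Y] (\<lambda>W. f \<otimes> Id W)"
definition al :: "'o \<Rightarrow> 'o \<Rightarrow> ('o, 'm) sarr" where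
  "al X Y = Arr [X \<boxtimes> Y] [X, Y] (\<alpha> X Y)"
definition ali :: "'o \<Rightarrow> 'o \<Rightarrow> ('o, 'm) sarr" where
  "ali X Y = Arr [X, Y] [X \<boxtimes> Y] (\<alpha>inv X Y)"
definition lu :: "('o, 'm) sarr" where
  "lu = Arr [\<I>] [] \<l>"
definition lui :: "('o, 'm) sarr" where
  "lui = Arr [] [\<I>] \<l>inv"

text \<open>Typing and word form are carried together, so that a nested expression of the category
  is translated by plain resolution with \<open>hats_rules\<close>, the word being produced as a
  schematic result and simplified afterwards.\<close>

definition hats :: "'o \<Rightarrow> 'o \<Rightarrow> 'm \<Rightarrow> ('o, 'm) sarr \<Rightarrow> bool" where
  "hats X Y f F \<longleftrightarrow> f \<in> Hom X Y \<and> hat X Y f = F"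
end

context tensor_category
begin

declare scomp.simps [simp del] whisk.simps [simp del]

lemma SH_iff: "f \<in> SH xs ys \<longleftrightarrow> valid f \<and> sdom f = xs \<and> scod f = ys"
  unfolding SH_def by (cases f) auto

lemma valid_scomp [simp]: "valid (g \<star> f) \<longleftrightarrow> valid g \<and> valid f \<and> sdom g = scod f"
  by (cases f; cases g) (auto simp: scomp.simps natfam_comp)
lemma sdom_scomp [simp]: "valid g \<Longrightarrow> valid f \<Longrightarrow> sdom g = scod f \<Longrightarrow> sdom (g \<star> f) = sdom f"
  by (cases f; cases g) (auto simp: scomp.simps)
lemma scod_scomp [simp]: "valid g \<Longrightarrow> valid f \<Longrightarrow> sdom g = scod f \<Longrightarrow> scod (g \<star> f) = scod g"
  by (cases f; cases g) (auto simp: scomp.simps)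
lemma valid_whisk [simp]: "valid (whisk ps f qs) = valid f"
  by (cases f) (auto simp: whisk.simps natfam_whisk)
lemma sdom_whisk [simp]: "valid f \<Longrightarrow> sdom (whisk ps f qs) = ps @ sdom f @ qs"
  by (cases f) (auto simp: whisk.simps)
lemma scod_whisk [simp]: "valid f \<Longrightarrow> scod (whisk ps f qs) = ps @ scod f @ qs"
  by (cases f) (auto simp: whisk.simps)
lemma valid_sscale [simp]: "valid (sscale c f) = valid f"
  by (cases f) (auto simp: natfam_sc)
lemma sdom_sscale [simp]: "valid f \<Longrightarrow> sdom (sscale c f) = sdom f"
  by (cases f) auto
lemma scod_sscale [simp]: "valid f \<Longrightarrow> scod (sscale c f) = scod f"
  by (cases f) auto
lemma valid_sid [simp]: "valid (sid xs)" "sdom (sid xs) = xs" "scod (sid xs) = xs"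
  unfolding sid_def by (auto simp: natfam_Id)
lemma sid_left [simp]: "valid f \<Longrightarrow> scod f = ys \<Longrightarrow> sid ys \<star> f = f"
  using scomp_sid(2)[of f "sdom f"] by (simp add: SH_iff)
lemma sid_right [simp]: "valid f \<Longrightarrow> sdom f = xs \<Longrightarrow> f \<star> sid xs = f"
  using scomp_sid(1)[of f _ "scod f"] by (simp add: SH_iff)
lemma whisk_empty [simp]: "valid f \<Longrightarrow> whisk [] f [] = f"
  using whisk_Nil by (simp add: SH_iff)

lemmas strict_simps [simp] = scomp_assoc whisk_scomp whisk_whisk whisk_sid scomp_sscale whisk_sscale

lemma ichg:
  assumes "valid f" "valid g" "Q = zs @ scod g @ qs" "P = ps @ sdom f @ zs" "P' = ps @ scod f @ zs" "Q' = zs @ sdom g @ qs"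
  shows "whisk ps f Q \<star> whisk P g qs = whisk P' g qs \<star> whisk ps f Q'"
  using interchange[of f "sdom f" "scod f" g "sdom g" "scod g"] assms by (simp add: SH_iff)

text \<open>Composites are normalised to right-nested form, where a rule for two factors meets a
  third one; this variant lets the rule fire there.\<close>

lemma tail_eq: "a \<star> b = c \<Longrightarrow> a \<star> (b \<star> h) = c \<star> h"
  by (metis scomp_assoc)
lemma natfam_hat: "f \<in> Hom X Y \<Longrightarrow> natfam [X] [Y] (\<lambda>W. f \<otimes> Id W)"
  unfolding natfam_def
proof (intro conjI allI ballI)
  fix W V h assume f: "f \<in> Hom X Y"
  show "f \<otimes> Id W \<in> Hom (ob [X] W) (ob [Y] W)" using mten_Hom[OF f Id_Hom] by simp
  show "asc [Y] W V \<cdot> ((f \<otimes> Id W) \<otimes> Id V) = (f \<otimes> Id (W \<boxtimes> V)) \<cdot> asc [X] W V"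
    using \<alpha>_natural[OF f Id_Hom Id_Hom, of W V] comp_Id_left[OF \<alpha>_Hom] by (simp add: mten_Id)
  assume h: "h \<in> Hom W V"
  show "(f \<otimes> Id V) \<cdot> wk [X] h = wk [Y] h \<cdot> (f \<otimes> Id W)"
    using mten_comp[OF Id_Hom f h Id_Hom] mten_comp[OF f Id_Hom Id_Hom h]
      comp_Id_left[OF f] comp_Id_right[OF f] comp_Id_left[OF h] comp_Id_right[OF h] by simp
qed

text \<open>Invertibility in each component is enough. This yields the words \<open>ali\<close> and
  \<open>lui\<close> from \<open>al\<close> and \<open>lu\<close> without further coherence
  computations.\<close>

lemma natfam_inverse:
  assumes f: "natfam xs ys \<phi>" and i: "\<And>W. inverse_pair (ob xs W) (ob ys W) (\<phi> W) (\<psi> W)"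
  shows "natfam ys xs \<psi>"
  unfolding natfam_def
proof (intro conjI allI ballI)
  note F = natfamD[OF f]
  have P: "\<psi> W \<in> Hom (ob ys W) (ob xs W)" "\<psi> W \<cdot> \<phi> W = Id (ob xs W)" "\<phi> W \<cdot> \<psi> W = Id (ob ys W)" for W
    using i[of W] unfolding inverse_pair_def by auto
  fix W V
  show "\<psi> W \<in> Hom (ob ys W) (ob xs W)" by (rule P)
  have PI: "(\<phi> W \<otimes> Id V) \<cdot> (\<psi> W \<otimes> Id V) = Id (ob ys W \<boxtimes> V)"
    using ten_comp_left[OF P(1) F(1), of W V] P(3) mten_Id by simp
  note pw = mten_Hom[OF P(1) Id_Hom, of W V] and fw = mten_Hom[OF F(1) Id_Hom, of W V]
  have "asc xs W V \<cdot> (\<psi> W \<otimes> Id V) = (\<psi> (W \<boxtimes> V) \<cdot> \<phi> (W \<boxtimes> V)) \<cdot> asc xs W V \<cdot> (\<psi> W \<otimes> Id V)"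
    using P(2)[of "W \<boxtimes> V"] comp_Id_left[OF comp_Hom[OF pw asc_Hom]] by simp
  also have "\<dots> = \<psi> (W \<boxtimes> V) \<cdot> ((\<phi> (W \<boxtimes> V) \<cdot> asc xs W V) \<cdot> (\<psi> W \<otimes> Id V))"
    using comp_assoc[OF comp_Hom[OF pw asc_Hom] F(1) P(1)] comp_assoc[OF pw asc_Hom F(1)] by simp
  also have "\<dots> = \<psi> (W \<boxtimes> V) \<cdot> ((asc ys W V \<cdot> (\<phi> W \<otimes> Id V)) \<cdot> (\<psi> W \<otimes> Id V))"
    by (simp add: F(3))
  also have "\<dots> = \<psi> (W \<boxtimes> V) \<cdot> asc ys W V"
    using comp_assoc[OF pw fw asc_Hom] PI comp_Id_right[OF asc_Hom] by simp
  finally show "asc xs W V \<cdot> (\<psi> W \<otimes> Id V) = \<psi> (W \<boxtimes> V) \<cdot> asc ys W V" .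
  fix h assume h: "h \<in> Hom W V"
  note wx = wk_Hom[OF h, of xs] and wy = wk_Hom[OF h, of ys]
  have "\<psi> V \<cdot> wk ys h = \<psi> V \<cdot> (wk ys h \<cdot> (\<phi> W \<cdot> \<psi> W))"
    using P(3)[of W] comp_Id_right[OF wy] by simp
  also have "\<dots> = \<psi> V \<cdot> ((\<phi> V \<cdot> wk xs h) \<cdot> \<psi> W)"
    using comp_assoc[OF P(1) F(1) wy] F(2)[OF h] by simp
  also have "\<dots> = (\<psi> V \<cdot> \<phi> V) \<cdot> wk xs h \<cdot> \<psi> W"
    using comp_assoc[OF P(1) wx F(1)] comp_assoc[OF comp_Hom[OF P(1) wx] F(1) P(1)] by simp
  also have "\<dots> = wk xs h \<cdot> \<psi> W"
    using P(2)[of V] comp_Id_left[OF comp_Hom[OF P(1) wx]] by simp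
  finally show "\<psi> V \<cdot> wk ys h = wk xs h \<cdot> \<psi> W" .
qed

lemma \<alpha>_inverse: "inverse_pair ((X \<boxtimes> Y) \<boxtimes> Z) (X \<boxtimes> (Y \<boxtimes> Z)) (\<alpha> X Y Z) (\<alpha>inv X Y Z)"
  by (rule inverse_pair_inv_arr[OF \<alpha>_iso])
lemma \<l>_inverse: "inverse_pair (\<I> \<boxtimes> X) X (\<l> X) (\<l>inv X)"
  by (rule inverse_pair_inv_arr[OF \<l>_iso])
lemma \<r>_inverse: "inverse_pair (X \<boxtimes> \<I>) X (\<r> X) (\<r>inv X)"
  by (rule inverse_pair_inv_arr[OF \<r>_iso])
lemma \<l>_Hom: "\<l> X \<in> Hom (\<I> \<boxtimes> X) X" and \<r>_Hom: "\<r> X \<in> Hom (X \<boxtimes> \<I>) X"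
  and \<l>inv_Hom: "\<l>inv X \<in> Hom X (\<I> \<boxtimes> X)" and \<r>inv_Hom: "\<r>inv X \<in> Hom X (X \<boxtimes> \<I>)"
  using \<l>_inverse[of X] \<r>_inverse[of X] unfolding inverse_pair_def by auto

lemma natfam_al: "natfam [X \<boxtimes> Y] [X, Y] (\<alpha> X Y)"
  unfolding natfam_def
proof (intro conjI allI ballI)
  fix W V h
  show "\<alpha> X Y W \<in> Hom (ob [X \<boxtimes> Y] W) (ob [X, Y] W)" using \<alpha>_Hom by simp
  have 1: "asc [X, Y] W V = (Id X \<otimes> \<alpha> Y W V) \<cdot> \<alpha> X (Y \<boxtimes> W) V" "asc [X \<boxtimes> Y] W V = \<alpha> (X \<boxtimes> Y) W V"
    using comp_Id_left[OF \<alpha>_Hom] by (auto simp: mten_Id)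
  show "asc [X, Y] W V \<cdot> (\<alpha> X Y W \<otimes> Id V) = \<alpha> X Y (W \<boxtimes> V) \<cdot> asc [X \<boxtimes> Y] W V"
    unfolding 1 pentagon
    by (rule comp_assoc[OF mten_Hom[OF \<alpha>_Hom Id_Hom] \<alpha>_Hom mten_Hom[OF Id_Hom \<alpha>_Hom]])
  assume h: "h \<in> Hom W V"
  show "\<alpha> X Y V \<cdot> wk [X \<boxtimes> Y] h = wk [X, Y] h \<cdot> \<alpha> X Y W"
    using \<alpha>_natural[OF Id_Hom Id_Hom h, of X Y] by (simp add: mten_Id)
qed

lemma ten_cancel_left:
  assumes f: "f \<in> Hom X Y" and g: "g \<in> Hom X Y" and eq: "Id \<I> \<otimes> f = Id \<I> \<otimes> g"
  shows "f = g"
proof -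
  have "f \<cdot> \<l> X = g \<cdot> \<l> X" using \<l>_natural[OF f] \<l>_natural[OF g] eq by simp
  then have "(f \<cdot> \<l> X) \<cdot> \<l>inv X = (g \<cdot> \<l> X) \<cdot> \<l>inv X" by simp
  then show ?thesis
    using comp_assoc[OF \<l>inv_Hom \<l>_Hom f] comp_assoc[OF \<l>inv_Hom \<l>_Hom g]
      \<l>_inverse[of X] comp_Id_right[OF f] comp_Id_right[OF g] unfolding inverse_pair_def by simp
qed

lemma iso_epi: "inverse_pair X Y e e' \<Longrightarrow> f \<in> Hom Y Z \<Longrightarrow> g \<in> Hom Y Z \<Longrightarrow> f \<cdot> e = g \<cdot> e \<Longrightarrow> f = g"
proof -
  assume i: "inverse_pair X Y e e'" and f: "f \<in> Hom Y Z" and g: "g \<in> Hom Y Z" and eq: "f \<cdot> e = g \<cdot> e"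
  have e: "e \<in> Hom X Y" "e' \<in> Hom Y X" "e \<cdot> e' = Id Y" using i unfolding inverse_pair_def by auto
  have "f = (f \<cdot> e) \<cdot> e'" unfolding comp_assoc[OF e(2,1) f] e(3) by (rule comp_Id_right[OF f, symmetric])
  also have "\<dots> = g" unfolding eq comp_assoc[OF e(2,1) g] e(3) by (rule comp_Id_right[OF g])
  finally show "f = g" .
qed

lemma inverse_pair_sym: "inverse_pair X Y f g \<Longrightarrow> inverse_pair Y X g f"
  unfolding inverse_pair_def by auto
lemma inverse_pair_ten_left: "inverse_pair X Y f g \<Longrightarrow> inverse_pair (X \<boxtimes> V) (Y \<boxtimes> V) (f \<otimes> Id V) (g \<otimes> Id V)"
  unfolding inverse_pair_def by (auto intro!: mten_Hom Id_Hom simp: ten_comp_left[symmetric] mten_Id)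
lemma inverse_pair_comp: "inverse_pair X Y f g \<Longrightarrow> inverse_pair Y Z h k \<Longrightarrow> inverse_pair X Z (h \<cdot> f) (g \<cdot> k)"
proof -
  assume "inverse_pair X Y f g" "inverse_pair Y Z h k"
  then have f: "f \<in> Hom X Y" "g \<in> Hom Y X" "g \<cdot> f = Id X" "f \<cdot> g = Id Y"
    and h: "h \<in> Hom Y Z" "k \<in> Hom Z Y" "k \<cdot> h = Id Y" "h \<cdot> k = Id Z"
    unfolding inverse_pair_def by auto
  have "(g \<cdot> k) \<cdot> h \<cdot> f = g \<cdot> (k \<cdot> h) \<cdot> f"
    using comp_assoc[OF comp_Hom[OF f(1) h(1)] h(2) f(2)] comp_assoc[OF f(1) h(1) h(2)] by simp
  moreover have "(h \<cdot> f) \<cdot> g \<cdot> k = h \<cdot> (f \<cdot> g) \<cdot> k"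
    using comp_assoc[OF comp_Hom[OF h(2) f(2)] f(1) h(1)] comp_assoc[OF h(2) f(2) f(1)] by simp
  ultimately show ?thesis
    unfolding inverse_pair_def using f h comp_Hom[OF f(1) h(1)] comp_Hom[OF h(2) f(2)] comp_Id_left[OF f(1)] comp_Id_left[OF h(2)]
    by simp
qed

text \<open>Kelly: after tensoring with \<open>\<I>\<close> on the left, both sides agree by pentagon and triangle.\<close>
lemma \<l>_ten: "\<l> X \<otimes> Id W = \<l> (X \<boxtimes> W) \<cdot> \<alpha> \<I> X W"
proof (rule ten_cancel_left[of _ "(\<I> \<boxtimes> X) \<boxtimes> W" "X \<boxtimes> W"])
  let ?I = "\<I>"
  show "\<l> X \<otimes> Id W \<in> Hom ((\<I> \<boxtimes> X) \<boxtimes> W) (X \<boxtimes> W)" by (intro mten_Hom \<l>_Hom Id_Hom)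
  show "\<l> (X \<boxtimes> W) \<cdot> \<alpha> \<I> X W \<in> Hom ((\<I> \<boxtimes> X) \<boxtimes> W) (X \<boxtimes> W)" by (rule comp_Hom[OF \<alpha>_Hom \<l>_Hom])
  let ?a = "\<alpha> ?I (?I \<boxtimes> X) W" and ?b = "\<alpha> ?I ?I X \<otimes> Id W" and ?c = "\<alpha> ?I X W"
  note aH = \<alpha>_Hom[of ?I "?I \<boxtimes> X" W] and bH = mten_Hom[OF \<alpha>_Hom Id_Hom, of ?I ?I X W]
  have L: "Id ?I \<otimes> \<l> (X \<boxtimes> W) \<in> Hom (?I \<boxtimes> (?I \<boxtimes> (X \<boxtimes> W))) (?I \<boxtimes> (X \<boxtimes> W))" by (intro mten_Hom \<l>_Hom Id_Hom)
  have A: "Id ?I \<otimes> ?c \<in> Hom (?I \<boxtimes> ((?I \<boxtimes> X) \<boxtimes> W)) (?I \<boxtimes> (?I \<boxtimes> (X \<boxtimes> W)))" by (intro mten_Hom \<alpha>_Hom Id_Hom)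
  have L2: "Id ?I \<otimes> (\<l> X \<otimes> Id W) \<in> Hom (?I \<boxtimes> ((?I \<boxtimes> X) \<boxtimes> W)) (?I \<boxtimes> (X \<boxtimes> W))" by (intro mten_Hom \<l>_Hom Id_Hom)
  have "((Id ?I \<otimes> \<l> (X \<boxtimes> W)) \<cdot> (Id ?I \<otimes> ?c)) \<cdot> ?a \<cdot> ?b = (Id ?I \<otimes> \<l> (X \<boxtimes> W)) \<cdot> (Id ?I \<otimes> ?c) \<cdot> ?a \<cdot> ?b"
    by (rule comp_assoc[OF comp_Hom[OF bH aH] A L])
  also have "\<dots> = (Id ?I \<otimes> \<l> (X \<boxtimes> W)) \<cdot> \<alpha> ?I ?I (X \<boxtimes> W) \<cdot> \<alpha> (?I \<boxtimes> ?I) X W"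
    by (simp only: pentagon)
  also have "\<dots> = ((Id ?I \<otimes> \<l> (X \<boxtimes> W)) \<cdot> \<alpha> ?I ?I (X \<boxtimes> W)) \<cdot> \<alpha> (?I \<boxtimes> ?I) X W"
    by (rule comp_assoc[OF \<alpha>_Hom \<alpha>_Hom L, symmetric])
  also have "\<dots> = (\<r> ?I \<otimes> (Id X \<otimes> Id W)) \<cdot> \<alpha> (?I \<boxtimes> ?I) X W"
    by (simp only: triangle mten_Id)
  also have "\<dots> = ?c \<cdot> ((\<r> ?I \<otimes> Id X) \<otimes> Id W)"
    using \<alpha>_natural[OF \<r>_Hom Id_Hom Id_Hom, of ?I X W] by simp
  also have "\<dots> = ?c \<cdot> ((Id ?I \<otimes> \<l> X) \<otimes> Id W) \<cdot> ?b"
    using ten_comp_left[OF \<alpha>_Hom[of ?I ?I X] mten_Hom[OF Id_Hom \<l>_Hom], of W] triangle[of ?I X] by simp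
  also have "\<dots> = (?c \<cdot> ((Id ?I \<otimes> \<l> X) \<otimes> Id W)) \<cdot> ?b"
    by (rule comp_assoc[OF bH mten_Hom[OF mten_Hom[OF Id_Hom \<l>_Hom] Id_Hom] \<alpha>_Hom, symmetric])
  also have "\<dots> = ((Id ?I \<otimes> (\<l> X \<otimes> Id W)) \<cdot> ?a) \<cdot> ?b"
    using \<alpha>_natural[OF Id_Hom \<l>_Hom Id_Hom, of ?I X W] by simp
  also have "\<dots> = (Id ?I \<otimes> (\<l> X \<otimes> Id W)) \<cdot> ?a \<cdot> ?b"
    by (rule comp_assoc[OF bH aH L2])
  finally have "((Id ?I \<otimes> \<l> (X \<boxtimes> W)) \<cdot> (Id ?I \<otimes> ?c)) \<cdot> ?a \<cdot> ?b = (Id ?I \<otimes> (\<l> X \<otimes> Id W)) \<cdot> ?a \<cdot> ?b" .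
  then have "(Id ?I \<otimes> \<l> (X \<boxtimes> W)) \<cdot> (Id ?I \<otimes> ?c) = Id ?I \<otimes> (\<l> X \<otimes> Id W)"
    by (rule iso_epi[OF inverse_pair_comp[OF inverse_pair_ten_left[OF \<alpha>_inverse] \<alpha>_inverse] comp_Hom[OF A L] L2])
  then show "Id ?I \<otimes> (\<l> X \<otimes> Id W) = Id ?I \<otimes> (\<l> (X \<boxtimes> W) \<cdot> \<alpha> ?I X W)"
    using ten_comp_right[OF \<alpha>_Hom[of ?I X W] \<l>_Hom, of ?I] by simp
qed

lemma natfam_lu: "natfam [\<I>] [] \<l>"
  unfolding natfam_def
proof (intro conjI allI ballI)
  fix W V h
  show "\<l> W \<in> Hom (ob [\<I>] W) (ob [] W)" using \<l>_Hom by simp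
  show "asc [] W V \<cdot> (\<l> W \<otimes> Id V) = \<l> (W \<boxtimes> V) \<cdot> asc [\<I>] W V"
    using \<l>_ten[of W V] comp_Id_left[OF \<alpha>_Hom] comp_Id_left[OF comp_Hom[OF \<alpha>_Hom \<l>_Hom]] by (simp add: mten_Id)
  assume h: "h \<in> Hom W V"
  show "\<l> V \<cdot> wk [\<I>] h = wk [] h \<cdot> \<l> W"
    using \<l>_natural[OF h] by simp
qed

lemma natfam_ali: "natfam [X, Y] [X \<boxtimes> Y] (\<alpha>inv X Y)"
  by (rule natfam_inverse[OF natfam_al]) (simp add: \<alpha>_inverse)
lemma natfam_lui: "natfam [] [\<I>] \<l>inv"
  by (rule natfam_inverse[OF natfam_lu]) (simp add: \<l>_inverse)

lemma valid_hat [simp]: "f \<in> Hom X Y \<Longrightarrow> valid (hat X Y f)" "sdom (hat X Y f) = [X]" "scod (hat X Y f) = [Y]"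
  unfolding hat_def by (auto simp: natfam_hat)
lemma valid_al [simp]: "valid (al X Y)" "sdom (al X Y) = [X \<boxtimes> Y]" "scod (al X Y) = [X, Y]"
  "valid (ali X Y)" "scod (ali X Y) = [X \<boxtimes> Y]" "sdom (ali X Y) = [X, Y]"
  unfolding al_def ali_def by (auto simp: natfam_al natfam_ali)
lemma valid_lu [simp]: "valid lu" "sdom lu = [\<I>]" "scod lu = []"
  "valid lui" "scod lui = [\<I>]" "sdom lui = []"
  unfolding lu_def lui_def by (auto simp: natfam_lu natfam_lui)

lemma al_ali [simp]: "al X Y \<star> ali X Y = sid [X, Y]" "ali X Y \<star> al X Y = sid [X \<boxtimes> Y]"
  "lu \<star> lui = sid []" "lui \<star> lu = sid [\<I>]"
  unfolding al_def ali_def lu_def lui_def sid_def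
  using \<alpha>_inverse \<l>_inverse
  by (auto simp: scomp.simps natfam_al natfam_ali natfam_lu natfam_lui inverse_pair_def)

lemma al_ali_whisk [simp]:
  "whisk ps (al X Y) qs \<star> whisk ps (ali X Y) qs = sid (ps @ [X, Y] @ qs)"
  "whisk ps (ali X Y) qs \<star> whisk ps (al X Y) qs = sid (ps @ [X \<boxtimes> Y] @ qs)"
  "whisk ps lu qs \<star> whisk ps lui qs = sid (ps @ qs)"
  "whisk ps lui qs \<star> whisk ps lu qs = sid (ps @ [\<I>] @ qs)"
  by (simp_all only: whisk_scomp[symmetric] al_ali whisk_sid append_Nil)

lemmas al_ali_tl [simp] = al_ali[THEN tail_eq] al_ali_whisk[THEN tail_eq]

lemma hat_comp: "f \<in> Hom X Y \<Longrightarrow> g \<in> Hom Y Z \<Longrightarrow> hat X Z (g \<cdot> f) = hat Y Z g \<star> hat X Y f"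
  unfolding hat_def by (auto simp: scomp.simps natfam_hat ten_comp_left)
lemma hat_Id: "hat X X (Id X) = sid [X]"
  unfolding hat_def sid_def by (auto simp: mten_Id)
lemma hat_sc: "f \<in> Hom X Y \<Longrightarrow> hat X Y (sc c f) = sscale c (hat X Y f)"
  unfolding hat_def using mten_sc_left[OF _ Id_Hom, of f X Y] by (auto simp: natfam_hat)

lemma hat_inj: assumes f: "f \<in> Hom X Y" and g: "g \<in> Hom X Y" and eq: "hat X Y f = hat X Y g" shows "f = g"
proof -
  have "f \<otimes> Id \<I> = g \<otimes> Id \<I>" using eq unfolding hat_def by (auto dest: fun_cong)
  then have "f \<cdot> \<r> X = g \<cdot> \<r> X" using \<r>_natural[OF f] \<r>_natural[OF g] by simp
  then show ?thesis by (rule iso_epi[OF \<r>_inverse f g])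
qed

lemma hat_ten:
  assumes f: "f \<in> Hom X Y" and g: "g \<in> Hom X' Y'"
  shows "hat (X \<boxtimes> X') (Y \<boxtimes> Y') (f \<otimes> g)
    = ali Y Y' \<star> whisk [] (hat X Y f) [Y'] \<star> whisk [X] (hat X' Y' g) [] \<star> al X X'"
proof -
  have n: "natfam [X, X'] [Y, X'] (\<lambda>W. f \<otimes> Id (ob [X'] W))" "natfam [X, Y'] [Y, Y'] (\<lambda>W. f \<otimes> Id (ob [Y'] W))"
    "natfam [X, X'] [X, Y'] (\<lambda>W. Id X \<otimes> (g \<otimes> Id W))"
    using natfam_whisk[OF natfam_hat[OF f], of "[]" "[X']"] natfam_whisk[OF natfam_hat[OF f], of "[]" "[Y']"]
      natfam_whisk[OF natfam_hat[OF g], of "[X]" "[]"] by simp_all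
  have "\<alpha> Y Y' W \<cdot> ((f \<otimes> g) \<otimes> Id W) = (f \<otimes> Id (Y' \<boxtimes> W)) \<cdot> (Id X \<otimes> (g \<otimes> Id W)) \<cdot> \<alpha> X X' W" for W
  proof -
    have "f \<otimes> (g \<otimes> Id W) = (f \<otimes> Id (Y' \<boxtimes> W)) \<cdot> (Id X \<otimes> (g \<otimes> Id W))"
      using mten_comp[OF Id_Hom f mten_Hom[OF g Id_Hom] Id_Hom, of W] comp_Id_right[OF f]
        comp_Id_left[OF mten_Hom[OF g Id_Hom]] by simp
    then show ?thesis using \<alpha>_natural[OF f g Id_Hom, of W]
      comp_assoc[OF \<alpha>_Hom mten_Hom[OF Id_Hom mten_Hom[OF g Id_Hom]] mten_Hom[OF f Id_Hom]] by simp
  qed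
  then have "al Y Y' \<star> hat (X \<boxtimes> X') (Y \<boxtimes> Y') (f \<otimes> g)
    = whisk [] (hat X Y f) [Y'] \<star> whisk [X] (hat X' Y' g) [] \<star> al X X'"
    using natfam_al[of Y Y'] natfam_hat[OF mten_Hom[OF f g]] natfam_hat[OF f] natfam_hat[OF g] n
      natfam_al[of X X'] natfam_comp[OF natfam_al[of X X'] n(3)]
    by (auto simp: al_def hat_def scomp.simps whisk.simps)
  then have "ali Y Y' \<star> al Y Y' \<star> hat (X \<boxtimes> X') (Y \<boxtimes> Y') (f \<otimes> g)
    = ali Y Y' \<star> whisk [] (hat X Y f) [Y'] \<star> whisk [X] (hat X' Y' g) [] \<star> al X X'" by simp
  then show ?thesis using mten_Hom[OF f g] by simp
qed

lemma hat_\<alpha>: "hat ((X \<boxtimes> Y) \<boxtimes> Z) (X \<boxtimes> (Y \<boxtimes> Z)) (\<alpha> X Y Z)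
   = ali X (Y \<boxtimes> Z) \<star> whisk [X] (ali Y Z) [] \<star> whisk [] (al X Y) [Z] \<star> al (X \<boxtimes> Y) Z"
proof -
  have n: "natfam [X \<boxtimes> Y, Z] [X, Y, Z] (\<lambda>W. \<alpha> X Y (Z \<boxtimes> W))" "natfam [X, Y \<boxtimes> Z] [X, Y, Z] (\<lambda>W. Id X \<otimes> \<alpha> Y Z W)"
    using natfam_whisk[OF natfam_al, of "[]" X Y "[Z]"] natfam_whisk[OF natfam_al, of "[X]" Y Z "[]"] by simp_all
  have "whisk [X] (al Y Z) [] \<star> al X (Y \<boxtimes> Z) \<star> hat ((X \<boxtimes> Y) \<boxtimes> Z) (X \<boxtimes> (Y \<boxtimes> Z)) (\<alpha> X Y Z)
    = whisk [] (al X Y) [Z] \<star> al (X \<boxtimes> Y) Z"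
    using n natfam_al[of X Y] natfam_al[of Y Z] natfam_al[of X "Y \<boxtimes> Z"] natfam_al[of "X \<boxtimes> Y" Z] natfam_hat[OF \<alpha>_Hom, of X Y Z]
      natfam_comp[OF natfam_hat[OF \<alpha>_Hom, of X Y Z] natfam_al[of X "Y \<boxtimes> Z"]] pentagon[of X Y Z]
    by (auto simp: al_def hat_def scomp.simps whisk.simps)
  then have "ali X (Y \<boxtimes> Z) \<star> whisk [X] (ali Y Z) [] \<star> (whisk [X] (al Y Z) [] \<star> al X (Y \<boxtimes> Z) \<star> hat ((X \<boxtimes> Y) \<boxtimes> Z) (X \<boxtimes> (Y \<boxtimes> Z)) (\<alpha> X Y Z))
    = ali X (Y \<boxtimes> Z) \<star> whisk [X] (ali Y Z) [] \<star> (whisk [] (al X Y) [Z] \<star> al (X \<boxtimes> Y) Z)" by simp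
  then show ?thesis using \<alpha>_Hom[of X Y Z] by simp
qed

lemma hat_\<l>: "hat (\<I> \<boxtimes> X) X (\<l> X) = whisk [] lu [X] \<star> al \<I> X"
proof -
  have n: "natfam [\<I>, X] [X] (\<lambda>W. \<l> (X \<boxtimes> W))"
    using natfam_whisk[OF natfam_lu, of "[]" "[X]"] by simp
  then show ?thesis using natfam_lu natfam_al[of \<I> X] \<l>_ten[of X]
    by (auto simp: lu_def al_def hat_def scomp.simps whisk.simps)
qed

lemma hat_\<r>: "hat (X \<boxtimes> \<I>) X (\<r> X) = whisk [X] lu [] \<star> al X \<I>"
proof -
  have n: "natfam [X, \<I>] [X] (\<lambda>W. Id X \<otimes> \<l> W)"
    using natfam_whisk[OF natfam_lu, of "[X]" "[]"] by simp
  then show ?thesis using natfam_lu natfam_al[of X \<I>] triangle[of X]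
    by (auto simp: lu_def al_def hat_def scomp.simps whisk.simps)
qed

text \<open>The inverse \<open>g\<close> is known only abstractly. A left inverse of
  \<open>F\<close> found in the strict calculus must be its word, by uniqueness of inverses.\<close>

lemma hats_inv:
  assumes "inverse_pair X Y f g" "hat X Y f = F" "G \<star> F = sid [X]" "valid G" "sdom G = [Y]"
  shows "hats Y X g G"
proof -
  have f: "f \<in> Hom X Y" and g: "g \<in> Hom Y X" and gf: "f \<cdot> g = Id Y" using assms(1) unfolding inverse_pair_def by auto
  have "hat Y X g = (G \<star> F) \<star> hat Y X g" unfolding assms(3) using g by simp
  also have "\<dots> = G \<star> (hat X Y f \<star> hat Y X g)" unfolding assms(2) by (simp only: scomp_assoc)
  also have "hat X Y f \<star> hat Y X g = sid [Y]" using hat_comp[OF g f] gf by (simp add: hat_Id)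
  also have "G \<star> sid [Y] = G" using assms(4,5) by simp
  finally show ?thesis using g unfolding hats_def by simp
qed

lemma hats_comp: "hats X Y f F \<Longrightarrow> hats Y Z g G \<Longrightarrow> hats X Z (g \<cdot> f) (G \<star> F)"
  unfolding hats_def by (auto simp: hat_comp comp_Hom)
lemma hats_ten: "hats X Y f F \<Longrightarrow> hats X' Y' g G \<Longrightarrow> hats (X \<boxtimes> X') (Y \<boxtimes> Y') (f \<otimes> g)
    (ali Y Y' \<star> whisk [] F [Y'] \<star> whisk [X] G [] \<star> al X X')"
  unfolding hats_def using hat_ten mten_Hom by blast
lemma hats_Id: "hats X X (Id X) (sid [X])"
  unfolding hats_def using hat_Id Id_Hom by auto
lemma hats_\<alpha>: "hats ((X \<boxtimes> Y) \<boxtimes> Z) (X \<boxtimes> (Y \<boxtimes> Z)) (\<alpha> X Y Z)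
  (ali X (Y \<boxtimes> Z) \<star> whisk [X] (ali Y Z) [] \<star> whisk [] (al X Y) [Z] \<star> al (X \<boxtimes> Y) Z)"
  unfolding hats_def using hat_\<alpha> \<alpha>_Hom by auto
lemma hats_\<alpha>inv: "hats (X \<boxtimes> (Y \<boxtimes> Z)) ((X \<boxtimes> Y) \<boxtimes> Z) (\<alpha>inv X Y Z)
  (ali (X \<boxtimes> Y) Z \<star> whisk [] (ali X Y) [Z] \<star> whisk [X] (al Y Z) [] \<star> al X (Y \<boxtimes> Z))"
  by (rule hats_inv[OF \<alpha>_inverse hat_\<alpha>]) simp_all
lemma hats_\<l>: "hats (\<I> \<boxtimes> X) X (\<l> X) (whisk [] lu [X] \<star> al \<I> X)"
  unfolding hats_def using hat_\<l> \<l>_Hom by auto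
lemma hats_\<r>: "hats (X \<boxtimes> \<I>) X (\<r> X) (whisk [X] lu [] \<star> al X \<I>)"
  unfolding hats_def using hat_\<r> \<r>_Hom by auto
lemma hats_\<l>inv: "hats X (\<I> \<boxtimes> X) (\<l>inv X) (ali \<I> X \<star> whisk [] lui [X])"
  by (rule hats_inv[OF \<l>_inverse hat_\<l>]) simp_all
lemma hats_\<r>inv: "hats X (X \<boxtimes> \<I>) (\<r>inv X) (ali X \<I> \<star> whisk [X] lui [])"
  by (rule hats_inv[OF \<r>_inverse hat_\<r>]) simp_all
lemma hats_hat: "f \<in> Hom X Y \<Longrightarrow> hats X Y f (hat X Y f)"
  unfolding hats_def by simp

lemmas hats_rules = hats_\<alpha> hats_\<alpha>inv hats_\<l> hats_\<r> hats_\<l>inv hats_\<r>inv hats_Id hats_ten hats_comp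

lemma hatsD: "hats X Y f F \<Longrightarrow> hat X Y f = F" "hats X Y f F \<Longrightarrow> f \<in> Hom X Y"
  unfolding hats_def by auto

text \<open>The witness is the component at the unit with the right unitors removed. The module
  condition relates the component at \<open>\<I> \<boxtimes> W\<close> to the one at
  \<open>\<I>\<close>, naturality along \<open>\<l> W\<close> relates it to the one at
  \<open>W\<close>, and the triangle identity joins the two. Words built by hand are turned back
  into morphisms by this lemma.\<close>

lemma hat_full:
  assumes F: "valid F" "sdom F = [X]" "scod F = [Y]"
  obtains f where "f \<in> Hom X Y" "hat X Y f = F"
proof -
  obtain \<phi> where Fe: "F = Arr [X] [Y] \<phi>" and n: "natfam [X] [Y] \<phi>" using F by (cases F) auto
  note N = natfamD[OF n]
  let ?f = "\<r> Y \<cdot> \<phi> \<I> \<cdot> \<r>inv X"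
  have p: "\<phi> W \<in> Hom (X \<boxtimes> W) (Y \<boxtimes> W)" for W using N(1)[of W] by simp
  have f: "?f \<in> Hom X Y" by (rule comp_Hom[OF comp_Hom[OF \<r>inv_Hom p] \<r>_Hom])
  have "?f \<otimes> Id W = \<phi> W" for W
  proof -
    let ?a = "\<alpha> X \<I> W" and ?e = "Id X \<otimes> \<l> W"
    have m: "\<alpha> Y \<I> W \<cdot> (\<phi> \<I> \<otimes> Id W) = \<phi> (\<I> \<boxtimes> W) \<cdot> \<alpha> X \<I> W"
      using N(3)[of \<I> W] comp_Id_left[OF \<alpha>_Hom] by (simp add: mten_Id)
    have nt: "\<phi> W \<cdot> (Id X \<otimes> \<l> W) = (Id Y \<otimes> \<l> W) \<cdot> \<phi> (\<I> \<boxtimes> W)"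
      using N(2)[OF \<l>_Hom, of W] by simp
    have eY: "Id Y \<otimes> \<l> W \<in> Hom (Y \<boxtimes> (\<I> \<boxtimes> W)) (Y \<boxtimes> W)" and eX: "?e \<in> Hom (X \<boxtimes> (\<I> \<boxtimes> W)) (X \<boxtimes> W)"
      by (intro mten_Hom Id_Hom \<l>_Hom)+
    have "(?f \<otimes> Id W) \<cdot> (\<r> X \<otimes> Id W) = (?f \<cdot> \<r> X) \<otimes> Id W"
      by (rule ten_comp_left[OF \<r>_Hom f, symmetric])
    also have "?f \<cdot> \<r> X = \<r> Y \<cdot> \<phi> \<I>"
      using comp_assoc[OF \<r>_Hom comp_Hom[OF \<r>inv_Hom p] \<r>_Hom] comp_assoc[OF \<r>_Hom \<r>inv_Hom p]
       \<r>_inverse[of X] comp_Id_right[OF p] unfolding inverse_pair_def by simp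
    also have "(\<r> Y \<cdot> \<phi> \<I>) \<otimes> Id W = (\<r> Y \<otimes> Id W) \<cdot> (\<phi> \<I> \<otimes> Id W)"
      by (rule ten_comp_left[OF p \<r>_Hom])
    also have "\<dots> = (Id Y \<otimes> \<l> W) \<cdot> \<alpha> Y \<I> W \<cdot> (\<phi> \<I> \<otimes> Id W)"
      using triangle[of Y W] comp_assoc[OF mten_Hom[OF p Id_Hom] \<alpha>_Hom eY] by simp
    also have "\<dots> = ((Id Y \<otimes> \<l> W) \<cdot> \<phi> (\<I> \<boxtimes> W)) \<cdot> \<alpha> X \<I> W"
      using m comp_assoc[OF \<alpha>_Hom p eY] by simp
    also have "\<dots> = \<phi> W \<cdot> (?e \<cdot> ?a)"
      using nt comp_assoc[OF \<alpha>_Hom eX p] by simp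
    finally have "(?f \<otimes> Id W) \<cdot> (\<r> X \<otimes> Id W) = \<phi> W \<cdot> (\<r> X \<otimes> Id W)"
      using triangle[of X W] by simp
    then show ?thesis
      by (rule iso_epi[OF inverse_pair_ten_left[OF \<r>_inverse] mten_Hom[OF f Id_Hom] p])
  qed
  then have "hat X Y ?f = F" unfolding Fe hat_def by simp
  with f show ?thesis using that by blast
qed

end

section \<open>Duality and traces\<close>

context btcat_data
begin
definition evw :: "'o \<Rightarrow> ('o, 'm) sarr" where
  "evw X = lu \<star> hat (Dual X \<boxtimes> X) \<I> (Ev X) \<star> ali (Dual X) X"
definition cow :: "'o \<Rightarrow> ('o, 'm) sarr" where
  "cow X = al X (Dual X) \<star> hat \<I> (X \<boxtimes> Dual X) (Coev X) \<star> lui"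
end

context tensor_category
begin

lemma exch:
  assumes "valid f" "valid g"
  shows "whisk ps f (zs @ scod g @ qs) \<star> whisk (ps @ sdom f @ zs) g qs
    = whisk (ps @ scod f @ zs) g qs \<star> whisk ps f (zs @ sdom g @ qs)"
  using ichg[OF assms] by simp

lemma hat_eqI: "hats X Y f F \<Longrightarrow> F = G \<Longrightarrow> hat X Y f = G"
  unfolding hats_def by simp

end

context fusion_category
begin

lemma hats_Ev: "hats (Dual X \<boxtimes> X) \<I> (Ev X) (hat (Dual X \<boxtimes> X) \<I> (Ev X))"
  by (rule hats_hat[OF Ev_Hom])
lemma hats_Coev: "hats \<I> (X \<boxtimes> Dual X) (Coev X) (hat \<I> (X \<boxtimes> Dual X) (Coev X))"
  by (rule hats_hat[OF Coev_Hom])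

lemma evw_simps [simp]: "valid (evw X)" "sdom (evw X) = [Dual X, X]" "scod (evw X) = []"
  "valid (cow X)" "scod (cow X) = [X, Dual X]" "sdom (cow X) = []"
  unfolding evw_def cow_def using Ev_Hom[of X] Coev_Hom[of X] by auto

lemma hat_Ev: "hat (Dual X \<boxtimes> X) \<I> (Ev X) = lui \<star> evw X \<star> al (Dual X) X"
  unfolding evw_def using Ev_Hom[of X] by simp
lemma hat_Coev: "hat \<I> (X \<boxtimes> Dual X) (Coev X) = ali X (Dual X) \<star> cow X \<star> lu"
  unfolding cow_def using Coev_Hom[of X] by simp

lemma zigzag1: "whisk [X] (evw X) [] \<star> whisk [] (cow X) [X] = sid [X]"
proof -
  have "hat X X (\<r> X \<cdot> (Id X \<otimes> Ev X) \<cdot> \<alpha> X (Dual X) X \<cdot> (Coev X \<otimes> Id X) \<cdot> \<l>inv X)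
    = whisk [X] (evw X) [] \<star> whisk [] (cow X) [X]"
    by (rule hat_eqI, (rule hats_rules hats_Ev hats_Coev)+, simp add: hat_Ev hat_Coev)
  then show ?thesis unfolding zigzag hat_Id by simp
qed


lemma zigzag2: "whisk [] (evw X) [Dual X] \<star> whisk [Dual X] (cow X) [] = sid [Dual X]"
proof -
  have "hat (Dual X) (Dual X) (\<l> (Dual X) \<cdot> (Ev X \<otimes> Id (Dual X)) \<cdot> \<alpha>inv (Dual X) X (Dual X) \<cdot>
      (Id (Dual X) \<otimes> Coev X) \<cdot> \<r>inv (Dual X))
    = whisk [] (evw X) [Dual X] \<star> whisk [Dual X] (cow X) []"
    by (rule hat_eqI, (rule hats_rules hats_Ev hats_Coev)+, simp add: hat_Ev hat_Coev)
  then show ?thesis unfolding zigzag_dual hat_Id by simp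
qed

lemma zigzag1_w: "whisk (ps @ [X]) (evw X) qs \<star> whisk ps (cow X) ([X] @ qs) = sid (ps @ [X] @ qs)"
  using arg_cong[OF zigzag1[of X], of "\<lambda>f. whisk ps f qs"] by simp
lemma hats_mate:
  assumes e: "e \<in> Hom (W \<boxtimes> P) \<I>"
  shows "hats W (Dual P) (mate W P e)
    (whisk [] (lu \<star> hat (W \<boxtimes> P) \<I> e \<star> ali W P) [Dual P] \<star> whisk [W] (cow P) [])"
proof -
  have "hat W (Dual P) (mate W P e) = whisk [] (lu \<star> hat (W \<boxtimes> P) \<I> e \<star> ali W P) [Dual P] \<star> whisk [W] (cow P) []"
    unfolding mate_def
    by (rule hat_eqI, (rule hats_rules hats_hat[OF e] hats_Coev)+, simp add: hat_Coev e)
  moreover have "mate W P e \<in> Hom W (Dual P)"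
    unfolding mate_def
    by (rule hatsD(2), (rule hats_rules hats_hat[OF e] hats_Coev)+)
  ultimately show ?thesis unfolding hats_def by simp
qed

lemma evw_mate:
  assumes e: "valid e" "sdom e = [W, P]" "scod e = []"
  shows "evw P \<star> whisk [] (whisk [] e [Dual P] \<star> whisk [W] (cow P) []) [P] = e"
proof -
  have "evw P \<star> whisk [] (whisk [] e [Dual P] \<star> whisk [W] (cow P) []) [P]
    = (evw P \<star> whisk [] e [Dual P, P]) \<star> whisk [W] (cow P) [P]" using e by simp
  also have "evw P \<star> whisk [] e [Dual P, P] = e \<star> whisk [W, P] (evw P) []"
    using exch[of e "evw P" "[]" "[]" "[]", simplified] e by simp
  also have "(e \<star> whisk [W, P] (evw P) []) \<star> whisk [W] (cow P) [P] = e \<star> (whisk [W, P] (evw P) [] \<star> whisk [W] (cow P) [P])"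
    by simp
  also have "\<dots> = e" using zigzag1_w[of "[W]" P "[]"] e by simp
  finally show ?thesis .
qed

lemma evw_hat_mate:
  assumes e: "e \<in> Hom (W \<boxtimes> P) \<I>"
  shows "evw P \<star> whisk [] (hat W (Dual P) (mate W P e)) [P] = lu \<star> hat (W \<boxtimes> P) \<I> e \<star> ali W P"
  unfolding hatsD(1)[OF hats_mate[OF e]] by (rule evw_mate) (use e in auto)

lemma dual_arr:
  assumes f: "f \<in> Hom X Y"
  shows "dual_arr X Y f \<in> Hom (Dual Y) (Dual X)"
    and "evw X \<star> whisk [] (hat (Dual Y) (Dual X) (dual_arr X Y f)) [X] = evw Y \<star> whisk [Dual Y] (hat X Y f) []"
    and "hat (Dual Y) (Dual X) (dual_arr X Y f)
      = whisk [] (evw Y) [Dual X] \<star> whisk [Dual Y] (hat X Y f) [Dual X] \<star> whisk [Dual Y] (cow X) []"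
proof -
  let ?e = "Ev Y \<cdot> (Id (Dual Y) \<otimes> f)"
  have e: "?e \<in> Hom (Dual Y \<boxtimes> X) \<I>" by (rule comp_Hom[OF mten_Hom[OF Id_Hom f] Ev_Hom])
  have h: "hat (Dual Y \<boxtimes> X) \<I> ?e = lui \<star> evw Y \<star> whisk [Dual Y] (hat X Y f) [] \<star> al (Dual Y) X"
    by (rule hat_eqI, (rule hats_rules hats_hat[OF f] hats_Ev)+, simp add: hat_Ev f)
  show "dual_arr X Y f \<in> Hom (Dual Y) (Dual X)"
    unfolding dual_arr_def by (rule hatsD(2)[OF hats_mate[OF e]])
  show "evw X \<star> whisk [] (hat (Dual Y) (Dual X) (dual_arr X Y f)) [X] = evw Y \<star> whisk [Dual Y] (hat X Y f) []"
    unfolding dual_arr_def evw_hat_mate[OF e] h using f by simp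
  show "hat (Dual Y) (Dual X) (dual_arr X Y f)
      = whisk [] (evw Y) [Dual X] \<star> whisk [Dual Y] (hat X Y f) [Dual X] \<star> whisk [Dual Y] (cow X) []"
    unfolding dual_arr_def hatsD(1)[OF hats_mate[OF e]] h using f by simp
qed

lemma dual_arr_cow:
  assumes f: "f \<in> Hom X Y"
  shows "whisk [] (hat X Y f) [Dual X] \<star> cow X = whisk [Y] (hat (Dual Y) (Dual X) (dual_arr X Y f)) [] \<star> cow Y"
proof -
  let ?f = "hat X Y f"
  have "whisk [Y] (hat (Dual Y) (Dual X) (dual_arr X Y f)) [] \<star> cow Y
    = whisk [Y] (evw Y) [Dual X] \<star> whisk [Y, Dual Y] ?f [Dual X] \<star> (whisk [Y, Dual Y] (cow X) [] \<star> cow Y)"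
    unfolding dual_arr(3)[OF f] by simp
  also have "whisk [Y, Dual Y] (cow X) [] \<star> cow Y = whisk [] (cow Y) [X, Dual X] \<star> cow X"
    using exch[of "cow Y" "cow X" "[]" "[]" "[]", simplified] by simp
  also have "whisk [Y] (evw Y) [Dual X] \<star> whisk [Y, Dual Y] ?f [Dual X] \<star> whisk [] (cow Y) [X, Dual X] \<star> cow X
    = whisk [Y] (evw Y) [Dual X] \<star> (whisk [Y, Dual Y] ?f [Dual X] \<star> whisk [] (cow Y) [X, Dual X]) \<star> cow X" by simp
  also have "whisk [Y, Dual Y] ?f [Dual X] \<star> whisk [] (cow Y) [X, Dual X] = whisk [] (cow Y) [Y, Dual X] \<star> whisk [] ?f [Dual X]"
    using exch[of "cow Y" ?f "[]" "[]" "[Dual X]", simplified] f by simp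
  also have "whisk [Y] (evw Y) [Dual X] \<star> (whisk [] (cow Y) [Y, Dual X] \<star> whisk [] ?f [Dual X]) \<star> cow X
     = (whisk [Y] (evw Y) [Dual X] \<star> whisk [] (cow Y) [Y, Dual X]) \<star> whisk [] ?f [Dual X] \<star> cow X" by simp
  also have "\<dots> = whisk [] ?f [Dual X] \<star> cow X" using zigzag1_w[of "[]" Y "[Dual X]"] f by simp
  finally show ?thesis by simp
qed

section \<open>The pivotal structure and the opposite cups and caps\<close>

lemma pivotal_s: "pivotal s" using spherical_s unfolding spherical_def by simp

lemma s_iso: "iso_arr X (Dual (Dual X)) (s X)" using pivotal_s unfolding pivotal_def by simp
lemma s_Hom: "s X \<in> Hom X (Dual (Dual X))" by (rule iso_arr_Hom[OF s_iso])

definition sw where "sw X = hat X (Dual (Dual X)) (s X)"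
definition swi where "swi X = hat (Dual (Dual X)) X (inv_arr X (Dual (Dual X)) (s X))"
text \<open>\<open>etw\<close> and \<open>ctw\<close> exhibit \<open>Dual X\<close> as a dual of
  \<open>X\<close> on the other side. They are the evaluation and coevaluation of
  \<open>Dual X\<close>, with its double dual replaced by \<open>X\<close> along
  \<open>s\<close>.\<close>

definition etw where "etw X = evw (Dual X) \<star> whisk [] (sw X) [Dual X]"
definition ctw where "ctw X = whisk [Dual X] (swi X) [] \<star> cow (Dual X)"

lemma sw_simps [simp]: "valid (sw X)" "sdom (sw X) = [X]" "scod (sw X) = [Dual (Dual X)]"
  "valid (swi X)" "scod (swi X) = [X]" "sdom (swi X) = [Dual (Dual X)]"
  "valid (etw X)" "sdom (etw X) = [X, Dual X]" "scod (etw X) = []"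
  "valid (ctw X)" "scod (ctw X) = [Dual X, X]" "sdom (ctw X) = []"
  unfolding sw_def swi_def etw_def ctw_def using s_Hom[of X] inv_arr_Hom[OF s_iso[of X]] by auto

lemma sw_swi: "sw X \<star> swi X = sid [Dual (Dual X)]"
  unfolding sw_def swi_def
  by (simp add: hat_comp[symmetric, OF inv_arr_Hom[OF s_iso] s_Hom] comp_inv_arr[OF s_iso] hat_Id)

lemma zigzag_etw: "whisk [Dual X] (etw X) [] \<star> whisk [] (ctw X) [Dual X] = sid [Dual X]"
proof -
  let ?D = "Dual X" and ?DD = "Dual (Dual X)"
  have "whisk [?D] (sw X) [?D] \<star> whisk [?D] (swi X) [?D] = sid [?D, ?DD, ?D]"
    using arg_cong[OF sw_swi[of X], of "\<lambda>f. whisk [?D] f [?D]"] by simp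
  then show ?thesis unfolding etw_def ctw_def using zigzag1[of ?D] by (simp add: tail_eq)
qed

text \<open>Naturality of \<open>s\<close> replaces \<open>f\<close> by its double transpose, and
  the defining property of the outer transpose against \<open>evw (Dual Y)\<close> leaves the single
  one.\<close>

lemma etw_natural:
  assumes f: "f \<in> Hom X Y"
  shows "etw Y \<star> whisk [] (hat X Y f) [Dual Y] = etw X \<star> whisk [X] (hat (Dual Y) (Dual X) (dual_arr X Y f)) []"
proof -
  let ?g = "dual_arr X Y f"
  let ?G = "hat (Dual Y) (Dual X) ?g"
  note g = dual_arr(1)[OF f]
  let ?h = "dual_arr (Dual Y) (Dual X) ?g"
  note h = dual_arr(1)[OF g]
  let ?H = "hat (Dual (Dual X)) (Dual (Dual Y)) ?h"
  have "s Y \<cdot> f = ?h \<cdot> s X" using pivotal_s f unfolding pivotal_def by blast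
  then have n: "sw Y \<star> hat X Y f = ?H \<star> sw X"
    unfolding sw_def using hat_comp[OF f s_Hom] hat_comp[OF s_Hom h] by simp
  have "etw Y \<star> whisk [] (hat X Y f) [Dual Y] = evw (Dual Y) \<star> whisk [] (sw Y \<star> hat X Y f) [Dual Y]"
    unfolding etw_def by simp
  also have "\<dots> = (evw (Dual Y) \<star> whisk [] ?H [Dual Y]) \<star> whisk [] (sw X) [Dual Y]"
    unfolding n by simp
  also have "\<dots> = (evw (Dual X) \<star> whisk [Dual (Dual X)] ?G []) \<star> whisk [] (sw X) [Dual Y]"
    using dual_arr(2)[OF g] by simp
  also have "\<dots> = evw (Dual X) \<star> (whisk [Dual (Dual X)] ?G [] \<star> whisk [] (sw X) [Dual Y])" by simp
  also have "whisk [Dual (Dual X)] ?G [] \<star> whisk [] (sw X) [Dual Y] = whisk [] (sw X) [Dual X] \<star> whisk [X] ?G []"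
    using exch[of "sw X" ?G "[]" "[]" "[]", simplified] g by simp
  finally show ?thesis unfolding etw_def by simp
qed

section \<open>Duals of tensor products\<close>

definition evw2 where "evw2 X Y = evw Y \<star> whisk [Dual Y] (evw X) [Y]"
definition cow2 where "cow2 X Y = whisk [X] (cow Y) [Dual X] \<star> cow X"
definition etw2 where "etw2 X Y = etw X \<star> whisk [X] (etw Y) [Dual X]"

lemma evw2_simps [simp]: "valid (evw2 X Y)" "sdom (evw2 X Y) = [Dual Y, Dual X, X, Y]" "scod (evw2 X Y) = []"
  "valid (cow2 X Y)" "scod (cow2 X Y) = [X, Y, Dual Y, Dual X]" "sdom (cow2 X Y) = []"
  "valid (etw2 X Y)" "sdom (etw2 X Y) = [X, Y, Dual Y, Dual X]" "scod (etw2 X Y) = []"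
  unfolding evw2_def cow2_def etw2_def by auto

lemma zigzag1_ten: "whisk [X, Y] (evw2 X Y) [] \<star> whisk [] (cow2 X Y) [X, Y] = sid [X, Y]"
proof -
  let ?X = "Dual X" and ?Y = "Dual Y"
  have "whisk [X, Y] (evw2 X Y) [] \<star> whisk [] (cow2 X Y) [X, Y]
    = whisk [X, Y] (evw Y) [] \<star> (whisk [X, Y, ?Y] (evw X) [Y] \<star> whisk [X] (cow Y) [?X, X, Y]) \<star> whisk [] (cow X) [X, Y]"
    unfolding evw2_def cow2_def by simp
  also have "whisk [X, Y, ?Y] (evw X) [Y] \<star> whisk [X] (cow Y) [?X, X, Y] = whisk [X] (cow Y) [Y] \<star> whisk [X] (evw X) [Y]"
    using exch[of "cow Y" "evw X" "[X]" "[]" "[Y]", simplified] by simp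
  also have "whisk [X, Y] (evw Y) [] \<star> (whisk [X] (cow Y) [Y] \<star> whisk [X] (evw X) [Y]) \<star> whisk [] (cow X) [X, Y]
    = (whisk [X, Y] (evw Y) [] \<star> whisk [X] (cow Y) [Y]) \<star> (whisk [X] (evw X) [Y] \<star> whisk [] (cow X) [X, Y])" by simp
  also have "\<dots> = sid [X, Y]" using zigzag1_w[of "[X]" Y "[]"] zigzag1_w[of "[]" X "[Y]"] by simp
  finally show ?thesis .
qed

end

context fusion_category
begin

lemma zigzag1_ten_w: "whisk (ps @ [X, Y]) (evw2 X Y) qs \<star> whisk ps (cow2 X Y) ([X, Y] @ qs) = sid (ps @ [X, Y] @ qs)"
  using arg_cong[OF zigzag1_ten[of X Y], of "\<lambda>f. whisk ps f qs"] by simp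

text \<open>The second zigzag bends the strand of \<open>Z\<close> back: a morphism into a dual is
  recovered explicitly from its pairing.\<close>

lemma evw_nondegenerate:
  assumes F: "valid F" "sdom F = [W]" "scod F = [Dual Z]" and eq: "evw Z \<star> whisk [] F [Z] = e"
  shows "F = whisk [] e [Dual Z] \<star> whisk [W] (cow Z) []"
proof -
  have "whisk [] e [Dual Z] \<star> whisk [W] (cow Z) []
    = whisk [] (evw Z) [Dual Z] \<star> (whisk [] F [Z, Dual Z] \<star> whisk [W] (cow Z) [])"
    unfolding eq[symmetric] using F by simp
  also have "whisk [] F [Z, Dual Z] \<star> whisk [W] (cow Z) [] = whisk [Dual Z] (cow Z) [] \<star> F"
    using exch[of F "cow Z" "[]" "[]" "[]", simplified] F by simp
  also have "whisk [] (evw Z) [Dual Z] \<star> whisk [Dual Z] (cow Z) [] \<star> F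
    = (whisk [] (evw Z) [Dual Z] \<star> whisk [Dual Z] (cow Z) []) \<star> F" by simp
  also have "\<dots> = F" unfolding zigzag2 using F by simp
  finally show ?thesis by simp
qed

lemma evw_dual_ten:
  "dual_ten X Y \<in> Hom (Dual Y \<boxtimes> Dual X) (Dual (X \<boxtimes> Y))"
  "evw (X \<boxtimes> Y) \<star> whisk [] (hat (Dual Y \<boxtimes> Dual X) (Dual (X \<boxtimes> Y)) (dual_ten X Y)) [X \<boxtimes> Y]
    = evw2 X Y \<star> whisk [Dual Y, Dual X] (al X Y) [] \<star> whisk [] (al (Dual Y) (Dual X)) [X \<boxtimes> Y]"
proof -
  let ?e = "Ev Y \<cdot> (Id (Dual Y) \<otimes> (\<l> Y \<cdot> (Ev X \<otimes> Id Y) \<cdot> \<alpha>inv (Dual X) X Y)) \<cdot>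
      \<alpha> (Dual Y) (Dual X) (X \<boxtimes> Y)"
  have h: "hat ((Dual Y \<boxtimes> Dual X) \<boxtimes> (X \<boxtimes> Y)) \<I> ?e
    = lui \<star> evw2 X Y \<star> whisk [Dual Y, Dual X] (al X Y) [] \<star> whisk [] (al (Dual Y) (Dual X)) [X \<boxtimes> Y] \<star> al (Dual Y \<boxtimes> Dual X) (X \<boxtimes> Y)"
    unfolding evw2_def
    by (rule hat_eqI, (rule hats_rules hats_Ev)+)
      (simp add: hat_Ev exch[of "al (Dual Y) (Dual X)" "al X Y" "[]" "[]" "[]", simplified])
  have e: "?e \<in> Hom ((Dual Y \<boxtimes> Dual X) \<boxtimes> (X \<boxtimes> Y)) \<I>"
    by (rule hatsD(2), (rule hats_rules hats_Ev)+)
  show "dual_ten X Y \<in> Hom (Dual Y \<boxtimes> Dual X) (Dual (X \<boxtimes> Y))"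
    unfolding dual_ten_def by (rule hatsD(2)[OF hats_mate[OF e]])
  show "evw (X \<boxtimes> Y) \<star> whisk [] (hat (Dual Y \<boxtimes> Dual X) (Dual (X \<boxtimes> Y)) (dual_ten X Y)) [X \<boxtimes> Y]
    = evw2 X Y \<star> whisk [Dual Y, Dual X] (al X Y) [] \<star> whisk [] (al (Dual Y) (Dual X)) [X \<boxtimes> Y]"
    unfolding dual_ten_def evw_hat_mate[OF e] h by simp
qed

text \<open>Separates the dual of a product into two dual strands, by transposition against the
  nested cup \<open>cow2\<close>. Up to \<open>ali\<close> it is a right inverse of
  \<open>dual_ten\<close>, see \<open>dual_ten_dualw\<close>.\<close>

definition dualw where "dualw X Y =
  whisk [] (evw (X \<boxtimes> Y) \<star> whisk [Dual (X \<boxtimes> Y)] (ali X Y) []) [Dual Y, Dual X] \<star> whisk [Dual (X \<boxtimes> Y)] (cow2 X Y) []"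

lemma dualw_simps [simp]: "valid (dualw X Y)" "sdom (dualw X Y) = [Dual (X \<boxtimes> Y)]" "scod (dualw X Y) = [Dual Y, Dual X]"
  unfolding dualw_def by auto

lemma dualw_cow: "whisk [X \<boxtimes> Y] (dualw X Y) [] \<star> cow (X \<boxtimes> Y) = whisk [] (ali X Y) [Dual Y, Dual X] \<star> cow2 X Y"
proof -
  let ?Z = "X \<boxtimes> Y" let ?P = "[Dual Y, Dual X]"
  have "whisk [?Z] (dualw X Y) [] \<star> cow ?Z
    = whisk [?Z] (evw ?Z) ?P \<star> whisk [?Z, Dual ?Z] (ali X Y) ?P \<star> (whisk [?Z, Dual ?Z] (cow2 X Y) [] \<star> cow ?Z)"
    unfolding dualw_def by simp
  also have "whisk [?Z, Dual ?Z] (cow2 X Y) [] \<star> cow ?Z = whisk [] (cow ?Z) ([X, Y] @ ?P) \<star> cow2 X Y"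
    using exch[of "cow ?Z" "cow2 X Y" "[]" "[]" "[]", simplified] by simp
  also have "whisk [?Z] (evw ?Z) ?P \<star> whisk [?Z, Dual ?Z] (ali X Y) ?P \<star> whisk [] (cow ?Z) ([X, Y] @ ?P) \<star> cow2 X Y
    = whisk [?Z] (evw ?Z) ?P \<star> (whisk [?Z, Dual ?Z] (ali X Y) ?P \<star> whisk [] (cow ?Z) ([X, Y] @ ?P)) \<star> cow2 X Y" by simp
  also have "whisk [?Z, Dual ?Z] (ali X Y) ?P \<star> whisk [] (cow ?Z) ([X, Y] @ ?P) = whisk [] (cow ?Z) ([?Z] @ ?P) \<star> whisk [] (ali X Y) ?P"
    using exch[of "cow ?Z" "ali X Y" "[]" "[]" ?P, simplified] by simp
  also have "whisk [?Z] (evw ?Z) ?P \<star> (whisk [] (cow ?Z) ([?Z] @ ?P) \<star> whisk [] (ali X Y) ?P) \<star> cow2 X Y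
    = (whisk [?Z] (evw ?Z) ?P \<star> whisk [] (cow ?Z) ([?Z] @ ?P)) \<star> whisk [] (ali X Y) ?P \<star> cow2 X Y" by simp
  also have "\<dots> = whisk [] (ali X Y) ?P \<star> cow2 X Y" using zigzag1_w[of "[]" ?Z ?P] by simp
  finally show ?thesis .
qed

lemma dual_ten_dualw:
  "hat (Dual Y \<boxtimes> Dual X) (Dual (X \<boxtimes> Y)) (dual_ten X Y) \<star> ali (Dual Y) (Dual X) \<star> dualw X Y = sid [Dual (X \<boxtimes> Y)]"
proof -
  let ?Z = "X \<boxtimes> Y" let ?P = "[Dual Y, Dual X]"
  let ?D = "hat (Dual Y \<boxtimes> Dual X) (Dual ?Z) (dual_ten X Y)"
  let ?e = "evw ?Z \<star> whisk [Dual ?Z] (ali X Y) []"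
  note D = evw_dual_ten(1)[of X Y]
  have "evw ?Z \<star> whisk [] (?D \<star> ali (Dual Y) (Dual X) \<star> dualw X Y) [?Z]
    = (evw ?Z \<star> whisk [] ?D [?Z]) \<star> whisk [] (ali (Dual Y) (Dual X)) [?Z] \<star> whisk [] (dualw X Y) [?Z]" by simp
  also have "\<dots> = evw2 X Y \<star> (whisk ?P (al X Y) [] \<star> whisk [] (dualw X Y) [?Z])"
    unfolding evw_dual_ten(2) by simp
  also have "whisk ?P (al X Y) [] \<star> whisk [] (dualw X Y) [?Z] = whisk [] (dualw X Y) [X, Y] \<star> whisk [Dual ?Z] (al X Y) []"
    using exch[of "dualw X Y" "al X Y" "[]" "[]" "[]", simplified] by simp
  also have "evw2 X Y \<star> whisk [] (dualw X Y) [X, Y] \<star> whisk [Dual ?Z] (al X Y) []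
    = (evw2 X Y \<star> whisk [] ?e (?P @ [X, Y])) \<star> whisk [Dual ?Z] (cow2 X Y) [X, Y] \<star> whisk [Dual ?Z] (al X Y) []"
    unfolding dualw_def by simp
  also have "evw2 X Y \<star> whisk [] ?e (?P @ [X, Y]) = ?e \<star> whisk [Dual ?Z, X, Y] (evw2 X Y) []"
    using exch[of "?e" "evw2 X Y" "[]" "[]" "[]"] by simp
  also have "(?e \<star> whisk [Dual ?Z, X, Y] (evw2 X Y) []) \<star> whisk [Dual ?Z] (cow2 X Y) [X, Y] \<star> whisk [Dual ?Z] (al X Y) []
    = ?e \<star> (whisk [Dual ?Z, X, Y] (evw2 X Y) [] \<star> whisk [Dual ?Z] (cow2 X Y) [X, Y]) \<star> whisk [Dual ?Z] (al X Y) []" by simp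
  also have "\<dots> = evw ?Z" using zigzag1_ten_w[of "[Dual ?Z]" X Y "[]"] by simp
  finally have 1: "evw ?Z \<star> whisk [] (?D \<star> ali (Dual Y) (Dual X) \<star> dualw X Y) [?Z] = evw ?Z" .
  have "?D \<star> ali (Dual Y) (Dual X) \<star> dualw X Y = whisk [] (evw ?Z) [Dual ?Z] \<star> whisk [Dual ?Z] (cow ?Z) []"
    by (rule evw_nondegenerate[OF _ _ _ 1]) (use D in auto)
  then show ?thesis unfolding zigzag2 .
qed

text \<open>Monoidality of \<open>s\<close> enters here: it says precisely that the cap of
  \<open>X \<boxtimes> Y\<close> built from \<open>s\<close> is the nested cap \<open>etw2\<close>,
  once the dual of the product is split by \<open>dualw\<close>.\<close>

lemma etw_dualw: "etw (X \<boxtimes> Y) \<star> whisk [] (ali X Y) [Dual (X \<boxtimes> Y)] = etw2 X Y \<star> whisk [X, Y] (dualw X Y) []"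
proof -
  let ?Z = "X \<boxtimes> Y" let ?X = "Dual X" and ?Y = "Dual Y"
  let ?P = "?Y \<boxtimes> ?X" let ?XX = "Dual ?X" and ?YY = "Dual ?Y"
  define D where "D = hat ?P (Dual ?Z) (dual_ten X Y)"
  note dH = evw_dual_ten(1)[of X Y]
  have D [simp]: "valid D" "sdom D = [?P]" "scod D = [Dual ?Z]" unfolding D_def using dH by auto
  define E where "E = hat (?XX \<boxtimes> ?YY) (Dual ?P) (dual_ten ?Y ?X)"
  note eH = evw_dual_ten(1)[of ?Y ?X]
  have E [simp]: "valid E" "sdom E = [?XX \<boxtimes> ?YY]" "scod E = [Dual ?P]" unfolding E_def using eH by auto
  define F where "F = hat (Dual (Dual ?Z)) (Dual ?P) (dual_arr ?P (Dual ?Z) (dual_ten X Y))"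
  note fH = dual_arr(1)[OF dH]
  have F [simp]: "valid F" "sdom F = [Dual (Dual ?Z)]" "scod F = [Dual ?P]" unfolding F_def using fH by auto
  have "dual_arr ?P (Dual ?Z) (dual_ten X Y) \<cdot> s ?Z = dual_ten ?Y ?X \<cdot> (s X \<otimes> s Y)"
    using pivotal_s unfolding pivotal_def by blast
  then have "F \<star> sw ?Z = E \<star> hat ?Z (?XX \<boxtimes> ?YY) (s X \<otimes> s Y)"
    unfolding F_def E_def sw_def using hat_comp[OF s_Hom fH] hat_comp[OF mten_Hom[OF s_Hom s_Hom] eH] by simp
  then have piv: "F \<star> sw ?Z = E \<star> ali ?XX ?YY \<star> whisk [] (sw X) [?YY] \<star> whisk [X] (sw Y) [] \<star> al X Y"
    unfolding sw_def hat_ten[OF s_Hom s_Hom] .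
  have "etw ?Z \<star> whisk [?Z] D [] = evw (Dual ?Z) \<star> (whisk [] (sw ?Z) [Dual ?Z] \<star> whisk [?Z] D [])"
    unfolding etw_def by simp
  also have "whisk [] (sw ?Z) [Dual ?Z] \<star> whisk [?Z] D [] = whisk [Dual (Dual ?Z)] D [] \<star> whisk [] (sw ?Z) [?P]"
    using exch[of "sw ?Z" D "[]" "[]" "[]", simplified] by simp
  also have "evw (Dual ?Z) \<star> whisk [Dual (Dual ?Z)] D [] \<star> whisk [] (sw ?Z) [?P]
    = (evw ?P \<star> whisk [] F [?P]) \<star> whisk [] (sw ?Z) [?P]"
    using dual_arr(2)[OF dH] unfolding D_def F_def by simp
  also have "\<dots> = evw ?P \<star> whisk [] (F \<star> sw ?Z) [?P]" by simp
  also have "\<dots> = (evw ?P \<star> whisk [] E [?P]) \<star> whisk [] (ali ?XX ?YY \<star> whisk [] (sw X) [?YY] \<star> whisk [X] (sw Y) [] \<star> al X Y) [?P]"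
    unfolding piv by simp
  also have "\<dots> = evw2 ?Y ?X \<star> (whisk [?XX, ?YY] (al ?Y ?X) [] \<star> whisk [] (whisk [] (sw X) [?YY] \<star> whisk [X] (sw Y) [] \<star> al X Y) [?P])"
    unfolding E_def evw_dual_ten(2) by simp
  also have "whisk [?XX, ?YY] (al ?Y ?X) [] \<star> whisk [] (whisk [] (sw X) [?YY] \<star> whisk [X] (sw Y) [] \<star> al X Y) [?P]
    = whisk [] (whisk [] (sw X) [?YY] \<star> whisk [X] (sw Y) [] \<star> al X Y) [?Y, ?X] \<star> whisk [?Z] (al ?Y ?X) []"
    using exch[of "whisk [] (sw X) [?YY] \<star> whisk [X] (sw Y) [] \<star> al X Y" "al ?Y ?X" "[]" "[]" "[]"] by simp
  finally have 0: "etw ?Z \<star> whisk [?Z] D []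
    = evw2 ?Y ?X \<star> whisk [] (whisk [] (sw X) [?YY] \<star> whisk [X] (sw Y) [] \<star> al X Y) [?Y, ?X] \<star> whisk [?Z] (al ?Y ?X) []" .
  have "etw ?Z \<star> whisk [?Z] (D \<star> ali ?Y ?X) [] = (etw ?Z \<star> whisk [?Z] D []) \<star> whisk [?Z] (ali ?Y ?X) []"
    by simp
  then have 1: "etw ?Z \<star> whisk [?Z] (D \<star> ali ?Y ?X) []
    = evw2 ?Y ?X \<star> whisk [] (sw X) [?YY, ?Y, ?X] \<star> whisk [X] (sw Y) [?Y, ?X] \<star> whisk [] (al X Y) [?Y, ?X]"
    unfolding 0 by simp
  have "etw2 X Y = evw ?X \<star> (whisk [] (sw X) [?X] \<star> whisk [X] (evw ?Y) [?X]) \<star> whisk [X] (sw Y) [?Y, ?X]"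
    unfolding etw2_def etw_def by simp
  also have "whisk [] (sw X) [?X] \<star> whisk [X] (evw ?Y) [?X] = whisk [?XX] (evw ?Y) [?X] \<star> whisk [] (sw X) [?YY, ?Y, ?X]"
    using exch[of "sw X" "evw ?Y" "[]" "[]" "[?X]", simplified] by simp
  finally have 2: "etw2 X Y = evw2 ?Y ?X \<star> whisk [] (sw X) [?YY, ?Y, ?X] \<star> whisk [X] (sw Y) [?Y, ?X]"
    unfolding evw2_def by simp
  have 3: "etw ?Z \<star> whisk [?Z] (D \<star> ali ?Y ?X) [] = etw2 X Y \<star> whisk [] (al X Y) [?Y, ?X]"
    unfolding 1 2 by simp
  \<comment> \<open>The identity of the dual strand is inserted in the factorised form
    \<open>D \<star> ali ?Y ?X \<star> dualw X Y\<close>, so that the equation labelled 3 becomes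
    applicable.\<close>
  have "etw ?Z \<star> whisk [] (ali X Y) [Dual ?Z] = etw ?Z \<star> whisk [?Z] (D \<star> ali ?Y ?X \<star> dualw X Y) [] \<star> whisk [] (ali X Y) [Dual ?Z]"
    unfolding D_def dual_ten_dualw by simp
  also have "\<dots> = (etw ?Z \<star> whisk [?Z] (D \<star> ali ?Y ?X) []) \<star> (whisk [?Z] (dualw X Y) [] \<star> whisk [] (ali X Y) [Dual ?Z])"
    by simp
  also have "whisk [?Z] (dualw X Y) [] \<star> whisk [] (ali X Y) [Dual ?Z] = whisk [] (ali X Y) [?Y, ?X] \<star> whisk [X, Y] (dualw X Y) []"
    using exch[of "ali X Y" "dualw X Y" "[]" "[]" "[]", simplified] by simp
  finally show ?thesis unfolding 3 by simp
qed

text \<open>Slides a morphism out of \<open>X \<boxtimes> Y\<close> around a closed loop of two strands.\<close>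
lemma ten_transpose:
  assumes g: "g \<in> Hom (X \<boxtimes> Y) T"
  obtains G where "valid G" "sdom G = [Dual T]" "scod G = [Dual Y, Dual X]"
    and "etw T \<star> whisk [] (hat (X \<boxtimes> Y) T g \<star> ali X Y) [Dual T] = etw2 X Y \<star> whisk [X, Y] G []"
    and "whisk [] (hat (X \<boxtimes> Y) T g \<star> ali X Y) [Dual Y, Dual X] \<star> cow2 X Y = whisk [T] G [] \<star> cow T"
proof -
  let ?Z = "X \<boxtimes> Y"
  define H where "H = hat (Dual T) (Dual ?Z) (dual_arr ?Z T g)"
  have H [simp]: "valid H" "sdom H = [Dual T]" "scod H = [Dual ?Z]"
    unfolding H_def using dual_arr(1)[OF g] by auto
  define G where "G = hat ?Z T g"
  have G [simp]: "valid G" "sdom G = [?Z]" "scod G = [T]" unfolding G_def using g by auto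
  have "etw T \<star> whisk [] (G \<star> ali X Y) [Dual T] = (etw T \<star> whisk [] G [Dual T]) \<star> whisk [] (ali X Y) [Dual T]" by simp
  also have "\<dots> = etw ?Z \<star> (whisk [?Z] H [] \<star> whisk [] (ali X Y) [Dual T])"
    unfolding G_def H_def etw_natural[OF g] by simp
  also have "whisk [?Z] H [] \<star> whisk [] (ali X Y) [Dual T] = whisk [] (ali X Y) [Dual ?Z] \<star> whisk [X, Y] H []"
    using exch[of "ali X Y" H "[]" "[]" "[]", simplified] by simp
  also have "etw ?Z \<star> whisk [] (ali X Y) [Dual ?Z] \<star> whisk [X, Y] H [] = (etw2 X Y \<star> whisk [X, Y] (dualw X Y) []) \<star> whisk [X, Y] H []"
    unfolding etw_dualw[symmetric] by simp
  finally have 1: "etw T \<star> whisk [] (G \<star> ali X Y) [Dual T] = etw2 X Y \<star> whisk [X, Y] (dualw X Y \<star> H) []" by simp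
  have "whisk [] (G \<star> ali X Y) [Dual Y, Dual X] \<star> cow2 X Y
    = (whisk [] G [Dual Y, Dual X] \<star> whisk [?Z] (dualw X Y) []) \<star> cow ?Z"
    using dualw_cow[of X Y] by simp
  also have "whisk [] G [Dual Y, Dual X] \<star> whisk [?Z] (dualw X Y) [] = whisk [T] (dualw X Y) [] \<star> whisk [] G [Dual ?Z]"
    using exch[of G "dualw X Y" "[]" "[]" "[]", simplified] by simp
  also have "(whisk [T] (dualw X Y) [] \<star> whisk [] G [Dual ?Z]) \<star> cow ?Z = whisk [T] (dualw X Y \<star> H) [] \<star> cow T"
    using dual_arr_cow[OF g] unfolding G_def H_def by simp
  finally have 2: "whisk [] (G \<star> ali X Y) [Dual Y, Dual X] \<star> cow2 X Y = whisk [T] (dualw X Y \<star> H) [] \<star> cow T" .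
  show ?thesis by (rule that[of "dualw X Y \<star> H"]) (use 1 2 G_def in simp_all)
qed

section \<open>Traces as closed loops\<close>

lemma trace_word:
  assumes f: "f \<in> Hom X X"
  shows "trace_right s X f \<in> Hom \<I> \<I>"
   and "hat \<I> \<I> (trace_right s X f) = lui \<star> etw X \<star> whisk [] (hat X X f) [Dual X] \<star> cow X \<star> lu"
proof -
  have 1: "hat X (Dual (Dual X)) (s X \<cdot> f) = sw X \<star> hat X X f"
    unfolding sw_def by (rule hat_comp[OF f s_Hom])
  note sf = comp_Hom[OF f s_Hom]
  show "hat \<I> \<I> (trace_right s X f) = lui \<star> etw X \<star> whisk [] (hat X X f) [Dual X] \<star> cow X \<star> lu"
    unfolding trace_right_def
    by (rule hat_eqI, (rule hats_\<alpha> hats_Id hats_ten hats_hat[OF sf] hats_comp hats_Ev hats_Coev)+, simp add: hat_Ev hat_Coev 1 f etw_def)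
  show "trace_right s X f \<in> Hom \<I> \<I>"
    unfolding trace_right_def by (rule hatsD(2), (rule hats_\<alpha> hats_Id hats_ten hats_hat[OF sf] hats_comp hats_Ev hats_Coev)+)
qed

text \<open>The loop over \<open>X \<boxtimes> Y\<close> is opened into two nested loops, so that a
  trace on a tensor product can be taken one strand at a time.\<close>

lemma trace_ten_word:
  assumes f: "f \<in> Hom (X \<boxtimes> Y) (X \<boxtimes> Y)"
  shows "hat \<I> \<I> (trace_right s (X \<boxtimes> Y) f) = lui \<star> etw2 X Y \<star>
    whisk [] (al X Y \<star> hat (X \<boxtimes> Y) (X \<boxtimes> Y) f \<star> ali X Y) [Dual Y, Dual X] \<star> cow2 X Y \<star> lu"
proof -
  let ?Z = "X \<boxtimes> Y" let ?P = "[Dual Y, Dual X]"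
  define F where "F = hat ?Z ?Z f"
  have F [simp]: "valid F" "sdom F = [?Z]" "scod F = [?Z]" unfolding F_def using f by auto
  have "etw2 X Y \<star> whisk [] (al X Y \<star> F \<star> ali X Y) ?P \<star> cow2 X Y
    = etw2 X Y \<star> (whisk [] (al X Y \<star> F) ?P \<star> whisk [?Z] (dualw X Y) []) \<star> cow ?Z"
    using dualw_cow[of X Y] by simp
  also have "whisk [] (al X Y \<star> F) ?P \<star> whisk [?Z] (dualw X Y) [] = whisk [X, Y] (dualw X Y) [] \<star> whisk [] (al X Y \<star> F) [Dual ?Z]"
    using exch[of "al X Y \<star> F" "dualw X Y" "[]" "[]" "[]"] by simp
  also have "etw2 X Y \<star> (whisk [X, Y] (dualw X Y) [] \<star> whisk [] (al X Y \<star> F) [Dual ?Z]) \<star> cow ?Z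
    = (etw ?Z \<star> whisk [] (ali X Y) [Dual ?Z]) \<star> whisk [] (al X Y \<star> F) [Dual ?Z] \<star> cow ?Z"
    unfolding etw_dualw by simp
  finally have "etw2 X Y \<star> whisk [] (al X Y \<star> F \<star> ali X Y) ?P \<star> cow2 X Y = etw ?Z \<star> whisk [] F [Dual ?Z] \<star> cow ?Z"
    by simp
  from arg_cong[OF this, of "\<lambda>h. lui \<star> h \<star> lu"] show ?thesis
    unfolding trace_word(2)[OF f] F_def[symmetric] by simp
qed

end

section \<open>Separable algebras\<close>

locale separable_algebra = fusion_category C s for C (structure) and s +
  fixes A m u \<kappa>
  assumes alg: "algebra A m u"
    and copair: "copairing s A m \<kappa>"
begin

lemma m_Hom: "m \<in> Hom (A \<boxtimes> A) A" and u_Hom: "u \<in> Hom \<I> A"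
  using alg unfolding algebra_def by auto
lemma \<kappa>_Hom: "\<kappa> \<in> Hom \<I> (A \<boxtimes> A)"
  using copair unfolding copairing_def by auto

abbreviation \<epsilon> where "\<epsilon> \<equiv> can_trace s A m"

definition "M = hat (A \<boxtimes> A) A m \<star> ali A A"
definition "U = hat \<I> A u \<star> lui"
definition "K = al A A \<star> hat \<I> (A \<boxtimes> A) \<kappa> \<star> lui"
definition "E = etw A \<star> whisk [] M [Dual A] \<star> whisk [A] (cow A) []"
definition "B = E \<star> M"
definition "\<Delta> = whisk [] M [A] \<star> whisk [A] K []"

lemma hat_m: "hat (A \<boxtimes> A) A m = M \<star> al A A" and hat_u: "hat \<I> A u = U \<star> lu"
  and hat_\<kappa>: "hat \<I> (A \<boxtimes> A) \<kappa> = ali A A \<star> K \<star> lu"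
  unfolding M_def U_def K_def using m_Hom u_Hom \<kappa>_Hom by simp_all

lemma word_simps [simp]:
  "valid M" "sdom M = [A, A]" "scod M = [A]"
  "valid U" "sdom U = []" "scod U = [A]"
  "valid K" "sdom K = []" "scod K = [A, A]"
  "valid E" "sdom E = [A]" "scod E = []"
  "valid B" "sdom B = [A, A]" "scod B = []"
  "valid \<Delta>" "sdom \<Delta> = [A]" "scod \<Delta> = [A, A]"
  unfolding \<Delta>_def B_def E_def unfolding M_def U_def K_def using m_Hom u_Hom \<kappa>_Hom by auto

lemmas hats_mu = hats_hat[OF m_Hom] hats_hat[OF u_Hom] hats_hat[OF \<kappa>_Hom] hats_hat[OF s_Hom]

lemma cancel_al: assumes "valid F" "valid G" "sdom F = ps @ [X, Y] @ qs" "sdom G = ps @ [X, Y] @ qs"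
    "F \<star> whisk ps (al X Y) qs = G \<star> whisk ps (al X Y) qs"
  shows "F = G"
proof -
  have "(F \<star> whisk ps (al X Y) qs) \<star> whisk ps (ali X Y) qs = (G \<star> whisk ps (al X Y) qs) \<star> whisk ps (ali X Y) qs"
    using assms(5) by simp
  then show ?thesis using assms(1-4) by simp
qed

lemma M_assoc: "M \<star> whisk [] M [A] = M \<star> whisk [A] M []"
proof -
  have 1: "hat ((A \<boxtimes> A) \<boxtimes> A) A (m \<cdot> (m \<otimes> Id A)) = M \<star> whisk [] M [A] \<star> whisk [] (al A A) [A] \<star> al (A \<boxtimes> A) A"
    by (rule hat_eqI, (rule hats_rules hats_mu)+, simp add: hat_m)
  have 2: "hat ((A \<boxtimes> A) \<boxtimes> A) A (m \<cdot> (Id A \<otimes> m) \<cdot> \<alpha> A A A) = M \<star> whisk [A] M [] \<star> whisk [] (al A A) [A] \<star> al (A \<boxtimes> A) A"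
    by (rule hat_eqI, (rule hats_rules hats_mu)+, simp add: hat_m)
  have "m \<cdot> (m \<otimes> Id A) = m \<cdot> (Id A \<otimes> m) \<cdot> \<alpha> A A A" using alg unfolding algebra_def by auto
  with 1 2 have 3: "(M \<star> whisk [] M [A] \<star> whisk [] (al A A) [A]) \<star> whisk [] (al (A \<boxtimes> A) A) [] = 
    (M \<star> whisk [A] M [] \<star> whisk [] (al A A) [A]) \<star> whisk [] (al (A \<boxtimes> A) A) []" by simp
  have 4: "(M \<star> whisk [] M [A]) \<star> whisk [] (al A A) [A] = (M \<star> whisk [A] M []) \<star> whisk [] (al A A) [A]"
    using cancel_al[OF _ _ _ _ 3] by simp
  show ?thesis by (rule cancel_al[OF _ _ _ _ 4]) auto
qed

lemma U_left: "M \<star> whisk [] U [A] = sid [A]" and U_right: "M \<star> whisk [A] U [] = sid [A]"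
proof -
  have 1: "hat (\<I> \<boxtimes> A) A (m \<cdot> (u \<otimes> Id A)) = M \<star> whisk [] U [A] \<star> whisk [] lu [A] \<star> al \<I> A"
    by (rule hat_eqI, (rule hats_rules hats_mu)+, simp add: hat_m hat_u)
  have "m \<cdot> (u \<otimes> Id A) = \<l> A" using alg unfolding algebra_def by auto
  then have "M \<star> whisk [] U [A] \<star> whisk [] lu [A] \<star> al \<I> A = whisk [] lu [A] \<star> al \<I> A"
    using 1 hat_\<l>[of A] by simp
  from arg_cong[OF this, of "\<lambda>f. f \<star> ali \<I> A \<star> whisk [] lui [A]"]
  show "M \<star> whisk [] U [A] = sid [A]" by simp
  have 1: "hat (A \<boxtimes> \<I>) A (m \<cdot> (Id A \<otimes> u)) = M \<star> whisk [A] U [] \<star> whisk [A] lu [] \<star> al A \<I>"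
    by (rule hat_eqI, (rule hats_rules hats_mu)+, simp add: hat_m hat_u)
  have "m \<cdot> (Id A \<otimes> u) = \<r> A" using alg unfolding algebra_def by auto
  then have "M \<star> whisk [A] U [] \<star> whisk [A] lu [] \<star> al A \<I> = whisk [A] lu [] \<star> al A \<I>"
    using 1 hat_\<r>[of A] by simp
  from arg_cong[OF this, of "\<lambda>f. f \<star> ali A \<I> \<star> whisk [A] lui []"]
  show "M \<star> whisk [A] U [] = sid [A]" by simp
qed

lemma hat_s: "hat A (Dual (Dual A)) (s A) = sw A" unfolding sw_def ..

lemma \<epsilon>_Hom: "\<epsilon> \<in> Hom A \<I>"
  unfolding can_trace_def by (rule hatsD(2), (rule hats_rules hats_mu hats_Ev hats_Coev)+)
lemma hat_\<epsilon>: "hat A \<I> \<epsilon> = lui \<star> E"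
  unfolding can_trace_def E_def etw_def
  by (rule hat_eqI, (rule hats_rules hats_mu hats_Ev hats_Coev)+, simp add: hat_m hat_Ev hat_Coev hat_s)
lemma hats_\<epsilon>: "hats A \<I> \<epsilon> (lui \<star> E)" unfolding hats_def using \<epsilon>_Hom hat_\<epsilon> by simp

lemma B_K: "whisk [] B [A] \<star> whisk [A] K [] = sid [A]"
proof -
  have "hat A A (\<l> A \<cdot> (can_pairing s A m \<otimes> Id A) \<cdot> \<alpha>inv A A A \<cdot> (Id A \<otimes> \<kappa>) \<cdot> \<r>inv A)
    = whisk [] B [A] \<star> whisk [A] K []"
    unfolding can_pairing_def B_def
    by (rule hat_eqI, (rule hats_rules hats_mu hats_\<epsilon>)+, simp add: hat_m hat_\<kappa>)
  then show ?thesis using copair hat_Id unfolding copairing_def by auto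
qed

lemma hats_comult_aux: "hats A (A \<boxtimes> A) ((m \<otimes> Id A) \<cdot> \<alpha>inv A A A \<cdot> (Id A \<otimes> \<kappa>) \<cdot> \<r>inv A) (ali A A \<star> \<Delta>)"
proof -
  have "hat A (A \<boxtimes> A) ((m \<otimes> Id A) \<cdot> \<alpha>inv A A A \<cdot> (Id A \<otimes> \<kappa>) \<cdot> \<r>inv A) = ali A A \<star> \<Delta>"
    unfolding \<Delta>_def
    by (rule hat_eqI, (rule hats_rules hats_mu)+, simp add: hat_m hat_\<kappa>)
  moreover have "(m \<otimes> Id A) \<cdot> \<alpha>inv A A A \<cdot> (Id A \<otimes> \<kappa>) \<cdot> \<r>inv A \<in> Hom A (A \<boxtimes> A)"
    by (rule hatsD(2), (rule hats_rules hats_mu)+)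
  ultimately show ?thesis unfolding hats_def by simp
qed

lemma M_assoc_E: "B \<star> whisk [] M [A] = B \<star> whisk [A] M []"
  unfolding B_def using M_assoc by simp

lemma M_assoc_w: "whisk ps M qs \<star> whisk ps M ([A] @ qs) = whisk ps M qs \<star> whisk (ps @ [A]) M qs"
  using arg_cong[OF M_assoc, of "\<lambda>f. whisk ps f qs"] by simp
lemma U_left_w: "whisk ps M qs \<star> whisk ps U ([A] @ qs) = sid (ps @ [A] @ qs)"
  using arg_cong[OF U_left, of "\<lambda>f. whisk ps f qs"] by simp
lemma B_K_w: "whisk ps B ([A] @ qs) \<star> whisk (ps @ [A]) K qs = sid (ps @ [A] @ qs)"
  using arg_cong[OF B_K, of "\<lambda>f. whisk ps f qs"] by simp

text \<open>By associativity, multiplication by a product is the composite of two multiplications;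
  the pairing of a and b is the trace of the composite of the left multiplications by a and b.
  Cyclicity can be applied to this shape.\<close>

lemma E_M: "B = etw A \<star> whisk [] M [Dual A] \<star> whisk [A] M [Dual A] \<star> whisk [A, A] (cow A) []"
proof -
  have "B = etw A \<star> whisk [] M [Dual A] \<star> (whisk [A] (cow A) [] \<star> M)"
    unfolding B_def E_def by simp
  also have "whisk [A] (cow A) [] \<star> M = whisk [] M [A, Dual A] \<star> whisk [A, A] (cow A) []"
    using exch[of M "cow A" "[]" "[]" "[]", simplified] by simp
  finally show ?thesis using tail_eq[OF M_assoc_w[of "[]" "[Dual A]", simplified]] by simp
qed

text \<open>\<open>H\<close> is the map from \<open>A\<close> to its dual given by the trace
  pairing, and \<open>Hi\<close> is its inverse. Together they make \<open>A\<close> self-dual, with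
  the copairing in the role of the coevaluation.\<close>

definition "H = whisk [] B [Dual A] \<star> whisk [A] (cow A) []"
definition "Hi = whisk [A] (etw A) [] \<star> whisk [] K [Dual A]"

lemma H_simps [simp]: "valid H" "sdom H = [A]" "scod H = [Dual A]" "valid Hi" "sdom Hi = [Dual A]" "scod Hi = [A]"
  unfolding H_def Hi_def by auto

text \<open>The trace form is symmetric in the pivotal sense: rotating its second leg turns the loop
  defining it into a loop over two strands, and cyclicity of that loop returns the form.\<close>
lemma etw_H: "etw A \<star> whisk [A] H [] = B"
proof -
  let ?A = "Dual A"
  obtain G where G [simp]: "valid G" "sdom G = [?A]" "scod G = [?A, ?A]"
    and G1: "etw A \<star> whisk [] M [?A] = etw2 A A \<star> whisk [A, A] G []"
    and G2: "whisk [] M [?A, ?A] \<star> cow2 A A = whisk [A] G [] \<star> cow A"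
    using ten_transpose[OF m_Hom] unfolding M_def by blast
  have "etw A \<star> whisk [A] H [] = etw A \<star> whisk [A] (etw A) [?A] \<star> whisk [A] M [?A, ?A] \<star> whisk [A, A] M [?A, ?A]
     \<star> whisk [A, A, A] (cow A) [?A] \<star> whisk [A, A] (cow A) []"
    unfolding H_def E_M by simp
  also have "\<dots> = etw2 A A \<star> whisk [A] M [?A, ?A] \<star> whisk [A, A] (whisk [] M [?A, ?A] \<star> cow2 A A) []"
    unfolding etw2_def cow2_def by simp
  also have "\<dots> = etw2 A A \<star> (whisk [A] M [?A, ?A] \<star> whisk [A, A, A] G []) \<star> whisk [A, A] (cow A) []"
    unfolding G2 by simp
  also have "whisk [A] M [?A, ?A] \<star> whisk [A, A, A] G [] = whisk [A, A] G [] \<star> whisk [A] M [?A]"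
    using exch[of M G "[A]" "[]" "[]", simplified] by simp
  also have "etw2 A A \<star> (whisk [A, A] G [] \<star> whisk [A] M [?A]) \<star> whisk [A, A] (cow A) []
     = (etw2 A A \<star> whisk [A, A] G []) \<star> whisk [A] M [?A] \<star> whisk [A, A] (cow A) []" by simp
  also have "\<dots> = B" unfolding G1[symmetric] E_M by simp
  finally show ?thesis .
qed

lemma evw_H: "evw A \<star> whisk [] H [A] = B"
  unfolding H_def by (rule evw_mate) simp_all

text \<open>An evaluation determines its coevaluation. Through this the copairing is identified with
  \<open>ctw A\<close> in \<open>H_K\<close>.\<close>

lemma ctw_unique:
  assumes V [simp]: "valid V" "sdom V = []" "scod V = [Dual A, A]" and eq: "whisk [] (etw A) [A] \<star> whisk [A] V [] = sid [A]"
  shows "V = ctw A"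
proof -
  let ?A = "Dual A"
  have "ctw A = whisk [?A] (whisk [] (etw A) [A] \<star> whisk [A] V []) [] \<star> ctw A" unfolding eq by simp
  also have "\<dots> = whisk [?A] (etw A) [A] \<star> (whisk [?A, A] V [] \<star> ctw A)" by simp
  also have "whisk [?A, A] V [] \<star> ctw A = whisk [] (ctw A) [?A, A] \<star> V"
    using exch[of "ctw A" V "[]" "[]" "[]", simplified] by simp
  also have "whisk [?A] (etw A) [A] \<star> whisk [] (ctw A) [?A, A] \<star> V
    = whisk [] (whisk [?A] (etw A) [] \<star> whisk [] (ctw A) [?A]) [A] \<star> V" by simp
  also have "\<dots> = V" unfolding zigzag_etw by simp
  finally show ?thesis by simp
qed

lemma H_K: "whisk [] H [A] \<star> K = ctw A"
proof (rule ctw_unique)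
  have "whisk [] (etw A) [A] \<star> whisk [A] (whisk [] H [A] \<star> K) [] = whisk [] (etw A \<star> whisk [A] H []) [A] \<star> whisk [A] K []"
    by simp
  then show "whisk [] (etw A) [A] \<star> whisk [A] (whisk [] H [A] \<star> K) [] = sid [A]" unfolding etw_H B_K .
qed auto

lemma H_Hi: "H \<star> Hi = sid [Dual A]"
proof -
  have "H \<star> Hi = (H \<star> whisk [A] (etw A) []) \<star> whisk [] K [Dual A]" unfolding Hi_def by simp
  also have "H \<star> whisk [A] (etw A) [] = whisk [Dual A] (etw A) [] \<star> whisk [] H [A, Dual A]"
    using exch[of H "etw A" "[]" "[]" "[]", simplified] by simp
  also have "(whisk [Dual A] (etw A) [] \<star> whisk [] H [A, Dual A]) \<star> whisk [] K [Dual A]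
    = whisk [Dual A] (etw A) [] \<star> whisk [] (whisk [] H [A] \<star> K) [Dual A]" by simp
  also have "\<dots> = sid [Dual A]" unfolding H_K zigzag_etw ..
  finally show ?thesis .
qed

text \<open>\<open>evw_H\<close> and \<open>B_K\<close> provide a left inverse of \<open>H\<close>.
  It has to agree with the right inverse \<open>Hi\<close>.\<close>

lemma Hi_alt: "Hi = whisk [] (evw A) [A] \<star> whisk [Dual A] K []" and Hi_H: "Hi \<star> H = sid [A]"
proof -
  let ?k = "whisk [] (evw A) [A] \<star> whisk [Dual A] K []"
  have "?k \<star> H = whisk [] (evw A) [A] \<star> (whisk [Dual A] K [] \<star> H)" by simp
  also have "whisk [Dual A] K [] \<star> H = whisk [] H [A, A] \<star> whisk [A] K []"
    using exch[of H K "[]" "[]" "[]", simplified] by simp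
  also have "whisk [] (evw A) [A] \<star> whisk [] H [A, A] \<star> whisk [A] K [] = whisk [] (evw A \<star> whisk [] H [A]) [A] \<star> whisk [A] K []"
    by simp
  also have "\<dots> = sid [A]" unfolding evw_H B_K ..
  finally have k: "?k \<star> H = sid [A]" .
  have "?k = ?k \<star> (H \<star> Hi)" unfolding H_Hi by simp
  also have "\<dots> = (?k \<star> H) \<star> Hi" by simp
  also have "\<dots> = Hi" unfolding k by simp
  finally show "Hi = ?k" by simp
  with k show "Hi \<star> H = sid [A]" by simp
qed

text \<open>The copairing is required to satisfy only one of the two zigzag identities; the other
  one is the equation \<open>Hi_H\<close> in disguise.\<close>

lemma K_B: "whisk [A] B [] \<star> whisk [] K [A] = sid [A]"
proof -
  have "whisk [A] B [] \<star> whisk [] K [A] = whisk [A] (etw A) [] \<star> (whisk [A, A] H [] \<star> whisk [] K [A])"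
    unfolding etw_H[symmetric] by simp
  also have "whisk [A, A] H [] \<star> whisk [] K [A] = whisk [] K [Dual A] \<star> H"
    using exch[of K H "[]" "[]" "[]", simplified] by simp
  also have "whisk [A] (etw A) [] \<star> whisk [] K [Dual A] \<star> H = Hi \<star> H" unfolding Hi_def by simp
  finally show ?thesis unfolding Hi_H .
qed
lemma K_B_w: "whisk (ps @ [A]) B qs \<star> whisk ps K ([A] @ qs) = sid (ps @ [A] @ qs)"
  using arg_cong[OF K_B, of "\<lambda>f. whisk ps f qs"] by simp

lemma cow_K: "cow A = whisk [A] H [] \<star> K"
proof -
  have "whisk [A] Hi [] \<star> cow A = whisk [A] (evw A) [A] \<star> (whisk [A, Dual A] K [] \<star> cow A)"
    unfolding Hi_alt by simp
  also have "whisk [A, Dual A] K [] \<star> cow A = whisk [] (cow A) [A, A] \<star> K"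
    using exch[of "cow A" K "[]" "[]" "[]", simplified] by simp
  also have "whisk [A] (evw A) [A] \<star> whisk [] (cow A) [A, A] \<star> K = (whisk [A] (evw A) [A] \<star> whisk [] (cow A) [A, A]) \<star> K" by simp
  also have "\<dots> = K" using zigzag1_w[of "[]" A "[A]"] by simp
  finally have "whisk [A] H [] \<star> K = whisk [A] (H \<star> Hi) [] \<star> cow A" by simp
  then show ?thesis unfolding H_Hi by simp
qed

text \<open>Self-duality replaces the loop through \<open>Dual A\<close> by one closed with the
  copairing and the trace form: the trace of F is the sum of b(F(e_i), f_i), where the copairing is
  the sum of e_i \<otimes> f_i.\<close>

lemma trace_K:
  assumes f: "valid F" "sdom F = [A]" "scod F = [A]"
  shows "etw A \<star> whisk [] F [Dual A] \<star> cow A = B \<star> whisk [] F [A] \<star> K"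
proof -
  have "etw A \<star> whisk [] F [Dual A] \<star> cow A = etw A \<star> (whisk [] F [Dual A] \<star> whisk [A] H []) \<star> K"
    unfolding cow_K by simp
  also have "whisk [] F [Dual A] \<star> whisk [A] H [] = whisk [A] H [] \<star> whisk [] F [A]"
    using exch[of F H "[]" "[]" "[]", simplified] f by simp
  also have "etw A \<star> (whisk [A] H [] \<star> whisk [] F [A]) \<star> K = (etw A \<star> whisk [A] H []) \<star> whisk [] F [A] \<star> K" by simp
  finally show ?thesis unfolding etw_H .
qed

text \<open>In elements, \<Sum> a e_i \<otimes> f_i = \<Sum> e_i \<otimes> f_i a. This is the
  invariance \<open>M_assoc_E\<close> of the form, transported to the copairing by inserting a
  zigzag on each side.\<close>

lemma \<Delta>_alt: "\<Delta> = whisk [A] M [] \<star> whisk [] K [A]"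
proof -
  have "\<Delta> = (whisk [A] B [A] \<star> whisk [] K [A, A]) \<star> whisk [] M [A] \<star> whisk [A] K []"
    using K_B_w[of "[]" "[A]"] unfolding \<Delta>_def by simp
  also have "\<dots> = whisk [A] B [A] \<star> (whisk [] K [A, A] \<star> whisk [] M [A]) \<star> whisk [A] K []" by simp
  also have "whisk [] K [A, A] \<star> whisk [] M [A] = whisk [A, A] M [A] \<star> whisk [] K [A, A, A]"
    using exch[of K M "[]" "[]" "[A]", simplified] by simp
  also have "whisk [A] B [A] \<star> (whisk [A, A] M [A] \<star> whisk [] K [A, A, A]) \<star> whisk [A] K []
    = whisk [A] (B \<star> whisk [A] M []) [A] \<star> (whisk [] K [A, A, A] \<star> whisk [A] K [])" by simp
  also have "whisk [] K [A, A, A] \<star> whisk [A] K [] = whisk [A, A, A] K [] \<star> whisk [] K [A]"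
    using exch[of K K "[]" "[A]" "[]", simplified] by simp
  also have "whisk [A] (B \<star> whisk [A] M []) [A] \<star> whisk [A, A, A] K [] \<star> whisk [] K [A]
    = whisk [A] B [A] \<star> (whisk [A] M [A, A] \<star> whisk [A, A, A] K []) \<star> whisk [] K [A]"
    unfolding M_assoc_E[symmetric] by simp
  also have "whisk [A] M [A, A] \<star> whisk [A, A, A] K [] = whisk [A, A] K [] \<star> whisk [A] M []"
    using exch[of M K "[A]" "[]" "[]", simplified] by simp
  also have "whisk [A] B [A] \<star> (whisk [A, A] K [] \<star> whisk [A] M []) \<star> whisk [] K [A]
    = (whisk [A] B [A] \<star> whisk [A, A] K []) \<star> whisk [A] M [] \<star> whisk [] K [A]" by simp
  also have "\<dots> = whisk [A] M [] \<star> whisk [] K [A]" using B_K_w[of "[A]" "[]"] by simp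
  finally show ?thesis .
qed

lemma E_\<Delta>: "whisk [] E [A] \<star> \<Delta> = sid [A]" "whisk [A] E [] \<star> \<Delta> = sid [A]"
proof -
  have "whisk [] E [A] \<star> \<Delta> = whisk [] B [A] \<star> whisk [A] K []" unfolding \<Delta>_def B_def by simp
  then show "whisk [] E [A] \<star> \<Delta> = sid [A]" using B_K by simp
  have "whisk [A] E [] \<star> \<Delta> = whisk [A] B [] \<star> whisk [] K [A]" unfolding \<Delta>_alt B_def by simp
  then show "whisk [A] E [] \<star> \<Delta> = sid [A]" using K_B by simp
qed

lemma \<Delta>_M_left: "\<Delta> \<star> M = whisk [] M [A] \<star> whisk [A] \<Delta> []"
proof -
  have "\<Delta> \<star> M = whisk [] M [A] \<star> (whisk [A] K [] \<star> M)" unfolding \<Delta>_def by simp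
  also have "whisk [A] K [] \<star> M = whisk [] M [A, A] \<star> whisk [A, A] K []"
    using exch[of M K "[]" "[]" "[]", simplified] by simp
  also have "whisk [] M [A] \<star> whisk [] M [A, A] \<star> whisk [A, A] K [] = whisk [] (M \<star> whisk [] M [A]) [A] \<star> whisk [A, A] K []" by simp
  also have "\<dots> = whisk [] M [A] \<star> whisk [A] \<Delta> []" unfolding M_assoc \<Delta>_def by simp
  finally show ?thesis .
qed

lemma \<Delta>_M_right: "\<Delta> \<star> M = whisk [A] M [] \<star> whisk [] \<Delta> [A]"
proof -
  have "\<Delta> \<star> M = whisk [A] M [] \<star> (whisk [] K [A] \<star> M)" unfolding \<Delta>_alt by simp
  also have "whisk [] K [A] \<star> M = whisk [A, A] M [] \<star> whisk [] K [A, A]"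
    using exch[of K M "[]" "[]" "[]", simplified] by simp
  also have "whisk [A] M [] \<star> whisk [A, A] M [] \<star> whisk [] K [A, A] = whisk [A] (M \<star> whisk [A] M []) [] \<star> whisk [] K [A, A]" by simp
  also have "\<dots> = whisk [A] M [] \<star> whisk [] \<Delta> [A]" unfolding M_assoc[symmetric] \<Delta>_alt by simp
  finally show ?thesis .
qed

lemma \<Delta>_K: "whisk [] \<Delta> [A] \<star> K = whisk [A] \<Delta> [] \<star> K"
proof -
  have "whisk [] \<Delta> [A] \<star> K = whisk [A] M [A] \<star> (whisk [] K [A, A] \<star> K)" unfolding \<Delta>_alt by simp
  also have "whisk [] K [A, A] \<star> K = whisk [A, A] K [] \<star> K"
    using exch[of K K "[]" "[]" "[]", simplified] by simp
  finally show ?thesis unfolding \<Delta>_def by simp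
qed

lemma \<Delta>_coassoc: "whisk [] \<Delta> [A] \<star> \<Delta> = whisk [A] \<Delta> [] \<star> \<Delta>"
proof -
  have "whisk [] \<Delta> [A] \<star> \<Delta> = whisk [] (\<Delta> \<star> M) [A] \<star> whisk [A] K []" unfolding \<Delta>_def by simp
  also have "\<dots> = whisk [] M [A, A] \<star> whisk [A] (whisk [] \<Delta> [A] \<star> K) []" unfolding \<Delta>_M_left by simp
  also have "\<dots> = (whisk [] M [A, A] \<star> whisk [A, A] \<Delta> []) \<star> whisk [A] K []" unfolding \<Delta>_K by simp
  also have "whisk [] M [A, A] \<star> whisk [A, A] \<Delta> [] = whisk [A] \<Delta> [] \<star> whisk [] M [A]"
    using exch[of M \<Delta> "[]" "[]" "[]", simplified] by simp
  also have "(whisk [A] \<Delta> [] \<star> whisk [] M [A]) \<star> whisk [A] K [] = whisk [A] \<Delta> [] \<star> \<Delta>" unfolding \<Delta>_def by simp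
  finally show ?thesis .
qed

lemma \<Delta>_U: "\<Delta> \<star> U = K"
proof -
  have "\<Delta> \<star> U = whisk [] M [A] \<star> (whisk [A] K [] \<star> U)" unfolding \<Delta>_def by simp
  also have "whisk [A] K [] \<star> U = whisk [] U [A, A] \<star> K"
    using exch[of U K "[]" "[]" "[]", simplified] by simp
  also have "whisk [] M [A] \<star> whisk [] U [A, A] \<star> K = (whisk [] M [A] \<star> whisk [] U [A, A]) \<star> K" by simp
  also have "\<dots> = K" using U_left_w[of "[]" "[A]"] by simp
  finally show ?thesis .
qed

text \<open>The canonical trace of the unit is the trace of multiplication by 1, a plain loop; this
  is how the dimension of \<open>A\<close> enters.\<close>

lemma E_U: "E \<star> U = etw A \<star> cow A"
proof -
  have "E \<star> U = etw A \<star> whisk [] M [Dual A] \<star> (whisk [A] (cow A) [] \<star> U)" unfolding E_def by simp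
  also have "whisk [A] (cow A) [] \<star> U = whisk [] U [A, Dual A] \<star> cow A"
    using exch[of U "cow A" "[]" "[]" "[]", simplified] by simp
  also have "etw A \<star> whisk [] M [Dual A] \<star> whisk [] U [A, Dual A] \<star> cow A
    = etw A \<star> (whisk [] M [Dual A] \<star> whisk [] U [A, Dual A]) \<star> cow A" by simp
  also have "\<dots> = etw A \<star> cow A" using U_left_w[of "[]" "[Dual A]"] by simp
  finally show ?thesis .
qed

end

section \<open>Reduced commutative algebras\<close>

context vector_space
begin

lemma span_family:
  fixes f :: "nat \<Rightarrow> 'b"
  shows "x \<in> span (f ` {..<k}) \<Longrightarrow> \<exists>c. x = (\<Sum>i<k. scale (c i) (f i))"
proof (induction k arbitrary: x)
  case (Suc k)
  have "f ` {..<Suc k} = insert (f k) (f ` {..<k})" by (auto simp: lessThan_Suc)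
  then have "x \<in> span (insert (f k) (f ` {..<k}))" using Suc.prems by simp
  then obtain a where "x - scale a (f k) \<in> span (f ` {..<k})"
    unfolding span_insert by blast
  then obtain c where "x - scale a (f k) = (\<Sum>i<k. scale (c i) (f i))" using Suc.IH by blast
  then have "x = (\<Sum>i<Suc k. scale ((c(k := a)) i) (f i))" by (simp add: algebra_simps)
  then show ?case by blast
qed simp

text \<open>The dependence is given with the last vector expressed by its predecessors, so that for
  the iterates of a linear map it reads as a monic polynomial relation.\<close>

lemma family_dependent:
  fixes f :: "nat \<Rightarrow> 'b"
  assumes T: "finite T" and f: "\<And>i. f i \<in> span T"
  shows "\<exists>k. f k \<in> span (f ` {..<k})"
proof (rule ccontr)
  assume "\<not> ?thesis"
  then have n: "f k \<notin> span (f ` {..<k})" for k by blast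
  have "independent (f ` {..<k}) \<and> card (f ` {..<k}) = k" for k
  proof (induction k)
    case (Suc k)
    have "f ` {..<Suc k} = insert (f k) (f ` {..<k})" by (auto simp: lessThan_Suc)
    moreover have "f k \<notin> f ` {..<k}" using n[of k] span_base[of "f k" "f ` {..<k}"] by argo
    ultimately show ?case using Suc n[of k] independent_insert by simp
  qed (simp add: independent_empty)
  from this[of "Suc (card T)"] have i: "independent (f ` {..<Suc (card T)})" "card (f ` {..<Suc (card T)}) = Suc (card T)"
    by blast+
  have "f ` {..<Suc (card T)} \<subseteq> span T" using f by blast
  then have "card (f ` {..<Suc (card T)}) \<le> card T" using independent_span_bound[OF T i(1)] by blast
  then show False using i(2) by linarith
qed

text \<open>Linear maps are only required to be linear on the subspace \<open>V\<close>.\<close>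
lemma linear_on_sum:
  assumes V: "subspace V" and add: "\<And>x y. x \<in> V \<Longrightarrow> y \<in> V \<Longrightarrow> L (x + y) = L x + L y"
    and sc: "\<And>c x. x \<in> V \<Longrightarrow> L (scale c x) = scale c (L x)"
    and "finite S" "\<And>i. i \<in> S \<Longrightarrow> g i \<in> V"
  shows "L (\<Sum>i\<in>S. scale (c i) (g i)) = (\<Sum>i\<in>S. scale (c i) (L (g i)))"
  using assms(4,5)
proof (induction S)
  case empty
  show ?case using sc[OF subspace_0[OF V], of 0] by simp
next
  case (insert i S)
  have "L (scale (c i) (g i) + (\<Sum>j\<in>S. scale (c j) (g j))) = L (scale (c i) (g i)) + L (\<Sum>j\<in>S. scale (c j) (g j))"
    by (rule add) (use insert.prems in \<open>auto intro!: subspace_scale[OF V] subspace_sum[OF V]\<close>)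
  then show ?case using insert sc by simp
qed

lemma subspace_linear_on_image:
  assumes V: "subspace V" and add: "\<And>x y. x \<in> V \<Longrightarrow> y \<in> V \<Longrightarrow> L (x + y) = L x + L y"
    and sc: "\<And>c x. x \<in> V \<Longrightarrow> L (scale c x) = scale c (L x)"
  shows "subspace (L ` V)"
  unfolding subspace_def
proof (intro conjI ballI allI)
  have "L 0 = 0" using sc[OF subspace_0[OF V], of 0] by simp
  then show "0 \<in> L ` V" using imageI[OF subspace_0[OF V], of L] by simp
next
  fix x z assume "x \<in> L ` V" "z \<in> L ` V"
  then obtain a b where "a \<in> V" "b \<in> V" "x = L a" "z = L b" by blast
  then show "x + z \<in> L ` V" using add[of a b] imageI[OF subspace_add[OF V, of a b], of L] by simp
next
  fix x c assume "x \<in> L ` V"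
  then obtain a where "a \<in> V" "x = L a" by blast
  then show "scale c x \<in> L ` V" using sc[of a c] imageI[OF subspace_scale[OF V, of a c], of L] by simp
qed

end

text \<open>Take a nonzero polynomial \<open>q\<close> of least degree annihilating
  \<open>v\<close>. It is not constant, so it has a root \<open>a\<close>; the cofactor of the
  corresponding linear factor sends \<open>v\<close> to a nonzero vector, which is an eigenvector
  for \<open>a\<close>.\<close>

lemma (in vector_space) eigenvector_exists:
  fixes L :: "'b \<Rightarrow> 'b"
  assumes ac: "\<And>p :: 'a poly. degree p > 0 \<Longrightarrow> \<exists>c. poly p c = 0"
    and V: "subspace V" and T: "finite T" "V \<subseteq> span T"
    and LV: "\<And>x. x \<in> V \<Longrightarrow> L x \<in> V"
    and add: "\<And>x y. x \<in> V \<Longrightarrow> y \<in> V \<Longrightarrow> L (x + y) = L x + L y"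
    and sc: "\<And>c x. x \<in> V \<Longrightarrow> L (scale c x) = scale c (L x)"
    and v: "v \<in> V" "v \<noteq> 0"
  shows "\<exists>c. \<exists>w\<in>V. w \<noteq> 0 \<and> L w = scale c w"
proof -
  have P: "(L ^^ i) v \<in> V" for i by (induction i) (use v LV in auto)
  define act where "act p = (\<Sum>i\<le>degree p. scale (coeff p i) ((L ^^ i) v))" for p
  have act_le: "act p = (\<Sum>i\<le>N. scale (coeff p i) ((L ^^ i) v))" if "degree p \<le> N" for p N
    unfolding act_def using that by (intro sum.mono_neutral_left) (auto simp: coeff_eq_0)
  have actV: "act p \<in> V" for p unfolding act_def
    by (intro subspace_sum[OF V] subspace_scale[OF V] P)
  have mul: "act ([:- c, 1:] * q) = L (act q) - scale c (act q)" for c q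
  proof -
    let ?N = "degree q"
    have d: "degree ([:- c, 1:] * q) \<le> Suc ?N"
      using degree_mult_le[of "[:- c, 1:]" q] by simp
    have co: "coeff ([:- c, 1:] * q) i = coeff (pCons 0 q) i - c * coeff q i" for i
      by (simp add: algebra_simps)
    have "L (act q) = (\<Sum>i\<le>?N. scale (coeff q i) (L ((L ^^ i) v)))"
      unfolding act_def by (rule linear_on_sum[OF V add sc]) (auto simp: P)
    then have 1: "(\<Sum>i\<le>Suc ?N. scale (coeff (pCons 0 q) i) ((L ^^ i) v)) = L (act q)"
      by (subst sum.atMost_Suc_shift) simp
    have "(\<Sum>i\<le>Suc ?N. scale (c * coeff q i) ((L ^^ i) v)) = scale c (\<Sum>i\<le>Suc ?N. scale (coeff q i) ((L ^^ i) v))"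
      by (simp add: scale_sum_right scale_right_distrib)
    then have 2: "(\<Sum>i\<le>Suc ?N. scale (c * coeff q i) ((L ^^ i) v)) = scale c (act q)"
      using act_le[of q "Suc ?N"] by simp
    show ?thesis unfolding act_le[OF d] co scale_left_diff_distrib sum_subtractf 1 2 ..
  qed
  obtain k where "(L ^^ k) v \<in> span ((\<lambda>i. (L ^^ i) v) ` {..<k})"
    using family_dependent[OF T(1), of "\<lambda>i. (L ^^ i) v"] P T(2) by blast
  then obtain c where c: "(L ^^ k) v = (\<Sum>i<k. scale (c i) ((L ^^ i) v))" using span_family by blast
  \<comment> \<open>Monic of degree \<open>k\<close>, hence nonzero, and annihilating
    \<open>v\<close> by the dependence relation.\<close>
  define p where "p = monom 1 k - (\<Sum>i<k. monom (c i) i)"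
  have cp: "coeff p i = (if i = k then 1 else if i < k then - c i else 0)" for i
    unfolding p_def by (auto simp: coeff_sum)
  have "p \<noteq> 0" using cp[of k] by auto
  moreover have "act p = 0"
  proof -
    have "degree p \<le> k" by (rule degree_le) (simp add: cp)
    then have "act p = (\<Sum>i\<le>k. scale (coeff p i) ((L ^^ i) v))" by (rule act_le)
    also have "\<dots> = (\<Sum>i<k. scale (coeff p i) ((L ^^ i) v)) + (L ^^ k) v"
      by (simp add: lessThan_Suc_atMost[symmetric] cp)
    also have "(\<Sum>i<k. scale (coeff p i) ((L ^^ i) v)) = (\<Sum>i<k. - scale (c i) ((L ^^ i) v))"
      by (intro sum.cong) (auto simp: cp)
    finally show ?thesis using c by (simp add: sum_negf)
  qed
  ultimately have ex: "\<exists>p. p \<noteq> 0 \<and> act p = 0" by blast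
  define q where "q = arg_min degree (\<lambda>p. p \<noteq> 0 \<and> act p = 0)"
  have q: "q \<noteq> 0" "act q = 0" and qm: "\<And>r. r \<noteq> 0 \<Longrightarrow> act r = 0 \<Longrightarrow> degree q \<le> degree r"
    unfolding q_def using arg_min_nat_lemma[of "\<lambda>p. p \<noteq> 0 \<and> act p = 0" _ degree] ex by blast+
  have "degree q > 0"
  proof (rule ccontr)
    assume "\<not> degree q > 0"
    then obtain a where "q = [:a:]" using degree_eq_zeroE by blast
    then show False using q v unfolding act_def by simp
  qed
  then obtain a where "poly q a = 0" using ac by blast
  then obtain r where r: "q = [:- a, 1:] * r" using poly_eq_0_iff_dvd by (metis dvdE)
  then have r0: "r \<noteq> 0" using q by auto
  have "degree q = Suc (degree r)" unfolding r using r0 by (subst degree_mult_eq) auto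
  then have "act r \<noteq> 0" using qm[OF r0] by auto
  moreover have "L (act r) = scale a (act r)" using mul[of a r] q(2) r by simp
  ultimately show ?thesis using actV by blast
qed

text \<open>The image of a basis is independent and as large as the basis; a vector outside its span
  would give an independent set that is too large.\<close>

lemma (in vector_space) linear_on_surj:
  fixes L :: "'b \<Rightarrow> 'b"
  assumes V: "subspace V" and T: "finite T" "V \<subseteq> span T"
    and LV: "\<And>x. x \<in> V \<Longrightarrow> L x \<in> V"
    and add: "\<And>x y. x \<in> V \<Longrightarrow> y \<in> V \<Longrightarrow> L (x + y) = L x + L y"
    and sc: "\<And>c x. x \<in> V \<Longrightarrow> L (scale c x) = scale c (L x)"
    and inj: "\<And>x. x \<in> V \<Longrightarrow> L x = 0 \<Longrightarrow> x = 0"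
    and y: "y \<in> V"
  shows "\<exists>x\<in>V. L x = y"
proof -
  obtain Bs where B: "Bs \<subseteq> V" "independent Bs" "V \<subseteq> span Bs" using maximal_independent_subset by blast
  have fB: "finite Bs" using independent_span_bound[OF T(1) B(2)] B(1) T(2) by blast
  have neg: "L (x - x') = L x - L x'" if "x \<in> V" "x' \<in> V" for x x'
    using add[OF subspace_diff[OF V that] that(2)] by simp
  have injB: "inj_on L Bs"
  proof (rule inj_onI)
    fix a b assume ab: "a \<in> Bs" "b \<in> Bs" "L a = L b"
    then have "a \<in> V" "b \<in> V" using B by auto
    then show "a = b" using neg[of a b] inj[OF subspace_diff[OF V]] ab by auto
  qed
  have ind: "independent (L ` Bs)"
  proof
    assume "dependent (L ` Bs)"
    then obtain u where u: "\<exists>v\<in>L ` Bs. u v \<noteq> 0" "(\<Sum>v\<in>L ` Bs. scale (u v) v) = 0"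
      using dependent_finite[of "L ` Bs"] fB by auto
    have "L (\<Sum>b\<in>Bs. scale (u (L b)) b) = (\<Sum>b\<in>Bs. scale (u (L b)) (L b))"
      by (rule linear_on_sum[OF V add sc fB]) (use B in auto)
    also have "\<dots> = 0" using u(2) by (simp add: sum.reindex[OF injB])
    finally have L0: "L (\<Sum>b\<in>Bs. scale (u (L b)) b) = 0" .
    have "(\<Sum>b\<in>Bs. scale (u (L b)) b) = 0"
      by (rule inj[OF _ L0]) (use B in \<open>auto intro!: subspace_sum[OF V] subspace_scale[OF V]\<close>)
    moreover have "\<exists>b\<in>Bs. u (L b) \<noteq> 0" using u(1) by auto
    ultimately have "dependent Bs" unfolding dependent_finite[OF fB] by (intro exI[of _ "\<lambda>b. u (L b)"] conjI)
    then show False using B(2) by simp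
  qed
  have "y \<in> span (L ` Bs)"
  proof (rule ccontr)
    assume n: "y \<notin> span (L ` Bs)"
    then have "independent (insert y (L ` Bs))" using ind independent_insert by simp
    moreover have "insert y (L ` Bs) \<subseteq> span Bs" using y B LV by auto
    ultimately have "card (insert y (L ` Bs)) \<le> card Bs" using independent_span_bound[OF fB] by blast
    moreover have "y \<notin> L ` Bs" using n span_base[of y "L ` Bs"] by argo
    ultimately show False using fB card_image[OF injB] by simp
  qed
  moreover have "subspace (L ` V)" by (rule subspace_linear_on_image[OF V add sc])
  moreover have "L ` Bs \<subseteq> L ` V" using B by auto
  ultimately have "y \<in> L ` V" using span_minimal[of "L ` Bs" "L ` V"] by auto
  then show ?thesis by auto
qed

text \<open>The algebra sits on a subspace \<open>V\<close> because hom-spaces are subspaces of one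
  big space of morphisms; \<open>T\<close> only bounds the dimension.\<close>

locale reduced_algebra = vector_space scale
  for scale :: "'k::alg_closed_field \<Rightarrow> 'v::ab_group_add \<Rightarrow> 'v" (infixr "*s" 75) +
  fixes V :: "'v set" and T :: "'v set" and mul :: "'v \<Rightarrow> 'v \<Rightarrow> 'v" (infixl "\<odot>" 70) and e :: 'v
  assumes V: "subspace V" and T: "finite T" "V \<subseteq> span T"
    and mulV: "x \<in> V \<Longrightarrow> y \<in> V \<Longrightarrow> x \<odot> y \<in> V" and eV: "e \<in> V" and e0: "e \<noteq> 0"
    and mul_add: "x \<in> V \<Longrightarrow> y \<in> V \<Longrightarrow> z \<in> V \<Longrightarrow> x \<odot> (y + z) = x \<odot> y + x \<odot> z"
    and mul_sc: "x \<in> V \<Longrightarrow> y \<in> V \<Longrightarrow> x \<odot> (c *s y) = c *s (x \<odot> y)"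
    and comm: "x \<in> V \<Longrightarrow> y \<in> V \<Longrightarrow> x \<odot> y = y \<odot> x"
    and assoc: "x \<in> V \<Longrightarrow> y \<in> V \<Longrightarrow> z \<in> V \<Longrightarrow> (x \<odot> y) \<odot> z = x \<odot> (y \<odot> z)"
    and unit: "x \<in> V \<Longrightarrow> e \<odot> x = x"
    and reduced: "x \<in> V \<Longrightarrow> x \<odot> x = 0 \<Longrightarrow> x = 0"
begin

definition "idem = {p \<in> V. p \<odot> p = p}"
definition "minidem = {p \<in> idem. p \<noteq> 0 \<and> (\<forall>q\<in>idem. p \<odot> q = q \<longrightarrow> q = 0 \<or> q = p)}"

lemma mul_zero: "x \<in> V \<Longrightarrow> x \<odot> 0 = 0"
  using mul_sc[of x 0 0] subspace_0[OF V] by simp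
lemma mul_zero_left: "x \<in> V \<Longrightarrow> 0 \<odot> x = 0"
  using mul_zero[of x] comm[OF subspace_0[OF V]] by simp
lemma mul_diff: "x \<in> V \<Longrightarrow> y \<in> V \<Longrightarrow> z \<in> V \<Longrightarrow> x \<odot> (y - z) = x \<odot> y - x \<odot> z"
  using mul_add[of x "y - z" z] subspace_diff[OF V, of y z] by (simp add: algebra_simps)
lemma mul_sum: "x \<in> V \<Longrightarrow> finite S \<Longrightarrow> (\<And>i. i \<in> S \<Longrightarrow> g i \<in> V) \<Longrightarrow> x \<odot> (\<Sum>i\<in>S. c i *s g i) = (\<Sum>i\<in>S. c i *s (x \<odot> g i))"
  using linear_on_sum[OF V mul_add[of x] mul_sc[of x]] by blast
lemma left_comm: "x \<in> V \<Longrightarrow> y \<in> V \<Longrightarrow> z \<in> V \<Longrightarrow> x \<odot> (y \<odot> z) = y \<odot> (x \<odot> z)"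
  using assoc[of x y z] assoc[of y x z] comm[of x y] by simp

text \<open>Von Neumann regularity. On the subspace \<open>z \<odot> V\<close> multiplication by
  \<open>z\<close> is injective, as the algebra is reduced and commutative; by finite dimension it
  is surjective there, and \<open>z\<close> lies in that subspace.\<close>

lemma regular: assumes z: "z \<in> V" shows "\<exists>w\<in>V. z \<odot> (z \<odot> w) = z"
proof -
  let ?W = "(\<odot>) z ` V"
  have W: "subspace ?W" by (rule subspace_linear_on_image[OF V mul_add[OF z] mul_sc[OF z]])
  have WV: "?W \<subseteq> V" using mulV z by auto
  have inj: "x = 0" if x: "x \<in> ?W" "z \<odot> x = 0" for x
  proof -
    obtain y where y: "y \<in> V" "x = z \<odot> y" using x(1) by blast
    have xV: "x \<in> V" using x WV by auto
    have "x \<odot> x = y \<odot> (z \<odot> x)" using y assoc[OF z y(1) xV] left_comm[OF z y(1) xV] by simp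
    then show ?thesis using x mul_zero[OF y(1)] reduced[OF xV] by simp
  qed
  have zW: "z \<in> ?W" using unit[OF z] comm[OF eV z] imageI[OF eV, of "(\<odot>) z"] by simp
  have "\<exists>x\<in>?W. z \<odot> x = z"
    by (rule linear_on_surj[OF W T(1)]) (use WV T(2) mulV z mul_add mul_sc inj zW in auto)
  then show ?thesis by auto
qed

lemma idemV: "p \<in> idem \<Longrightarrow> p \<in> V" unfolding idem_def by simp
lemma minV: "p \<in> minidem \<Longrightarrow> p \<in> V" unfolding minidem_def idem_def by simp

text \<open>Multiplication by \<open>x\<close> has an eigenvector \<open>w\<close> below
  \<open>p\<close>, with eigenvalue \<open>c\<close>, and \<open>w\<close> kills
  \<open>z = p \<odot> x - c *s p\<close>. By regularity \<open>z\<close> generates an idempotent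
  \<open>q\<close> below \<open>p\<close>, which is 0 or \<open>p\<close>. It cannot be
  \<open>p\<close>, since then \<open>w\<close> would be killed by a multiple of itself; so
  \<open>q\<close> and with it \<open>z\<close> vanish.\<close>

lemma minidem_scalar: assumes p: "p \<in> minidem" and x: "x \<in> V" shows "\<exists>c. p \<odot> x = c *s p"
proof -
  have pV: "p \<in> V" and pp: "p \<odot> p = p" and p0: "p \<noteq> 0" using p unfolding minidem_def idem_def by auto
  let ?W = "{y \<in> V. p \<odot> y = y}"
  have W: "subspace ?W" unfolding subspace_def
    using subspace_0[OF V] subspace_add[OF V] subspace_scale[OF V] mul_zero[OF pV] mul_add[OF pV] mul_sc[OF pV] by auto
  have "\<exists>c. \<exists>w\<in>?W. w \<noteq> 0 \<and> x \<odot> w = c *s w"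
  proof (rule eigenvector_exists[OF _ W T(1)])
    show "\<exists>c. poly q c = 0" if "degree q > 0" for q :: "'k poly" using that alg_closed_imp_poly_has_root by blast
  qed (use T(2) mulV[OF x] mul_add[OF x] mul_sc[OF x] left_comm[OF pV x] pV pp p0 in auto)
  then obtain c w where w: "w \<in> V" "p \<odot> w = w" "w \<noteq> 0" "x \<odot> w = c *s w" by auto
  define z where "z = p \<odot> x - c *s p"
  have zV: "z \<in> V" unfolding z_def by (intro subspace_diff[OF V] mulV pV x subspace_scale[OF V])
  have pz: "p \<odot> z = z" unfolding z_def
    using mul_diff[OF pV mulV[OF pV x] subspace_scale[OF V pV]] mul_sc[OF pV pV] assoc[OF pV pV x] pp by simp
  have "w \<odot> z = w \<odot> (p \<odot> x) - c *s (w \<odot> p)" unfolding z_def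
    using mul_diff[OF w(1) mulV[OF pV x] subspace_scale[OF V pV]] mul_sc[OF w(1) pV] by simp
  also have "\<dots> = 0" using w comm[OF w(1) pV] left_comm[OF w(1) pV x] comm[OF w(1) x] mul_sc[OF pV w(1)] by simp
  finally have wz: "w \<odot> z = 0" .
  obtain t where t: "t \<in> V" "z \<odot> (z \<odot> t) = z" using regular[OF zV] by blast
  define q where "q = z \<odot> t"
  have qV: "q \<in> V" unfolding q_def by (rule mulV[OF zV t(1)])
  have zq: "z \<odot> q = z" using t unfolding q_def by simp
  have "q \<odot> q = q" unfolding q_def using assoc[OF zV t(1) mulV[OF zV t(1)]] left_comm[OF zV t(1) mulV[OF zV t(1)]] t(2) comm[OF zV t(1)] by simp
  moreover have "p \<odot> q = q" unfolding q_def using assoc[OF pV zV t(1)] pz by simp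
  ultimately have "q = 0 \<or> q = p" using p qV unfolding minidem_def idem_def by auto
  moreover have "q \<noteq> p"
  proof
    assume "q = p"
    then have "w = w \<odot> (z \<odot> t)" using w(2) comm[OF w(1) pV] unfolding q_def by simp
    also have "\<dots> = 0" using assoc[OF w(1) zV t(1)] wz mul_zero_left[OF t(1)] by simp
    finally show False using w(3) by simp
  qed
  ultimately have "z = 0" using zq mul_zero[OF zV] by simp
  then show ?thesis unfolding z_def by auto
qed

definition "orth S \<longleftrightarrow> finite S \<and> S \<subseteq> idem - {0} \<and> (\<forall>p\<in>S. \<forall>q\<in>S. p \<noteq> q \<longrightarrow> p \<odot> q = 0) \<and> \<Sum>S = e"

lemma orth_mul_sum:
  assumes S: "finite S" "S \<subseteq> idem" "\<forall>p\<in>S. \<forall>q\<in>S. p \<noteq> q \<longrightarrow> p \<odot> q = 0" and p: "p \<in> S"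
  shows "p \<odot> (\<Sum>q\<in>S. c q *s q) = c p *s p"
proof -
  have pV: "p \<in> V" and pp: "p \<odot> p = p" using p S(2) unfolding idem_def by auto
  have "p \<odot> (\<Sum>q\<in>S. c q *s q) = (\<Sum>q\<in>S. c q *s (p \<odot> q))"
    by (rule mul_sum[OF pV S(1)]) (use S(2) idemV in auto)
  also have "\<dots> = (\<Sum>q\<in>S. if q = p then c p *s p else 0)"
    by (rule sum.cong) (use S p pp in auto)
  also have "\<dots> = c p *s p" using S(1) p by simp
  finally show ?thesis .
qed

lemma orth_independent: "orth S \<Longrightarrow> independent S"
proof
  assume S: "orth S" and "dependent S"
  then obtain u v where u: "v \<in> S" "u v \<noteq> 0" "(\<Sum>v\<in>S. u v *s v) = 0"
    using dependent_finite[of S] unfolding orth_def by auto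
  have "u v *s v = v \<odot> (\<Sum>v\<in>S. u v *s v)"
    by (rule orth_mul_sum[of S v u, symmetric]) (use S u(1) in \<open>auto simp: orth_def\<close>)
  also have "\<dots> = 0" using u(1,3) mul_zero idemV S unfolding orth_def by auto
  finally show False using u S unfolding orth_def by auto
qed

text \<open>An orthogonal decomposition of the unit of maximal length consists of minimal idempotents.\<close>
lemma orth_minidem: "orth minidem"
proof -
  have bound: "card S \<le> card T" if "orth S" for S
    using independent_span_bound[OF T(1) orth_independent[OF that]] that T(2) idemV unfolding orth_def by blast
  have e: "orth {e}" unfolding orth_def idem_def using eV e0 unit[OF eV] by auto
  define S where "S = arg_max card orth"
  have S: "orth S" and max: "\<And>S'. orth S' \<Longrightarrow> card S' \<le> card S"
    \<comment> \<open>The bound required for the maximum is strict, hence the successor of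
      \<open>card T\<close>.\<close>
    unfolding S_def using arg_max_nat_lemma[of orth "{e}" card "Suc (card T)"] e bound by (auto simp: less_Suc_eq_le)
  have fS: "finite S" and SI: "S \<subseteq> idem" "0 \<notin> S" and oS: "\<And>p q. p \<in> S \<Longrightarrow> q \<in> S \<Longrightarrow> p \<noteq> q \<Longrightarrow> p \<odot> q = 0" and sS: "\<Sum>S = e"
    using S unfolding orth_def by auto
  have "S \<subseteq> minidem"
  proof
    fix p assume p: "p \<in> S"
    have pV: "p \<in> V" and pp: "p \<odot> p = p" using p SI unfolding idem_def by auto
    { fix q assume q: "q \<in> idem" "p \<odot> q = q" "q \<noteq> 0" "q \<noteq> p"
      have qV: "q \<in> V" and qq: "q \<odot> q = q" using q unfolding idem_def by auto
      let ?r = "p - q"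
      have rV: "?r \<in> V" by (rule subspace_diff[OF V pV qV])
      have qp: "q \<odot> p = q" using q(2) comm[OF qV pV] by simp
      have qr: "q \<odot> ?r = 0" using mul_diff[OF qV pV qV] qp qq by simp
      have pr: "p \<odot> ?r = ?r" using mul_diff[OF pV pV qV] q(2) pp by simp
      have rr: "?r \<odot> ?r = ?r" using mul_diff[OF rV pV qV] comm[OF rV pV] comm[OF rV qV] pr qr by simp
      have r0: "?r \<noteq> 0" using q by auto
      have rI: "?r \<in> idem" using rV rr unfolding idem_def by simp
      \<comment> \<open>Whatever lies below \<open>p\<close> inherits orthogonality to the other
        members. Replacing \<open>p\<close> by \<open>q\<close> and \<open>p - q\<close> therefore
        gives a decomposition that is longer by one.\<close>
      have orq: "x \<odot> s = 0" if x: "x \<in> V" "p \<odot> x = x" and s: "s \<in> S - {p}" for x s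
      proof -
        have sV: "s \<in> V" using s SI idemV by auto
        have "x \<odot> s = x \<odot> (p \<odot> s)" using assoc[OF pV x(1) sV] left_comm[OF x(1) pV sV] x(2) by simp
        then show ?thesis using oS[of p s] p s mul_zero[OF x(1)] by auto
      qed
      have orq': "s \<odot> x = 0" if x: "x \<in> V" "p \<odot> x = x" and s: "s \<in> S - {p}" for x s
        using orq[OF that] comm[OF x(1), of s] s SI idemV by auto
      have nS: "q \<notin> S - {p}" "?r \<notin> S - {p}"
        using orq[OF qV q(2), of q] orq[OF rV pr, of ?r] qq rr q r0 by auto
      have qnr: "q \<noteq> ?r" using qr qq q(3) by auto
      let ?S = "insert q (insert ?r (S - {p}))"
      have "orth ?S" unfolding orth_def
      proof (intro conjI ballI impI)
        show "finite ?S" using fS by simp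
        show "?S \<subseteq> idem - {0}" using q rI r0 SI by auto
        show "\<Sum>?S = e" using nS qnr fS sS sum.remove[OF fS p, of "\<lambda>x. x"] by simp
        fix x y assume "x \<in> ?S" "y \<in> ?S" "x \<noteq> y"
        then show "x \<odot> y = 0"
          using qr comm[OF rV qV] orq[OF qV q(2)] orq[OF rV pr] orq'[OF qV q(2)] orq'[OF rV pr] oS by auto
      qed
      moreover have "card ?S = Suc (card S)"
        using nS qnr fS card_Suc_Diff1[OF fS p] by simp
      ultimately have False using max[of ?S] by simp }
    then show "p \<in> minidem" unfolding minidem_def using p SI by auto
  qed
  \<comment> \<open>As \<open>S\<close> sums to the unit, some \<open>p \<odot> s\<close> is
    nonzero; it is an idempotent below both \<open>p\<close> and \<open>s\<close>, so by minimality
    equal to both.\<close>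
  moreover have "minidem \<subseteq> S"
  proof
    fix p assume p: "p \<in> minidem"
    have pV: "p \<in> V" and pp: "p \<odot> p = p" and p0: "p \<noteq> 0" using p unfolding minidem_def idem_def by auto
    have "p = p \<odot> (\<Sum>s\<in>S. 1 *s s)" using sS comm[OF pV eV] unit[OF pV] by simp
    also have "\<dots> = (\<Sum>s\<in>S. 1 *s (p \<odot> s))"
      by (rule mul_sum[OF pV fS]) (use SI idemV in auto)
    finally have "(\<Sum>s\<in>S. p \<odot> s) \<noteq> 0" using p0 by simp
    then obtain s where s: "s \<in> S" "p \<odot> s \<noteq> 0" using sum.neutral by metis
    have sV: "s \<in> V" and ss: "s \<odot> s = s" using s SI unfolding idem_def by auto
    have sm: "s \<in> minidem" using s \<open>S \<subseteq> minidem\<close> by auto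
    have ps: "p \<odot> s \<in> V" by (rule mulV[OF pV sV])
    have 1: "p \<odot> (p \<odot> s) = p \<odot> s" using assoc[OF pV pV sV] pp by simp
    have 2: "s \<odot> (p \<odot> s) = p \<odot> s" using left_comm[OF sV pV sV] ss by simp
    have "(p \<odot> s) \<odot> (p \<odot> s) = p \<odot> s" using assoc[OF pV sV ps] 2 1 by simp
    then have "p \<odot> s \<in> idem" using ps unfolding idem_def by simp
    then have "p \<odot> s = p" "p \<odot> s = s" using p sm 1 2 s(2) unfolding minidem_def by auto
    then show "p \<in> S" using s by simp
  qed
  ultimately show ?thesis using S by simp
qed

lemma minidem_sum: "\<Sum>minidem = e" and minidem_finite: "finite minidem"
  using orth_minidem unfolding orth_def by auto

lemma minidem_span: assumes x: "x \<in> V" shows "x \<in> span minidem"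
proof -
  have "x = x \<odot> (\<Sum>p\<in>minidem. 1 *s p)" using minidem_sum comm[OF x eV] unit[OF x] by simp
  also have "\<dots> = (\<Sum>p\<in>minidem. 1 *s (x \<odot> p))"
    by (rule mul_sum[OF x minidem_finite]) (use minV in auto)
  finally have 1: "x = (\<Sum>p\<in>minidem. x \<odot> p)" by simp
  have "x \<odot> p \<in> span minidem" if p: "p \<in> minidem" for p
    using minidem_scalar[OF p x] comm[OF x minV[OF p]] span_base[OF p] span_scale by auto
  then have "(\<Sum>p\<in>minidem. x \<odot> p) \<in> span minidem" by (rule span_sum)
  then show ?thesis using 1 by simp
qed

lemma dim_minidem: "dim V = card minidem"
  by (rule dim_unique[OF _ _ orth_independent[OF orth_minidem]])
    (use minV minidem_span in auto)

end

section \<open>Semisimplicity and traces\<close>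

context tensor_category
begin

lemma iso_arrI: "inverse_pair X Y f g \<Longrightarrow> iso_arr X Y f"
  unfolding iso_arr_def by blast

lemma zero_cancel_iso: assumes f: "iso_arr X Y f" and g: "g \<in> Hom Y Z" and 0: "g \<cdot> f = 0" shows "g = 0"
proof -
  have "g = g \<cdot> (f \<cdot> inv_arr X Y f)" using comp_inv_arr[OF f] comp_Id_right[OF g] by simp
  also have "\<dots> = (g \<cdot> f) \<cdot> inv_arr X Y f" using comp_assoc[OF inv_arr_Hom[OF f] iso_arr_Hom[OF f] g] by simp
  finally show ?thesis using 0 comp_zero_left[OF inv_arr_Hom[OF f]] by simp
qed

lemma schur:
  assumes S: "simple_ob S" and T: "simple_ob T" and f: "f \<in> Hom S T" and f0: "f \<noteq> 0"
  shows "iso_arr S T f"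
proof -
  obtain N i where k: "kernel_of S T f N i" using kernels[OF f] by blast
  have i: "i \<in> Hom N S" "f \<cdot> i = 0" and uni: "\<And>W g. g \<in> Hom W S \<Longrightarrow> f \<cdot> g = 0 \<Longrightarrow> \<exists>!h. h \<in> Hom W N \<and> i \<cdot> h = g"
    using k unfolding kernel_of_def by auto
  have "mono_arr N S i"
    unfolding mono_arr_def
  proof (intro conjI allI ballI impI)
    fix W g assume g: "g \<in> Hom W N" "i \<cdot> g = 0"
    have "\<exists>!h. h \<in> Hom W N \<and> i \<cdot> h = 0" by (rule uni) (use zero_Hom comp_zero_right[OF f] in auto)
    then show "g = 0" using g zero_Hom comp_zero_right[OF i(1)] by (metis (lifting))
  qed (rule i)
  then have "i = 0 \<or> iso_arr N S i" using S unfolding simple_ob_def by blast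
  moreover have "\<not> iso_arr N S i" using zero_cancel_iso[OF _ f i(2)] f0 by blast
  ultimately have i0: "i = 0" by blast
  have "mono_arr S T f"
    unfolding mono_arr_def
  proof (intro conjI allI ballI impI)
    fix W g assume g: "g \<in> Hom W S" "f \<cdot> g = 0"
    then obtain h where "h \<in> Hom W N" "i \<cdot> h = g" using uni by blast
    then show "g = 0" using i0 comp_zero_left by metis
  qed (rule f)
  then show ?thesis using T f0 unfolding simple_ob_def by blast
qed

definition decomposition :: "'b \<Rightarrow> 'b list \<Rightarrow> (nat \<Rightarrow> 'c) \<Rightarrow> (nat \<Rightarrow> 'c) \<Rightarrow> bool" where
  "decomposition X Xs i p \<longleftrightarrow> (\<forall>a<length Xs. simple_ob (Xs ! a) \<and> i a \<in> Hom (Xs ! a) X \<and> p a \<in> Hom X (Xs ! a)) \<and>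
     (\<Sum>a<length Xs. i a \<cdot> p a) = Id X"

lemma comp_sum_right: assumes g: "g \<in> Hom Y Z" and f: "\<And>a. a \<in> S \<Longrightarrow> f a \<in> Hom X Y"
  shows "g \<cdot> (\<Sum>a\<in>S. f a) = (\<Sum>a\<in>S. g \<cdot> f a)"
proof (cases "finite S")
  case True
  then show ?thesis using f
  proof (induction S)
    case (insert a S)
    then show ?case using comp_add_right[of "f a" X Y "sum f S" g Z] g sum_Hom[of S f X Y] by simp
  qed (simp add: comp_zero_right[OF g])
qed (simp add: comp_zero_right[OF g])

lemma comp_sum_left: assumes g: "g \<in> Hom X Y" and f: "\<And>a. a \<in> S \<Longrightarrow> f a \<in> Hom Y Z"
  shows "(\<Sum>a\<in>S. f a) \<cdot> g = (\<Sum>a\<in>S. f a \<cdot> g)"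
proof (cases "finite S")
  case True
  then show ?thesis using f
  proof (induction S)
    case (insert a S)
    then show ?case using comp_add_left[of g X Y "f a" Z "sum f S"] g sum_Hom[of S f Y Z] by simp
  qed (simp add: comp_zero_left[OF g])
qed (simp add: comp_zero_left[OF g])

end

section \<open>Simple summands as detectors of nonzero morphisms\<close>

context fusion_category
begin

lemma decomposition_exists: obtains Xs i p where "decomposition X Xs i p"
proof -
  obtain Xs where Xs: "\<forall>S\<in>set Xs. simple_ob S" "direct_sum X Xs" using semisimple by blast
  then obtain i p where "(\<forall>a<length Xs. i a \<in> Hom (Xs ! a) X \<and> p a \<in> Hom X (Xs ! a)) \<and> (\<Sum>a<length Xs. i a \<cdot> p a) = Id X"
    unfolding direct_sum_def by blast
  then have "decomposition X Xs i p" unfolding decomposition_def using Xs(1) by auto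
  then show ?thesis using that by blast
qed

lemma decomposition_nonzero:
  assumes d: "decomposition X Xs i p" and f: "f \<in> Hom X Y" "f \<noteq> 0"
  shows "\<exists>a<length Xs. f \<cdot> i a \<noteq> 0"
proof (rule ccontr)
  assume "\<not> ?thesis"
  then have z: "\<And>a. a < length Xs \<Longrightarrow> f \<cdot> i a = 0" by blast
  have h: "\<And>a. a < length Xs \<Longrightarrow> i a \<in> Hom (Xs ! a) X \<and> p a \<in> Hom X (Xs ! a)"
    using d unfolding decomposition_def by blast
  have "f = f \<cdot> (\<Sum>a<length Xs. i a \<cdot> p a)" using d comp_Id_right[OF f(1)] unfolding decomposition_def by simp
  also have "\<dots> = (\<Sum>a<length Xs. f \<cdot> i a \<cdot> p a)"
    by (rule comp_sum_right[OF f(1)]) (use h comp_Hom in blast)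
  also have "\<dots> = (\<Sum>a<length Xs. 0)"
  proof (rule sum.cong[OF refl])
    fix a assume "a \<in> {..<length Xs}"
    then show "f \<cdot> i a \<cdot> p a = 0" using h[of a] z[of a] comp_assoc[of "p a" X "Xs ! a" "i a" X f Y] f(1) comp_zero_left[of "p a" X "Xs ! a"] by simp
  qed
  finally show False using f(2) by simp
qed

text \<open>A nonzero morphism out of a simple object has a nonzero component at some simple summand
  of its target. By Schur this component is invertible, and its inverse after the projection is the
  retraction.\<close>

lemma decomposition_detect:
  assumes d: "decomposition X Xs i p" and f: "f \<in> Hom X Y" and a: "a < length Xs" "f \<cdot> i a \<noteq> 0"
  obtains v where "v \<in> Hom Y (Xs ! a)" "v \<cdot> f \<cdot> i a = Id (Xs ! a)"
proof -
  let ?S = "Xs ! a"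
  have ia: "i a \<in> Hom ?S X" and S: "simple_ob ?S" using d a unfolding decomposition_def by auto
  have g: "f \<cdot> i a \<in> Hom ?S Y" by (rule comp_Hom[OF ia f])
  obtain Ys j q where e: "decomposition Y Ys j q" using decomposition_exists by blast
  have h: "\<And>b. b < length Ys \<Longrightarrow> j b \<in> Hom (Ys ! b) Y \<and> q b \<in> Hom Y (Ys ! b) \<and> simple_ob (Ys ! b)"
    using e unfolding decomposition_def by blast
  have "\<exists>b<length Ys. q b \<cdot> f \<cdot> i a \<noteq> 0"
  proof (rule ccontr)
    assume "\<not> ?thesis"
    then have z: "\<And>b. b < length Ys \<Longrightarrow> q b \<cdot> f \<cdot> i a = 0" by blast
    have "f \<cdot> i a = (\<Sum>b<length Ys. j b \<cdot> q b) \<cdot> f \<cdot> i a" using e comp_Id_left[OF g] unfolding decomposition_def by simp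
    also have "\<dots> = (\<Sum>b<length Ys. (j b \<cdot> q b) \<cdot> f \<cdot> i a)"
      by (rule comp_sum_left[OF g]) (use h comp_Hom in blast)
    also have "\<dots> = (\<Sum>b<length Ys. 0)"
    proof (rule sum.cong[OF refl])
      fix b assume "b \<in> {..<length Ys}"
      then show "(j b \<cdot> q b) \<cdot> f \<cdot> i a = 0" using h[of b] z[of b] comp_assoc[OF g, of "q b" "Ys ! b" "j b" Y] comp_zero_right[of "j b" "Ys ! b" Y] by simp
    qed
    finally show False using a(2) by simp
  qed
  then obtain b where b: "b < length Ys" "q b \<cdot> f \<cdot> i a \<noteq> 0" by blast
  have qb: "q b \<in> Hom Y (Ys ! b)" using h[OF b(1)] by simp
  have iso: "iso_arr ?S (Ys ! b) (q b \<cdot> f \<cdot> i a)"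
    by (rule schur[OF S _ comp_Hom[OF g qb] b(2)]) (use h[OF b(1)] in simp)
  let ?v = "inv_arr ?S (Ys ! b) (q b \<cdot> f \<cdot> i a) \<cdot> q b"
  have "?v \<cdot> f \<cdot> i a = Id ?S"
    using comp_assoc[OF g qb inv_arr_Hom[OF iso]] inv_arr_comp[OF iso] by simp
  then show ?thesis using that[of ?v] comp_Hom[OF qb inv_arr_Hom[OF iso]] by blast
qed

text \<open>The summand \<open>Xs ! a\<close> of \<open>\<I>\<close> is not identified with
  \<open>\<I>\<close>. Instead \<open>(i a \<cdot> v) \<cdot> f\<close> is a scalar by
  \<open>unit_End\<close>; it is nonzero, because otherwise
  \<open>v \<cdot> f \<cdot> i a = Id (Xs ! a)\<close> would force \<open>i a = 0\<close>.\<close>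

lemma unit_retraction:
  assumes f: "f \<in> Hom \<I> X" "f \<noteq> 0" obtains r where "r \<in> Hom X \<I>" "r \<cdot> f = Id \<I>"
proof -
  obtain Xs i p where d: "decomposition \<I> Xs i p" using decomposition_exists by blast
  obtain a where a: "a < length Xs" "f \<cdot> i a \<noteq> 0" using decomposition_nonzero[OF d f] by blast
  obtain v where v: "v \<in> Hom X (Xs ! a)" "v \<cdot> f \<cdot> i a = Id (Xs ! a)" using decomposition_detect[OF d f(1) a] by blast
  have ia: "i a \<in> Hom (Xs ! a) \<I>" and S: "simple_ob (Xs ! a)" using d a unfolding decomposition_def by auto
  have r: "i a \<cdot> v \<in> Hom X \<I>" by (rule comp_Hom[OF v(1) ia])
  obtain c where c: "(i a \<cdot> v) \<cdot> f = sc c (Id \<I>)" using unit_End[OF comp_Hom[OF f(1) r]] by blast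
  have "c \<noteq> 0"
  proof
    assume "c = 0"
    then have "(i a \<cdot> v) \<cdot> f = 0" using c by simp
    then have "i a \<cdot> (v \<cdot> f) = 0" using comp_assoc[OF f(1) v(1) ia] by simp
    then have "(i a \<cdot> v \<cdot> f) \<cdot> i a = 0" using comp_zero_left[OF ia] by simp
    then have "i a \<cdot> (v \<cdot> f) \<cdot> i a = 0" using comp_assoc[OF ia comp_Hom[OF f(1) v(1)] ia] by simp
    then have "i a = 0" using v(2) comp_assoc[OF ia f(1) v(1)] comp_Id_right[OF ia] by simp
    then show False using a(2) comp_zero_right[OF f(1)] by simp
  qed
  then have "sc (inverse c) (i a \<cdot> v) \<cdot> f = Id \<I>"
    using c comp_sc_left[OF f(1) r] by simp
  then show ?thesis using that[OF sc_Hom[OF r]] by blast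
qed

lemma Id_unit_nonzero: "Id \<I> \<noteq> 0" using unit_simple unfolding simple_ob_def by simp

lemma sc_Id_unit_eq: "sc c (Id \<I>) = sc d (Id \<I>) \<longleftrightarrow> c = d"
  using Id_unit_nonzero by simp

section \<open>The scalar-valued trace\<close>

definition tr where "tr X f = (THE c. trace_right s X f = sc c (Id \<I>))"

lemma tr_eqI: "trace_right s X f = sc c (Id \<I>) \<Longrightarrow> tr X f = c"
  unfolding tr_def using sc_Id_unit_eq by auto
lemma trace_tr: "f \<in> Hom X X \<Longrightarrow> trace_right s X f = sc (tr X f) (Id \<I>)"
  using unit_End[OF trace_word(1)] tr_eqI by metis
lemma qdim_tr: "qdim s X = tr X (Id X)"
  unfolding qdim_def tr_def ..

lemma tr_add: assumes f: "f \<in> Hom X X" and g: "g \<in> Hom X X" shows "tr X (f + g) = tr X f + tr X g"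
proof (rule tr_eqI)
  let ?D = "Dual X"
  have h: "(s X \<cdot> h) \<otimes> Id ?D \<in> Hom (X \<boxtimes> ?D) (Dual ?D \<boxtimes> ?D)" if "h \<in> Hom X X" for h
    by (rule mten_Hom[OF comp_Hom[OF that s_Hom] Id_Hom])
  have "trace_right s X (f + g) = trace_right s X f + trace_right s X g"
    unfolding trace_right_def comp_add_right[OF f g s_Hom] mten_add_left[OF comp_Hom[OF f s_Hom] comp_Hom[OF g s_Hom] Id_Hom]
      comp_add_left[OF Coev_Hom h[OF f] h[OF g]]
    by (rule comp_add_right[OF comp_Hom[OF Coev_Hom h[OF f]] comp_Hom[OF Coev_Hom h[OF g]] Ev_Hom])
  then show "trace_right s X (f + g) = sc (tr X f + tr X g) (Id \<I>)"
    using trace_tr[OF f] trace_tr[OF g] by (simp add: scale_left_distrib)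
qed

lemma tr_sc: assumes f: "f \<in> Hom X X" shows "tr X (sc c f) = c * tr X f"
proof (rule tr_eqI)
  let ?D = "Dual X"
  have h: "(s X \<cdot> h) \<otimes> Id ?D \<in> Hom (X \<boxtimes> ?D) (Dual ?D \<boxtimes> ?D)" if "h \<in> Hom X X" for h
    by (rule mten_Hom[OF comp_Hom[OF that s_Hom] Id_Hom])
  have "trace_right s X (sc c f) = sc c (trace_right s X f)"
    unfolding trace_right_def comp_sc_right[OF f s_Hom] mten_sc_left[OF comp_Hom[OF f s_Hom] Id_Hom]
      comp_sc_left[OF Coev_Hom h[OF f]]
    by (rule comp_sc_right[OF comp_Hom[OF Coev_Hom h[OF f]] Ev_Hom])
  then show "trace_right s X (sc c f) = sc (c * tr X f) (Id \<I>)"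
    using trace_tr[OF f] by simp
qed

lemma tr_zero: "tr X 0 = 0" using tr_sc[OF zero_Hom, of X 0] by simp
lemma tr_diff: "f \<in> Hom X X \<Longrightarrow> g \<in> Hom X X \<Longrightarrow> tr X (f - g) = tr X f - tr X g"
  using tr_add[of "f - g" X g] diff_Hom by auto

text \<open>The morphism \<open>f\<close> is slid around the loop: \<open>dual_arr_cow\<close> moves
  it through the cup onto the dual strand, \<open>etw_natural\<close> brings it back through the
  cap.\<close>

lemma tr_cyclic: assumes f: "f \<in> Hom X Y" and g: "g \<in> Hom Y X" shows "tr X (g \<cdot> f) = tr Y (f \<cdot> g)"
proof -
  let ?f = "hat X Y f" and ?g = "hat Y X g" and ?d = "hat (Dual Y) (Dual X) (dual_arr X Y f)"
  note gf = comp_Hom[OF f g] and fg = comp_Hom[OF g f] and d = dual_arr(1)[OF f]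
  have "etw X \<star> whisk [] (?g \<star> ?f) [Dual X] \<star> cow X = etw X \<star> (whisk [] ?g [Dual X] \<star> whisk [Y] ?d []) \<star> cow Y"
    using dual_arr_cow[OF f] by simp
  also have "whisk [] ?g [Dual X] \<star> whisk [Y] ?d [] = whisk [X] ?d [] \<star> whisk [] ?g [Dual Y]"
    using exch[of ?g ?d "[]" "[]" "[]", simplified] g d by simp
  also have "etw X \<star> (whisk [X] ?d [] \<star> whisk [] ?g [Dual Y]) \<star> cow Y = (etw X \<star> whisk [X] ?d []) \<star> whisk [] ?g [Dual Y] \<star> cow Y"
    by simp
  also have "\<dots> = etw Y \<star> whisk [] (?f \<star> ?g) [Dual Y] \<star> cow Y" unfolding etw_natural[OF f, symmetric] by simp
  finally have e: "etw X \<star> whisk [] (?g \<star> ?f) [Dual X] \<star> cow X = etw Y \<star> whisk [] (?f \<star> ?g) [Dual Y] \<star> cow Y" .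
  have "hat \<I> \<I> (trace_right s X (g \<cdot> f)) = lui \<star> (etw X \<star> whisk [] (?g \<star> ?f) [Dual X] \<star> cow X) \<star> lu"
    unfolding trace_word(2)[OF gf] hat_comp[OF f g] by simp
  also have "\<dots> = hat \<I> \<I> (trace_right s Y (f \<cdot> g))"
    unfolding e trace_word(2)[OF fg] hat_comp[OF g f] by simp
  finally have "trace_right s X (g \<cdot> f) = trace_right s Y (f \<cdot> g)"
    by (rule hat_inj[OF trace_word(1)[OF gf] trace_word(1)[OF fg]])
  then show ?thesis unfolding tr_def by simp
qed

text \<open>Gaussian elimination: \<open>f - f \<cdot> h \<cdot> f\<close> vanishes on one more simple summand than \<open>f\<close>.\<close>
lemma decomposition_reduce:
  assumes d: "decomposition X Xs i p" and f: "f \<in> Hom X X" and f0: "f \<noteq> 0"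
  obtains S h where "simple_ob S" "h \<in> Hom X X" "h \<cdot> f \<cdot> h = h" "tr X (f \<cdot> h) = qdim s S"
    "card {a. a < length Xs \<and> (f - f \<cdot> h \<cdot> f) \<cdot> i a \<noteq> 0} < card {a. a < length Xs \<and> f \<cdot> i a \<noteq> 0}"
proof -
  obtain a where a: "a < length Xs" "f \<cdot> i a \<noteq> 0" using decomposition_nonzero[OF d f f0] by blast
  let ?S = "Xs ! a"
  obtain v where v: "v \<in> Hom X ?S" "v \<cdot> f \<cdot> i a = Id ?S" using decomposition_detect[OF d f a] by blast
  have ia: "i a \<in> Hom ?S X" and S: "simple_ob ?S" using d a unfolding decomposition_def by auto
  define h where "h = i a \<cdot> v"
  have h: "h \<in> Hom X X" unfolding h_def by (rule comp_Hom[OF v(1) ia])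
  note hf = comp_Hom[OF f h]
  have hfi: "h \<cdot> f \<cdot> i a = i a" unfolding h_def
    using comp_assoc[OF comp_Hom[OF ia f] v(1) ia] v(2) comp_Id_right[OF ia] by simp
  have fh: "f \<cdot> h = (f \<cdot> i a) \<cdot> v" unfolding h_def using comp_assoc[OF v(1) ia f] by simp
  have "h \<cdot> f \<cdot> h = (h \<cdot> f \<cdot> i a) \<cdot> v" unfolding fh using comp_assoc[OF v(1) comp_Hom[OF ia f] h] by simp
  then have hfh: "h \<cdot> f \<cdot> h = h" unfolding hfi by (simp add: h_def)
  have "tr X (f \<cdot> h) = tr ?S (v \<cdot> f \<cdot> i a)" unfolding fh by (rule tr_cyclic[OF v(1) comp_Hom[OF ia f]])
  then have trS: "tr X (f \<cdot> h) = qdim s ?S" using v(2) qdim_tr by simp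
  have red: "(f - f \<cdot> h \<cdot> f) \<cdot> x = f \<cdot> x - f \<cdot> h \<cdot> f \<cdot> x" if "x \<in> Hom W X" for x W
    using comp_diff_left[OF that f comp_Hom[OF hf f]] comp_assoc[OF that hf f] comp_assoc[OF that f h] by simp
  have "(f - f \<cdot> h \<cdot> f) \<cdot> i a = 0" using red[OF ia] hfi by simp
  moreover have "f \<cdot> i b \<noteq> 0" if "b < length Xs" "(f - f \<cdot> h \<cdot> f) \<cdot> i b \<noteq> 0" for b
  proof
    assume z: "f \<cdot> i b = 0"
    have ib: "i b \<in> Hom (Xs ! b) X" using d that(1) unfolding decomposition_def by auto
    show False using red[OF ib] z comp_zero_right[OF h] comp_zero_right[OF f] that(2) by simp
  qed
  ultimately have "card {b. b < length Xs \<and> (f - f \<cdot> h \<cdot> f) \<cdot> i b \<noteq> 0} < card {a. a < length Xs \<and> f \<cdot> i a \<noteq> 0}"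
    by (intro psubset_card_mono) (use a in auto)
  then show ?thesis using that[OF S h hfh trS] by blast
qed

text \<open>Induction on the number of simple summands on which \<open>f\<close> does not vanish.
  The piece \<open>f \<cdot> h \<cdot> f\<close> has trace zero by cyclicity and
  \<open>f \<cdot> f = 0\<close>, and the remainder squares to zero again.\<close>

lemma tr_square_zero:
  assumes f: "f \<in> Hom X X" "f \<cdot> f = 0"
  shows "tr X f = 0"
proof -
  obtain Xs i p where d: "decomposition X Xs i p" using decomposition_exists by blast
  show ?thesis using f
  proof (induction "card {a. a < length Xs \<and> f \<cdot> i a \<noteq> 0}" arbitrary: f rule: less_induct)
    case less
    note f = less.prems
    show ?case
    proof (cases "f = 0")
      case False
      obtain h where h: "h \<in> Hom X X" and c: "card {a. a < length Xs \<and> (f - f \<cdot> h \<cdot> f) \<cdot> i a \<noteq> 0} < card {a. a < length Xs \<and> f \<cdot> i a \<noteq> 0}"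
        using decomposition_reduce[OF d f(1) False] by blast
      note hf = comp_Hom[OF f(1) h]
      have g: "f \<cdot> h \<cdot> f \<in> Hom X X" by (rule comp_Hom[OF hf f(1)])
      have 1: "f \<cdot> f \<cdot> h \<cdot> f = 0" using comp_assoc[OF hf f(1) f(1)] f(2) comp_zero_left[OF hf] by simp
      have gx: "(f \<cdot> h \<cdot> f) \<cdot> x = f \<cdot> h \<cdot> (f \<cdot> x)" if "x \<in> Hom W X" for x W
        using comp_assoc[OF that hf f(1)] comp_assoc[OF that f(1) h] by simp
      have "(f \<cdot> h \<cdot> f) \<cdot> x = 0" if "f \<cdot> x = 0" "x \<in> Hom X X" for x
        using gx[OF that(2)] that(1) comp_zero_right[OF h] comp_zero_right[OF f(1)] by simp
      then have "(f - f \<cdot> h \<cdot> f) \<cdot> (f - f \<cdot> h \<cdot> f) = 0"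
        using comp_diff_left[OF diff_Hom[OF f(1) g] f(1) g] comp_diff_right[OF f(1) g f(1)] comp_diff_right[OF f(1) g g] 1 f g by simp
      then have 0: "tr X (f - f \<cdot> h \<cdot> f) = 0" using less.hyps[OF c diff_Hom[OF f(1) g]] by simp
      have "tr X (f \<cdot> (h \<cdot> f)) = tr X ((h \<cdot> f) \<cdot> f)" by (rule tr_cyclic[OF hf f(1)])
      also have "(h \<cdot> f) \<cdot> f = 0" using comp_assoc[OF f(1) f(1) h] f(2) comp_zero_right[OF h] by simp
      finally show ?thesis using 0 tr_diff[OF f(1) g] tr_zero by simp
    qed (simp add: tr_zero)
  qed
qed

text \<open>An idempotent is dismantled without splitting it: \<open>f \<cdot> h \<cdot> f\<close>
  is an idempotent below \<open>f\<close> whose trace is the dimension of one simple object, and the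
  difference is an idempotent with fewer detected summands. The last clause keeps the information
  needed for faithfulness of the trace.\<close>

lemma tr_idempotent:
  assumes f: "f \<in> Hom X X" "f \<cdot> f = f"
  shows "\<exists>Ss. (\<forall>S\<in>set Ss. simple_ob S) \<and> tr X f = (\<Sum>S\<leftarrow>Ss. qdim s S) \<and> (Ss = [] \<longrightarrow> f = 0)"
proof -
  obtain Xs i p where d: "decomposition X Xs i p" using decomposition_exists by blast
  show ?thesis using f
  proof (induction "card {a. a < length Xs \<and> f \<cdot> i a \<noteq> 0}" arbitrary: f rule: less_induct)
    case less
    note f = less.prems
    show ?case
    proof (cases "f = 0")
      case False
      obtain S h where S: "simple_ob S" and h: "h \<in> Hom X X" and hfh: "h \<cdot> f \<cdot> h = h" and trS: "tr X (f \<cdot> h) = qdim s S"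
        and c: "card {a. a < length Xs \<and> (f - f \<cdot> h \<cdot> f) \<cdot> i a \<noteq> 0} < card {a. a < length Xs \<and> f \<cdot> i a \<noteq> 0}"
        using decomposition_reduce[OF d f(1) False] by blast
      note hf = comp_Hom[OF f(1) h] and fh = comp_Hom[OF h f(1)]
      have g: "f \<cdot> h \<cdot> f \<in> Hom X X" by (rule comp_Hom[OF hf f(1)])
      have gx: "(f \<cdot> h \<cdot> f) \<cdot> x = f \<cdot> h \<cdot> (f \<cdot> x)" if "x \<in> Hom W X" for x W
        using comp_assoc[OF that hf f(1)] comp_assoc[OF that f(1) h] by simp
      have ff: "f \<cdot> f \<cdot> x = f \<cdot> x" if "x \<in> Hom W X" for x W
        using comp_assoc[OF that f(1) f(1)] f(2) by simp
      have 1: "(f \<cdot> h \<cdot> f) \<cdot> f = f \<cdot> h \<cdot> f" using gx[OF f(1)] f(2) by simp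
      have 2: "f \<cdot> f \<cdot> h \<cdot> f = f \<cdot> h \<cdot> f" using ff[OF hf] by simp
      have "h \<cdot> f \<cdot> h \<cdot> f = h \<cdot> f" using comp_assoc[OF f(1) fh h] comp_assoc[OF f(1) h f(1)] hfh by simp
      then have 3: "(f \<cdot> h \<cdot> f) \<cdot> (f \<cdot> h \<cdot> f) = f \<cdot> h \<cdot> f" using gx[OF g] 2 by simp
      have "(f - f \<cdot> h \<cdot> f) \<cdot> (f - f \<cdot> h \<cdot> f) = f - f \<cdot> h \<cdot> f"
        using comp_diff_left[OF diff_Hom[OF f(1) g] f(1) g] comp_diff_right[OF f(1) g f(1)] comp_diff_right[OF f(1) g g] 1 2 3 f(2) by simp
      then obtain Ss where Ss: "\<forall>S\<in>set Ss. simple_ob S" "tr X (f - f \<cdot> h \<cdot> f) = (\<Sum>S\<leftarrow>Ss. qdim s S)"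
        using less.hyps[OF c diff_Hom[OF f(1) g]] by blast
      have "tr X (f \<cdot> h \<cdot> f) = qdim s S"
        using tr_cyclic[OF hf f(1)] tr_cyclic[OF f(1) h] comp_assoc[OF f(1) f(1) h] f(2) ff[OF h] trS by simp
      then have "tr X f = qdim s S + tr X (f - f \<cdot> h \<cdot> f)" using tr_diff[OF f(1) g] by simp
      then show ?thesis using Ss S by (intro exI[of _ "S # Ss"]) auto
    qed (auto intro!: exI[of _ "[]"] simp: tr_zero)
  qed
qed

text \<open>A retraction of the name \<open>\<I> \<rightarrow> Y \<boxtimes> Dual X\<close> of \<open>f\<close> is a pairing, and its mate is \<open>h\<close>.\<close>
lemma tr_nondegenerate:
  assumes f: "f \<in> Hom X Y" and f0: "f \<noteq> 0"
  shows "\<exists>h\<in>Hom Y X. tr X (h \<cdot> f) = 1"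
proof -
  let ?D = "Dual X"
  let ?n = "(f \<otimes> Id ?D) \<cdot> Coev X"
  have n: "?n \<in> Hom \<I> (Y \<boxtimes> ?D)" by (rule comp_Hom[OF Coev_Hom mten_Hom[OF f Id_Hom]])
  have hn: "hat \<I> (Y \<boxtimes> ?D) ?n = ali Y ?D \<star> whisk [] (hat X Y f) [?D] \<star> cow X \<star> lu"
    by (rule hat_eqI, (rule hats_ten hats_Id hats_hat[OF f] hats_Coev hats_comp)+, simp add: hat_Coev f)
  have "?n \<noteq> 0"
  proof
    assume "?n = 0"
    \<comment> \<open>Words carry scalars but no addition, so vanishing is expressed as invariance
      under \<open>sscale 0\<close>. Straightening the strand of \<open>X\<close> transports this
      property from the name of \<open>f\<close> back to \<open>f\<close>.\<close>
    then have "hat \<I> (Y \<boxtimes> ?D) ?n = hat \<I> (Y \<boxtimes> ?D) (sc 0 0)" by simp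
    also have "\<dots> = sscale 0 (hat \<I> (Y \<boxtimes> ?D) ?n)" using hat_sc[OF n, of 0] by simp
    finally have "ali Y ?D \<star> whisk [] (hat X Y f) [?D] \<star> cow X \<star> lu = sscale 0 (ali Y ?D \<star> whisk [] (hat X Y f) [?D] \<star> cow X \<star> lu)"
      unfolding hn .
    from arg_cong[OF this, of "\<lambda>h. whisk [Y] (evw X) [] \<star> whisk [] (al Y ?D \<star> h \<star> lui) [X]"]
    have "whisk [Y] (evw X) [] \<star> whisk [] (hat X Y f) [?D, X] \<star> whisk [] (cow X) [X]
      = sscale 0 (whisk [Y] (evw X) [] \<star> whisk [] (hat X Y f) [?D, X] \<star> whisk [] (cow X) [X])" using f by simp
    moreover have "whisk [Y] (evw X) [] \<star> whisk [] (hat X Y f) [?D, X] \<star> whisk [] (cow X) [X] = hat X Y f"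
    proof -
      have "whisk [Y] (evw X) [] \<star> whisk [] (hat X Y f) [?D, X] = hat X Y f \<star> whisk [X] (evw X) []"
        using exch[of "hat X Y f" "evw X" "[]" "[]" "[]", simplified] f by simp
      from tail_eq[OF this, of "whisk [] (cow X) [X]"] show ?thesis using zigzag1[of X] f by simp
    qed
    ultimately have "hat X Y f = hat X Y (sc 0 f)" unfolding hat_sc[OF f] by simp
    then have "f = sc 0 f" by (rule hat_inj[OF f sc_Hom[OF f]])
    then show False using f0 by simp
  qed
  then obtain r where r: "r \<in> Hom (Y \<boxtimes> ?D) \<I>" "r \<cdot> ?n = Id \<I>" using unit_retraction[OF n] by blast
  define R where "R = lu \<star> hat (Y \<boxtimes> ?D) \<I> r \<star> ali Y ?D"
  have R [simp]: "valid R" "sdom R = [Y, ?D]" "scod R = []" unfolding R_def using r by auto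
  let ?H = "whisk [] R [X] \<star> whisk [Y] (ctw X) []"
  obtain h where h: "h \<in> Hom Y X" "hat Y X h = ?H" using hat_full[of ?H Y X] by auto
  have Rr: "hat (Y \<boxtimes> ?D) \<I> r = lui \<star> R \<star> al Y ?D" unfolding R_def using r(1) by simp
  have "etw X \<star> whisk [] ?H [?D] = (etw X \<star> whisk [] R [X, ?D]) \<star> whisk [Y] (ctw X) [?D]" by simp
  also have "etw X \<star> whisk [] R [X, ?D] = R \<star> whisk [Y, ?D] (etw X) []"
    using exch[of R "etw X" "[]" "[]" "[]", simplified] by simp
  also have "(R \<star> whisk [Y, ?D] (etw X) []) \<star> whisk [Y] (ctw X) [?D] = R \<star> whisk [Y] (whisk [?D] (etw X) [] \<star> whisk [] (ctw X) [?D]) []"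
    by simp
  also have "\<dots> = R" unfolding zigzag_etw by simp
  finally have "etw X \<star> whisk [] ?H [?D] = R" .
  note hf = comp_Hom[OF f h(1)]
  have "hat \<I> \<I> (trace_right s X (h \<cdot> f)) = lui \<star> (etw X \<star> whisk [] ?H [?D]) \<star> whisk [] (hat X Y f) [?D] \<star> cow X \<star> lu"
    unfolding trace_word(2)[OF hf] hat_comp[OF f h(1)] h(2) using f by simp
  also have "\<dots> = hat \<I> \<I> (r \<cdot> ?n)"
    unfolding \<open>etw X \<star> whisk [] ?H [?D] = R\<close> hat_comp[OF n r(1)] Rr hn using f by simp
  finally have "trace_right s X (h \<cdot> f) = sc 1 (Id \<I>)"
    using hat_inj[OF trace_word(1)[OF hf] comp_Hom[OF n r(1)]] r(2) by simp
  then show ?thesis using h(1) tr_eqI by blast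
qed

section \<open>Finite-dimensional hom-spaces and dimensions of simple objects\<close>

lemma Hom_unit_finite: "\<exists>T. finite T \<and> T \<subseteq> Hom \<I> X \<and> Hom \<I> X \<subseteq> span T"
proof -
  obtain Xs i p where d: "decomposition X Xs i p" using decomposition_exists by blast
  have h: "\<And>a. a < length Xs \<Longrightarrow> i a \<in> Hom (Xs ! a) X \<and> p a \<in> Hom X (Xs ! a) \<and> simple_ob (Xs ! a)"
    using d unfolding decomposition_def by blast
  have "\<exists>w\<in>Hom \<I> S. \<forall>x\<in>Hom \<I> S. \<exists>c. x = sc c w" if S: "simple_ob S" for S
  proof (cases "\<exists>w\<in>Hom \<I> S. w \<noteq> 0")
    case True
    then obtain w where w: "w \<in> Hom \<I> S" "w \<noteq> 0" by blast
    have iso: "iso_arr \<I> S w" by (rule schur[OF unit_simple S w])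
    have "\<exists>c. x = sc c w" if x: "x \<in> Hom \<I> S" for x
    proof -
      obtain c where c: "inv_arr \<I> S w \<cdot> x = sc c (Id \<I>)" using unit_End[OF comp_Hom[OF x inv_arr_Hom[OF iso]]] by blast
      have "x = w \<cdot> inv_arr \<I> S w \<cdot> x"
        using comp_assoc[OF x inv_arr_Hom[OF iso] w(1)] comp_inv_arr[OF iso] comp_Id_left[OF x] by simp
      also have "\<dots> = sc c w" unfolding c using comp_sc_right[OF Id_Hom w(1)] comp_Id_right[OF w(1)] by simp
      finally show ?thesis by blast
    qed
    then show ?thesis using w by blast
  next
    case False
    then show ?thesis using zero_Hom[of \<I> S] by (metis scale_zero_right)
  qed
  then have "\<forall>a. \<exists>w. a < length Xs \<longrightarrow> w \<in> Hom \<I> (Xs ! a) \<and> (\<forall>x\<in>Hom \<I> (Xs ! a). \<exists>c. x = sc c w)"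
    using h by blast
  then obtain w where w: "\<And>a. a < length Xs \<Longrightarrow> w a \<in> Hom \<I> (Xs ! a)"
      "\<And>a x. a < length Xs \<Longrightarrow> x \<in> Hom \<I> (Xs ! a) \<Longrightarrow> \<exists>c. x = sc c (w a)" by metis
  let ?T = "(\<lambda>a. i a \<cdot> w a) ` {..<length Xs}"
  have "x \<in> span ?T" if x: "x \<in> Hom \<I> X" for x
  proof -
    have "x = (\<Sum>a<length Xs. i a \<cdot> p a) \<cdot> x" using d comp_Id_left[OF x] unfolding decomposition_def by simp
    also have "\<dots> = (\<Sum>a<length Xs. (i a \<cdot> p a) \<cdot> x)"
      by (rule comp_sum_left[OF x]) (use h comp_Hom in blast)
    also have "\<dots> \<in> span ?T"
    proof (rule span_sum)
      fix a assume "a \<in> {..<length Xs}"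
      then have a: "a < length Xs" by simp
      note H = h[OF a]
      have ia: "i a \<in> Hom (Xs ! a) X" and pa: "p a \<in> Hom X (Xs ! a)" using H by auto
      obtain c where c: "p a \<cdot> x = sc c (w a)" using w(2)[OF a comp_Hom[OF x pa]] by blast
      have "(i a \<cdot> p a) \<cdot> x = sc c (i a \<cdot> w a)"
        using comp_assoc[OF x pa ia] c comp_sc_right[OF w(1)[OF a] ia] by simp
      then show "(i a \<cdot> p a) \<cdot> x \<in> span ?T" using a by (auto intro: span_scale span_base)
    qed
    finally show ?thesis .
  qed
  moreover have "?T \<subseteq> Hom \<I> X" using w(1) h comp_Hom by blast
  ultimately show ?thesis by (intro exI[of _ ?T]) auto
qed

text \<open>So far only the endomorphisms of the unit are known to be scalars, which controls the
  morphisms out of \<open>\<I>\<close>. Duality carries this over: \<open>\<Phi>\<close> bends a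
  strand down, and each \<open>f\<close> is the image of its own name. Only then are eigenvectors
  available for the endomorphisms of other simple objects.\<close>

lemma Hom_finite: "\<exists>T. finite T \<and> T \<subseteq> Hom X Y \<and> Hom X Y \<subseteq> span T"
proof -
  let ?D = "Dual X"
  define \<Phi> where "\<Phi> g = \<r> Y \<cdot> (Id Y \<otimes> Ev X) \<cdot> \<alpha> Y ?D X \<cdot> (g \<otimes> Id X) \<cdot> \<l>inv X" for g
  obtain T where T: "finite T" "T \<subseteq> Hom \<I> (Y \<boxtimes> ?D)" "Hom \<I> (Y \<boxtimes> ?D) \<subseteq> span T" using Hom_unit_finite by blast
  define e where "e = \<r> Y \<cdot> (Id Y \<otimes> Ev X) \<cdot> \<alpha> Y ?D X"
  have e: "e \<in> Hom ((Y \<boxtimes> ?D) \<boxtimes> X) Y" unfolding e_def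
    by (rule comp_Hom[OF comp_Hom[OF \<alpha>_Hom mten_Hom[OF Id_Hom Ev_Hom]] \<r>_Hom])
  have gH: "(g \<otimes> Id X) \<cdot> \<l>inv X \<in> Hom X ((Y \<boxtimes> ?D) \<boxtimes> X)" if "g \<in> Hom \<I> (Y \<boxtimes> ?D)" for g
    by (rule comp_Hom[OF \<l>inv_Hom mten_Hom[OF that Id_Hom]])
  have \<Phi>e: "\<Phi> g = e \<cdot> ((g \<otimes> Id X) \<cdot> \<l>inv X)" if "g \<in> Hom \<I> (Y \<boxtimes> ?D)" for g
    unfolding \<Phi>_def e_def
    using comp_assoc[OF gH[OF that] comp_Hom[OF \<alpha>_Hom mten_Hom[OF Id_Hom Ev_Hom]] \<r>_Hom]
      comp_assoc[OF gH[OF that] \<alpha>_Hom mten_Hom[OF Id_Hom Ev_Hom]] by simp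
  have add: "\<Phi> (g + g') = \<Phi> g + \<Phi> g'" if g: "g \<in> Hom \<I> (Y \<boxtimes> ?D)" and g': "g' \<in> Hom \<I> (Y \<boxtimes> ?D)" for g g'
    using \<Phi>e[OF g] \<Phi>e[OF g'] \<Phi>e[OF add_Hom[OF g g']] mten_add_left[OF g g' Id_Hom, of X]
      comp_add_left[OF \<l>inv_Hom mten_Hom[OF g Id_Hom] mten_Hom[OF g' Id_Hom], of X]
      comp_add_right[OF gH[OF g] gH[OF g'] e] by simp
  have sca: "\<Phi> (sc c g) = sc c (\<Phi> g)" if g: "g \<in> Hom \<I> (Y \<boxtimes> ?D)" for c g
    using \<Phi>e[OF g] \<Phi>e[OF sc_Hom[OF g]] mten_sc_left[OF g Id_Hom[of X]]
      comp_sc_left[OF \<l>inv_Hom mten_Hom[OF g Id_Hom[of X]]] comp_sc_right[OF gH[OF g] e] by simp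
  have \<Phi>H: "\<Phi> g \<in> Hom X Y" if "g \<in> Hom \<I> (Y \<boxtimes> ?D)" for g
    using \<Phi>e[OF that] comp_Hom[OF gH[OF that] e] by simp
  have sub: "x \<in> Hom \<I> (Y \<boxtimes> ?D) \<and> \<Phi> x \<in> span (\<Phi> ` T)" if "x \<in> span T" for x
    using that
  proof (induction rule: span_induct_alt)
    case base
    show ?case using zero_Hom sca[OF zero_Hom, of 0] by (simp add: span_zero)
  next
    case (step c x y)
    then have x: "x \<in> Hom \<I> (Y \<boxtimes> ?D)" using T by blast
    show ?case using step add[OF sc_Hom[OF x]] sca[OF x] add_Hom[OF sc_Hom[OF x]]
      by (simp add: span_add span_scale span_base)
  qed
  have "f \<in> span (\<Phi> ` T)" if f: "f \<in> Hom X Y" for f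
  proof -
    let ?n = "(f \<otimes> Id ?D) \<cdot> Coev X"
    have n: "?n \<in> Hom \<I> (Y \<boxtimes> ?D)" by (rule comp_Hom[OF Coev_Hom mten_Hom[OF f Id_Hom]])
    have "hat X Y (\<Phi> ?n) = whisk [Y] (evw X) [] \<star> whisk [] (hat X Y f) [?D, X] \<star> whisk [] (cow X) [X]"
      unfolding \<Phi>_def
      by (rule hat_eqI, (rule hats_rules hats_hat[OF f] hats_Coev hats_Ev)+, simp add: hat_Coev hat_Ev f)
    also have "\<dots> = hat X Y f"
    proof -
      have "whisk [Y] (evw X) [] \<star> whisk [] (hat X Y f) [?D, X] = hat X Y f \<star> whisk [X] (evw X) []"
        using exch[of "hat X Y f" "evw X" "[]" "[]" "[]", simplified] f by simp
      from tail_eq[OF this, of "whisk [] (cow X) [X]"] show ?thesis using zigzag1[of X] f by simp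
    qed
    finally have "\<Phi> ?n = f" by (rule hat_inj[OF \<Phi>H[OF n] f])
    then show ?thesis using sub[of ?n] T(3) n by auto
  qed
  moreover have "\<Phi> ` T \<subseteq> Hom X Y" using \<Phi>H T(2) by blast
  ultimately show ?thesis using T(1) by (intro exI[of _ "\<Phi> ` T"]) auto
qed

lemma simple_End: assumes S: "simple_ob S" and f: "f \<in> Hom S S" shows "\<exists>c. f = sc c (Id S)"
proof -
  obtain T where T: "finite T" "Hom S S \<subseteq> span T" using Hom_finite by blast
  have "\<exists>c. \<exists>w\<in>Hom S S. w \<noteq> 0 \<and> f \<cdot> w = sc c w"
  proof (rule eigenvector_exists[OF _ subspace_Hom T])
    show "\<exists>c. poly q c = 0" if "degree q > 0" for q :: "'a poly" using that alg_closed_imp_poly_has_root by blast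
    show "Id S \<noteq> 0" using S unfolding simple_ob_def by simp
  qed (use f comp_Hom comp_add_right comp_sc_right Id_Hom in blast)+
  then obtain c w where w: "w \<in> Hom S S" "w \<noteq> 0" "f \<cdot> w = sc c w" by blast
  have cI: "sc c (Id S) \<in> Hom S S" by (rule sc_Hom[OF Id_Hom])
  have "(f - sc c (Id S)) \<cdot> w = 0"
    using comp_diff_left[OF w(1) f cI] w(3) comp_sc_left[OF w(1) Id_Hom] comp_Id_left[OF w(1)] by simp
  then have "f - sc c (Id S) = 0"
    by (rule zero_cancel_iso[OF schur[OF S S w(1,2)] diff_Hom[OF f cI]])
  then show ?thesis by auto
qed

text \<open>Nondegeneracy of the trace form gives an endomorphism of trace 1, which is a scalar
  multiple of the identity.\<close>

lemma simple_qdim_nonzero: assumes S: "simple_ob S" shows "qdim s S \<noteq> 0"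
proof -
  have "Id S \<noteq> 0" using S unfolding simple_ob_def by simp
  then obtain h where h: "h \<in> Hom S S" "tr S (h \<cdot> Id S) = 1" using tr_nondegenerate[OF Id_Hom] by blast
  obtain c where "h = sc c (Id S)" using simple_End[OF S h(1)] by blast
  then have "c * qdim s S = 1" using h comp_Id_right[OF h(1)] tr_sc[OF Id_Hom] qdim_tr by simp
  then show ?thesis by auto
qed

end

section \<open>Connected and commutative algebras\<close>

context tensor_category
begin

lemma sscale_sscale [simp]: "sscale c (sscale d f) = sscale (c * d) f"
  by (cases f) (auto simp: natfam_sc)
lemma sscale_one [simp]: "valid f \<Longrightarrow> sscale 1 f = f"
  by (cases f) auto

lemma sscale_hat_eq:
  assumes g: "g \<in> Hom X Y" "g \<noteq> 0" and eq: "sscale c (hat X Y g) = sscale d (hat X Y g)"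
  shows "c = d"
proof -
  have "sc c g = sc d g" by (rule hat_inj[OF sc_Hom[OF g(1)] sc_Hom[OF g(1)]]) (use eq hat_sc[OF g(1)] in simp)
  then show ?thesis using g(2) by simp
qed

lemma mten_zero_left: "g \<in> Hom X' Y' \<Longrightarrow> 0 \<otimes> g = 0"
  using mten_sc_left[OF zero_Hom, of g X' Y' 0] by simp

end

context fusion_category
begin

lemma sscale_sid_eq: "sscale c (sid []) = sscale d (sid []) \<Longrightarrow> c = d"
proof -
  assume eq: "sscale c (sid []) = sscale d (sid [])"
  have "sscale c (hat \<I> \<I> (Id \<I>)) = sscale d (hat \<I> \<I> (Id \<I>))"
    using arg_cong[OF eq, of "\<lambda>h. lui \<star> h \<star> lu"] by (simp add: hat_Id)
  then show ?thesis by (rule sscale_hat_eq[OF Id_Hom Id_unit_nonzero])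
qed

end

locale connected_algebra = separable_algebra C s A m u \<kappa> for C (structure) and s A m u \<kappa> +
  assumes conn: "hom_dim \<I> A = 1"
begin

lemma Id_A_nonzero: "Id A \<noteq> 0"
proof
  assume z: "Id A = 0"
  have "f = 0" if "f \<in> Hom \<I> A" for f using comp_Id_left[OF that] z comp_zero_left[OF that] by simp
  then have "Hom \<I> A \<subseteq> {0}" by blast
  then have "hom_dim \<I> A \<le> card ({} :: 'c set)" unfolding hom_dim_def by (intro dim_le_card) (auto simp: span_empty)
  then show False using conn by simp
qed

lemma u_nonzero: "u \<noteq> 0"
proof
  assume "u = 0"
  then have "\<l> A = 0" using alg mten_zero_left[OF Id_Hom] comp_zero_right[OF m_Hom] unfolding algebra_def by auto
  then have "Id A = 0" using \<l>_inverse[of A] comp_zero_left[OF \<l>inv_Hom, of A] unfolding inverse_pair_def by simp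
  then show False using Id_A_nonzero by simp
qed

lemma Hom_unit_A: assumes f: "f \<in> Hom \<I> A" shows "\<exists>c. f = sc c u"
proof -
  obtain Bs where B: "Bs \<subseteq> Hom \<I> A" "independent Bs" "Hom \<I> A \<subseteq> span Bs" "card Bs = dim (Hom \<I> A)"
    using basis_exists by blast
  then have "card Bs = 1" using conn unfolding hom_dim_def by simp
  then obtain b where b: "Bs = {b}" using card_1_singletonE by blast
  have "u \<in> span {b}" "f \<in> span {b}" using B(3) u_Hom f b by auto
  then obtain c0 c where c0: "u = sc c0 b" and c: "f = sc c b" unfolding span_singleton by auto
  have "c0 \<noteq> 0" using c0 u_nonzero by auto
  then have "f = sc (c / c0) u" using c c0 by simp
  then show ?thesis by blast
qed

lemma word_unit:
  assumes V: "valid V" "sdom V = []" "scod V = [A]" shows "\<exists>c. V = sscale c U"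
proof -
  obtain f where f: "f \<in> Hom \<I> A" "hat \<I> A f = V \<star> lu" using hat_full[of "V \<star> lu" \<I> A] V by auto
  obtain c where "f = sc c u" using Hom_unit_A[OF f(1)] by blast
  then have "V \<star> lu = sscale c (U \<star> lu)" using f hat_sc[OF u_Hom, of c] hat_u by simp
  from arg_cong[OF this, of "\<lambda>h. h \<star> lui"] show ?thesis using V by auto
qed

text \<open>Self-duality of \<open>A\<close> exchanges morphisms into and out of the unit object, so
  that connectedness also makes every morphism from \<open>A\<close> to the unit a multiple of the
  canonical trace.\<close>

lemma word_counit:
  assumes V [simp]: "valid V" "sdom V = [A]" "scod V = []" shows "\<exists>c. V = sscale c E"
proof -
  obtain c where c: "whisk [] V [A] \<star> K = sscale c U" using word_unit[of "whisk [] V [A] \<star> K"] by auto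
  have "V = V \<star> (whisk [A] B [] \<star> whisk [] K [A])" unfolding K_B by simp
  also have "\<dots> = (V \<star> whisk [A] B []) \<star> whisk [] K [A]" by simp
  also have "V \<star> whisk [A] B [] = B \<star> whisk [] V [A, A]"
    using exch[of V B "[]" "[]" "[]", simplified] by simp
  also have "(B \<star> whisk [] V [A, A]) \<star> whisk [] K [A] = B \<star> whisk [] (whisk [] V [A] \<star> K) [A]" by simp
  also have "\<dots> = sscale c (E \<star> (M \<star> whisk [] U [A]))" unfolding c B_def by simp
  also have "\<dots> = sscale c E" unfolding U_left by simp
  finally show ?thesis by blast
qed

text \<open>This is the nonvanishing of the dimension of \<open>A\<close>, phrased as cancellation
  of scalars since words form no vector space. A retraction of \<open>u\<close> is a multiple of the
  canonical trace, so the trace cannot vanish on the unit.\<close>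

lemma E_U_scaled: assumes eq: "sscale c (E \<star> U) = sscale d (E \<star> U)" shows "c = d"
proof -
  obtain r where r: "r \<in> Hom A \<I>" "r \<cdot> u = Id \<I>" using unit_retraction[OF u_Hom u_nonzero] by blast
  let ?R = "lu \<star> hat A \<I> r"
  obtain c' where c': "?R = sscale c' E" using word_counit[of ?R] r(1) by auto
  have "hat \<I> \<I> (r \<cdot> u) = hat A \<I> r \<star> U \<star> lu" using hat_comp[OF u_Hom r(1)] hat_u by simp
  then have "lu \<star> (hat A \<I> r \<star> U \<star> lu) \<star> lui = lu \<star> sid [\<I>] \<star> lui" using r(2) hat_Id by simp
  then have "?R \<star> U = sid []" using r(1) by simp
  then have 1: "sscale c' (E \<star> U) = sid []" unfolding c' by simp
  have "sscale c (sid []) = sscale c' (sscale c (E \<star> U))" unfolding 1[symmetric] by (simp add: mult.commute)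
  also have "\<dots> = sscale d (sid [])" unfolding eq 1[symmetric] by (simp add: mult.commute)
  finally show ?thesis by (rule sscale_sid_eq)
qed

text \<open>By connectedness the product of the two legs of the copairing is a multiple of the unit.
  Applying the canonical trace gives the loop over \<open>A\<close> on both sides, and the factor is
  1. So \<open>A\<close> is a Frobenius algebra whose coproduct splits its product.\<close>

lemma M_K: "M \<star> K = U"
proof -
  obtain c where c: "M \<star> K = sscale c U" using word_unit[of "M \<star> K"] by auto
  have "sscale c (E \<star> U) = B \<star> K" unfolding B_def using c by simp
  also have "\<dots> = sscale 1 (E \<star> U)" using trace_K[of "sid [A]"] E_U by simp
  finally have "c = 1" by (rule E_U_scaled)
  then show ?thesis using c by simp
qed

lemma M_\<Delta>: "M \<star> \<Delta> = sid [A]"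
proof -
  have "M \<star> \<Delta> = (M \<star> whisk [] M [A]) \<star> whisk [A] K []" unfolding \<Delta>_def by simp
  also have "\<dots> = M \<star> whisk [A] (M \<star> K) []" unfolding M_assoc by simp
  also have "\<dots> = sid [A]" unfolding M_K U_right ..
  finally show ?thesis .
qed

lemma sscale_sid_A: "sscale c (sid [A]) = sid [A] \<Longrightarrow> c = 1"
  using sscale_hat_eq[OF Id_Hom Id_A_nonzero, of c 1] by (simp add: hat_Id)

end

text \<open>The copairing is fixed to the one chosen by \<open>comult\<close>.\<close>
locale etale_algebra = braided_fusion_category C s + connected_algebra C s A m u \<kappa>
  for C (structure) and s A m u \<kappa> +
  assumes comm: "m \<cdot> \<beta> A A = m" and \<kappa>_def: "\<kappa> = (SOME \<kappa>. copairing s A m \<kappa>)"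
begin

lemma \<beta>_Hom: "\<beta> X Y \<in> Hom (X \<boxtimes> Y) (Y \<boxtimes> X)" by (rule iso_arr_Hom[OF \<beta>_iso])

section \<open>The braiding in words\<close>

definition "R X Y = al Y X \<star> hat (X \<boxtimes> Y) (Y \<boxtimes> X) (\<beta> X Y) \<star> ali X Y"

lemma R_simps [simp]: "valid (R X Y)" "sdom (R X Y) = [X, Y]" "scod (R X Y) = [Y, X]"
  unfolding R_def using \<beta>_Hom[of X Y] by auto
lemma hat_\<beta>: "hat (X \<boxtimes> Y) (Y \<boxtimes> X) (\<beta> X Y) = ali Y X \<star> R X Y \<star> al X Y"
  unfolding R_def using \<beta>_Hom[of X Y] by simp
lemma hats_\<beta>: "hats (X \<boxtimes> Y) (Y \<boxtimes> X) (\<beta> X Y) (ali Y X \<star> R X Y \<star> al X Y)"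
  unfolding hats_def using hat_\<beta> \<beta>_Hom by simp

lemma R_natural:
  assumes f: "f \<in> Hom X X'" and g: "g \<in> Hom Y Y'"
  shows "R X' Y' \<star> whisk [] (hat X X' f) [Y'] \<star> whisk [X] (hat Y Y' g) []
    = whisk [] (hat Y Y' g) [X'] \<star> whisk [Y] (hat X X' f) [] \<star> R X Y"
proof -
  have "hat (X \<boxtimes> Y) (Y' \<boxtimes> X') (\<beta> X' Y' \<cdot> (f \<otimes> g)) =
    ali Y' X' \<star> R X' Y' \<star> whisk [] (hat X X' f) [Y'] \<star> whisk [X] (hat Y Y' g) [] \<star> al X Y"
    by (rule hat_eqI, (rule hats_ten hats_hat[OF f] hats_hat[OF g] hats_comp hats_\<beta>)+) (use f g in simp)
  moreover have "hat (X \<boxtimes> Y) (Y' \<boxtimes> X') ((g \<otimes> f) \<cdot> \<beta> X Y) =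
    ali Y' X' \<star> whisk [] (hat Y Y' g) [X'] \<star> whisk [Y] (hat X X' f) [] \<star> R X Y \<star> al X Y"
    by (rule hat_eqI, (rule hats_ten hats_hat[OF f] hats_hat[OF g] hats_comp hats_\<beta>)+) (use f g in simp)
  ultimately have "ali Y' X' \<star> R X' Y' \<star> whisk [] (hat X X' f) [Y'] \<star> whisk [X] (hat Y Y' g) [] \<star> al X Y
    = ali Y' X' \<star> whisk [] (hat Y Y' g) [X'] \<star> whisk [Y] (hat X X' f) [] \<star> R X Y \<star> al X Y"
    using \<beta>_natural[OF f g] by simp
  from arg_cong[OF this, of "\<lambda>h. al Y' X' \<star> h \<star> ali X Y"] show ?thesis using f g by simp
qed

lemma R_hexagon: "whisk [] (al Y Z) [X] \<star> R X (Y \<boxtimes> Z) \<star> whisk [X] (ali Y Z) [] = whisk [Y] (R X Z) [] \<star> whisk [] (R X Y) [Z]"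
proof -
  have "hat ((X \<boxtimes> Y) \<boxtimes> Z) (Y \<boxtimes> (Z \<boxtimes> X)) (\<alpha> Y Z X \<cdot> \<beta> X (Y \<boxtimes> Z) \<cdot> \<alpha> X Y Z) =
    ali Y (Z \<boxtimes> X) \<star> whisk [Y] (ali Z X) [] \<star> whisk [] (al Y Z) [X] \<star> R X (Y \<boxtimes> Z) \<star> whisk [X] (ali Y Z) []
      \<star> whisk [] (al X Y) [Z] \<star> al (X \<boxtimes> Y) Z"
    by (rule hat_eqI, (rule hats_rules hats_\<beta>)+) simp
  moreover have "hat ((X \<boxtimes> Y) \<boxtimes> Z) (Y \<boxtimes> (Z \<boxtimes> X)) ((Id Y \<otimes> \<beta> X Z) \<cdot> \<alpha> Y X Z \<cdot> (\<beta> X Y \<otimes> Id Z)) =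
    ali Y (Z \<boxtimes> X) \<star> whisk [Y] (ali Z X) [] \<star> whisk [Y] (R X Z) [] \<star> whisk [] (R X Y) [Z]
      \<star> whisk [] (al X Y) [Z] \<star> al (X \<boxtimes> Y) Z"
    by (rule hat_eqI, (rule hats_rules hats_\<beta>)+) simp
  ultimately have "ali Y (Z \<boxtimes> X) \<star> whisk [Y] (ali Z X) [] \<star> whisk [] (al Y Z) [X] \<star> R X (Y \<boxtimes> Z) \<star> whisk [X] (ali Y Z) []
      \<star> whisk [] (al X Y) [Z] \<star> al (X \<boxtimes> Y) Z
    = ali Y (Z \<boxtimes> X) \<star> whisk [Y] (ali Z X) [] \<star> whisk [Y] (R X Z) [] \<star> whisk [] (R X Y) [Z]
      \<star> whisk [] (al X Y) [Z] \<star> al (X \<boxtimes> Y) Z" using hexagon[of Y Z X] by simp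
  from arg_cong[OF this, of "\<lambda>h. whisk [Y] (al Z X) [] \<star> al Y (Z \<boxtimes> X) \<star> h \<star> ali (X \<boxtimes> Y) Z \<star> whisk [] (ali X Y) [Z]"]
  show ?thesis by simp
qed

lemma R_hexagon_inv: "whisk [Z] (al X Y) [] \<star> R (X \<boxtimes> Y) Z \<star> whisk [] (ali X Y) [Z] = whisk [] (R X Z) [Y] \<star> whisk [X] (R Y Z) []"
proof -
  have "hat (X \<boxtimes> (Y \<boxtimes> Z)) ((Z \<boxtimes> X) \<boxtimes> Y) (\<alpha>inv Z X Y \<cdot> \<beta> (X \<boxtimes> Y) Z \<cdot> \<alpha>inv X Y Z) =
    ali (Z \<boxtimes> X) Y \<star> whisk [] (ali Z X) [Y] \<star> whisk [Z] (al X Y) [] \<star> R (X \<boxtimes> Y) Z \<star> whisk [] (ali X Y) [Z]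
      \<star> whisk [X] (al Y Z) [] \<star> al X (Y \<boxtimes> Z)"
    by (rule hat_eqI, (rule hats_rules hats_\<beta>)+) simp
  moreover have "hat (X \<boxtimes> (Y \<boxtimes> Z)) ((Z \<boxtimes> X) \<boxtimes> Y) ((\<beta> X Z \<otimes> Id Y) \<cdot> \<alpha>inv X Z Y \<cdot> (Id X \<otimes> \<beta> Y Z)) =
    ali (Z \<boxtimes> X) Y \<star> whisk [] (ali Z X) [Y] \<star> whisk [] (R X Z) [Y] \<star> whisk [X] (R Y Z) []
      \<star> whisk [X] (al Y Z) [] \<star> al X (Y \<boxtimes> Z)"
    by (rule hat_eqI, (rule hats_rules hats_\<beta>)+) simp
  ultimately have "ali (Z \<boxtimes> X) Y \<star> whisk [] (ali Z X) [Y] \<star> whisk [Z] (al X Y) [] \<star> R (X \<boxtimes> Y) Z \<star> whisk [] (ali X Y) [Z]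
      \<star> whisk [X] (al Y Z) [] \<star> al X (Y \<boxtimes> Z)
    = ali (Z \<boxtimes> X) Y \<star> whisk [] (ali Z X) [Y] \<star> whisk [] (R X Z) [Y] \<star> whisk [X] (R Y Z) []
      \<star> whisk [X] (al Y Z) [] \<star> al X (Y \<boxtimes> Z)" using hexagon_inv[of Z X Y] by simp
  from arg_cong[OF this, of "\<lambda>h. whisk [] (al Z X) [Y] \<star> al (Z \<boxtimes> X) Y \<star> h \<star> ali X (Y \<boxtimes> Z) \<star> whisk [X] (ali Y Z) []"]
  show ?thesis by simp
qed

abbreviation "RA \<equiv> R A A"

lemma M_R: "M \<star> RA = M"
proof -
  have "hat (A \<boxtimes> A) A (m \<cdot> \<beta> A A) = M \<star> RA \<star> al A A" using hat_comp[OF \<beta>_Hom m_Hom] hat_\<beta> hat_m by simp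
  then have "M \<star> RA \<star> al A A = M \<star> al A A" using comm hat_m by simp
  from arg_cong[OF this, of "\<lambda>h. h \<star> ali A A"] show ?thesis by simp
qed

lemma R_M_left: "RA \<star> whisk [] M [A] = whisk [A] M [] \<star> whisk [] RA [A] \<star> whisk [A] RA []"
proof -
  have n: "RA \<star> whisk [] (hat (A \<boxtimes> A) A m) [A] = whisk [A] (hat (A \<boxtimes> A) A m) [] \<star> R (A \<boxtimes> A) A"
    using R_natural[OF m_Hom Id_Hom[of A]] m_Hom by (simp add: hat_Id)
  have "RA \<star> whisk [] M [A] = (RA \<star> whisk [] (hat (A \<boxtimes> A) A m) [A]) \<star> whisk [] (ali A A) [A]" unfolding M_def by simp
  also have "\<dots> = whisk [A] M [] \<star> (whisk [A] (al A A) [] \<star> R (A \<boxtimes> A) A \<star> whisk [] (ali A A) [A])"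
    unfolding n by (simp add: hat_m)
  finally show ?thesis unfolding R_hexagon_inv .
qed

lemma R_M_right: "RA \<star> whisk [A] M [] = whisk [] M [A] \<star> whisk [A] RA [] \<star> whisk [] RA [A]"
proof -
  have n: "RA \<star> whisk [A] (hat (A \<boxtimes> A) A m) [] = whisk [] (hat (A \<boxtimes> A) A m) [A] \<star> R A (A \<boxtimes> A)"
    using R_natural[OF Id_Hom[of A] m_Hom] m_Hom by (simp add: hat_Id)
  have "RA \<star> whisk [A] M [] = (RA \<star> whisk [A] (hat (A \<boxtimes> A) A m) []) \<star> whisk [A] (ali A A) []" unfolding M_def by simp
  also have "\<dots> = whisk [] M [A] \<star> (whisk [] (al A A) [A] \<star> R A (A \<boxtimes> A) \<star> whisk [A] (ali A A) [])"
    unfolding n by (simp add: hat_m)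
  finally show ?thesis unfolding R_hexagon .
qed

lemma R_D_left:
  assumes D [simp]: "valid D" "sdom D = [A]" "scod D = [A, A]"
  shows "whisk [] D [A] \<star> RA = whisk [A] RA [] \<star> whisk [] RA [A] \<star> whisk [A] D []"
proof -
  obtain f where f: "f \<in> Hom A (A \<boxtimes> A)" "hat A (A \<boxtimes> A) f = ali A A \<star> D" using hat_full[of "ali A A \<star> D" A "A \<boxtimes> A"] by auto
  have n: "R A (A \<boxtimes> A) \<star> whisk [A] (ali A A \<star> D) [] = whisk [] (ali A A \<star> D) [A] \<star> RA"
    using R_natural[OF Id_Hom[of A] f(1)] f by (simp add: hat_Id)
  have "whisk [] D [A] \<star> RA = whisk [] (al A A) [A] \<star> (whisk [] (ali A A \<star> D) [A] \<star> RA)" by simp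
  also have "\<dots> = (whisk [] (al A A) [A] \<star> R A (A \<boxtimes> A) \<star> whisk [A] (ali A A) []) \<star> whisk [A] D []"
    unfolding n[symmetric] by simp
  finally show ?thesis unfolding R_hexagon by simp
qed

lemma R_D_right:
  assumes D [simp]: "valid D" "sdom D = [A]" "scod D = [A, A]"
  shows "whisk [A] D [] \<star> RA = whisk [] RA [A] \<star> whisk [A] RA [] \<star> whisk [] D [A]"
proof -
  obtain f where f: "f \<in> Hom A (A \<boxtimes> A)" "hat A (A \<boxtimes> A) f = ali A A \<star> D" using hat_full[of "ali A A \<star> D" A "A \<boxtimes> A"] by auto
  have n: "R (A \<boxtimes> A) A \<star> whisk [] (ali A A \<star> D) [A] = whisk [A] (ali A A \<star> D) [] \<star> RA"
    using R_natural[OF f(1) Id_Hom[of A]] f by (simp add: hat_Id)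
  have "whisk [A] D [] \<star> RA = whisk [A] (al A A) [] \<star> (whisk [A] (ali A A \<star> D) [] \<star> RA)" by simp
  also have "\<dots> = (whisk [A] (al A A) [] \<star> R (A \<boxtimes> A) A \<star> whisk [] (ali A A) [A]) \<star> whisk [] D [A]"
    unfolding n[symmetric] by simp
  finally show ?thesis unfolding R_hexagon_inv by simp
qed

definition "RAi = al A A \<star> hat (A \<boxtimes> A) (A \<boxtimes> A) (inv_arr (A \<boxtimes> A) (A \<boxtimes> A) (\<beta> A A)) \<star> ali A A"

lemma RAi_simps [simp]: "valid RAi" "sdom RAi = [A, A]" "scod RAi = [A, A]"
  unfolding RAi_def using inv_arr_Hom[OF \<beta>_iso[of A A]] by auto

lemma RA_RAi: "RA \<star> RAi = sid [A, A]"
proof -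
  note i = inv_arr_Hom[OF \<beta>_iso[of A A]]
  have "hat (A \<boxtimes> A) (A \<boxtimes> A) (\<beta> A A) \<star> hat (A \<boxtimes> A) (A \<boxtimes> A) (inv_arr (A \<boxtimes> A) (A \<boxtimes> A) (\<beta> A A)) = sid [A \<boxtimes> A]"
    using hat_comp[OF i \<beta>_Hom] comp_inv_arr[OF \<beta>_iso[of A A]] hat_Id by simp
  from arg_cong[OF this, of "\<lambda>h. al A A \<star> h \<star> ali A A"] show ?thesis
    unfolding R_def RAi_def using i \<beta>_Hom[of A A] by simp
qed

text \<open>\<open>D = RA \<star> \<Delta>\<close> is again a bimodule map splitting the product, and such a map is unique.\<close>
lemma R_\<Delta>: "RA \<star> \<Delta> = \<Delta>"
proof -
  define D where "D = RA \<star> \<Delta>"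
  have D [simp]: "valid D" "sdom D = [A]" "scod D = [A, A]" unfolding D_def by auto
  have cancel: "F = G" if "F \<star> RA = G \<star> RA" "valid F" "valid G" "sdom F = [A, A]" "sdom G = [A, A]" for F G
  proof -
    have "F = (F \<star> RA) \<star> RAi" using RA_RAi that(2-5) by simp
    also have "\<dots> = G" unfolding that(1) using RA_RAi that(2-5) by simp
    finally show ?thesis .
  qed
  have right: "D \<star> M = whisk [A] M [] \<star> whisk [] D [A]"
  proof (rule cancel)
    have "(D \<star> M) \<star> RA = D \<star> M" using M_R by simp
    also have "\<dots> = RA \<star> whisk [] M [A] \<star> whisk [A] \<Delta> []" unfolding D_def using \<Delta>_M_left by simp
    also have "\<dots> = whisk [A] M [] \<star> whisk [] RA [A] \<star> whisk [A] D []" 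
      using tail_eq[OF R_M_left, of "whisk [A] \<Delta> []"] unfolding D_def by simp
    \<comment> \<open>Commutativity inserts a second crossing; the two together carry a strand past
      both legs of \<open>D\<close> and can be pulled through it.\<close>
    also have "\<dots> = whisk [A] (M \<star> RA) [] \<star> whisk [] RA [A] \<star> whisk [A] D []" unfolding M_R ..
    also have "\<dots> = whisk [A] M [] \<star> (whisk [A] RA [] \<star> whisk [] RA [A] \<star> whisk [A] D [])" by simp
    also have "\<dots> = (whisk [A] M [] \<star> whisk [] D [A]) \<star> RA" unfolding R_D_left[OF D, symmetric] by simp
    finally show "(D \<star> M) \<star> RA = (whisk [A] M [] \<star> whisk [] D [A]) \<star> RA" .
  qed auto
  have left: "D \<star> M = whisk [] M [A] \<star> whisk [A] D []"
  proof (rule cancel)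
    have "(D \<star> M) \<star> RA = D \<star> M" using M_R by simp
    also have "\<dots> = RA \<star> whisk [A] M [] \<star> whisk [] \<Delta> [A]" unfolding D_def using \<Delta>_M_right by simp
    also have "\<dots> = whisk [] M [A] \<star> whisk [A] RA [] \<star> whisk [] D [A]" 
      using tail_eq[OF R_M_right, of "whisk [] \<Delta> [A]"] unfolding D_def by simp
    also have "\<dots> = whisk [] (M \<star> RA) [A] \<star> whisk [A] RA [] \<star> whisk [] D [A]" unfolding M_R ..
    also have "\<dots> = whisk [] M [A] \<star> (whisk [] RA [A] \<star> whisk [A] RA [] \<star> whisk [] D [A])" by simp
    also have "\<dots> = (whisk [] M [A] \<star> whisk [A] D []) \<star> RA" unfolding R_D_right[OF D, symmetric] by simp
    finally show "(D \<star> M) \<star> RA = (whisk [] M [A] \<star> whisk [A] D []) \<star> RA" .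
  qed auto
  define k where "k = D \<star> U"
  have k [simp]: "valid k" "sdom k = []" "scod k = [A, A]" unfolding k_def by auto
  have Dk1: "D = whisk [] M [A] \<star> whisk [A] k []"
  proof -
    have "D = (D \<star> M) \<star> whisk [A] U []" using U_right by simp
    then show ?thesis unfolding left k_def by simp
  qed
  have Dk2: "D = whisk [A] M [] \<star> whisk [] k [A]"
  proof -
    have "D = (D \<star> M) \<star> whisk [] U [A]" using U_left by simp
    then show ?thesis unfolding right k_def by simp
  qed
  \<comment> \<open>Connectedness supplies the scalar comparing \<open>D\<close> with
    \<open>\<Delta>\<close>: a leg of \<open>k\<close> capped off by the trace leaves a multiple of
    the unit.\<close>
  obtain c where c: "whisk [] E [A] \<star> k = sscale c U" using word_unit[of "whisk [] E [A] \<star> k"] by auto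
  have "whisk [] B [A] \<star> whisk [A] k [] = whisk [] E [A] \<star> D" unfolding Dk1 B_def by simp
  also have "\<dots> = (whisk [] E [A] \<star> whisk [A] M []) \<star> whisk [] k [A]" unfolding Dk2 by simp
  also have "whisk [] E [A] \<star> whisk [A] M [] = M \<star> whisk [] E [A, A]"
    using exch[of E M "[]" "[]" "[]", simplified] by simp
  also have "(M \<star> whisk [] E [A, A]) \<star> whisk [] k [A] = M \<star> whisk [] (whisk [] E [A] \<star> k) [A]" by simp
  also have "\<dots> = sscale c (sid [A])" unfolding c using U_left by simp
  finally have Bk: "whisk [] B [A] \<star> whisk [A] k [] = sscale c (sid [A])" .
  have "k = (whisk [A] B [A] \<star> whisk [] K [A, A]) \<star> k" using K_B_w[of "[]" "[A]"] by simp
  also have "\<dots> = whisk [A] B [A] \<star> (whisk [] K [A, A] \<star> k)" by simp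
  also have "whisk [] K [A, A] \<star> k = whisk [A, A] k [] \<star> K"
    using exch[of K k "[]" "[]" "[]", simplified] by simp
  also have "whisk [A] B [A] \<star> whisk [A, A] k [] \<star> K = whisk [A] (whisk [] B [A] \<star> whisk [A] k []) [] \<star> K" by simp
  also have "\<dots> = sscale c K" unfolding Bk by simp
  finally have "D = sscale c \<Delta>" unfolding Dk1 \<Delta>_def by simp
  moreover have "M \<star> D = sid [A]" unfolding D_def using tail_eq[OF M_R, of \<Delta>] M_\<Delta> by simp
  ultimately have "c = 1" using M_\<Delta> sscale_sid_A by simp
  with \<open>D = sscale c \<Delta>\<close> show ?thesis unfolding D_def by simp
qed

end

section \<open>The convolution algebra\<close>

context etale_algebra
begin

abbreviation Q where "Q \<equiv> Hom A A"
abbreviation h where "h x \<equiv> hat A A x"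
abbreviation conv (infixl "\<otimes>\<^sub>c" 68) where "x \<otimes>\<^sub>c y \<equiv> convolution s A m x y"
abbreviation \<delta> where "\<delta> \<equiv> comult s A m"

lemma comult_eq: "\<delta> = (m \<otimes> Id A) \<cdot> \<alpha>inv A A A \<cdot> (Id A \<otimes> \<kappa>) \<cdot> \<r>inv A"
  unfolding comult_def \<kappa>_def[symmetric] ..
lemma hats_\<delta>: "hats A (A \<boxtimes> A) \<delta> (ali A A \<star> \<Delta>)"
  unfolding comult_eq by (rule hats_comult_aux)
lemma \<delta>_Hom: "\<delta> \<in> Hom A (A \<boxtimes> A)" by (rule hatsD(2)[OF hats_\<delta>])

lemma conv_Hom: assumes x: "x \<in> Q" and y: "y \<in> Q" shows "x \<otimes>\<^sub>c y \<in> Q"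
  unfolding convolution_def by (rule comp_Hom[OF comp_Hom[OF \<delta>_Hom mten_Hom[OF x y]] m_Hom])
lemma hat_conv: assumes x: "x \<in> Q" and y: "y \<in> Q"
  shows "h (x \<otimes>\<^sub>c y) = M \<star> whisk [] (h x) [A] \<star> whisk [A] (h y) [] \<star> \<Delta>"
  unfolding convolution_def
  by (rule hat_eqI, (rule hats_ten hats_hat[OF x] hats_hat[OF y] hats_comp hats_mu hats_\<delta>)+) (use x y in \<open>simp add: hat_m\<close>)

lemma conv_add: assumes x: "x \<in> Q" and y: "y \<in> Q" and z: "z \<in> Q"
  shows "x \<otimes>\<^sub>c (y + z) = x \<otimes>\<^sub>c y + x \<otimes>\<^sub>c z"
  unfolding convolution_def mten_add_right[OF x y z] comp_add_left[OF \<delta>_Hom mten_Hom[OF x y] mten_Hom[OF x z]]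
  by (rule comp_add_right[OF comp_Hom[OF \<delta>_Hom mten_Hom[OF x y]] comp_Hom[OF \<delta>_Hom mten_Hom[OF x z]] m_Hom])
lemma conv_sc: assumes x: "x \<in> Q" and y: "y \<in> Q"
  shows "x \<otimes>\<^sub>c sc c y = sc c (x \<otimes>\<^sub>c y)"
  unfolding convolution_def mten_sc_right[OF x y] comp_sc_left[OF \<delta>_Hom mten_Hom[OF x y]]
  by (rule comp_sc_right[OF comp_Hom[OF \<delta>_Hom mten_Hom[OF x y]] m_Hom])

lemma conv_comm: assumes x: "x \<in> Q" and y: "y \<in> Q" shows "x \<otimes>\<^sub>c y = y \<otimes>\<^sub>c x"
proof (rule hat_inj[OF conv_Hom[OF x y] conv_Hom[OF y x]])
  have "h (x \<otimes>\<^sub>c y) = M \<star> (RA \<star> whisk [] (h x) [A] \<star> whisk [A] (h y) []) \<star> \<Delta>"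
    unfolding hat_conv[OF x y] using tail_eq[OF M_R, of "whisk [] (h x) [A] \<star> whisk [A] (h y) [] \<star> \<Delta>"] by simp
  also have "\<dots> = M \<star> (whisk [] (h y) [A] \<star> whisk [A] (h x) []) \<star> (RA \<star> \<Delta>)"
    unfolding R_natural[OF x y] by simp
  also have "\<dots> = h (y \<otimes>\<^sub>c x)" unfolding R_\<Delta> hat_conv[OF y x] by simp
  finally show "h (x \<otimes>\<^sub>c y) = h (y \<otimes>\<^sub>c x)" .
qed

lemma word_conv_assoc:
  assumes [simp]: "valid X" "sdom X = [A]" "scod X = [A]" "valid Y" "sdom Y = [A]" "scod Y = [A]" "valid Z" "sdom Z = [A]" "scod Z = [A]"
  shows "M \<star> whisk [] (M \<star> whisk [] X [A] \<star> whisk [A] Y [] \<star> \<Delta>) [A] \<star> whisk [A] Z [] \<star> \<Delta>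
    = M \<star> whisk [] X [A] \<star> whisk [A] (M \<star> whisk [] Y [A] \<star> whisk [A] Z [] \<star> \<Delta>) [] \<star> \<Delta>"
proof -
  have i1: "whisk [] \<Delta> [A] \<star> whisk [A] Z [] = whisk [A, A] Z [] \<star> whisk [] \<Delta> [A]"
    using exch[of \<Delta> Z "[]" "[]" "[]", simplified] by simp
  have i2: "whisk [] X [A] \<star> whisk [A] M [] = whisk [A] M [] \<star> whisk [] X [A, A]"
    using exch[of X M "[]" "[]" "[]", simplified] by simp
  have "M \<star> whisk [] (M \<star> whisk [] X [A] \<star> whisk [A] Y [] \<star> \<Delta>) [A] \<star> whisk [A] Z [] \<star> \<Delta>
    = (M \<star> whisk [] M [A]) \<star> whisk [] X [A, A] \<star> whisk [A] Y [A] \<star> (whisk [] \<Delta> [A] \<star> whisk [A] Z []) \<star> \<Delta>" by simp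
  also have "\<dots> = M \<star> (whisk [A] M [] \<star> whisk [] X [A, A]) \<star> whisk [A] Y [A] \<star> whisk [A, A] Z [] \<star> (whisk [] \<Delta> [A] \<star> \<Delta>)"
    unfolding i1 M_assoc by simp
  also have "\<dots> = M \<star> whisk [] X [A] \<star> whisk [A] (M \<star> whisk [] Y [A] \<star> whisk [A] Z [] \<star> \<Delta>) [] \<star> \<Delta>"
    unfolding i2[symmetric] \<Delta>_coassoc by simp
  finally show ?thesis .
qed

lemma conv_assoc: assumes x: "x \<in> Q" and y: "y \<in> Q" and z: "z \<in> Q"
  shows "(x \<otimes>\<^sub>c y) \<otimes>\<^sub>c z = x \<otimes>\<^sub>c (y \<otimes>\<^sub>c z)"
proof (rule hat_inj)
  show "h ((x \<otimes>\<^sub>c y) \<otimes>\<^sub>c z) = h (x \<otimes>\<^sub>c (y \<otimes>\<^sub>c z))"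
    unfolding hat_conv[OF conv_Hom[OF x y] z] hat_conv[OF x conv_Hom[OF y z]] hat_conv[OF x y] hat_conv[OF y z]
    by (rule word_conv_assoc) (use x y z in auto)
qed (intro conv_Hom x y z)+

section \<open>The unit of the convolution and the linear form \<open>lam\<close>\<close>

definition e where "e = u \<cdot> \<epsilon>"
lemma e_Hom: "e \<in> Q" unfolding e_def by (rule comp_Hom[OF \<epsilon>_Hom u_Hom])
lemma hat_e: "h e = U \<star> E" unfolding e_def hat_comp[OF \<epsilon>_Hom u_Hom] hat_u hat_\<epsilon> by simp

lemma conv_unit: assumes x: "x \<in> Q" shows "e \<otimes>\<^sub>c x = x"
proof (rule hat_inj[OF conv_Hom[OF e_Hom x] x])
  have "h (e \<otimes>\<^sub>c x) = M \<star> whisk [] U [A] \<star> (whisk [] E [A] \<star> whisk [A] (h x) []) \<star> \<Delta>"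
    unfolding hat_conv[OF e_Hom x] hat_e by simp
  also have "whisk [] E [A] \<star> whisk [A] (h x) [] = h x \<star> whisk [] E [A]"
    using exch[of E "h x" "[]" "[]" "[]", simplified] x by simp
  also have "M \<star> whisk [] U [A] \<star> (h x \<star> whisk [] E [A]) \<star> \<Delta> = (M \<star> whisk [] U [A]) \<star> h x \<star> (whisk [] E [A] \<star> \<Delta>)" by simp
  also have "\<dots> = h x" unfolding U_left E_\<Delta> using x by simp
  finally show "h (e \<otimes>\<^sub>c x) = h x" .
qed

lemma \<epsilon>_u: "\<epsilon> \<cdot> u = sc (qdim s A) (Id \<I>)"
proof -
  have "hat \<I> \<I> (\<epsilon> \<cdot> u) = lui \<star> (E \<star> U) \<star> lu" unfolding hat_comp[OF u_Hom \<epsilon>_Hom] hat_\<epsilon> hat_u by simp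
  also have "\<dots> = hat \<I> \<I> (trace_right s A (Id A))" unfolding E_U trace_word(2)[OF Id_Hom] hat_Id by simp
  finally have "\<epsilon> \<cdot> u = trace_right s A (Id A)" by (rule hat_inj[OF comp_Hom[OF u_Hom \<epsilon>_Hom] trace_word(1)[OF Id_Hom]])
  then show ?thesis using trace_tr[OF Id_Hom] qdim_tr by simp
qed

lemma qdim_nonzero: "qdim s A \<noteq> 0"
proof
  assume z: "qdim s A = 0"
  have "hat \<I> \<I> (\<epsilon> \<cdot> u) = lui \<star> (E \<star> U) \<star> lu" unfolding hat_comp[OF u_Hom \<epsilon>_Hom] hat_\<epsilon> hat_u by simp
  moreover have "hat \<I> \<I> (\<epsilon> \<cdot> u) = sscale 0 (sid [\<I>])" unfolding \<epsilon>_u z hat_sc[OF Id_Hom] hat_Id ..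
  ultimately have "lui \<star> (E \<star> U) \<star> lu = sscale 0 (sid [\<I>])" by simp
  from arg_cong[OF this, of "\<lambda>f. lu \<star> f \<star> lui"] have 0: "E \<star> U = sscale 0 (sid [])" by simp
  have "sscale 0 (E \<star> U) = sscale 1 (E \<star> U)" unfolding 0 by simp
  then have "(0 :: 'a) = 1" by (rule E_U_scaled)
  then show False by simp
qed

lemma e_nonzero: "e \<noteq> 0"
proof
  assume "e = 0"
  then have "\<epsilon> \<cdot> (u \<cdot> \<epsilon>) \<cdot> u = 0" unfolding e_def[symmetric] using comp_zero_left[OF u_Hom] comp_zero_right[OF \<epsilon>_Hom] by simp
  then have "(\<epsilon> \<cdot> u) \<cdot> (\<epsilon> \<cdot> u) = 0"
    using comp_assoc[OF u_Hom \<epsilon>_Hom u_Hom] comp_assoc[OF comp_Hom[OF u_Hom \<epsilon>_Hom] u_Hom \<epsilon>_Hom] by simp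
  then show False unfolding \<epsilon>_u using comp_sc_left[OF sc_Hom[OF Id_Hom] Id_Hom] comp_sc_right[OF Id_Hom Id_Hom] comp_Id_left[OF Id_Hom]
     qdim_nonzero Id_unit_nonzero by simp
qed

definition lam where "lam x = (THE c. \<epsilon> \<cdot> x = sc c \<epsilon>)"

lemma \<epsilon>_nonzero: "\<epsilon> \<noteq> 0"
  using e_nonzero comp_zero_right[OF u_Hom] unfolding e_def by auto

lemma \<epsilon>_lam: assumes x: "x \<in> Q" shows "\<epsilon> \<cdot> x = sc (lam x) \<epsilon>"
proof -
  obtain c where c: "E \<star> h x = sscale c E" using word_counit[of "E \<star> h x"] x by auto
  have "hat A \<I> (\<epsilon> \<cdot> x) = hat A \<I> (sc c \<epsilon>)" unfolding hat_comp[OF x \<epsilon>_Hom] hat_sc[OF \<epsilon>_Hom] hat_\<epsilon> using c by simp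
  then have c: "\<epsilon> \<cdot> x = sc c \<epsilon>" by (rule hat_inj[OF comp_Hom[OF x \<epsilon>_Hom] sc_Hom[OF \<epsilon>_Hom]])
  moreover have "c' = c" if "\<epsilon> \<cdot> x = sc c' \<epsilon>" for c' using that c \<epsilon>_nonzero by simp
  ultimately have "lam x = c" unfolding lam_def by blast
  with c show ?thesis by simp
qed

lemma lam_eqI: "x \<in> Q \<Longrightarrow> \<epsilon> \<cdot> x = sc c \<epsilon> \<Longrightarrow> lam x = c"
  using \<epsilon>_lam[of x] \<epsilon>_nonzero by simp

lemma word_lam: assumes x: "x \<in> Q" shows "E \<star> h x = sscale (lam x) E"
proof -
  have "hat A \<I> (\<epsilon> \<cdot> x) = hat A \<I> (sc (lam x) \<epsilon>)" using \<epsilon>_lam[OF x] by simp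
  then have "lui \<star> E \<star> h x = sscale (lam x) (lui \<star> E)" unfolding hat_comp[OF x \<epsilon>_Hom] hat_sc[OF \<epsilon>_Hom] hat_\<epsilon> by simp
  from arg_cong[OF this, of "\<lambda>f. lu \<star> f"] show ?thesis using x by simp
qed

lemma lam_add: assumes x: "x \<in> Q" and y: "y \<in> Q" shows "lam (x + y) = lam x + lam y"
  by (rule lam_eqI[OF add_Hom[OF x y]])
    (simp add: comp_add_right[OF x y \<epsilon>_Hom] \<epsilon>_lam[OF x] \<epsilon>_lam[OF y] scale_left_distrib)
lemma lam_zero: "lam 0 = 0"
  by (rule lam_eqI[OF zero_Hom]) (simp add: comp_zero_right[OF \<epsilon>_Hom])
lemma lam_sum: "finite S \<Longrightarrow> S \<subseteq> Q \<Longrightarrow> lam (\<Sum>S) = (\<Sum>x\<in>S. lam x)"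
proof (induction S rule: finite_induct)
  case (insert x S)
  then show ?case using lam_add[of x "\<Sum>S"] sum_Hom[of S "\<lambda>x. x" A A] by auto
qed (simp add: lam_zero)
lemma lam_sc: assumes x: "x \<in> Q" shows "lam (sc c x) = c * lam x"
  by (rule lam_eqI[OF sc_Hom[OF x]]) (simp add: comp_sc_right[OF x \<epsilon>_Hom] \<epsilon>_lam[OF x])

lemma lam_e: "lam e = qdim s A"
proof (rule lam_eqI[OF e_Hom])
  show "\<epsilon> \<cdot> e = sc (qdim s A) \<epsilon>" unfolding e_def
    using comp_assoc[OF \<epsilon>_Hom u_Hom \<epsilon>_Hom] \<epsilon>_u comp_sc_left[OF \<epsilon>_Hom Id_Hom] comp_Id_left[OF \<epsilon>_Hom] by simp
qed

lemma lam_trace: assumes x: "x \<in> Q" and eq: "E \<star> h x \<star> U = etw A \<star> whisk [] (h y) [Dual A] \<star> cow A" and y: "y \<in> Q"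
  shows "lam x * qdim s A = tr A y"
proof (rule tr_eqI[symmetric])
  have "hat \<I> \<I> (trace_right s A y) = lui \<star> (E \<star> h x \<star> U) \<star> lu" unfolding trace_word(2)[OF y] eq by simp
  also have "\<dots> = hat \<I> \<I> ((\<epsilon> \<cdot> x) \<cdot> u)"
    unfolding hat_comp[OF u_Hom comp_Hom[OF x \<epsilon>_Hom]] hat_comp[OF x \<epsilon>_Hom] hat_\<epsilon> hat_u using x by simp
  finally have "trace_right s A y = (\<epsilon> \<cdot> x) \<cdot> u"
    by (rule hat_inj[OF trace_word(1)[OF y] comp_Hom[OF u_Hom comp_Hom[OF x \<epsilon>_Hom]]])
  then show "trace_right s A y = sc (lam x * qdim s A) (Id \<I>)"
    unfolding \<epsilon>_lam[OF x] using comp_sc_left[OF u_Hom \<epsilon>_Hom] \<epsilon>_u by simp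
qed

text \<open>The adjoint of \<open>X\<close> for the trace pairing, as \<open>B_Tw\<close>
  shows.\<close>

definition "Tw X = whisk [A] B [] \<star> whisk [A] X [A] \<star> whisk [] K [A]"
lemma Tw_simps [simp]: "valid X \<Longrightarrow> sdom X = [A] \<Longrightarrow> scod X = [A] \<Longrightarrow> valid (Tw X) \<and> sdom (Tw X) = [A] \<and> scod (Tw X) = [A]"
  unfolding Tw_def by auto

lemma B_Tw: assumes [simp]: "valid X" "sdom X = [A]" "scod X = [A]"
  shows "B \<star> whisk [A] (Tw X) [] = B \<star> whisk [] X [A]"
proof -
  have "B \<star> whisk [A] (Tw X) [] = (B \<star> whisk [A, A] B []) \<star> whisk [A, A] X [A] \<star> whisk [A] K [A]" unfolding Tw_def by simp
  also have "B \<star> whisk [A, A] B [] = B \<star> whisk [] B [A, A]"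
    using exch[of B B "[]" "[]" "[]", simplified] by simp
  also have "(B \<star> whisk [] B [A, A]) \<star> whisk [A, A] X [A] \<star> whisk [A] K [A]
    = B \<star> (whisk [] B [A, A] \<star> whisk [A, A] X [A]) \<star> whisk [A] K [A]" by simp
  also have "whisk [] B [A, A] \<star> whisk [A, A] X [A] = whisk [] X [A] \<star> whisk [] B [A, A]"
    using exch[of B X "[]" "[]" "[A]", simplified] by simp
  also have "B \<star> (whisk [] X [A] \<star> whisk [] B [A, A]) \<star> whisk [A] K [A] = B \<star> whisk [] X [A] \<star> whisk [] (whisk [] B [A] \<star> whisk [A] K []) [A]" by simp
  also have "\<dots> = B \<star> whisk [] X [A]" unfolding B_K by simp
  finally show ?thesis .
qed

text \<open>The bridge between convolution and composition. In elements, with Y' the adjoint of Y,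
  the left side is the sum of b(X(e_i), Y'(f_i)) = b(Y(X(e_i)), f_i), and this sum is the trace of
  the composite by \<open>trace_K\<close>.\<close>

lemma conv_trace_word:
  assumes [simp]: "valid X" "sdom X = [A]" "scod X = [A]" "valid Y" "sdom Y = [A]" "scod Y = [A]"
  shows "E \<star> (M \<star> whisk [] X [A] \<star> whisk [A] (Tw Y) [] \<star> \<Delta>) \<star> U = etw A \<star> whisk [] (Y \<star> X) [Dual A] \<star> cow A"
proof -
  have "E \<star> (M \<star> whisk [] X [A] \<star> whisk [A] (Tw Y) [] \<star> \<Delta>) \<star> U = B \<star> (whisk [] X [A] \<star> whisk [A] (Tw Y) []) \<star> K"
    unfolding B_def using \<Delta>_U by simp
  also have "whisk [] X [A] \<star> whisk [A] (Tw Y) [] = whisk [A] (Tw Y) [] \<star> whisk [] X [A]"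
    using exch[of X "Tw Y" "[]" "[]" "[]", simplified] by simp
  also have "B \<star> (whisk [A] (Tw Y) [] \<star> whisk [] X [A]) \<star> K = (B \<star> whisk [A] (Tw Y) []) \<star> whisk [] X [A] \<star> K" by simp
  also have "\<dots> = B \<star> whisk [] (Y \<star> X) [A] \<star> K" unfolding B_Tw[OF assms(4-6)] by simp
  also have "\<dots> = etw A \<star> whisk [] (Y \<star> X) [Dual A] \<star> cow A" by (rule trace_K[symmetric]) auto
  finally show ?thesis .
qed

lemma transpose_exists: assumes y: "y \<in> Q" obtains y' where "y' \<in> Q" "h y' = Tw (h y)"
  using hat_full[of "Tw (h y)" A A] y by auto

lemma lam_conv: assumes y: "y \<in> Q"
  obtains y' where "y' \<in> Q" "h y' = Tw (h y)" "\<And>x. x \<in> Q \<Longrightarrow> lam (x \<otimes>\<^sub>c y') * qdim s A = tr A (y \<cdot> x)"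
proof -
  obtain y' where y': "y' \<in> Q" "h y' = Tw (h y)" using transpose_exists[OF y] by blast
  have "lam (x \<otimes>\<^sub>c y') * qdim s A = tr A (y \<cdot> x)" if x: "x \<in> Q" for x
    by (rule lam_trace[OF conv_Hom[OF x y'(1)] _ comp_Hom[OF x y]])
      (unfold hat_conv[OF x y'(1)] y'(2) hat_comp[OF x y], rule conv_trace_word, use x y in auto)
  then show ?thesis using that y' by blast
qed

lemma Tw_sid: "Tw (sid [A]) = sid [A]"
  unfolding Tw_def using K_B by simp

text \<open>The identity is its own adjoint, so convolution with \<open>Id A\<close> computes the
  trace. This makes the trace of a nontrivial automorphism accessible.\<close>

lemma lam_conv_Id: assumes x: "x \<in> Q" shows "lam (x \<otimes>\<^sub>c Id A) * qdim s A = tr A x"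
proof -
  obtain y' where y': "y' \<in> Q" "h y' = Tw (h (Id A))" "\<And>x. x \<in> Q \<Longrightarrow> lam (x \<otimes>\<^sub>c y') * qdim s A = tr A (Id A \<cdot> x)"
    using lam_conv[OF Id_Hom] by blast
  have "h y' = h (Id A)" using y'(2) hat_Id Tw_sid by simp
  then have "y' = Id A" by (rule hat_inj[OF y'(1) Id_Hom])
  then show ?thesis using y'(3)[OF x] comp_Id_left[OF x] by simp
qed

text \<open>Up to the factor \<open>qdim s A\<close> and an adjoint in one argument, this form is
  the trace form for composition, whose nondegeneracy is \<open>tr_nondegenerate\<close>.\<close>

lemma lam_nondegenerate: assumes x: "x \<in> Q" "x \<noteq> 0" shows "\<exists>y\<in>Q. lam (x \<otimes>\<^sub>c y) \<noteq> 0"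
proof -
  obtain k where k: "k \<in> Q" "tr A (k \<cdot> x) = 1" using tr_nondegenerate[OF x] by blast
  obtain y where y: "y \<in> Q" "lam (x \<otimes>\<^sub>c y) * qdim s A = tr A (k \<cdot> x)" using lam_conv[OF k(1)] x(1) by metis
  have "lam (x \<otimes>\<^sub>c y) \<noteq> 0"
  proof
    assume "lam (x \<otimes>\<^sub>c y) = 0"
    then show False using y(2) k(2) by simp
  qed
  then show ?thesis using y(1) by blast
qed

text \<open>The endomorphism \<open>a \<otimes> b \<mapsto> \<Sum> a e\<^sub>i \<otimes> x(f\<^sub>i) b\<close> of \<open>A \<boxtimes> A\<close>, where \<open>\<kappa> = \<Sum> e\<^sub>i \<otimes> f\<^sub>i\<close>.\<close>
definition P where "P x = (Id A \<otimes> m) \<cdot> \<alpha> A A A \<cdot> ((Id A \<otimes> x) \<otimes> Id A) \<cdot> (\<delta> \<otimes> Id A)"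
definition "Pw X = whisk [A] M [] \<star> whisk [A] X [A] \<star> whisk [] \<Delta> [A]"

lemma Pw_simps [simp]: "valid X \<Longrightarrow> sdom X = [A] \<Longrightarrow> scod X = [A] \<Longrightarrow> valid (Pw X) \<and> sdom (Pw X) = [A, A] \<and> scod (Pw X) = [A, A]"
  unfolding Pw_def by auto

lemma assumes x: "x \<in> Q" shows P_Hom: "P x \<in> Hom (A \<boxtimes> A) (A \<boxtimes> A)"
  and hat_P: "hat (A \<boxtimes> A) (A \<boxtimes> A) (P x) = ali A A \<star> Pw (h x) \<star> al A A"
proof -
  show "P x \<in> Hom (A \<boxtimes> A) (A \<boxtimes> A)" unfolding P_def
    by (rule hatsD(2), (rule hats_\<alpha> hats_ten hats_Id hats_hat[OF x] hats_comp hats_mu hats_\<delta>)+)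
  show "hat (A \<boxtimes> A) (A \<boxtimes> A) (P x) = ali A A \<star> Pw (h x) \<star> al A A" unfolding P_def Pw_def
    by (rule hat_eqI, (rule hats_\<alpha> hats_ten hats_Id hats_hat[OF x] hats_comp hats_mu hats_\<delta>)+) (use x in \<open>simp add: hat_m\<close>)
qed

lemma Pw_comp:
  assumes [simp]: "valid X" "sdom X = [A]" "scod X = [A]" "valid Y" "sdom Y = [A]" "scod Y = [A]"
  shows "Pw X \<star> Pw Y = Pw (M \<star> whisk [] X [A] \<star> whisk [A] Y [] \<star> \<Delta>)"
proof -
  have i1: "whisk [] \<Delta> [A] \<star> whisk [A] M [] = whisk [A, A] M [] \<star> whisk [] \<Delta> [A, A]"
    using exch[of \<Delta> M "[]" "[]" "[]", simplified] by simp
  have i2: "whisk [A] X [A] \<star> whisk [A, A] M [] = whisk [A, A] M [] \<star> whisk [A] X [A, A]"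
    using exch[of X M "[A]" "[]" "[]", simplified] by simp
  have i3: "whisk [] \<Delta> [A, A] \<star> whisk [A] Y [A] = whisk [A, A] Y [A] \<star> whisk [] \<Delta> [A, A]"
    using exch[of \<Delta> Y "[]" "[]" "[A]", simplified] by simp
  have "Pw X \<star> Pw Y = whisk [A] M [] \<star> whisk [A] X [A] \<star> (whisk [] \<Delta> [A] \<star> whisk [A] M []) \<star> whisk [A] Y [A] \<star> whisk [] \<Delta> [A]"
    unfolding Pw_def by simp
  also have "\<dots> = whisk [A] M [] \<star> (whisk [A] X [A] \<star> whisk [A, A] M []) \<star> (whisk [] \<Delta> [A, A] \<star> whisk [A] Y [A]) \<star> whisk [] \<Delta> [A]"
    unfolding i1 by simp
  also have "\<dots> = whisk [A] (M \<star> whisk [A] M []) [] \<star> whisk [A] X [A, A] \<star> whisk [A, A] Y [A] \<star> whisk [] (whisk [] \<Delta> [A] \<star> \<Delta>) [A]"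
    unfolding i2 i3 by simp
  also have "\<dots> = Pw (M \<star> whisk [] X [A] \<star> whisk [A] Y [] \<star> \<Delta>)"
    unfolding M_assoc[symmetric] \<Delta>_coassoc Pw_def by simp
  finally show ?thesis .
qed

lemma P_comp: assumes x: "x \<in> Q" and y: "y \<in> Q" shows "P x \<cdot> P y = P (x \<otimes>\<^sub>c y)"
proof (rule hat_inj[OF comp_Hom[OF P_Hom[OF y] P_Hom[OF x]] P_Hom[OF conv_Hom[OF x y]]])
  have e: "Pw (h x) \<star> Pw (h y) = Pw (h (x \<otimes>\<^sub>c y))"
    unfolding hat_conv[OF x y] by (rule Pw_comp) (use x y in auto)
  show "hat (A \<boxtimes> A) (A \<boxtimes> A) (P x \<cdot> P y) = hat (A \<boxtimes> A) (A \<boxtimes> A) (P (x \<otimes>\<^sub>c y))"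
    unfolding hat_comp[OF P_Hom[OF y] P_Hom[OF x]] hat_P[OF x] hat_P[OF y] hat_P[OF conv_Hom[OF x y]]
    using x y tail_eq[OF e, of "al A A"] by simp
qed

lemma P_zero: "P 0 = 0"
proof -
  have "hat (A \<boxtimes> A) (A \<boxtimes> A) (P 0) = ali A A \<star> Pw (h (sc 0 0)) \<star> al A A" using hat_P[OF zero_Hom] by simp
  also have "\<dots> = sscale 0 (ali A A \<star> Pw (h 0) \<star> al A A)" unfolding hat_sc[OF zero_Hom] Pw_def by simp
  also have "\<dots> = hat (A \<boxtimes> A) (A \<boxtimes> A) (sc 0 (P 0))" unfolding hat_sc[OF P_Hom[OF zero_Hom]] hat_P[OF zero_Hom] ..
  finally have "P 0 = sc 0 (P 0)" by (rule hat_inj[OF P_Hom[OF zero_Hom] sc_Hom[OF P_Hom[OF zero_Hom]]])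
  then show ?thesis by simp
qed

text \<open>Closing the second strand turns \<open>P x\<close> into the coproduct followed by
  \<open>E \<star> h x\<close> on its second leg, which is \<open>lam x\<close> times the identity
  of \<open>A\<close> by the counit law. The remaining loop over the first strand contributes the
  dimension.\<close>

lemma P_trace: assumes x: "x \<in> Q" shows "tr (A \<boxtimes> A) (P x) = lam x * qdim s A"
proof (rule tr_eqI)
  let ?D = "Dual A"
  define X where "X = h x"
  have [simp]: "valid X" "sdom X = [A]" "scod X = [A]" unfolding X_def using x by auto
  have "whisk [A] (etw A) [] \<star> whisk [] (Pw X) [?D] \<star> whisk [A] (cow A) []
    = whisk [A] (etw A) [] \<star> whisk [A] M [?D] \<star> whisk [A] X [A, ?D] \<star> (whisk [] \<Delta> [A, ?D] \<star> whisk [A] (cow A) [])"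
    unfolding Pw_def by simp
  also have "whisk [] \<Delta> [A, ?D] \<star> whisk [A] (cow A) [] = whisk [A, A] (cow A) [] \<star> \<Delta>"
    using exch[of \<Delta> "cow A" "[]" "[]" "[]", simplified] by simp
  also have "whisk [A] (etw A) [] \<star> whisk [A] M [?D] \<star> whisk [A] X [A, ?D] \<star> whisk [A, A] (cow A) [] \<star> \<Delta>
    = whisk [A] (etw A) [] \<star> whisk [A] M [?D] \<star> (whisk [A] X [A, ?D] \<star> whisk [A, A] (cow A) []) \<star> \<Delta>" by simp
  also have "whisk [A] X [A, ?D] \<star> whisk [A, A] (cow A) [] = whisk [A, A] (cow A) [] \<star> whisk [A] X []"
    using exch[of X "cow A" "[A]" "[]" "[]", simplified] by simp
  also have "whisk [A] (etw A) [] \<star> whisk [A] M [?D] \<star> (whisk [A, A] (cow A) [] \<star> whisk [A] X []) \<star> \<Delta>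
    = whisk [A] (E \<star> X) [] \<star> \<Delta>" unfolding E_def by simp
  also have "\<dots> = sscale (lam x) (whisk [A] E [] \<star> \<Delta>)" unfolding X_def word_lam[OF x] by simp
  also have "\<dots> = sscale (lam x) (sid [A])" unfolding E_\<Delta>(2) ..
  finally have 1: "whisk [A] (etw A) [] \<star> whisk [] (Pw X) [?D] \<star> whisk [A] (cow A) [] = sscale (lam x) (sid [A])" .
  have "hat \<I> \<I> (trace_right s (A \<boxtimes> A) (P x)) = lui \<star> etw2 A A \<star> whisk [] (Pw X) [?D, ?D] \<star> cow2 A A \<star> lu"
    unfolding trace_ten_word[OF P_Hom[OF x]] hat_P[OF x] X_def using x by simp
  also have "\<dots> = lui \<star> etw A \<star> whisk [] (whisk [A] (etw A) [] \<star> whisk [] (Pw X) [?D] \<star> whisk [A] (cow A) []) [?D] \<star> cow A \<star> lu"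
    unfolding etw2_def cow2_def by simp
  also have "\<dots> = sscale (lam x) (hat \<I> \<I> (trace_right s A (Id A)))" unfolding 1 trace_word(2)[OF Id_Hom] hat_Id by simp
  also have "\<dots> = hat \<I> \<I> (sc (lam x) (trace_right s A (Id A)))" by (rule hat_sc[OF trace_word(1)[OF Id_Hom], symmetric])
  finally have "trace_right s (A \<boxtimes> A) (P x) = sc (lam x) (trace_right s A (Id A))"
    by (rule hat_inj[OF trace_word(1)[OF P_Hom[OF x]] sc_Hom[OF trace_word(1)[OF Id_Hom]]])
  then show "trace_right s (A \<boxtimes> A) (P x) = sc (lam x * qdim s A) (Id \<I>)"
    using trace_tr[OF Id_Hom, of A] qdim_tr by simp
qed

text \<open>If \<open>x\<close> squares to zero, so does every multiple
  \<open>x \<otimes>\<^sub>c y\<close>. Its action \<open>P\<close> on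
  \<open>A \<boxtimes> A\<close> then squares to zero and has trace zero, so that \<open>lam\<close>
  vanishes on all multiples of \<open>x\<close>, against nondegeneracy.\<close>

lemma conv_reduced: assumes x: "x \<in> Q" and sq: "x \<otimes>\<^sub>c x = 0" shows "x = 0"
proof (rule ccontr)
  assume "x \<noteq> 0"
  then obtain y where y: "y \<in> Q" "lam (x \<otimes>\<^sub>c y) \<noteq> 0" using lam_nondegenerate[OF x] by blast
  let ?z = "x \<otimes>\<^sub>c y"
  note z = conv_Hom[OF x y(1)]
  have "?z \<otimes>\<^sub>c ?z = x \<otimes>\<^sub>c (y \<otimes>\<^sub>c ?z)" by (rule conv_assoc[OF x y(1) z])
  also have "y \<otimes>\<^sub>c ?z = ?z \<otimes>\<^sub>c y" by (rule conv_comm[OF y(1) z])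
  also have "\<dots> = x \<otimes>\<^sub>c (y \<otimes>\<^sub>c y)" by (rule conv_assoc[OF x y(1) y(1)])
  also have "x \<otimes>\<^sub>c (x \<otimes>\<^sub>c (y \<otimes>\<^sub>c y)) = (x \<otimes>\<^sub>c x) \<otimes>\<^sub>c (y \<otimes>\<^sub>c y)" by (rule conv_assoc[OF x x conv_Hom[OF y(1) y(1)], symmetric])
  also have "\<dots> = 0"
    unfolding sq using conv_comm[OF zero_Hom conv_Hom[OF y(1) y(1)]] conv_sc[OF conv_Hom[OF y(1) y(1)] zero_Hom, of 0] by simp
  finally have "P ?z \<cdot> P ?z = 0" using P_comp[OF z z] P_zero by simp
  then have "tr (A \<boxtimes> A) (P ?z) = 0" by (rule tr_square_zero[OF P_Hom[OF z]])
  then show False using P_trace[OF z] y(2) qdim_nonzero by simp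
qed

end

section \<open>Minimal idempotents and automorphisms\<close>

context etale_algebra
begin

lemma conv_reduced_algebra: "\<exists>T. reduced_algebra sc Q T (convolution s A m) e"
proof -
  obtain T where T: "finite T" "Q \<subseteq> span T" using Hom_finite by blast
  have "reduced_algebra sc Q T (convolution s A m) e"
    by unfold_locales (fact subspace_Hom T conv_Hom e_Hom e_nonzero conv_add conv_sc conv_comm conv_assoc conv_unit conv_reduced)+
  then show ?thesis by blast
qed

abbreviation minidems where "minidems \<equiv> minimal_idempotents s A m"

lemma minidems_facts:
  shows minidems_finite: "finite minidems" and minidems_sum: "\<Sum>minidems = e" and minidems_card: "hom_dim A A = card minidems"
    and minidems_scalar: "\<And>p x. p \<in> minidems \<Longrightarrow> x \<in> Q \<Longrightarrow> \<exists>c. p \<otimes>\<^sub>c x = sc c p"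
proof -
  obtain T where "reduced_algebra sc Q T (convolution s A m) e" using conv_reduced_algebra by blast
  then interpret ra: reduced_algebra sc Q T "convolution s A m" e .
  have eq: "ra.minidem = minidems"
    unfolding ra.minidem_def minimal_idempotents_def ra.idem_def conv_idempotents_def ..
  show "finite minidems" using ra.minidem_finite unfolding eq .
  show "\<Sum>minidems = e" using ra.minidem_sum unfolding eq .
  show "hom_dim A A = card minidems" using ra.dim_minidem unfolding eq hom_dim_def .
  show "\<And>p x. p \<in> minidems \<Longrightarrow> x \<in> Q \<Longrightarrow> \<exists>c. p \<otimes>\<^sub>c x = sc c p" using ra.minidem_scalar unfolding eq .
qed

lemma minidemsD: assumes "p \<in> minidems" shows "p \<in> Q" "p \<otimes>\<^sub>c p = p" "p \<noteq> 0"
  using assms unfolding minimal_idempotents_def conv_idempotents_def by auto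

lemma lam_minidems_sum: "(\<Sum>p\<in>minidems. lam p) = qdim s A"
  using lam_sum[OF minidems_finite subsetI[OF minidemsD(1)]] minidems_sum lam_e by simp

text \<open>The multiples of a minimal idempotent form a line, so if \<open>lam\<close> vanished at
  \<open>p\<close>, it would vanish on all of them.\<close>

lemma lam_minidems_nonzero: assumes p: "p \<in> minidems" shows "lam p \<noteq> 0"
proof
  assume z: "lam p = 0"
  obtain y where y: "y \<in> Q" "lam (p \<otimes>\<^sub>c y) \<noteq> 0" using lam_nondegenerate minidemsD[OF p] by blast
  obtain c where "p \<otimes>\<^sub>c y = sc c p" using minidems_scalar[OF p y(1)] by blast
  then show False using y(2) z lam_sc[OF minidemsD(1)[OF p]] by simp
qed

section \<open>Algebra automorphisms as minimal idempotents\<close>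

abbreviation Auts where "Auts \<equiv> algebra_auts A m u"

lemma AutsD:
  assumes "g \<in> Auts" shows "g \<in> Q" "g \<cdot> m = m \<cdot> (g \<otimes> g)" "g \<cdot> u = u"
  using assms iso_arr_Hom unfolding algebra_auts_def by auto

text \<open>The defining equation of \<open>lam\<close> is evaluated at \<open>u\<close>, where the
  canonical trace is the nonzero dimension.\<close>

lemma lam_of_unit: assumes x: "x \<in> Q" and xu: "x \<cdot> u = sc c u" shows "lam x = c"
proof -
  have "(\<epsilon> \<cdot> x) \<cdot> u = \<epsilon> \<cdot> sc c u" using comp_assoc[OF u_Hom x \<epsilon>_Hom] xu by simp
  then have "sc (lam x) (\<epsilon> \<cdot> u) = sc c (\<epsilon> \<cdot> u)"
    unfolding \<epsilon>_lam[OF x] using comp_sc_left[OF u_Hom \<epsilon>_Hom] comp_sc_right[OF u_Hom \<epsilon>_Hom] by simp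
  then have "lam x * qdim s A = c * qdim s A" unfolding \<epsilon>_u using sc_Id_unit_eq by simp
  then show ?thesis using qdim_nonzero by simp
qed

lemma lam_aut: "g \<in> Auts \<Longrightarrow> lam g = 1"
  using lam_of_unit[of g 1] AutsD[of g] by simp

lemma word_aut: assumes g: "g \<in> Auts"
  shows "h g \<star> M = M \<star> whisk [] (h g) [A] \<star> whisk [A] (h g) []" "h g \<star> U = U"
proof -
  note G = AutsD[OF g]
  have "hat (A \<boxtimes> A) A (m \<cdot> (g \<otimes> g)) = M \<star> whisk [] (h g) [A] \<star> whisk [A] (h g) [] \<star> al A A"
    by (rule hat_eqI, (rule hats_ten hats_hat[OF G(1)] hats_comp hats_mu)+) (use G(1) in \<open>simp add: hat_m\<close>)
  then have "h g \<star> M \<star> al A A = M \<star> whisk [] (h g) [A] \<star> whisk [A] (h g) [] \<star> al A A"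
    using hat_comp[OF m_Hom G(1)] hat_m G(2) by simp
  from arg_cong[OF this, of "\<lambda>f. f \<star> ali A A"]
  show "h g \<star> M = M \<star> whisk [] (h g) [A] \<star> whisk [A] (h g) []" using G(1) by simp
  have "h g \<star> U \<star> lu = U \<star> lu" using hat_comp[OF u_Hom G(1)] hat_u G(3) by simp
  from arg_cong[OF this, of "\<lambda>f. f \<star> lui"] show "h g \<star> U = U" using G(1) by simp
qed

text \<open>In elements, multiplicativity of g turns (g * x)(a) = \<Sum> g(a e_i) x(f_i) into g(a)
  \<Sum> g(e_i) x(f_i), and by connectedness the last sum is a multiple of the unit.\<close>

lemma aut_conv: assumes g: "g \<in> Auts" and x: "x \<in> Q" shows "\<exists>c. g \<otimes>\<^sub>c x = sc c g"
proof -
  note gH = AutsD(1)[OF g]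
  define G where "G = h g"
  have [simp]: "valid G" "sdom G = [A]" "scod G = [A]" unfolding G_def using gH by auto
  define X where "X = h x"
  have [simp]: "valid X" "sdom X = [A]" "scod X = [A]" unfolding X_def using x by auto
  have aut: "G \<star> M = M \<star> whisk [] G [A] \<star> whisk [A] G []" unfolding G_def by (rule word_aut[OF g])
  obtain c where c: "M \<star> whisk [] G [A] \<star> whisk [A] X [] \<star> K = sscale c U"
    using word_unit[of "M \<star> whisk [] G [A] \<star> whisk [A] X [] \<star> K"] by auto
  have i1: "whisk [] M [A] \<star> whisk [A, A] X [] = whisk [A] X [] \<star> whisk [] M [A]"
    using exch[of M X "[]" "[]" "[]", simplified] by simp
  have i2: "whisk [] G [A] \<star> whisk [A] M [] = whisk [A] M [] \<star> whisk [] G [A, A]"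
    using exch[of G M "[]" "[]" "[]", simplified] by simp
  have "h (g \<otimes>\<^sub>c x) = M \<star> whisk [] G [A] \<star> (whisk [A] X [] \<star> whisk [] M [A]) \<star> whisk [A] K []"
    unfolding hat_conv[OF gH x] G_def X_def \<Delta>_def by simp
  also have "\<dots> = M \<star> whisk [] (G \<star> M) [A] \<star> whisk [A, A] X [] \<star> whisk [A] K []" unfolding i1[symmetric] by simp
  also have "\<dots> = (M \<star> whisk [] M [A]) \<star> whisk [] G [A, A] \<star> whisk [A] G [A] \<star> whisk [A, A] X [] \<star> whisk [A] K []"
    unfolding aut by simp
  also have "\<dots> = M \<star> (whisk [A] M [] \<star> whisk [] G [A, A]) \<star> whisk [A] G [A] \<star> whisk [A, A] X [] \<star> whisk [A] K []"
    unfolding M_assoc by simp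
  also have "\<dots> = M \<star> whisk [] G [A] \<star> whisk [A] (M \<star> whisk [] G [A] \<star> whisk [A] X [] \<star> K) []"
    unfolding i2[symmetric] by simp
  also have "\<dots> = sscale c (M \<star> (whisk [] G [A] \<star> whisk [A] U []))" unfolding c by simp
  also have "whisk [] G [A] \<star> whisk [A] U [] = whisk [A] U [] \<star> G"
    using exch[of G U "[]" "[]" "[]", simplified] by simp
  also have "M \<star> whisk [A] U [] \<star> G = (M \<star> whisk [A] U []) \<star> G" by simp
  also have "\<dots> = G" unfolding U_right by simp
  also have "sscale c G = h (sc c g)" unfolding G_def hat_sc[OF gH] ..
  finally have "g \<otimes>\<^sub>c x = sc c g" by (rule hat_inj[OF conv_Hom[OF gH x] sc_Hom[OF gH]])
  then show ?thesis by blast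
qed

lemma aut_idem: assumes g: "g \<in> Auts" shows "g \<otimes>\<^sub>c g = g"
proof (rule hat_inj[OF conv_Hom[OF AutsD(1)[OF g] AutsD(1)[OF g]] AutsD(1)[OF g]])
  note gH = AutsD(1)[OF g]
  have "h (g \<otimes>\<^sub>c g) = (M \<star> whisk [] (h g) [A] \<star> whisk [A] (h g) []) \<star> \<Delta>" unfolding hat_conv[OF gH gH] by simp
  also have "\<dots> = h g \<star> (M \<star> \<Delta>)" unfolding word_aut(1)[OF g, symmetric] by simp
  finally show "h (g \<otimes>\<^sub>c g) = h g" unfolding M_\<Delta> using gH by simp
qed

lemma aut_nonzero: "g \<in> Auts \<Longrightarrow> g \<noteq> 0"
  using AutsD(3)[of g] u_nonzero comp_zero_left[OF u_Hom] by auto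

lemma Auts_subset: "Auts \<subseteq> minidems"
proof
  fix g assume g: "g \<in> Auts"
  note gH = AutsD(1)[OF g]
  have "q = 0 \<or> q = g" if q: "q \<in> Q" "q \<otimes>\<^sub>c q = q" "g \<otimes>\<^sub>c q = q" for q
  proof -
    obtain c where c: "q = sc c g" using aut_conv[OF g q(1)] q(3) by auto
    have "q \<otimes>\<^sub>c sc c g = sc c q" unfolding conv_sc[OF q(1) gH] conv_comm[OF q(1) gH] q(3) ..
    then have "sc c q = q" using q(2) unfolding c[symmetric] by simp
    then have "c = 1 \<or> q = 0" using scale_cancel_right[of c q 1] by simp
    then show ?thesis using c by auto
  qed
  then show "g \<in> minidems" unfolding minimal_idempotents_def conv_idempotents_def
    using gH aut_idem[OF g] aut_nonzero[OF g] by auto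
qed

lemma Id_Auts: "Id A \<in> Auts"
proof -
  have "inverse_pair A A (Id A) (Id A)" unfolding inverse_pair_def using Id_Hom comp_Id_left[OF Id_Hom] by auto
  then show ?thesis unfolding algebra_auts_def
    using iso_arrI comp_Id_left[OF m_Hom] comp_Id_right[OF m_Hom] comp_Id_left[OF u_Hom] mten_Id by auto
qed

text \<open>The convolution of \<open>g\<close> with the identity is a multiple of either of them.
  Both fix \<open>u\<close>, so the two factors agree, and for \<open>g \<noteq> Id A\<close> this
  common factor is zero.\<close>

lemma aut_trace_zero: assumes g: "g \<in> Auts" and ne: "g \<noteq> Id A" shows "tr A g = 0"
proof -
  note gH = AutsD(1)[OF g]
  obtain c where c: "g \<otimes>\<^sub>c Id A = sc c g" using aut_conv[OF g Id_Hom] by blast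
  obtain d where d: "Id A \<otimes>\<^sub>c g = sc d (Id A)" using aut_conv[OF Id_Auts gH] by blast
  have eq: "sc c g = sc d (Id A)" using c d conv_comm[OF gH Id_Hom] by simp
  have "sc c u = sc c g \<cdot> u" using AutsD(3)[OF g] comp_sc_left[OF u_Hom gH] by simp
  also have "\<dots> = sc d u" unfolding eq using comp_sc_left[OF u_Hom Id_Hom] comp_Id_left[OF u_Hom] by simp
  finally have "c = d" using u_nonzero by simp
  then have "c = 0" using eq ne by (simp add: scale_cancel_left)
  then have "lam (g \<otimes>\<^sub>c Id A) = 0" using c lam_zero by simp
  then show ?thesis using lam_conv_Id[OF gH] by simp
qed

text \<open>\<open>a \<mapsto> \<Sum> a e\<^sub>i \<otimes> p(f\<^sub>i)\<close>, and the projection \<open>a \<otimes> b \<mapsto> a \<epsilon>(b)\<close>.\<close>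
definition inc where "inc p = (Id A \<otimes> p) \<cdot> \<delta>"
definition proj where "proj = \<r> A \<cdot> (Id A \<otimes> \<epsilon>)"

lemma proj_Hom: "proj \<in> Hom (A \<boxtimes> A) A" and hat_proj: "hat (A \<boxtimes> A) A proj = whisk [A] E [] \<star> al A A"
proof -
  show "proj \<in> Hom (A \<boxtimes> A) A" unfolding proj_def
    by (rule comp_Hom[OF mten_Hom[OF Id_Hom \<epsilon>_Hom] \<r>_Hom])
  show "hat (A \<boxtimes> A) A proj = whisk [A] E [] \<star> al A A" unfolding proj_def
    by (rule hat_eqI, (rule hats_\<r> hats_ten hats_Id hats_comp hats_\<epsilon>)+) simp
qed

lemma assumes p: "p \<in> Q" shows inc_Hom: "inc p \<in> Hom A (A \<boxtimes> A)"
  and hat_inc: "hat A (A \<boxtimes> A) (inc p) = ali A A \<star> whisk [A] (h p) [] \<star> \<Delta>"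
proof -
  show "inc p \<in> Hom A (A \<boxtimes> A)" unfolding inc_def
    by (rule comp_Hom[OF \<delta>_Hom mten_Hom[OF Id_Hom p]])
  show "hat A (A \<boxtimes> A) (inc p) = ali A A \<star> whisk [A] (h p) [] \<star> \<Delta>" unfolding inc_def
    by (rule hat_eqI, (rule hats_ten hats_Id hats_comp hats_\<delta> hats_hat[OF p])+) (use p in simp)
qed

text \<open>Whenever \<open>lam p\<close> is nonzero, \<open>inc p\<close> is a split monomorphism.
  Together with \<open>P_inc\<close> this places a copy of \<open>A\<close> inside the image of
  \<open>P p\<close>.\<close>

lemma proj_inc: assumes p: "p \<in> Q" shows "proj \<cdot> inc p = sc (lam p) (Id A)"
proof (rule hat_inj[OF comp_Hom[OF inc_Hom[OF p] proj_Hom] sc_Hom[OF Id_Hom]])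
  have "h (proj \<cdot> inc p) = whisk [A] (E \<star> h p) [] \<star> \<Delta>"
    unfolding hat_comp[OF inc_Hom[OF p] proj_Hom] hat_inc[OF p] hat_proj using p by simp
  also have "\<dots> = sscale (lam p) (whisk [A] E [] \<star> \<Delta>)" unfolding word_lam[OF p] by simp
  finally show "h (proj \<cdot> inc p) = h (sc (lam p) (Id A))" unfolding E_\<Delta>(2) hat_sc[OF Id_Hom] hat_Id .
qed

lemma P_inc: assumes p: "p \<in> Q" "p \<otimes>\<^sub>c p = p" shows "P p \<cdot> inc p = inc p"
proof (rule hat_inj[OF comp_Hom[OF inc_Hom[OF p(1)] P_Hom[OF p(1)]] inc_Hom[OF p(1)]])
  define X where "X = h p"
  have [simp]: "valid X" "sdom X = [A]" "scod X = [A]" unfolding X_def using p by auto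
  have i: "whisk [] \<Delta> [A] \<star> whisk [A] X [] = whisk [A, A] X [] \<star> whisk [] \<Delta> [A]"
    using exch[of \<Delta> X "[]" "[]" "[]", simplified] by simp
  have "hat A (A \<boxtimes> A) (P p \<cdot> inc p) = ali A A \<star> Pw X \<star> whisk [A] X [] \<star> \<Delta>"
    unfolding hat_comp[OF inc_Hom[OF p(1)] P_Hom[OF p(1)]] hat_inc[OF p(1)] hat_P[OF p(1)] X_def[symmetric] by simp
  also have "Pw X \<star> whisk [A] X [] \<star> \<Delta> = whisk [A] M [] \<star> whisk [A] X [A] \<star> (whisk [] \<Delta> [A] \<star> whisk [A] X []) \<star> \<Delta>"
    unfolding Pw_def by simp
  also have "\<dots> = whisk [A] M [] \<star> whisk [A] X [A] \<star> whisk [A, A] X [] \<star> (whisk [] \<Delta> [A] \<star> \<Delta>)" unfolding i by simp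
  also have "\<dots> = whisk [A] (M \<star> whisk [] X [A] \<star> whisk [A] X [] \<star> \<Delta>) [] \<star> \<Delta>" unfolding \<Delta>_coassoc by simp
  also have "\<dots> = whisk [A] X [] \<star> \<Delta>" unfolding X_def hat_conv[OF p(1) p(1), symmetric] p(2) ..
  finally show "hat A (A \<boxtimes> A) (P p \<cdot> inc p) = hat A (A \<boxtimes> A) (inc p)" unfolding hat_inc[OF p(1)] X_def .
qed

text \<open>The leg of \<open>K\<close> left open can be paired off again with \<open>B\<close>, and
  the zigzag \<open>B_K\<close> gives back the morphism.\<close>

lemma K_cancel:
  assumes [simp]: "valid F" "sdom F = [A, A]" "scod F = [A]" "valid G" "sdom G = [A, A]" "scod G = [A]"
    and eq: "whisk [A] F [] \<star> whisk [] K [A] = whisk [A] G [] \<star> whisk [] K [A]"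
  shows "F = G"
proof -
  have 1: "whisk [] B [A] \<star> whisk [A] (whisk [A] F [] \<star> whisk [] K [A]) [] = F"
    if [simp]: "valid F" "sdom F = [A, A]" "scod F = [A]" for F
  proof -
    have i: "whisk [] B [A] \<star> whisk [A, A] F [] = F \<star> whisk [] B [A, A]"
      using exch[of B F "[]" "[]" "[]", simplified] by simp
    have "whisk [] B [A] \<star> whisk [A] (whisk [A] F [] \<star> whisk [] K [A]) [] = (whisk [] B [A] \<star> whisk [A, A] F []) \<star> whisk [A] K [A]" by simp
    also have "\<dots> = F \<star> (whisk [] B [A, A] \<star> whisk [A] K [A])" unfolding i by simp
    also have "\<dots> = F" using B_K_w[of "[]" "[A]"] by simp
    finally show ?thesis .
  qed
  show ?thesis using 1[of F] 1[of G] eq by simp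
qed

text \<open>If \<open>P p\<close> factors through \<open>A\<close>, then \<open>p(f) b = p(f p\<^sup>t(b))\<close> with \<open>p\<^sup>t\<close> the transpose of \<open>p\<close>;
  for \<open>p\<close> normalised by \<open>\<lambda>(p) = 1\<close> this makes \<open>p\<^sup>t\<close> a right inverse of \<open>p\<close>.\<close>
lemma P_factor:
  assumes p: "p \<in> Q" and l: "lam p = 1" and eq: "P p = inc p \<cdot> proj \<cdot> P p"
  obtains q where "q \<in> Q" "p \<cdot> q = Id A" "q \<cdot> p = Id A \<Longrightarrow> p \<in> Auts"
proof -
  define X where "X = h p"
  have X [simp]: "valid X" "sdom X = [A]" "scod X = [A]" unfolding X_def using p by auto
  define T where "T = Tw X"
  have T [simp]: "valid T" "sdom T = [A]" "scod T = [A]" unfolding T_def using Tw_simps[OF X] by auto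
  obtain q where q: "q \<in> Q" "h q = T" using transpose_exists[OF p] unfolding T_def X_def by blast
  have PX [simp]: "valid (Pw X)" "sdom (Pw X) = [A, A]" "scod (Pw X) = [A, A]" using Pw_simps[OF X] by auto
  have "hat (A \<boxtimes> A) (A \<boxtimes> A) (inc p \<cdot> proj \<cdot> P p) = ali A A \<star> whisk [A] X [] \<star> \<Delta> \<star> whisk [A] E [] \<star> Pw X \<star> al A A"
    unfolding hat_comp[OF comp_Hom[OF P_Hom[OF p] proj_Hom] inc_Hom[OF p]] hat_comp[OF P_Hom[OF p] proj_Hom]
      hat_inc[OF p] hat_proj hat_P[OF p] X_def[symmetric] by simp
  then have "ali A A \<star> Pw X \<star> al A A = ali A A \<star> whisk [A] X [] \<star> \<Delta> \<star> whisk [A] E [] \<star> Pw X \<star> al A A"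
    using eq hat_P[OF p] X_def by simp
  from arg_cong[OF this, of "\<lambda>f. al A A \<star> f \<star> ali A A"]
  have w: "Pw X = whisk [A] X [] \<star> \<Delta> \<star> whisk [A] E [] \<star> Pw X" by simp
  have pu: "Pw X \<star> whisk [] U [A] = whisk [A] M [] \<star> whisk [A] X [A] \<star> whisk [] K [A]"
    unfolding Pw_def using arg_cong[OF \<Delta>_U, of "\<lambda>f. whisk [A] M [] \<star> whisk [A] X [A] \<star> whisk [] f [A]"] by simp
  have i: "whisk [] K [A] \<star> T = whisk [A, A] T [] \<star> whisk [] K [A]"
    using exch[of K T "[]" "[]" "[]", simplified] by simp
  \<comment> \<open>The factorisation is evaluated at 1 \<otimes> b. The left side is \<Sum> e_i
    \<otimes> p(f_i) b; on the right, capping the second leg of this very element produces the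
    adjoint T(b), whence \<Sum> e_i \<otimes> p(f_i T(b)).\<close>
  have "whisk [A] (M \<star> whisk [] X [A]) [] \<star> whisk [] K [A] = (whisk [A] X [] \<star> \<Delta> \<star> whisk [A] E [] \<star> Pw X) \<star> whisk [] U [A]"
    using pu unfolding w[symmetric] by simp
  also have "\<dots> = whisk [A] X [] \<star> \<Delta> \<star> whisk [A] E [] \<star> (Pw X \<star> whisk [] U [A])" by simp
  also have "\<dots> = whisk [A] X [] \<star> \<Delta> \<star> T" unfolding pu T_def Tw_def B_def by simp
  also have "\<dots> = whisk [A] X [] \<star> whisk [A] M [] \<star> (whisk [] K [A] \<star> T)" unfolding \<Delta>_alt by simp
  also have "\<dots> = whisk [A] (X \<star> M \<star> whisk [A] T []) [] \<star> whisk [] K [A]" unfolding i by simp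
  finally have main: "M \<star> whisk [] X [A] = X \<star> M \<star> whisk [A] T []" by (rule K_cancel[rotated -1]) auto
  obtain c where c: "p \<cdot> u = sc c u" using Hom_unit_A[OF comp_Hom[OF u_Hom p]] by blast
  then have "c = 1" using lam_of_unit[OF p c] l by simp
  then have pu1: "p \<cdot> u = u" using c by simp
  have "X \<star> U \<star> lu = U \<star> lu" using hat_comp[OF u_Hom p] hat_u pu1 X_def by simp
  from arg_cong[OF this, of "\<lambda>f. f \<star> lui"] have XU: "X \<star> U = U" by simp
  have i2: "whisk [A] T [] \<star> whisk [] U [A] = whisk [] U [A] \<star> T"
    using exch[of U T "[]" "[]" "[]", simplified] by simp
  \<comment> \<open>The identity p(a) b = p(a T(b)) at a = 1, with p(1) = 1, says that T is a right
    inverse of p.\<close>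
  have "M \<star> whisk [] (X \<star> U) [A] = (M \<star> whisk [] X [A]) \<star> whisk [] U [A]" by simp
  also have "\<dots> = X \<star> M \<star> (whisk [A] T [] \<star> whisk [] U [A])" unfolding main by simp
  also have "\<dots> = X \<star> (M \<star> whisk [] U [A]) \<star> T" unfolding i2 by simp
  finally have XT: "X \<star> T = sid [A]" unfolding XU U_left by simp
  have pq: "p \<cdot> q = Id A"
    by (rule hat_inj[OF comp_Hom[OF q(1) p] Id_Hom]) (unfold hat_comp[OF q(1) p] q(2) X_def[symmetric] XT hat_Id, rule refl)
  have "p \<in> Auts" if qp: "q \<cdot> p = Id A"
  proof -
    have TX: "T \<star> X = sid [A]" using hat_comp[OF p q(1)] qp hat_Id q(2) X_def by simp
    \<comment> \<open>The same identity with b replaced by p(b) becomes multiplicativity as soon as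
      T is also a left inverse.\<close>
    have "hat (A \<boxtimes> A) A (m \<cdot> (p \<otimes> p)) = (M \<star> whisk [] X [A]) \<star> whisk [A] X [] \<star> al A A"
      by (rule hat_eqI, (rule hats_ten hats_hat[OF p] hats_comp hats_mu)+) (use p in \<open>simp add: hat_m X_def\<close>)
    also have "\<dots> = X \<star> M \<star> whisk [A] (T \<star> X) [] \<star> al A A" unfolding main by simp
    also have "\<dots> = hat (A \<boxtimes> A) A (p \<cdot> m)" unfolding TX hat_comp[OF m_Hom p] hat_m X_def[symmetric] by simp
    finally have "m \<cdot> (p \<otimes> p) = p \<cdot> m" by (rule hat_inj[OF comp_Hom[OF mten_Hom[OF p p] m_Hom] comp_Hom[OF m_Hom p]])
    moreover have "inverse_pair A A p q" unfolding inverse_pair_def using p q(1) pq qp by simp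
    ultimately show ?thesis unfolding algebra_auts_def using pu1 iso_arrI by auto
  qed
  then show ?thesis using that q(1) pq by blast
qed

end

section \<open>Nonnegative matrices\<close>

text \<open>Squaring doubles the angle: for w of modulus 1 and real part x, 1 - Re(w^2) = 2 (1 - x)
  (1 + x), which is at least 2 (1 - x) as long as x \<ge> 0. If all real parts stayed positive, the
  distance of the real part from 1 would double at each squaring and eventually exceed 1.\<close>

lemma power_Re_nonpos:
  fixes w :: complex
  assumes n: "norm w = 1" and w: "w \<noteq> 1"
  shows "\<exists>k\<ge>1. Re (w ^ k) \<le> 0"
proof (rule ccontr)
  assume "\<not> ?thesis"
  then have pos: "Re (w ^ k) > 0" if "k \<ge> 1" for k using that by force
  have dbl: "Re (z ^ 2) = 2 * (Re z)\<^sup>2 - 1" if "norm z = 1" for z :: complex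
    using that cmod_power2[of z] by (simp add: power2_eq_square)
  have "1 - Re (w ^ (2 ^ j)) \<ge> 2 ^ j * (1 - Re w)" for j
  proof (induction j)
    case (Suc j)
    define x where "x = Re (w ^ (2 ^ j))"
    have x: "0 < x" unfolding x_def by (rule pos) simp
    have x1: "x \<le> 1" unfolding x_def using complex_Re_le_cmod[of "w ^ (2 ^ j)"] n by (simp add: norm_power)
    have "Re (w ^ (2 ^ Suc j)) = 2 * x\<^sup>2 - 1"
      unfolding x_def using dbl[of "w ^ (2 ^ j)"] n by (simp add: norm_power power_mult[symmetric] mult.commute)
    then have "1 - Re (w ^ (2 ^ Suc j)) = 2 * (1 - x) * (1 + x)" by (simp add: power2_eq_square algebra_simps)
    also have "\<dots> \<ge> 2 * (1 - x)" using x x1 by (simp add: mult_le_cancel_left1)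
    finally show ?case using Suc unfolding x_def by simp
  qed simp
  moreover have "Re w < 1"
  proof -
    have "Re w \<le> 1" using complex_Re_le_cmod[of w] n by simp
    moreover have "Re w \<noteq> 1"
    proof
      assume "Re w = 1"
      then have "Im w = 0" using n cmod_power2[of w] by simp
      then show False using w \<open>Re w = 1\<close> by (simp add: complex_eq_iff)
    qed
    ultimately show ?thesis by simp
  qed
  moreover obtain j where "1 / (1 - Re w) < 2 ^ j" using real_arch_pow[of 2 "1 / (1 - Re w)"] by auto
  ultimately have "1 < 2 ^ j * (1 - Re w)" by (simp add: field_simps)
  then have "Re (w ^ (2 ^ j)) < 0" using \<open>\<And>j. 1 - Re (w ^ (2 ^ j)) \<ge> 2 ^ j * (1 - Re w)\<close>[of j] by simp
  then show False using pos[of "2 ^ j"] by simp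
qed

lemma power_Re_nonpos':
  fixes z :: complex
  assumes z: "\<And>r. r \<ge> 0 \<Longrightarrow> z \<noteq> complex_of_real r"
  shows "\<exists>k\<ge>1. Re (z ^ k) \<le> 0"
proof -
  have z0: "z \<noteq> 0" using z[of 0] by simp
  define w where "w = z / of_real (norm z)"
  have zw: "z = of_real (norm z) * w" unfolding w_def using z0 by simp
  have "norm w = 1" unfolding w_def using z0 by (simp add: norm_divide)
  moreover have "w \<noteq> 1" using z[of "norm z"] zw by auto
  ultimately obtain k where k: "k \<ge> 1" "Re (w ^ k) \<le> 0" using power_Re_nonpos by blast
  have "z ^ k = of_real (norm z ^ k) * w ^ k" using zw by (metis of_real_power power_mult_distrib)
  then have "Re (z ^ k) = norm z ^ k * Re (w ^ k)" by simp
  then show ?thesis using k by (auto intro!: exI[of _ k] mult_nonneg_nonpos)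
qed

section \<open>Triangular matrices and products of quadratic polynomials\<close>

lemma upper_triangular_mult:
  fixes A B :: "'a :: comm_ring_1 mat"
  assumes A: "A \<in> carrier_mat n n" "upper_triangular A" and B: "B \<in> carrier_mat n n" "upper_triangular B"
  shows "upper_triangular (A * B)" and "i < n \<Longrightarrow> (A * B) $$ (i, i) = A $$ (i, i) * B $$ (i, i)"
proof -
  have a: "A $$ (i, k) = 0" if "k < i" "i < n" for i k using A that by auto
  have b: "B $$ (k, j) = 0" if "j < k" "k < n" for k j using B that by auto
  have e: "(A * B) $$ (i, j) = (\<Sum>k<n. A $$ (i, k) * B $$ (k, j))" if "i < n" "j < n" for i j
    using A B that by (simp add: scalar_prod_def lessThan_atLeast0)
  show "upper_triangular (A * B)"
  proof
    fix i j assume ij: "j < i" "i < dim_row (A * B)"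
    then have "(A * B) $$ (i, j) = (\<Sum>k<n. A $$ (i, k) * B $$ (k, j))" using e A by auto
    also have "\<dots> = 0"
    proof (rule sum.neutral, rule ballI)
      fix k assume "k \<in> {..<n}"
      then show "A $$ (i, k) * B $$ (k, j) = 0" using a[of k i] b[of j k] ij A by (cases "k < i") auto
    qed
    finally show "(A * B) $$ (i, j) = 0" .
  qed
  show "(A * B) $$ (i, i) = A $$ (i, i) * B $$ (i, i)" if i: "i < n"
  proof -
    have "(A * B) $$ (i, i) = (\<Sum>k<n. A $$ (i, k) * B $$ (k, i))" using e i by simp
    also have "\<dots> = (\<Sum>k<n. if k = i then A $$ (i, i) * B $$ (i, i) else 0)"
    proof (rule sum.cong)
      fix k assume "k \<in> {..<n}"
      then show "A $$ (i, k) * B $$ (k, i) = (if k = i then A $$ (i, i) * B $$ (i, i) else 0)"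
        using a[of k i] b[of i k] i by (cases "k < i"; cases "i < k") auto
    qed simp
    finally show ?thesis using i by simp
  qed
qed

lemma upper_triangular_pow:
  fixes A :: "'a :: comm_ring_1 mat"
  assumes A: "A \<in> carrier_mat n n" "upper_triangular A"
  shows "upper_triangular (A ^\<^sub>m k) \<and> (\<forall>i<n. (A ^\<^sub>m k) $$ (i, i) = (A $$ (i, i)) ^ k)"
proof (induction k)
  case 0
  then show ?case using A by auto
next
  case (Suc k)
  have c: "A ^\<^sub>m k \<in> carrier_mat n n" using A by simp
  show ?case using upper_triangular_mult[OF c _ A] Suc by simp
qed

text \<open>The polynomial \<open>x\<^sup>2\<^sup>k - t x\<^sup>k + r\<close> at a matrix. For \<open>t = 2 Re (z\<^sup>k)\<close> and \<open>r = \<bar>z\<bar>\<^sup>2\<^sup>k\<close> it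
  vanishes at \<open>z\<close>, and its coefficients are nonnegative as soon as \<open>Re (z\<^sup>k) \<le> 0\<close>.\<close>
definition quad :: "nat \<times> 'a \<times> 'a \<Rightarrow> 'a mat \<Rightarrow> 'a :: comm_ring_1 mat" where
  "quad q A = (case q of (k, t, r) \<Rightarrow> A ^\<^sub>m (2 * k) + (t \<cdot>\<^sub>m A ^\<^sub>m k + r \<cdot>\<^sub>m 1\<^sub>m (dim_row A)))"

definition quads :: "(nat \<times> 'a \<times> 'a) list \<Rightarrow> 'a mat \<Rightarrow> 'a :: comm_ring_1 mat" where
  "quads qs A = foldr (\<lambda>q X. quad q A * X) qs (1\<^sub>m (dim_row A))"

lemma quads_Cons: "quads (q # qs) A = quad q A * quads qs A"
  unfolding quads_def by simp

lemma quad_carrier [simp]: "A \<in> carrier_mat n n \<Longrightarrow> quad q A \<in> carrier_mat n n"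
  unfolding quad_def by (cases q) auto
lemma quads_carrier [simp]: "A \<in> carrier_mat n n \<Longrightarrow> quads qs A \<in> carrier_mat n n"
  unfolding quads_def by (induction qs) (auto intro!: mult_carrier_mat[of _ n n])

lemma quad_index:
  fixes A :: "'a :: comm_ring_1 mat"
  assumes A: "A \<in> carrier_mat n n" and ij: "i < n" "j < n"
  shows "quad (k, t, r) A $$ (i, j) = (A ^\<^sub>m (2 * k)) $$ (i, j) + t * (A ^\<^sub>m k) $$ (i, j) + (if i = j then r else 0)"
proof -
  have "(X + (t \<cdot>\<^sub>m Y + r \<cdot>\<^sub>m 1\<^sub>m n)) $$ (i, j) = X $$ (i, j) + t * Y $$ (i, j) + (if i = j then r else 0)"
    if "X \<in> carrier_mat n n" "Y \<in> carrier_mat n n" for X Y :: "'a mat"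
    using that ij by auto
  from this[OF pow_carrier_mat[OF A] pow_carrier_mat[OF A]] show ?thesis unfolding quad_def using A by auto
qed

lemma quad_triangular:
  assumes A: "A \<in> carrier_mat n n" "upper_triangular A"
  shows "upper_triangular (quad (k, t, r) A)"
    and "i < n \<Longrightarrow> quad (k, t, r) A $$ (i, i) = (A $$ (i, i)) ^ (2 * k) + t * (A $$ (i, i)) ^ k + r"
proof -
  note p = upper_triangular_pow[OF A] and ix = quad_index[OF A(1)]
  have z: "(A ^\<^sub>m k) $$ (i, j) = 0" if "j < i" "i < n" for i j k
    using p[of k] that pow_carrier_mat[OF A(1), of k] by auto
  show "upper_triangular (quad (k, t, r) A)"
    using ix z quad_carrier[OF A(1), of "(k, t, r)"] by auto
  show "quad (k, t, r) A $$ (i, i) = (A $$ (i, i)) ^ (2 * k) + t * (A $$ (i, i)) ^ k + r" if "i < n"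
    using ix[OF that that] p that by simp
qed

lemma quads_triangular:
  assumes A: "A \<in> carrier_mat n n" "upper_triangular A"
  shows "upper_triangular (quads qs A) \<and> (\<forall>i<n. quads qs A $$ (i, i) = (\<Prod>q\<leftarrow>qs. quad q A $$ (i, i)))"
proof (induction qs)
  case Nil
  then show ?case using A by (auto simp: quads_def)
next
  case (Cons q qs)
  have q: "upper_triangular (quad q A)" using quad_triangular(1)[OF A] by (cases q) auto
  have "quads (q # qs) A = quad q A * quads qs A" unfolding quads_def by simp
  then show ?case
    using upper_triangular_mult[OF quad_carrier[OF A(1)] q quads_carrier[OF A(1)]] Cons by simp
qed

lemma mat_trace_comm:
  fixes A B :: "'a :: comm_ring_1 mat"
  assumes A: "A \<in> carrier_mat n n" and B: "B \<in> carrier_mat n n"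
  shows "(\<Sum>i<n. (A * B) $$ (i, i)) = (\<Sum>i<n. (B * A) $$ (i, i))"
proof -
  have "(\<Sum>i<n. (A * B) $$ (i, i)) = (\<Sum>i<n. \<Sum>k<n. A $$ (i, k) * B $$ (k, i))"
    using A B by (intro sum.cong) (simp_all add: scalar_prod_def lessThan_atLeast0)
  also have "\<dots> = (\<Sum>k<n. \<Sum>i<n. B $$ (k, i) * A $$ (i, k))"
    by (subst sum.swap) (simp add: mult.commute)
  also have "\<dots> = (\<Sum>i<n. (B * A) $$ (i, i))"
    using A B by (intro sum.cong) (simp_all add: scalar_prod_def lessThan_atLeast0)
  finally show ?thesis .
qed

lemma quads_similar:
  fixes A B :: "'a :: comm_ring_1 mat"
  assumes A: "A \<in> carrier_mat n n" and sim: "similar_mat_wit A B P Q"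
  shows "quads qs A = P * quads qs B * Q"
proof -
  note D = similar_mat_witD2[OF A sim]
  have B: "B \<in> carrier_mat n n" and P: "P \<in> carrier_mat n n" and Q: "Q \<in> carrier_mat n n"
    and PQ: "P * Q = 1\<^sub>m n" and QP: "Q * P = 1\<^sub>m n" using D by auto
  have dA: "dim_row A = n" and dB: "dim_row B = n" using A B by auto
  have pow: "A ^\<^sub>m k = P * B ^\<^sub>m k * Q" for k by (rule similar_mat_wit_pow_id[OF sim])
  have Bk: "B ^\<^sub>m k \<in> carrier_mat n n" for k using B by simp
  have quad: "quad q A = P * quad q B * Q" for q
  proof (cases q)
    case (fields k t r)
    have "r \<cdot>\<^sub>m 1\<^sub>m n = P * (r \<cdot>\<^sub>m 1\<^sub>m n) * Q" using P Q PQ 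
      by (simp add: mult_smult_distrib[of P n n "1\<^sub>m n" n] mult_smult_assoc_mat[of P n n Q n])
    moreover have "t \<cdot>\<^sub>m A ^\<^sub>m k = P * (t \<cdot>\<^sub>m B ^\<^sub>m k) * Q"
      unfolding pow mult_smult_distrib[OF P Bk] by (rule mult_smult_assoc_mat[symmetric, OF mult_carrier_mat[OF P Bk] Q])
    moreover have "P * (X + Y) * Q = P * X * Q + P * Y * Q" if "X \<in> carrier_mat n n" "Y \<in> carrier_mat n n" for X Y
      using mult_add_distrib_mat[OF P that] add_mult_distrib_mat[OF mult_carrier_mat[OF P that(1)] mult_carrier_mat[OF P that(2)] Q] by simp
    moreover have "r \<cdot>\<^sub>m 1\<^sub>m n \<in> carrier_mat n n" "t \<cdot>\<^sub>m B ^\<^sub>m k \<in> carrier_mat n n" using Bk by auto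
    ultimately show ?thesis unfolding fields quad_def using pow dA dB Bk by simp
  qed
  show ?thesis
  proof (induction qs)
    case Nil
    then show ?case unfolding quads_def using P PQ dA dB by simp
  next
    case (Cons q qs)
    let ?X = "quad q B" and ?Y = "quads qs B"
    have X: "?X \<in> carrier_mat n n" and Y: "?Y \<in> carrier_mat n n" using B by auto
    have "quads (q # qs) A = (P * ?X * Q) * (P * ?Y * Q)" using Cons quad unfolding quads_def by simp
    also have "\<dots> = (P * ?X) * (Q * (P * ?Y * Q))"
      by (rule assoc_mult_mat[of _ n n _ n _ n]) (use P Q X Y in auto)
    also have "P * ?Y * Q = P * (?Y * Q)" by (rule assoc_mult_mat[OF P Y Q])
    also have "Q * (P * (?Y * Q)) = (Q * P) * (?Y * Q)"
      by (rule assoc_mult_mat[symmetric, of _ n n _ n _ n]) (use P Q X Y in auto)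
    also have "\<dots> = ?Y * Q" unfolding QP using Y Q by simp
    also have "(P * ?X) * (?Y * Q) = ((P * ?X) * ?Y) * Q"
      by (rule assoc_mult_mat[symmetric, of _ n n _ n _ n]) (use P Q X Y in auto)
    also have "(P * ?X) * ?Y = P * (?X * ?Y)" by (rule assoc_mult_mat[OF P X Y])
    finally show ?case unfolding quads_def by simp
  qed
qed

section \<open>Entrywise nonnegative matrices\<close>

lemma nonneg_mat_mult:
  fixes A B :: "real mat"
  assumes A: "A \<in> carrier_mat n n" and B: "B \<in> carrier_mat n n"
    and nA: "\<And>i j. i < n \<Longrightarrow> j < n \<Longrightarrow> A $$ (i, j) \<ge> 0" and nB: "\<And>i j. i < n \<Longrightarrow> j < n \<Longrightarrow> B $$ (i, j) \<ge> 0"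
  shows "i < n \<Longrightarrow> j < n \<Longrightarrow> (A * B) $$ (i, j) \<ge> 0"
    and "i < n \<Longrightarrow> (A * B) $$ (i, i) \<ge> A $$ (i, i) * B $$ (i, i)"
proof -
  have e: "(A * B) $$ (i, j) = (\<Sum>k<n. A $$ (i, k) * B $$ (k, j))" if "i < n" "j < n" for i j
    using A B that by (simp add: scalar_prod_def lessThan_atLeast0)
  show "i < n \<Longrightarrow> j < n \<Longrightarrow> (A * B) $$ (i, j) \<ge> 0" using e nA nB by (auto intro!: sum_nonneg)
  show "i < n \<Longrightarrow> (A * B) $$ (i, i) \<ge> A $$ (i, i) * B $$ (i, i)"
    using e nA nB by (auto intro!: member_le_sum[where f = "\<lambda>k. A $$ (i, k) * B $$ (k, i)"])
qed

lemma nonneg_mat_pow: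
  fixes A :: "real mat"
  assumes A: "A \<in> carrier_mat n n" and nA: "\<And>i j. i < n \<Longrightarrow> j < n \<Longrightarrow> A $$ (i, j) \<ge> 0"
  shows "i < n \<Longrightarrow> j < n \<Longrightarrow> (A ^\<^sub>m k) $$ (i, j) \<ge> 0"
proof (induction k arbitrary: i j)
  case 0
  then show ?case using A by auto
next
  case (Suc k)
  have c: "A ^\<^sub>m k \<in> carrier_mat n n" using A by simp
  show ?case using nonneg_mat_mult(1)[OF c A Suc.IH nA Suc.prems] by simp
qed

text \<open>The constant term \<open>r\<close> makes the diagonal of each factor strictly positive,
  and a product of nonnegative matrices keeps a diagonal entry at least as large as the product of
  the diagonal entries.\<close>

lemma quads_nonneg:
  fixes A :: "real mat"
  assumes A: "A \<in> carrier_mat n n" and nA: "\<And>i j. i < n \<Longrightarrow> j < n \<Longrightarrow> A $$ (i, j) \<ge> 0"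
    and qs: "\<And>k t r. (k, t, r) \<in> set qs \<Longrightarrow> t \<ge> 0 \<and> r > 0"
  shows "(\<forall>i<n. \<forall>j<n. quads qs A $$ (i, j) \<ge> 0) \<and> (\<forall>i<n. quads qs A $$ (i, i) > 0)"
  using qs
proof (induction qs)
  case Nil
  then show ?case using A by (auto simp: quads_def)
next
  case (Cons q qs)
  obtain k t r where q: "q = (k, t, r)" by (cases q)
  have tr: "t \<ge> 0" "r > 0" using Cons.prems q by auto
  have Q: "quad q A $$ (i, j) \<ge> 0" if "i < n" "j < n" for i j
    unfolding q quad_index[OF A that] using that tr nonneg_mat_pow[OF A nA that] by simp
  have QD: "quad q A $$ (i, i) > 0" if "i < n" for i
    unfolding q quad_index[OF A that that] using tr nonneg_mat_pow[OF A nA that that] by (simp add: add_nonneg_pos)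
  have IH: "\<And>i j. i < n \<Longrightarrow> j < n \<Longrightarrow> quads qs A $$ (i, j) \<ge> 0" "\<And>i. i < n \<Longrightarrow> quads qs A $$ (i, i) > 0"
    using Cons by auto
  have e: "quads (q # qs) A = quad q A * quads qs A" unfolding quads_def by simp
  note nm = nonneg_mat_mult[OF quad_carrier[OF A] quads_carrier[OF A] Q IH(1)]
  show ?case unfolding e
    using nm QD IH(2) by (auto intro: less_le_trans[OF mult_pos_pos nm(2)])
qed

lemma map_mat_pow_real:
  fixes A :: "real mat" assumes A: "A \<in> carrier_mat n n"
  shows "map_mat complex_of_real (A ^\<^sub>m k) = (map_mat complex_of_real A) ^\<^sub>m k"
  by (rule of_real_hom.mat_hom_pow[OF A])

lemma map_mat_quads:
  fixes A :: "real mat" assumes A: "A \<in> carrier_mat n n"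
  shows "map_mat complex_of_real (quads qs A) = quads (map (\<lambda>(k, t, r). (k, of_real t, of_real r)) qs) (map_mat complex_of_real A)"
proof (induction qs)
  case Nil
  then show ?case using A by (auto simp: quads_def of_real_hom.mat_hom_one)
next
  case (Cons q qs)
  obtain k t r where q: "q = (k, t, r)" by (cases q)
  have C: "map_mat complex_of_real A \<in> carrier_mat n n" using A by simp
  have "map_mat complex_of_real (quad q A) = quad (k, of_real t, of_real r) (map_mat complex_of_real A)"
  proof (rule eq_matI)
    fix i j assume "i < dim_row (quad (k, of_real t, of_real r) (map_mat complex_of_real A))"
      "j < dim_col (quad (k, of_real t, of_real r) (map_mat complex_of_real A))"
    then have ij: "i < n" "j < n" using quad_carrier[OF C, of "(k, of_real t, of_real r)"] by auto
    have e: "(map_mat complex_of_real X) $$ (i, j) = complex_of_real (X $$ (i, j))" if "X \<in> carrier_mat n n" for X :: "real mat"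
      using that ij by auto
    show "map_mat complex_of_real (quad q A) $$ (i, j) = quad (k, of_real t, of_real r) (map_mat complex_of_real A) $$ (i, j)"
      unfolding q e[OF quad_carrier[OF A]] quad_index[OF C ij] quad_index[OF A ij] map_mat_pow_real[OF A, symmetric]
        e[OF pow_carrier_mat[OF A]] by simp
  qed (use quad_carrier[OF A, of q] quad_carrier[OF C, of "(k, of_real t, of_real r)"] in auto)
  then show ?case
    unfolding quads_Cons list.map of_real_hom.mat_hom_mult[OF quad_carrier[OF A] quads_carrier[OF A]] Cons.IH by (simp add: q)
qed

text \<open>Suppose no eigenvalue is a nonnegative real. Each complex eigenvalue is then a root of
  some quadratic in a power of x with nonnegative coefficients and positive constant term. The
  product of these polynomials at \<open>N\<close> has a strictly positive diagonal. After
  triangularisation, though, its diagonal vanishes, as each diagonal entry of the triangular form is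
  a root of one factor; so its trace is zero, a contradiction.\<close>

lemma nonneg_mat_eigenvalue:
  fixes N :: "real mat"
  assumes N: "N \<in> carrier_mat n n" and n: "n > 0" and nn: "\<And>i j. i < n \<Longrightarrow> j < n \<Longrightarrow> N $$ (i, j) \<ge> 0"
  shows "\<exists>r\<ge>0. eigenvalue N r"
proof (rule ccontr)
  assume no: "\<not> ?thesis"
  let ?C = "map_mat complex_of_real N"
  have C: "?C \<in> carrier_mat n n" using N by simp
  obtain as where as: "char_poly ?C = (\<Prod>a\<leftarrow>as. [:- a, 1:])" using char_poly_factorized[OF C] by blast
  obtain B P Q where "schur_decomposition ?C as = (B, P, Q)" by (cases "schur_decomposition ?C as") auto
  then have sim: "similar_mat_wit ?C B P Q" and ut: "upper_triangular B" and dg: "diag_mat B = as"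
    using schur_decomposition[OF C as] by blast+
  note D = similar_mat_witD2[OF C sim]
  have B: "B \<in> carrier_mat n n" and P: "P \<in> carrier_mat n n" and Q: "Q \<in> carrier_mat n n" and QP: "Q * P = 1\<^sub>m n" using D by auto
  have nr: "a \<noteq> complex_of_real r" if a: "a \<in> set as" and r: "r \<ge> 0" for a r
  proof
    assume "a = complex_of_real r"
    moreover have "poly (char_poly ?C) a = 0" unfolding as using linear_poly_root[OF a] .
    ultimately have "poly (map_poly complex_of_real (char_poly N)) (complex_of_real r) = 0"
      using of_real_hom.char_poly_hom[OF N] by metis
    then have "poly (char_poly N) r = 0" by simp
    then show False using no r eigenvalue_root_char_poly[OF N] by blast
  qed
  have "\<forall>a. \<exists>k. a \<in> set as \<longrightarrow> k \<ge> 1 \<and> Re (a ^ k) \<le> 0"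
    using power_Re_nonpos' nr by metis
  then obtain k where k: "\<And>a. a \<in> set as \<Longrightarrow> k a \<ge> 1 \<and> Re (a ^ k a) \<le> 0" by metis
  define q where "q a = (k a, - (2 * Re (a ^ k a)), (norm (a ^ k a))\<^sup>2)" for a
  define qs where "qs = map q as"
  define qc where "qc a = (k a, complex_of_real (- (2 * Re (a ^ k a))), complex_of_real ((norm (a ^ k a))\<^sup>2))" for a
  have pos: "t \<ge> 0 \<and> r > 0" if kt: "(l, t, r) \<in> set qs" for l t r
  proof -
    obtain a where a: "a \<in> set as" "(l, t, r) = q a" using kt unfolding qs_def by auto
    have "a \<noteq> 0" using nr[OF a(1), of 0] by simp
    then show ?thesis using a k[OF a(1)] unfolding q_def by auto
  qed
  let ?R = "quads qs N"
  have "(\<Sum>i<n. ?R $$ (i, i)) > 0"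
    using quads_nonneg[OF N nn pos] n by (intro sum_pos) auto
  moreover have "complex_of_real (\<Sum>i<n. ?R $$ (i, i)) = 0"
  proof -
    let ?S = "quads (map qc as) B"
    have S: "?S \<in> carrier_mat n n" using B by simp
    have R: "?R \<in> carrier_mat n n" using N by simp
    have "map (\<lambda>(k, t, r). (k, complex_of_real t, complex_of_real r)) qs = map qc as"
      unfolding qs_def q_def qc_def by simp
    then have "map_mat complex_of_real ?R = quads (map qc as) ?C" using map_mat_quads[OF N, of qs] by simp
    also have "\<dots> = P * ?S * Q" by (rule quads_similar[OF C sim])
    finally have e: "map_mat complex_of_real ?R = P * ?S * Q" .
    have "complex_of_real (\<Sum>i<n. ?R $$ (i, i)) = (\<Sum>i<n. (map_mat complex_of_real ?R) $$ (i, i))"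
      using R by simp
    also have "\<dots> = (\<Sum>i<n. (Q * (P * ?S)) $$ (i, i))"
      unfolding e by (rule mat_trace_comm[OF mult_carrier_mat[OF P S] Q])
    also have "Q * (P * ?S) = ?S" using assoc_mult_mat[OF Q P S] QP S by simp
    also have "(\<Sum>i<n. ?S $$ (i, i)) = 0"
    proof (rule sum.neutral, rule ballI)
      fix i assume "i \<in> {..<n}"
      then have i: "i < n" by simp
      let ?a = "B $$ (i, i)"
      have a: "?a \<in> set as" unfolding dg[symmetric] diag_mat_def using i B by auto
      let ?z = "?a ^ k ?a"
      have "quad (qc ?a) B $$ (i, i) = ?z\<^sup>2 + complex_of_real (- (2 * Re ?z)) * ?z + complex_of_real ((norm ?z)\<^sup>2)"
        unfolding qc_def quad_triangular(2)[OF B ut i] by (simp add: power_mult[symmetric] mult.commute)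
      also have "\<dots> = 0"
        unfolding cmod_power2 by (simp add: complex_eq_iff power2_eq_square algebra_simps)
      finally have "0 \<in> set (map (\<lambda>q. quad q B $$ (i, i)) (map qc as))" using a by force
      then show "?S $$ (i, i) = 0" using quads_triangular[OF B ut, of "map qc as"] i prod_list_zero_iff by simp
    qed
    finally show ?thesis .
  qed
  ultimately show False by (simp only: of_real_eq_0_iff)
qed

section \<open>Positivity and the main theorem\<close>

context fusion_category
begin

lemma evw_cancel:
  assumes f: "f \<in> Hom W (Dual Z)" and g: "g \<in> Hom W (Dual Z)"
    and eq: "evw Z \<star> whisk [] (hat W (Dual Z) f) [Z] = evw Z \<star> whisk [] (hat W (Dual Z) g) [Z]"
  shows "f = g"
proof (rule hat_inj[OF f g])
  show "hat W (Dual Z) f = hat W (Dual Z) g"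
    using evw_nondegenerate[of "hat W (Dual Z) f" W Z, OF _ _ _ eq] evw_nondegenerate[of "hat W (Dual Z) g" W Z, OF _ _ _ refl] f g by simp
qed

lemma dual_arr_Id: "dual_arr X X (Id X) = Id (Dual X)"
  by (rule evw_cancel[OF dual_arr(1)[OF Id_Hom] Id_Hom]) (unfold dual_arr(2)[OF Id_Hom] hat_Id, simp)

lemma dual_arr_comp:
  assumes f: "f \<in> Hom X Y" and g: "g \<in> Hom Y Z"
  shows "dual_arr X Z (g \<cdot> f) = dual_arr X Y f \<cdot> dual_arr Y Z g"
proof (rule evw_cancel[OF dual_arr(1)[OF comp_Hom[OF f g]] comp_Hom[OF dual_arr(1)[OF g] dual_arr(1)[OF f]]])
  let ?F = "hat (Dual Y) (Dual X) (dual_arr X Y f)" and ?G = "hat (Dual Z) (Dual Y) (dual_arr Y Z g)"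
  note df = dual_arr(1)[OF f] and dg = dual_arr(1)[OF g]
  have "evw X \<star> whisk [] (hat (Dual Z) (Dual X) (dual_arr X Y f \<cdot> dual_arr Y Z g)) [X] = (evw X \<star> whisk [] ?F [X]) \<star> whisk [] ?G [X]"
    unfolding hat_comp[OF dg df] by simp
  also have "\<dots> = evw Y \<star> (whisk [Dual Y] (hat X Y f) [] \<star> whisk [] ?G [X])" unfolding dual_arr(2)[OF f] by simp
  also have "whisk [Dual Y] (hat X Y f) [] \<star> whisk [] ?G [X] = whisk [] ?G [Y] \<star> whisk [Dual Z] (hat X Y f) []"
    using exch[of ?G "hat X Y f" "[]" "[]" "[]", simplified] f dg by simp
  also have "evw Y \<star> whisk [] ?G [Y] \<star> whisk [Dual Z] (hat X Y f) [] = (evw Y \<star> whisk [] ?G [Y]) \<star> whisk [Dual Z] (hat X Y f) []" by simp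
  also have "\<dots> = evw Z \<star> whisk [Dual Z] (hat X Z (g \<cdot> f)) []" unfolding dual_arr(2)[OF g] hat_comp[OF f g] by simp
  finally show "evw X \<star> whisk [] (hat (Dual Z) (Dual X) (dual_arr X Z (g \<cdot> f))) [X]
    = evw X \<star> whisk [] (hat (Dual Z) (Dual X) (dual_arr X Y f \<cdot> dual_arr Y Z g)) [X]"
    unfolding dual_arr(2)[OF comp_Hom[OF f g]] by simp
qed

section \<open>Comparison of two pivotal structures\<close>

definition compare where "compare t X = inv_arr X (Dual (Dual X)) (s X) \<cdot> t X"

lemma s_cancel: assumes "f \<in> Hom W X" "g \<in> Hom W X" "s X \<cdot> f = s X \<cdot> g" shows "f = g"
proof -
  have 1: "f = inv_arr X (Dual (Dual X)) (s X) \<cdot> s X \<cdot> f" if "f \<in> Hom W X" for f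
    using comp_assoc[OF that s_Hom inv_arr_Hom[OF s_iso]] inv_arr_comp[OF s_iso] comp_Id_left[OF that] by simp
  show ?thesis using 1[OF assms(1)] 1[OF assms(2)] assms(3) by simp
qed

text \<open>Two pivotal structures differ by a monoidal automorphism of the identity functor.\<close>
context
  fixes t assumes t: "pivotal t"
begin

lemma t_iso: "iso_arr X (Dual (Dual X)) (t X)" using t unfolding pivotal_def by simp
lemma t_Hom: "t X \<in> Hom X (Dual (Dual X))" by (rule iso_arr_Hom[OF t_iso])

lemma compare_Hom: "compare t X \<in> Hom X X"
  unfolding compare_def by (rule comp_Hom[OF t_Hom inv_arr_Hom[OF s_iso]])

lemma s_compare: "s X \<cdot> compare t X = t X"
  unfolding compare_def using comp_assoc[OF t_Hom inv_arr_Hom[OF s_iso] s_Hom] comp_inv_arr[OF s_iso] comp_Id_left[OF t_Hom] by simp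

lemma compare_iso: "iso_arr X X (compare t X)"
  unfolding compare_def
  by (rule iso_arrI[OF inverse_pair_comp[OF inverse_pair_inv_arr[OF t_iso] inverse_pair_sym[OF inverse_pair_inv_arr[OF s_iso]]]])

lemma compare_natural: assumes f: "f \<in> Hom X Y" shows "compare t Y \<cdot> f = f \<cdot> compare t X"
proof (rule s_cancel[OF comp_Hom[OF f compare_Hom] comp_Hom[OF compare_Hom f]])
  let ?f = "dual_arr (Dual Y) (Dual X) (dual_arr X Y f)"
  note ff = dual_arr(1)[OF dual_arr(1)[OF f]]
  have "s Y \<cdot> compare t Y \<cdot> f = t Y \<cdot> f" using comp_assoc[OF f compare_Hom s_Hom] s_compare by simp
  also have "\<dots> = ?f \<cdot> t X" using t f unfolding pivotal_def by blast
  also have "\<dots> = ?f \<cdot> s X \<cdot> compare t X" unfolding s_compare ..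
  also have "\<dots> = (?f \<cdot> s X) \<cdot> compare t X" by (rule comp_assoc[OF compare_Hom s_Hom ff, symmetric])
  also have "?f \<cdot> s X = s Y \<cdot> f" using pivotal_s f unfolding pivotal_def by simp
  also have "(s Y \<cdot> f) \<cdot> compare t X = s Y \<cdot> f \<cdot> compare t X" by (rule comp_assoc[OF compare_Hom f s_Hom])
  finally show "s Y \<cdot> compare t Y \<cdot> f = s Y \<cdot> f \<cdot> compare t X" .
qed

text \<open>Monoidality of both structures gives the claim after composition with the transpose of
  \<open>dual_ten\<close>. This transpose has a left inverse because \<open>dual_ten\<close> has the
  right inverse \<open>d\<close> and transposition reverses composites; so it cancels.\<close>

lemma compare_ten: "compare t (X \<boxtimes> Y) = compare t X \<otimes> compare t Y"
proof -
  let ?Z = "X \<boxtimes> Y" and ?P = "Dual Y \<boxtimes> Dual X"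
  let ?D = "dual_ten X Y" let ?F = "dual_arr ?P (Dual ?Z) ?D" and ?D' = "dual_ten (Dual Y) (Dual X)"
  note DH = evw_dual_ten(1)[of X Y] and D'H = evw_dual_ten(1)[of "Dual Y" "Dual X"]
  note FH = dual_arr(1)[OF DH]
  obtain d where d: "d \<in> Hom (Dual ?Z) ?P" "hat (Dual ?Z) ?P d = ali (Dual Y) (Dual X) \<star> dualw X Y"
    using hat_full[of "ali (Dual Y) (Dual X) \<star> dualw X Y" "Dual ?Z" ?P] by auto
  have "?D \<cdot> d = Id (Dual ?Z)"
    by (rule hat_inj[OF comp_Hom[OF d(1) DH] Id_Hom]) (unfold hat_comp[OF d(1) DH] d(2) dual_ten_dualw hat_Id, rule refl)
  then have dF: "dual_arr (Dual ?Z) ?P d \<cdot> ?F = Id (Dual (Dual ?Z))"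
    using dual_arr_comp[OF d(1) DH] dual_arr_Id by simp
  note d'H = dual_arr(1)[OF d(1)]
  have cc: "compare t X \<otimes> compare t Y \<in> Hom ?Z ?Z" by (rule mten_Hom[OF compare_Hom compare_Hom])
  have "?F \<cdot> s ?Z \<cdot> compare t ?Z = ?D' \<cdot> (t X \<otimes> t Y)"
    unfolding s_compare using t unfolding pivotal_def by blast
  also have "t X \<otimes> t Y = (s X \<otimes> s Y) \<cdot> (compare t X \<otimes> compare t Y)"
    using mten_comp[OF compare_Hom s_Hom compare_Hom s_Hom] s_compare by simp
  also have "?D' \<cdot> \<dots> = (?D' \<cdot> (s X \<otimes> s Y)) \<cdot> (compare t X \<otimes> compare t Y)"
    by (rule comp_assoc[OF cc mten_Hom[OF s_Hom s_Hom] D'H, symmetric])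
  also have "?D' \<cdot> (s X \<otimes> s Y) = ?F \<cdot> s ?Z" using pivotal_s unfolding pivotal_def by simp
  also have "(?F \<cdot> s ?Z) \<cdot> (compare t X \<otimes> compare t Y) = ?F \<cdot> s ?Z \<cdot> (compare t X \<otimes> compare t Y)"
    by (rule comp_assoc[OF cc s_Hom FH])
  finally have eq: "?F \<cdot> (s ?Z \<cdot> compare t ?Z) = ?F \<cdot> (s ?Z \<cdot> (compare t X \<otimes> compare t Y))" .
  have 1: "f = dual_arr (Dual ?Z) ?P d \<cdot> ?F \<cdot> f" if "f \<in> Hom ?Z (Dual (Dual ?Z))" for f
    using comp_assoc[OF that FH d'H] dF comp_Id_left[OF that] by simp
  have "s ?Z \<cdot> compare t ?Z = s ?Z \<cdot> (compare t X \<otimes> compare t Y)"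
    using 1[OF comp_Hom[OF compare_Hom s_Hom]] 1[OF comp_Hom[OF cc s_Hom]] eq by simp
  then show ?thesis by (rule s_cancel[OF compare_Hom cc])
qed

text \<open>The right-hand side of the last clause of \<open>pivotal\<close> does not mention the
  structure, so \<open>s\<close> and \<open>t\<close> have the same pairing at the unit and
  therefore coincide there.\<close>

lemma compare_unit: "compare t \<I> = Id \<I>"
proof -
  let ?D = "Dual \<I>"
  have h: "hat (\<I> \<boxtimes> ?D) \<I> (Ev ?D \<cdot> (f \<otimes> Id ?D)) = lui \<star> evw ?D \<star> whisk [] (hat \<I> (Dual ?D) f) [?D] \<star> al \<I> ?D"
    if f: "f \<in> Hom \<I> (Dual ?D)" for f
    by (rule hat_eqI, (rule hats_ten hats_hat[OF f] hats_Id hats_comp hats_Ev)+) (use f in \<open>simp add: hat_Ev\<close>)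
  have "Ev ?D \<cdot> (s \<I> \<otimes> Id ?D) = Ev ?D \<cdot> (t \<I> \<otimes> Id ?D)"
    using t pivotal_s unfolding pivotal_def by simp
  then have "lui \<star> evw ?D \<star> whisk [] (hat \<I> (Dual ?D) (s \<I>)) [?D] \<star> al \<I> ?D = lui \<star> evw ?D \<star> whisk [] (hat \<I> (Dual ?D) (t \<I>)) [?D] \<star> al \<I> ?D"
    using h[OF s_Hom] h[OF t_Hom] by simp
  from arg_cong[OF this, of "\<lambda>f. lu \<star> f \<star> ali \<I> ?D"]
  have "evw ?D \<star> whisk [] (hat \<I> (Dual ?D) (s \<I>)) [?D] = evw ?D \<star> whisk [] (hat \<I> (Dual ?D) (t \<I>)) [?D]"
    using s_Hom[of \<I>] t_Hom[of \<I>] by simp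
  then have "s \<I> = t \<I>" by (rule evw_cancel[OF s_Hom t_Hom])
  then show ?thesis unfolding compare_def using inv_arr_comp[OF s_iso, of \<I>] by simp
qed

end

end

lemma (in etale_algebra) compare_Auts: assumes t: "pivotal t" shows "compare t A \<in> Auts"
  unfolding algebra_auts_def
  using compare_iso[OF t] compare_natural[OF t m_Hom] compare_ten[OF t] compare_natural[OF t u_Hom] compare_unit[OF t] comp_Id_right[OF u_Hom]
  by auto

text \<open>The canonical structure takes the place of the spherical structure of the underlying
  fusion category, so that \<open>tr\<close> refers to \<open>t\<close> here and dimensions of
  simple objects are images of real numbers.\<close>

locale canonical_fusion_category = fusion_category C t for C (structure) and t +
  fixes K :: "real set" and \<phi> :: "real \<Rightarrow> 'a"
  assumes embedding: "real_embedding K \<phi>" and canonical: "canonical_spherical \<phi> t"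
begin

lemma irr_reps: "simple_reps irr"
  unfolding irr_def using finitely_many_simples by (rule someI_ex)

text \<open>A maximum belongs to its set only if the set is finite and nonempty. Finiteness comes
  from the roots of the characteristic polynomial, nonemptiness from
  \<open>nonneg_mat_eigenvalue\<close>; the matrix has positive size because the unit is
  simple.\<close>

lemma fp_dim_nonneg: "fp_dim X \<ge> 0"
proof -
  let ?N = "fusion_matrix X" and ?n = "length irr"
  have N: "?N \<in> carrier_mat ?n ?n" unfolding fusion_matrix_def by simp
  have n: "?n > 0" using irr_reps unit_simple unfolding simple_reps_def by fastforce
  have "?N $$ (i, j) \<ge> 0" if "i < ?n" "j < ?n" for i j using that unfolding fusion_matrix_def by simp
  then obtain r where r: "r \<ge> 0" "eigenvalue ?N r" using nonneg_mat_eigenvalue[OF N n] by blast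
  let ?S = "{r. r \<ge> 0 \<and> eigenvalue ?N r}"
  have "?S \<subseteq> {r. poly (char_poly ?N) r = 0}" using eigenvalue_root_char_poly[OF N] by auto
  moreover have "char_poly ?N \<noteq> 0" using degree_monic_char_poly[OF N] by auto
  ultimately have "finite ?S" using poly_roots_finite finite_subset by blast
  then have "Max ?S \<in> ?S" using r by (intro Max_in) auto
  then show ?thesis unfolding fp_dim_def by simp
qed

lemma emb: "1 \<in> K" "x \<in> K \<Longrightarrow> y \<in> K \<Longrightarrow> x - y \<in> K" "x \<in> K \<Longrightarrow> y \<in> K \<Longrightarrow> x * y \<in> K" "x \<in> K \<Longrightarrow> inverse x \<in> K"
  "\<phi> 1 = 1" "x \<in> K \<Longrightarrow> y \<in> K \<Longrightarrow> \<phi> (x + y) = \<phi> x + \<phi> y" "x \<in> K \<Longrightarrow> y \<in> K \<Longrightarrow> \<phi> (x * y) = \<phi> x * \<phi> y" "fp_dim X \<in> K"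
  using embedding unfolding real_embedding_def by auto

lemma K_zero: "0 \<in> K" using emb(2)[OF emb(1) emb(1)] by simp
lemma K_add: "x \<in> K \<Longrightarrow> y \<in> K \<Longrightarrow> x + y \<in> K" using emb(2)[of x "0 - y"] emb(2)[OF K_zero, of y] by simp
lemma \<phi>_zero: "\<phi> 0 = 0" using emb(6)[OF K_zero K_zero] by simp
lemma \<phi>_inj: assumes x: "x \<in> K" and z: "\<phi> x = 0" shows "x = 0"
proof (rule ccontr)
  assume "x \<noteq> 0"
  then have "\<phi> (x * inverse x) = 1" using emb(5) by simp
  then show False using emb(7)[OF x emb(4)[OF x]] z by simp
qed
lemma \<phi>_sum: "finite S \<Longrightarrow> (\<And>i. i \<in> S \<Longrightarrow> g i \<in> K) \<Longrightarrow> sum g S \<in> K \<and> \<phi> (sum g S) = (\<Sum>i\<in>S. \<phi> (g i))"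
  by (induction S rule: finite_induct) (auto simp: K_zero \<phi>_zero K_add emb(6))
lemma \<phi>_divide: assumes x: "x \<in> K" and y: "y \<in> K" "y \<noteq> 0" shows "x / y \<in> K" "\<phi> (x / y) * \<phi> y = \<phi> x"
proof -
  show 1: "x / y \<in> K" using emb(3)[OF x emb(4)[OF y(1)]] by (simp add: divide_inverse)
  show "\<phi> (x / y) * \<phi> y = \<phi> x" using emb(7)[OF 1 y(1)] y(2) by simp
qed

text \<open>Positivity is not read off the fusion matrix: the dimension is nonnegative, and its
  image under \<open>\<phi>\<close> is a nonzero categorical dimension.\<close>

lemma simple_qdim: assumes S: "simple_ob S" shows "qdim t S = \<phi> (fp_dim S)" "fp_dim S > 0"
proof -
  show 1: "qdim t S = \<phi> (fp_dim S)" using canonical S unfolding canonical_spherical_def by simp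
  then have "fp_dim S \<noteq> 0" using simple_qdim_nonzero[OF S] \<phi>_zero by auto
  then show "fp_dim S > 0" using fp_dim_nonneg[of S] by simp
qed

text \<open>The preimage is the sum of the Frobenius--Perron dimensions of the simple constituents.
  All of them are strictly positive, so it vanishes only when there are none, and then
  \<open>f = 0\<close>.\<close>

lemma tr_idempotent_nonneg:
  assumes f: "f \<in> Hom X X" "f \<cdot> f = f"
  obtains \<rho> where "\<rho> \<in> K" "\<rho> \<ge> 0" "tr X f = \<phi> \<rho>" "\<rho> = 0 \<Longrightarrow> f = 0"
proof -
  obtain Ss where Ss: "\<forall>S\<in>set Ss. simple_ob S" "tr X f = (\<Sum>S\<leftarrow>Ss. qdim t S)" "Ss = [] \<longrightarrow> f = 0"
    using tr_idempotent[OF f] by blast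
  let ?r = "\<Sum>S\<leftarrow>Ss. fp_dim S"
  have "?r \<in> K \<and> ?r \<ge> 0 \<and> (\<Sum>S\<leftarrow>Ss. qdim t S) = \<phi> ?r \<and> (Ss \<noteq> [] \<longrightarrow> ?r > 0)"
    using Ss(1)
  proof (induction Ss)
    case (Cons S Ss)
    then show ?case using simple_qdim[of S] K_add[OF emb(8)] emb(6)[OF emb(8)] fp_dim_nonneg[of S] by auto
  qed (simp add: K_zero \<phi>_zero)
  then show ?thesis using that[of ?r] Ss(2,3) by (metis less_irrefl)
qed

lemma tr_idempotent_zero: "f \<in> Hom X X \<Longrightarrow> f \<cdot> f = f \<Longrightarrow> tr X f = 0 \<Longrightarrow> f = 0"
  by (metis tr_idempotent_nonneg \<phi>_inj)

end

section \<open>The two implications\<close>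

locale canonical_etale_algebra = etale_algebra C t A m u \<kappa> + canonical_fusion_category C t K \<phi>
  for C (structure) and t A m u \<kappa> K \<phi>
begin

lemma galois_imp_symmetric: assumes "galois t A m u" shows "maximally_symmetric t A"
proof -
  have eq: "Auts = minidems" using assms unfolding galois_def .
  have "qdim t A = (\<Sum>p\<in>minidems. lam p)" using lam_minidems_sum by simp
  also have "\<dots> = (\<Sum>p\<in>minidems. 1)" by (rule sum.cong) (use lam_aut eq in auto)
  also have "\<dots> = of_nat (hom_dim A A)" using minidems_card by simp
  finally show ?thesis unfolding maximally_symmetric_def by simp
qed

text \<open>With \<open>r\<close> the projection divided by \<open>lam p\<close>, the idempotent
  \<open>G\<close> is the copy of \<open>A\<close> inside \<open>P p\<close> and has trace
  \<open>qdim t A\<close>. The complement \<open>F\<close> has trace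
  \<open>(lam p - 1) * qdim t A\<close>, the image of some \<open>\<rho> \<ge> 0\<close>; dividing
  by the real dimension \<open>D\<close> gives the excess \<open>\<sigma>\<close>. If it is zero,
  \<open>F\<close> vanishes and \<open>r = proj\<close>.\<close>

lemma minidems_excess:
  assumes p: "p \<in> minidems"
  shows "\<exists>\<sigma>\<in>K. \<sigma> \<ge> 0 \<and> lam p = 1 + \<phi> \<sigma> \<and> (\<sigma> = 0 \<longrightarrow> P p = inc p \<cdot> proj \<cdot> P p)"
proof -
  note pK = minidemsD[OF p]
  let ?Z = "A \<boxtimes> A"
  define l where "l = lam p"
  have l0: "l \<noteq> 0" unfolding l_def by (rule lam_minidems_nonzero[OF p])
  define r where "r = sc (inverse l) proj"
  have r: "r \<in> Hom ?Z A" unfolding r_def by (rule sc_Hom[OF proj_Hom])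
  note iH = inc_Hom[OF pK(1)] and PH = P_Hom[OF pK(1)]
  have ri: "r \<cdot> inc p = Id A" unfolding r_def
    using comp_sc_left[OF iH proj_Hom] proj_inc[OF pK(1)] l0 unfolding l_def by simp
  have PP: "P p \<cdot> P p = P p" using P_comp[OF pK(1) pK(1)] pK(2) by simp
  have Pi: "P p \<cdot> inc p = inc p" by (rule P_inc[OF pK(1,2)])
  note rP = comp_Hom[OF PH r] and irP = comp_Hom[OF comp_Hom[OF PH r] iH]
  define G where "G = inc p \<cdot> r \<cdot> P p"
  have GH: "G \<in> Hom ?Z ?Z" unfolding G_def by (rule irP)
  have PG: "P p \<cdot> G = G" unfolding G_def using comp_assoc[OF rP iH PH] Pi by simp
  have GP: "G \<cdot> P p = G" unfolding G_def using comp_assoc[OF PH rP iH] comp_assoc[OF PH PH r] PP by simp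
  have GG: "G \<cdot> G = G"
  proof -
    have "G \<cdot> G = inc p \<cdot> r \<cdot> (P p \<cdot> G)" unfolding G_def
      using comp_assoc[OF irP rP iH] comp_assoc[OF irP PH r] by simp
    also have "P p \<cdot> G = G" by (rule PG)
    also have "r \<cdot> G = r \<cdot> P p" unfolding G_def using comp_assoc[OF rP iH r] ri comp_Id_left[OF rP] by simp
    finally show ?thesis unfolding G_def .
  qed
  define F where "F = P p - G"
  have FH: "F \<in> Hom ?Z ?Z" unfolding F_def by (rule diff_Hom[OF PH GH])
  have FF: "F \<cdot> F = F" unfolding F_def
    using comp_diff_left[OF diff_Hom[OF PH GH] PH GH] comp_diff_right[OF PH GH PH] comp_diff_right[OF PH GH GH] PP PG GP GG by simp
  have "tr ?Z G = tr A ((r \<cdot> P p) \<cdot> inc p)" unfolding G_def by (rule tr_cyclic[OF rP iH])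
  also have "(r \<cdot> P p) \<cdot> inc p = Id A" using comp_assoc[OF iH PH r] Pi ri by simp
  finally have "tr ?Z G = qdim t A" using qdim_tr by simp
  then have tF: "tr ?Z F = l * qdim t A - qdim t A"
    unfolding F_def tr_diff[OF PH GH] P_trace[OF pK(1)] l_def by simp
  obtain \<rho> where \<rho>: "\<rho> \<in> K" "\<rho> \<ge> 0" "tr ?Z F = \<phi> \<rho>" "\<rho> = 0 \<Longrightarrow> F = 0" using tr_idempotent_nonneg[OF FH FF] by blast
  \<comment> \<open>The identity is an idempotent too, which provides a nonnegative real preimage of
    the dimension of \<open>A\<close> itself.\<close>
  obtain D where D: "D \<in> K" "D \<ge> 0" "tr A (Id A) = \<phi> D" using tr_idempotent_nonneg[OF Id_Hom comp_Id_left[OF Id_Hom]] by blast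
  have dD: "qdim t A = \<phi> D" using D(3) qdim_tr by simp
  have D0: "D \<noteq> 0" using qdim_nonzero dD \<phi>_zero by auto
  define \<sigma> where "\<sigma> = \<rho> / D"
  have \<sigma>: "\<sigma> \<in> K" "\<phi> \<sigma> * \<phi> D = \<phi> \<rho>" unfolding \<sigma>_def using \<phi>_divide[OF \<rho>(1) D(1) D0] by auto
  have "(l - 1 - \<phi> \<sigma>) * \<phi> D = 0" using tF \<rho>(3) \<sigma>(2) unfolding dD by (simp add: algebra_simps)
  moreover have "\<phi> D \<noteq> 0" using qdim_nonzero dD by simp
  ultimately have "l - 1 - \<phi> \<sigma> = 0" by (simp only: mult_eq_0_iff simp_thms)
  then have l1: "l = 1 + \<phi> \<sigma>" by (simp add: algebra_simps)
  moreover have "\<sigma> \<ge> 0" unfolding \<sigma>_def using \<rho>(2) D(2) by simp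
  moreover have "P p = inc p \<cdot> proj \<cdot> P p" if "\<sigma> = 0"
  proof -
    have "\<rho> = 0" using that D0 unfolding \<sigma>_def by simp
    then have "P p = G" using \<rho>(4) unfolding F_def by simp
    moreover have "l = 1" using l1 that \<phi>_zero by simp
    then have "r = proj" unfolding r_def by simp
    ultimately show ?thesis unfolding G_def by simp
  qed
  ultimately show ?thesis using \<sigma>(1) unfolding l_def by blast
qed

text \<open>There are \<open>qdim t A\<close> minimal idempotents and their values of
  \<open>lam\<close> sum to \<open>qdim t A\<close>, so the images of the excesses sum to zero in
  \<open>'k\<close>. Injectivity of \<open>\<phi>\<close> on \<open>K\<close> moves this to the
  reals, where nonnegativity makes every single excess vanish.\<close>

lemma symmetric_imp_galois: assumes ms: "maximally_symmetric t A" shows "galois t A m u"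
proof -
  have "\<forall>p. \<exists>\<sigma>. p \<in> minidems \<longrightarrow> \<sigma> \<in> K \<and> \<sigma> \<ge> 0 \<and> lam p = 1 + \<phi> \<sigma> \<and> (\<sigma> = 0 \<longrightarrow> P p = inc p \<cdot> proj \<cdot> P p)"
    using minidems_excess by blast
  then obtain \<sigma> where \<sigma>: "\<And>p. p \<in> minidems \<Longrightarrow> \<sigma> p \<in> K \<and> \<sigma> p \<ge> 0 \<and> lam p = 1 + \<phi> (\<sigma> p) \<and> (\<sigma> p = 0 \<longrightarrow> P p = inc p \<cdot> proj \<cdot> P p)"
    by metis
  have "of_nat (card minidems) = qdim t A" using ms minidems_card unfolding maximally_symmetric_def by simp
  also have "\<dots> = (\<Sum>p\<in>minidems. lam p)" using lam_minidems_sum by simp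
  also have "\<dots> = (\<Sum>p\<in>minidems. 1 + \<phi> (\<sigma> p))" by (rule sum.cong) (use \<sigma> in auto)
  also have "\<dots> = of_nat (card minidems) + \<phi> (\<Sum>p\<in>minidems. \<sigma> p)"
    using \<phi>_sum[OF minidems_finite, of \<sigma>] \<sigma> by (simp add: sum.distrib)
  finally have "\<phi> (\<Sum>p\<in>minidems. \<sigma> p) = 0" by simp
  then have "(\<Sum>p\<in>minidems. \<sigma> p) = 0" using \<phi>_inj \<phi>_sum[OF minidems_finite, of \<sigma>] \<sigma> by blast
  then have z: "\<sigma> p = 0" if "p \<in> minidems" for p using sum_nonneg_eq_0_iff[OF minidems_finite, of \<sigma>] \<sigma> that by blast
  have "minidems \<subseteq> Auts"
  proof
    fix p assume p: "p \<in> minidems"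
    note pH = minidemsD(1)[OF p]
    have l: "lam p = 1" and fac: "P p = inc p \<cdot> proj \<cdot> P p" using \<sigma>[OF p] z[OF p] \<phi>_zero by auto
    obtain q where q: "q \<in> Q" "p \<cdot> q = Id A" "q \<cdot> p = Id A \<Longrightarrow> p \<in> Auts" using P_factor[OF pH l fac] by blast
    note qp = comp_Hom[OF pH q(1)]
    have i: "(q \<cdot> p) \<cdot> (q \<cdot> p) = q \<cdot> p"
      using comp_assoc[OF qp pH q(1)] comp_assoc[OF pH q(1) pH] q(2) comp_Id_left[OF pH] by simp
    \<comment> \<open>By cyclicity \<open>q \<cdot> p\<close> has the same trace as
      \<open>p \<cdot> q = Id A\<close>, so the complementary idempotent has trace zero and
      vanishes.\<close>
    let ?f = "Id A - q \<cdot> p"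
    have fH: "?f \<in> Q" by (rule diff_Hom[OF Id_Hom qp])
    have "?f \<cdot> ?f = ?f"
      using comp_diff_left[OF fH Id_Hom qp] comp_Id_left[OF fH] comp_diff_right[OF Id_Hom qp qp] comp_Id_right[OF qp] i by simp
    moreover have "tr A ?f = 0" using tr_diff[OF Id_Hom qp] tr_cyclic[OF pH q(1)] q(2) by simp
    ultimately have "?f = 0" by (rule tr_idempotent_zero[OF fH])
    then show "p \<in> Auts" using q(3) by simp
  qed
  then show ?thesis unfolding galois_def using Auts_subset by blast
qed

end

theorem corollary10:
  fixes C :: "('k::{alg_closed_field, field_char_0}, 'o, 'm::ab_group_add) btcat"
    and s t :: "'o \<Rightarrow> 'm"
    and K :: "real set" and \<phi> :: "real \<Rightarrow> 'k"
    and A :: 'o and m u :: 'm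
  assumes "braided_fusion_category C s"
    and "btcat_data.real_embedding C K \<phi>"
    and "btcat_data.pseudo_unitary C s \<phi>"
    and "btcat_data.canonical_spherical C \<phi> t"
    and "btcat_data.etale C s A m u"
  shows "btcat_data.galois C s A m u \<longleftrightarrow> btcat_data.maximally_symmetric C t A"
proof -
  interpret braided_fusion_category C s by fact
  note et = assms(5)[unfolded etale_def]
  define \<kappa> where "\<kappa> = (SOME \<kappa>. copairing s A m \<kappa>)"
  have cop: "copairing s A m \<kappa>" unfolding \<kappa>_def using et unfolding separable_def by (blast intro: someI_ex)
  interpret S: etale_algebra C s A m u \<kappa>
    by unfold_locales (use et cop \<kappa>_def in auto)
  have sph: "spherical t" using assms(4) unfolding canonical_spherical_def by simp
  then have piv: "pivotal t" unfolding spherical_def by simp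
  interpret T: canonical_fusion_category C t K \<phi>
    by unfold_locales (fact Ev_Hom Coev_Hom zigzag zigzag_dual sph semisimple finitely_many_simples assms(2,4))+
  \<comment> \<open>The nonvanishing shown for an etale algebra concerns \<open>s\<close>. For
    \<open>t\<close> it comes from faithfulness of the canonical trace on the idempotent
    \<open>Id A\<close>.\<close>
  have "qdim t A \<noteq> 0"
    using T.tr_idempotent_zero[OF Id_Hom comp_Id_left[OF Id_Hom]] T.qdim_tr S.Id_A_nonzero by metis
  moreover have "qdim t A = tr A (compare t A)"
    unfolding T.qdim_tr T.tr_def tr_def trace_right_def s_compare[OF piv] comp_Id_right[OF t_Hom[OF piv]] ..
  ultimately have "compare t A = Id A" using S.aut_trace_zero[OF S.compare_Auts[OF piv]] by auto
  then have st: "t A = s A" using s_compare[OF piv, of A] comp_Id_right[OF s_Hom, of A] by simp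
  \<comment> \<open>The canonical trace, and with it the copairing and the convolution, depends on
    the spherical structure only through its component at \<open>A\<close>. The algebra may
    therefore be treated as etale for \<open>t\<close>.\<close>
  have ct: "can_trace t A m = can_trace s A m" unfolding can_trace_def st ..
  have cp: "copairing t A m = copairing s A m" unfolding copairing_def can_pairing_def ct ..
  have gal: "galois t A m u \<longleftrightarrow> galois s A m u"
    unfolding galois_def minimal_idempotents_def conv_idempotents_def convolution_def comult_def cp ..
  interpret canonical_etale_algebra C t A m u \<kappa> K \<phi>
    by unfold_locales (use et cop \<kappa>_def cp \<beta>_iso \<beta>_natural hexagon hexagon_inv in auto)
  show ?thesis using galois_imp_symmetric symmetric_imp_galois gal by blast
qed

end
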